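(* Let $G$ be a simple and simply-connected complex algebraic group and $k$ a non-negative integer. Let $\mathcal V_G^{(k)}$ be the free $\mathbb C$-vector space on the finite set $\Lambda_k$ of level-$k$ integrable dominant weights, with multiplication $$\lambda\star_t\mu=\sum_{\nu\in\Lambda_k}d_{0,3}(\lambda,\mu,\nu^* )(t)\,d_\nu(t)\,\nu$$ and symmetric bilinear pairing $$\langle\lambda,\mu\rangle_t=\delta_{\lambda,\mu^*}\,d_\lambda(t)^{-1}.$$ Then for small enough $t$ the triple $(\mathcal V_G^{(k)},\star_t,\langle\cdot,\cdot\rangle_t)$ is a Frobenius algebra.
   Context: $\Lambda_k$ is the set of dominant weights $\lambda$ of $G$ with $\langle\lambda,\vartheta\rangle\le k$, $\vartheta$ the highest root; $\lambda^*=-w_0(\lambda)$. For $\vec\lambda=(\lambda_1,\dots,\lambda_n)\in\Lambda_k^n$ and sufficiently small $t$, $$d_{g,n}(\vec\lambda)(t)=\sum_{f\in F^{\rm reg}_{\rho,t}/W}\theta_t(f)^{1-g}\prod_{i=1}^n\Theta_{\lambda_i,t}(f),\qquad d_\lambda(t)=d_{0,2}(\lambda,\lambda^* )(t)^{-1}.$$ Here $$\Theta_{\lambda,t}=\sum_{w\in W}\frac{e^{w(\lambda)}}{\prod_{\alpha\in\mathfrak R_+}(1-e^{-w(\alpha)})(1-te^{w(\alpha)})}$$ (this is the case where all parabolic subgroups used are the Borel subgroup). Group data. $K$ is the compact form of $G$, $T$ a maximal torus, $T_K=T\cap K$, $W$ the Weyl group, $\mathfrak R$ the roots, $\mathfrak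 R_+$ the positive roots, $h$ the dual Coxeter number, $Q^\vee$ the coroot lattice, $\mathfrak t_{\mathbb R}=Q^\vee\otimes\mathbb R$, $(\cdot,\cdot)$ the $W$-invariant positive-definite form on $\mathfrak t_{\mathbb R}$ normalized so that the longest root has norm squared $2$. Write $f=e^{2\pi i x}\in T_K$ with $x\in\mathfrak t_{\mathbb R}/Q^\vee$, $e^{\mu}(f)=e^{2\pi i\mu(x)}$. $F=\{e^{2\pi i x}:(k+h)(x,y)\in\mathbb Z\ \forall y\in Q^\vee\}$. For real $t$ close to $0$, $F_{\rho,t}\subset T_K$ is the set of $f=e^{2\pi i x}$ with $$e^{2\pi i (k+h)(x,y)}\prod_{\alpha\in\mathfrak R_+}\left(\frac{1-te^{-\alpha}(f)}{1-te^{\alpha}(f)}\right)^{\alpha(y)}=1\quad\text{for all }y\in Q^\vee,$$ and $F^{\rm reg}_{\rho,t}$ is its subset of elements with trivial stabilizer in $W$. $H_t^\dagger(f)$ is the endomorphism of $\mathfrak t_{\mathbb R}$ with $(k+h)(H_t^\dagger(f)y,y')=(k+h)(y,y')+\sum_{\alpha\in\mathfrak R}\frac{te^{\alpha}(f)}{1-te^{\alpha}(f)}\alpha(y)\alpha(y')$, and $$\theta_t(f)=(1-t)^{\mathrm{rk}\,G}\frac{1}{|F|}\frac{\prod_{\alpha\in\mathfrak R}(1-e^\alpha(f))(1-te^\alpha(f))}{\det H_t^\dagger(f)}.$$ *)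

theory Defs
  imports "HOL-Analysis.Analysis" "HOL-Library.Function_Algebras"
begin

text \<open>
  A semisimple complex algebraic group with maximal torus \<open>T\<close> and Borel subgroup is represented by
  its root datum, which determines it up to isomorphism. The space
  \<open>t\<^sub>\<real> = X\<^sub>*(T) \<otimes> \<real>\<close> is \<open>real ^ 'n\<close>, so the rank is \<open>CARD('n)\<close>.
  The standard inner product plays the role of a Weyl group invariant form (invariance is built into
  the reflections being orthogonal); it identifies \<open>t\<^sub>\<real>\<close> with its dual, so roots
  and weights are vectors too and \<open>\<alpha>(y) = \<alpha> \<bullet> y\<close>.
\<close>

record ('n::finite) root_datum =
  roots :: "(real ^ 'n) set"
  pos_roots :: "(real ^ 'n) set"
  cocharacters :: "(real ^ 'n) set"

definition coroot :: "real ^ 'n \<Rightarrow> real ^ 'n" where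
  "coroot \<alpha> = (2 / (\<alpha> \<bullet> \<alpha>)) *\<^sub>R \<alpha>"

definition reflection :: "real ^ 'n \<Rightarrow> real ^ 'n \<Rightarrow> real ^ 'n" where
  "reflection \<alpha> x = x - (x \<bullet> coroot \<alpha>) *\<^sub>R \<alpha>"

definition root_system :: "(real ^ 'n) set \<Rightarrow> bool" where
  "root_system R \<longleftrightarrow>
     finite R \<and> 0 \<notin> R \<and> span R = UNIV \<and>
     (\<forall>\<alpha>\<in>R. \<forall>\<beta>\<in>R. reflection \<alpha> \<beta> \<in> R) \<and>
     (\<forall>\<alpha>\<in>R. \<forall>\<beta>\<in>R. \<beta> \<bullet> coroot \<alpha> \<in> \<int>) \<and>
     (\<forall>\<alpha>\<in>R. \<forall>c. c *\<^sub>R \<alpha> \<in> R \<longrightarrow> c = 1 \<or> c = -1)"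

definition positive_system :: "(real ^ 'n) set \<Rightarrow> (real ^ 'n) set \<Rightarrow> bool" where
  "positive_system R P \<longleftrightarrow>
     (\<exists>v. (\<forall>\<alpha>\<in>R. \<alpha> \<bullet> v \<noteq> 0) \<and> P = {\<alpha>\<in>R. \<alpha> \<bullet> v > 0})"

definition irreducible_roots :: "(real ^ 'n) set \<Rightarrow> bool" where
  "irreducible_roots R \<longleftrightarrow> R \<noteq> {} \<and>
     (\<forall>A B. R = A \<union> B \<longrightarrow> A \<noteq> {} \<longrightarrow> B \<noteq> {} \<longrightarrow>
        (\<exists>\<alpha>\<in>A. \<exists>\<beta>\<in>B. \<alpha> \<bullet> \<beta> \<noteq> 0))"

text \<open>\<open>Q\<^sup>\<or>\<close>\<close>
definition coroot_lattice :: "('n::finite) root_datum \<Rightarrow> (real ^ 'n) set" where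
  "coroot_lattice G = {\<Sum>\<alpha>\<in>roots G. of_int (c \<alpha>) *\<^sub>R coroot \<alpha> | c :: real ^ 'n \<Rightarrow> int. True}"

definition semisimple_group :: "('n::finite) root_datum \<Rightarrow> bool" where
  "semisimple_group G \<longleftrightarrow>
     root_system (roots G) \<and> positive_system (roots G) (pos_roots G) \<and>
     (\<forall>x\<in>cocharacters G. \<forall>y\<in>cocharacters G. x - y \<in> cocharacters G) \<and>
     coroot_lattice G \<subseteq> cocharacters G \<and>
     (\<forall>y\<in>cocharacters G. \<forall>\<alpha>\<in>roots G. \<alpha> \<bullet> y \<in> \<int>)"

definition simple_group :: "('n::finite) root_datum \<Rightarrow> bool" where
  "simple_group G \<longleftrightarrow> semisimple_group G \<and> irreducible_roots (roots G)"

text \<open>\<open>\<pi>\<^sub>1(G) = X\<^sub>*(T) / Q\<^sup>\<or>\<close>.\<close>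
definition simply_connected_group :: "('n::finite) root_datum \<Rightarrow> bool" where
  "simply_connected_group G \<longleftrightarrow> cocharacters G = coroot_lattice G"

definition normalized_form :: "('n::finite) root_datum \<Rightarrow> bool" where
  "normalized_form G \<longleftrightarrow>
     (\<forall>\<alpha>\<in>roots G. \<alpha> \<bullet> \<alpha> \<le> 2) \<and> (\<exists>\<alpha>\<in>roots G. \<alpha> \<bullet> \<alpha> = 2)"

inductive_set weyl_group :: "('n::finite) root_datum \<Rightarrow> (real ^ 'n \<Rightarrow> real ^ 'n) set"
  for G where
  id: "id \<in> weyl_group G"
| refl: "\<alpha> \<in> roots G \<Longrightarrow> w \<in> weyl_group G \<Longrightarrow> reflection \<alpha> \<circ> w \<in> weyl_group G"

definition longest_element :: "('n::finite) root_datum \<Rightarrow> real ^ 'n \<Rightarrow> real ^ 'n" where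
  "longest_element G = (THE w. w \<in> weyl_group G \<and> w ` pos_roots G = uminus ` pos_roots G)"

definition highest_root :: "('n::finite) root_datum \<Rightarrow> real ^ 'n" where
  "highest_root G = (THE \<theta>. \<theta> \<in> roots G \<and>
     (\<forall>\<beta>\<in>roots G. \<exists>c :: real ^ 'n \<Rightarrow> nat.
        \<theta> - \<beta> = (\<Sum>\<alpha>\<in>pos_roots G. of_nat (c \<alpha>) *\<^sub>R \<alpha>)))"

text \<open>\<open>h = 1 + \<langle>\<rho>, \<theta>\<^sup>\<or>\<rangle>\<close> with \<open>\<rho>\<close> the half sum of the positive roots.\<close>
definition dual_coxeter :: "('n::finite) root_datum \<Rightarrow> real" where
  "dual_coxeter G =
     1 + ((1 / 2) *\<^sub>R (\<Sum>\<alpha>\<in>pos_roots G. \<alpha>)) \<bullet> coroot (highest_root G)"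

definition weights :: "('n::finite) root_datum \<Rightarrow> (real ^ 'n) set" where
  "weights G = {\<mu>. \<forall>y\<in>cocharacters G. \<mu> \<bullet> y \<in> \<int>}"

definition dominant_weights :: "('n::finite) root_datum \<Rightarrow> (real ^ 'n) set" where
  "dominant_weights G = {\<mu>\<in>weights G. \<forall>\<alpha>\<in>pos_roots G. \<mu> \<bullet> coroot \<alpha> \<ge> 0}"

text \<open>\<open>\<Lambda>\<^sub>k\<close>\<close>
definition level_weights :: "('n::finite) root_datum \<Rightarrow> nat \<Rightarrow> (real ^ 'n) set" where
  "level_weights G k = {\<mu>\<in>dominant_weights G. \<mu> \<bullet> highest_root G \<le> real k}"

text \<open>\<open>\<lambda>\<^sup>*\<close>\<close>
definition dual_weight :: "('n::finite) root_datum \<Rightarrow> real ^ 'n \<Rightarrow> real ^ 'n" where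
  "dual_weight G \<mu> = - longest_element G \<mu>"

text \<open>
  An element \<open>f\<close> of the compact torus \<open>T\<^sub>K = t\<^sub>\<real> / X\<^sub>*(T)\<close> is represented by the function
  \<open>\<mu> \<mapsto> e\<^sup>\<mu>(f)\<close> on the weight lattice (Pontryagin duality); hence \<open>e\<^sup>\<mu>(f)\<close> is written \<open>f \<mu>\<close>.
  The function \<open>torus_exp\<close> is \<open>x \<mapsto> e\<close> to the power \<open>2\<pi>ix\<close>.
\<close>
definition torus_exp :: "('n::finite) root_datum \<Rightarrow> real ^ 'n \<Rightarrow> (real ^ 'n \<Rightarrow> complex)" where
  "torus_exp G x = (\<lambda>\<mu>\<in>weights G. cis (2 * pi * (\<mu> \<bullet> x)))"

definition torus_act ::
  "('n::finite) root_datum \<Rightarrow> (real ^ 'n \<Rightarrow> real ^ 'n) \<Rightarrow> (real ^ 'n \<Rightarrow> complex) \<Rightarrow> (real ^ 'n \<Rightarrow> complex)"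
where
  "torus_act G w f = (\<lambda>\<mu>\<in>weights G. f (inv w \<mu>))"

definition F_set :: "('n::finite) root_datum \<Rightarrow> nat \<Rightarrow> (real ^ 'n \<Rightarrow> complex) set" where
  "F_set G k =
     {torus_exp G x | x. \<forall>y\<in>coroot_lattice G. (real k + dual_coxeter G) * (x \<bullet> y) \<in> \<int>}"

text \<open>The exponent \<open>\<alpha>(y)\<close> is an integer, so taking its floor only changes its type.\<close>
definition F_rho :: "('n::finite) root_datum \<Rightarrow> nat \<Rightarrow> real \<Rightarrow> (real ^ 'n \<Rightarrow> complex) set" where
  "F_rho G k t =
     {f. \<exists>x. f = torus_exp G x \<and>
        (\<forall>y\<in>coroot_lattice G.
           cis (2 * pi * ((real k + dual_coxeter G) * (x \<bullet> y))) *
           (\<Prod>\<alpha>\<in>pos_roots G.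
              ((1 - of_real t * f (- \<alpha>)) / (1 - of_real t * f \<alpha>)) powi \<lfloor>\<alpha> \<bullet> y\<rfloor>) = 1)}"

definition F_rho_reg :: "('n::finite) root_datum \<Rightarrow> nat \<Rightarrow> real \<Rightarrow> (real ^ 'n \<Rightarrow> complex) set" where
  "F_rho_reg G k t =
     {f\<in>F_rho G k t. \<forall>w\<in>weyl_group G. torus_act G w f = f \<longrightarrow> w = id}"

definition weyl_orbits ::
  "('n::finite) root_datum \<Rightarrow> (real ^ 'n \<Rightarrow> complex) set \<Rightarrow> (real ^ 'n \<Rightarrow> complex) set set"
where
  "weyl_orbits G S = (\<lambda>f. (\<lambda>w. torus_act G w f) ` weyl_group G) ` S"

text \<open>
  The roots \<open>\<alpha>\<close> and \<open>-\<alpha>\<close> contribute complex conjugate terms, so the sum is real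
  and the endomorphism \<open>H\<close> of \<open>t\<^sub>\<real>\<close> exists.
\<close>
definition H_dagger ::
  "('n::finite) root_datum \<Rightarrow> nat \<Rightarrow> real \<Rightarrow> (real ^ 'n \<Rightarrow> complex) \<Rightarrow> real ^ 'n \<Rightarrow> real ^ 'n"
where
  "H_dagger G k t f = (THE H. linear H \<and>
     (\<forall>y y'. complex_of_real ((real k + dual_coxeter G) * (H y \<bullet> y')) =
        complex_of_real ((real k + dual_coxeter G) * (y \<bullet> y')) +
        (\<Sum>\<alpha>\<in>roots G. of_real t * f \<alpha> / (1 - of_real t * f \<alpha>) *
           of_real (\<alpha> \<bullet> y) * of_real (\<alpha> \<bullet> y'))))"

definition theta ::
  "('n::finite) root_datum \<Rightarrow> nat \<Rightarrow> real \<Rightarrow> (real ^ 'n \<Rightarrow> complex) \<Rightarrow> complex"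
where
  "theta G k t f =
     (1 - of_real t) ^ CARD('n) * (1 / of_nat (card (F_set G k))) *
     ((\<Prod>\<alpha>\<in>roots G. (1 - f \<alpha>) * (1 - of_real t * f \<alpha>)) /
      of_real (det (matrix (H_dagger G k t f))))"

definition Theta ::
  "('n::finite) root_datum \<Rightarrow> real ^ 'n \<Rightarrow> real \<Rightarrow> (real ^ 'n \<Rightarrow> complex) \<Rightarrow> complex"
where
  "Theta G \<mu> t f =
     (\<Sum>w\<in>weyl_group G. f (w \<mu>) /
        (\<Prod>\<alpha>\<in>pos_roots G. (1 - f (- w \<alpha>)) * (1 - of_real t * f (w \<alpha>))))"

text \<open>
  The number \<open>d\<^bsub>g,n\<^esub>(\<lambda>\<^sub>1, \<dots>, \<lambda>\<^sub>n)(t)\<close>, with \<open>n\<close> the length of the list. The summand is constant on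
  orbits, so it is evaluated at an arbitrary representative.
\<close>
definition verlinde_d ::
  "('n::finite) root_datum \<Rightarrow> nat \<Rightarrow> nat \<Rightarrow> (real ^ 'n) list \<Rightarrow> real \<Rightarrow> complex"
where
  "verlinde_d G k g \<mu>s t =
     (\<Sum>orb\<in>weyl_orbits G (F_rho_reg G k t).
        let f = (SOME f. f \<in> orb)
        in theta G k t f powi (1 - int g) * (\<Prod>\<mu>\<leftarrow>\<mu>s. Theta G \<mu> t f))"

definition d_weight :: "('n::finite) root_datum \<Rightarrow> nat \<Rightarrow> real ^ 'n \<Rightarrow> real \<Rightarrow> complex" where
  "d_weight G k \<mu> t = inverse (verlinde_d G k 0 [\<mu>, dual_weight G \<mu>] t)"

text \<open>
  The free complex vector space on a set \<open>S\<close>, as a subspace of the space of all functions (with the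
  pointwise addition of \<open>Function_Algebras\<close>).
\<close>
definition free_space :: "'a set \<Rightarrow> ('a \<Rightarrow> complex) set" where
  "free_space S = {v. finite {s. v s \<noteq> 0} \<and> {s. v s \<noteq> 0} \<subseteq> S}"

definition fun_scale :: "complex \<Rightarrow> ('a \<Rightarrow> complex) \<Rightarrow> 'a \<Rightarrow> complex" where
  "fun_scale c v = (\<lambda>s. c * v s)"

definition basis_vec :: "'a \<Rightarrow> 'a \<Rightarrow> complex" where
  "basis_vec s = (\<lambda>s'. if s' = s then 1 else 0)"

definition verlinde_space :: "('n::finite) root_datum \<Rightarrow> nat \<Rightarrow> (real ^ 'n \<Rightarrow> complex) set" where
  "verlinde_space G k = free_space (level_weights G k)"

definition star_basis ::
  "('n::finite) root_datum \<Rightarrow> nat \<Rightarrow> real \<Rightarrow> real ^ 'n \<Rightarrow> real ^ 'n \<Rightarrow> (real ^ 'n \<Rightarrow> complex)"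
where
  "star_basis G k t \<mu> \<mu>' =
     (\<Sum>\<nu>\<in>level_weights G k.
        fun_scale (verlinde_d G k 0 [\<mu>, \<mu>', dual_weight G \<nu>] t * d_weight G k \<nu> t) (basis_vec \<nu>))"

definition star ::
  "('n::finite) root_datum \<Rightarrow> nat \<Rightarrow> real \<Rightarrow>
   (real ^ 'n \<Rightarrow> complex) \<Rightarrow> (real ^ 'n \<Rightarrow> complex) \<Rightarrow> (real ^ 'n \<Rightarrow> complex)"
where
  "star G k t u v =
     (\<Sum>\<mu>\<in>level_weights G k. \<Sum>\<mu>'\<in>level_weights G k.
        fun_scale (u \<mu> * v \<mu>') (star_basis G k t \<mu> \<mu>'))"

definition pairing_basis ::
  "('n::finite) root_datum \<Rightarrow> nat \<Rightarrow> real \<Rightarrow> real ^ 'n \<Rightarrow> real ^ 'n \<Rightarrow> complex"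
where
  "pairing_basis G k t \<mu> \<mu>' = (if \<mu> = dual_weight G \<mu>' then inverse (d_weight G k \<mu> t) else 0)"

definition pairing ::
  "('n::finite) root_datum \<Rightarrow> nat \<Rightarrow> real \<Rightarrow>
   (real ^ 'n \<Rightarrow> complex) \<Rightarrow> (real ^ 'n \<Rightarrow> complex) \<Rightarrow> complex"
where
  "pairing G k t u v =
     (\<Sum>\<mu>\<in>level_weights G k. \<Sum>\<mu>'\<in>level_weights G k. u \<mu> * v \<mu>' * pairing_basis G k t \<mu> \<mu>')"

text \<open>Only the values of the product and of the form on the carrier \<open>V\<close> matter.\<close>
locale frobenius_algebra = vector_space scale
  for scale :: "'f::field \<Rightarrow> 'b::ab_group_add \<Rightarrow> 'b" +
  fixes V :: "'b set"
    and mult :: "'b \<Rightarrow> 'b \<Rightarrow> 'b"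
    and form :: "'b \<Rightarrow> 'b \<Rightarrow> 'f"
  assumes subspace_V: "subspace V"
    and finite_dim_V: "\<exists>B. finite B \<and> V = span B"
    and mult_closed: "\<lbrakk>u \<in> V; v \<in> V\<rbrakk> \<Longrightarrow> mult u v \<in> V"
    and mult_add_left: "\<lbrakk>u \<in> V; u' \<in> V; v \<in> V\<rbrakk> \<Longrightarrow> mult (u + u') v = mult u v + mult u' v"
    and mult_add_right: "\<lbrakk>u \<in> V; v \<in> V; v' \<in> V\<rbrakk> \<Longrightarrow> mult u (v + v') = mult u v + mult u v'"
    and mult_scale_left: "\<lbrakk>u \<in> V; v \<in> V\<rbrakk> \<Longrightarrow> mult (scale c u) v = scale c (mult u v)"
    and mult_scale_right: "\<lbrakk>u \<in> V; v \<in> V\<rbrakk> \<Longrightarrow> mult u (scale c v) = scale c (mult u v)"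
    and mult_assoc: "\<lbrakk>u \<in> V; v \<in> V; w \<in> V\<rbrakk> \<Longrightarrow> mult (mult u v) w = mult u (mult v w)"
    and unit: "\<exists>e\<in>V. \<forall>v\<in>V. mult e v = v \<and> mult v e = v"
    and form_add_left: "\<lbrakk>u \<in> V; u' \<in> V; v \<in> V\<rbrakk> \<Longrightarrow> form (u + u') v = form u v + form u' v"
    and form_add_right: "\<lbrakk>u \<in> V; v \<in> V; v' \<in> V\<rbrakk> \<Longrightarrow> form u (v + v') = form u v + form u v'"
    and form_scale_left: "\<lbrakk>u \<in> V; v \<in> V\<rbrakk> \<Longrightarrow> form (scale c u) v = c * form u v"
    and form_scale_right: "\<lbrakk>u \<in> V; v \<in> V\<rbrakk> \<Longrightarrow> form u (scale c v) = c * form u v"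
    and form_invariant: "\<lbrakk>u \<in> V; v \<in> V; w \<in> V\<rbrakk> \<Longrightarrow> form (mult u v) w = form u (mult v w)"
    and form_nondegenerate_left: "\<lbrakk>u \<in> V; \<And>v. v \<in> V \<Longrightarrow> form u v = 0\<rbrakk> \<Longrightarrow> u = 0"
    and form_nondegenerate_right: "\<lbrakk>v \<in> V; \<And>u. u \<in> V \<Longrightarrow> form u v = 0\<rbrakk> \<Longrightarrow> v = 0"

end

theory Submission
  imports Defs
begin

text \<open>
  On \<open>t\<^sub>\<real>\<close> the equations defining \<open>F\<^bsub>\<rho>,t\<^esub>\<close> say that \<open>(k + h) \<Phi>(x)\<close> is a weight, where
  \<open>\<Phi>\<close> is a diffeomorphism, close to the identity, that commutes with the affine Weyl group; its
  derivative is \<open>H\<close>. Hence, by Fourier analysis after the change of variables \<open>z = \<Phi>(x)\<close>, the sum of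
  a periodic function \<open>\<phi>\<close> divided by the Jacobian over the solutions vanishes as soon as
  the integral of \<open>\<phi>(x) exp (2\<pi>i (k + h) (y, \<Phi>(x)))\<close> over the torus is zero for all coroot lattice
  vectors \<open>y\<close>. For the product of the Weyl numerators of \<open>\<Theta>\<^sub>\<lambda>\<close> and of the conjugate of \<open>\<Theta>\<^sub>\<mu>\<close>,
  where \<open>\<lambda> \<noteq> \<mu>\<close> have level \<open>k\<close>, no term of the expansion has a constant Fourier coefficient, because
  \<open>\<lambda>\<close> and \<open>\<mu>\<close> lie in different orbits of the affine Weyl group and the geometric series only move
  the shifted weights further apart. So the functions \<open>\<Theta>\<^sub>\<lambda>\<close> on the orbits of regular solutions
  are orthogonal for the weight \<open>\<theta>\<^sub>t\<close>; their norms are sums of terms of one sign, not all zero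
  for small \<open>t\<close> because this is so at \<open>t = 0\<close>. Moving \<open>\<Phi>(x)\<close> into the alcove shows that there are at
  most as many orbits as weights of level \<open>k\<close>. Thus the \<open>\<Theta>\<^sub>\<lambda>\<close> form a basis of the functions
  on the orbits, the product \<open>\<star>\<^sub>t\<close> is the pointwise one, and the pairing of two functions is the
  \<open>\<theta>\<^sub>t\<close>-weighted sum of their product.
\<close>

section \<open>Reflections and root data\<close>

text \<open>Why no constant Fourier coefficient survives: a term of the expansion has frequency
  \<mu> + \<rho> - u (\<nu> + \<rho>) + (k + h) y plus integer multiples of the positive roots, each
  multiple bounded on one side by an exponent. With z = - y, the bounds number the strips between
  root hyperplanes that contain the image of the alcove under x -> u x + z. Hence the displacement
  \<xi> of the alcove point \<rho> / h has on every root the sign for which the bound is the extreme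
  case. At the extreme, the identity \<Sum> \<alpha>(x) \<alpha> = h x over the positive roots
  removes \<rho> and h and leaves \<mu> - u \<nu> - k z. Its pairing with \<xi> is nonpositive,
  because two points of the closed alcove are at most as far apart as one of them and any image of
  the other. Equality forces \<mu> = u \<nu> + k z, hence \<mu> = \<nu>. Vanishing is thus a matter
  of supports of frequencies. It is carried out with uniform limits of trigonometric polynomials,
  and no Fourier coefficient is computed.\<close>

lemma reflection_inner:
  "reflection \<alpha> x = x - (2 * (x \<bullet> \<alpha>) / (\<alpha> \<bullet> \<alpha>)) *\<^sub>R \<alpha>"
  by (simp add: reflection_def coroot_def)

lemma linear_reflection: "linear (reflection \<alpha>)"
  by (rule linearI) (simp_all add: reflection_def inner_add_left scaleR_add_left algebra_simps)

lemma inner_reflection_both: "reflection \<alpha> x \<bullet> reflection \<alpha> y = x \<bullet> y"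
  by (cases "\<alpha> = 0")
     (simp_all add: reflection_inner inner_diff_left inner_diff_right inner_commute field_simps)

lemma orthogonal_reflection: "orthogonal_transformation (reflection \<alpha>)"
  by (simp add: orthogonal_transformation_def linear_reflection inner_reflection_both)

lemma reflection_reflection [simp]: "reflection \<alpha> (reflection \<alpha> x) = x"
  by (cases "\<alpha> = 0") (simp_all add: reflection_inner inner_diff_left)

lemma reflection_comp_reflection [simp]: "reflection \<alpha> \<circ> reflection \<alpha> = id"
  by (simp add: fun_eq_iff)

lemma inv_reflection [simp]: "inv (reflection \<alpha>) = reflection \<alpha>"
  by (rule inv_unique_comp) simp_all

lemma reflection_self: "\<alpha> \<noteq> 0 \<Longrightarrow> reflection \<alpha> \<alpha> = - \<alpha>"
  by (simp add: reflection_inner flip: scaleR_add_left) (simp add: scaleR_2)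

lemma reflection_adjoint: "reflection \<alpha> x \<bullet> y = x \<bullet> reflection \<alpha> y"
  by (metis inner_reflection_both reflection_reflection)

lemma reflection_coroot: "reflection \<alpha> x = x - (x \<bullet> \<alpha>) *\<^sub>R coroot \<alpha>"
  by (simp add: reflection_inner coroot_def)

lemma coroot_minus: "coroot (- \<alpha>) = - coroot \<alpha>"
  by (simp add: coroot_def)

lemma reflection_minus: "reflection (- \<alpha>) = reflection \<alpha>"
  by (simp add: fun_eq_iff reflection_def coroot_minus)

lemma coroot_orthogonal:
  assumes "orthogonal_transformation w"
  shows "w (coroot \<alpha>) = coroot (w \<alpha>)"
  using assms by (simp add: coroot_def orthogonal_transformation_def linear_scale)

lemma orthogonal_comp_reflection:
  assumes "orthogonal_transformation w"
  shows "w \<circ> reflection \<alpha> = reflection (w \<alpha>) \<circ> w"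
  using assms
  by (simp add: fun_eq_iff reflection_def coroot_orthogonal[symmetric] linear_scale linear_diff
      orthogonal_transformation_def)

lemma coroot_inner_self: "\<alpha> \<noteq> 0 \<Longrightarrow> coroot \<alpha> \<bullet> \<alpha> = 2"
  by (simp add: coroot_def)

lemma inner_coroot_sign:
  "\<alpha> \<noteq> 0 \<Longrightarrow> 0 \<le> x \<bullet> coroot \<alpha> \<longleftrightarrow> 0 \<le> x \<bullet> \<alpha>"
  "\<alpha> \<noteq> 0 \<Longrightarrow> 0 < x \<bullet> coroot \<alpha> \<longleftrightarrow> 0 < x \<bullet> \<alpha>"
  "\<alpha> \<noteq> 0 \<Longrightarrow> x \<bullet> coroot \<alpha> < 0 \<longleftrightarrow> x \<bullet> \<alpha> < 0"
proof -
  assume "\<alpha> \<noteq> 0"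
  then have "2 / (\<alpha> \<bullet> \<alpha>) > 0" by simp
  then show "0 \<le> x \<bullet> coroot \<alpha> \<longleftrightarrow> 0 \<le> x \<bullet> \<alpha>" "0 < x \<bullet> coroot \<alpha> \<longleftrightarrow> 0 < x \<bullet> \<alpha>"
    "x \<bullet> coroot \<alpha> < 0 \<longleftrightarrow> x \<bullet> \<alpha> < 0"
    unfolding coroot_def inner_scaleR_right
    by (meson zero_le_mult_iff zero_less_mult_iff mult_less_0_iff less_le_not_le less_imp_le)+
qed

locale based_root_datum =
  fixes G :: "('n::finite) root_datum" and v :: "real ^ 'n"
  assumes semisimple: "semisimple_group G"
    and v_regular: "\<And>\<alpha>. \<alpha> \<in> roots G \<Longrightarrow> \<alpha> \<bullet> v \<noteq> 0"
    and pos_roots_eq: "pos_roots G = {\<alpha>\<in>roots G. \<alpha> \<bullet> v > 0}"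
begin

abbreviation "R \<equiv> roots G"
abbreviation "P \<equiv> pos_roots G"
abbreviation "W \<equiv> weyl_group G"
abbreviation "Q \<equiv> coroot_lattice G"

lemma root_system: "root_system R"
  using semisimple by (simp add: semisimple_group_def)

lemma finite_R [simp]: "finite R" and zero_notin_R: "0 \<notin> R" and span_R: "span R = UNIV"
  and reflection_R: "\<And>\<alpha> \<beta>. \<alpha> \<in> R \<Longrightarrow> \<beta> \<in> R \<Longrightarrow> reflection \<alpha> \<beta> \<in> R"
  and integral_R: "\<And>\<alpha> \<beta>. \<alpha> \<in> R \<Longrightarrow> \<beta> \<in> R \<Longrightarrow> \<beta> \<bullet> coroot \<alpha> \<in> \<int>"
  and reduced_R: "\<And>\<alpha> c. \<alpha> \<in> R \<Longrightarrow> c *\<^sub>R \<alpha> \<in> R \<Longrightarrow> c = 1 \<or> c = -1"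
  using root_system unfolding root_system_def by auto

lemma nonzero_R: "\<alpha> \<in> R \<Longrightarrow> \<alpha> \<noteq> 0"
  using zero_notin_R by auto

lemma P_subset_R: "P \<subseteq> R" and finite_P [simp]: "finite P"
  by (auto simp: pos_roots_eq)

lemma P_R: "\<alpha> \<in> P \<Longrightarrow> \<alpha> \<in> R"
  using P_subset_R by auto

lemma nonzero_P: "\<alpha> \<in> P \<Longrightarrow> \<alpha> \<noteq> 0"
  using P_R nonzero_R by auto

lemma uminus_R: "\<alpha> \<in> R \<Longrightarrow> - \<alpha> \<in> R"
  using reflection_R[of \<alpha> \<alpha>] reflection_self[of \<alpha>] nonzero_R by auto

lemma uminus_R_iff [simp]: "- \<alpha> \<in> R \<longleftrightarrow> \<alpha> \<in> R"
  using uminus_R[of \<alpha>] uminus_R[of "- \<alpha>"] by auto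

lemma P_or_uminus_P: "\<alpha> \<in> R \<Longrightarrow> \<alpha> \<in> P \<or> - \<alpha> \<in> P"
  using v_regular[of \<alpha>] by (auto simp: pos_roots_eq)

lemma uminus_P: "\<alpha> \<in> P \<Longrightarrow> - \<alpha> \<notin> P"
  by (auto simp: pos_roots_eq)

lemma R_eq: "R = P \<union> uminus ` P" and disjoint_P: "P \<inter> uminus ` P = {}"
  using P_or_uminus_P P_R uminus_R uminus_P by (auto simp: image_iff) (metis minus_minus)+

lemma W_orthogonal: "w \<in> W \<Longrightarrow> orthogonal_transformation w"
  by (induction rule: weyl_group.induct)
     (simp_all only: orthogonal_transformation_compose orthogonal_reflection id_def
       orthogonal_transformation_id)

lemma W_linear: "w \<in> W \<Longrightarrow> linear w"
  using W_orthogonal orthogonal_transformation_linear by auto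

lemma W_inner: "w \<in> W \<Longrightarrow> w x \<bullet> w y = x \<bullet> y"
  using W_orthogonal by (auto simp: orthogonal_transformation_def)

lemma W_bij: "w \<in> W \<Longrightarrow> bij w"
  using W_orthogonal orthogonal_transformation_bij by auto

lemma W_inv_left [simp]: "w \<in> W \<Longrightarrow> inv w (w x) = x"
  using W_bij by (simp add: bij_is_inj)

lemma W_inv_right [simp]: "w \<in> W \<Longrightarrow> w (inv w x) = x"
  using W_bij by (simp add: bij_is_surj surj_f_inv_f)

lemma W_inj: "w \<in> W \<Longrightarrow> w x = w y \<longleftrightarrow> x = y"
  by (metis W_inv_left)

lemma W_inner_inv: "w \<in> W \<Longrightarrow> w x \<bullet> y = x \<bullet> inv w y"
  by (metis W_inner W_inv_right)

lemma W_diff: "w \<in> W \<Longrightarrow> w (x - y) = w x - w y" and W_add: "w \<in> W \<Longrightarrow> w (x + y) = w x + w y"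
  and W_scale: "w \<in> W \<Longrightarrow> w (c *\<^sub>R x) = c *\<^sub>R w x" and W_minus: "w \<in> W \<Longrightarrow> w (- x) = - w x"
  and W_zero: "w \<in> W \<Longrightarrow> w 0 = 0" and W_sum: "w \<in> W \<Longrightarrow> w (sum f A) = (\<Sum>a\<in>A. w (f a))"
  using W_linear by (auto simp: linear_diff linear_add linear_scale linear_neg linear_0 linear_sum)

lemma W_comp: "u \<in> W \<Longrightarrow> w \<in> W \<Longrightarrow> u \<circ> w \<in> W"
  by (induction rule: weyl_group.induct) (auto simp: comp_assoc intro: weyl_group.intros)

lemma reflection_W: "\<alpha> \<in> R \<Longrightarrow> reflection \<alpha> \<in> W"
  using weyl_group.refl[OF _ weyl_group.id, of \<alpha> G] by simp

lemma id_W [simp]: "id \<in> W"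
  by (rule weyl_group.id)

lemma W_inv: "w \<in> W \<Longrightarrow> inv w \<in> W"
proof (induction rule: weyl_group.induct)
  case (refl \<alpha> w)
  have "inv (reflection \<alpha> \<circ> w) = inv w \<circ> inv (reflection \<alpha>)"
    by (rule o_inv_distrib) (auto simp: W_bij refl reflection_W)
  moreover have "inv w \<circ> reflection \<alpha> \<in> W" by (rule W_comp) (auto simp: refl reflection_W)
  ultimately show ?case by (simp only: inv_reflection)
qed (simp only: inv_id weyl_group.id)

lemma W_inv_inv: "w \<in> W \<Longrightarrow> inv (inv w) = w"
  by (simp add: W_bij inv_inv_eq)

lemma W_inv_comp: "u \<in> W \<Longrightarrow> w \<in> W \<Longrightarrow> inv (u \<circ> w) = inv w \<circ> inv u"
  by (simp add: W_bij o_inv_distrib)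

lemma W_R: "w \<in> W \<Longrightarrow> \<alpha> \<in> R \<Longrightarrow> w \<alpha> \<in> R"
  by (induction arbitrary: \<alpha> rule: weyl_group.induct) (auto simp: reflection_R)

lemma W_image_R: "w \<in> W \<Longrightarrow> w ` R = R"
  by (metis W_R W_inj card_image finite_R inj_onI card_subset_eq image_subsetI)

lemma bij_betw_W_R: "w \<in> W \<Longrightarrow> bij_betw w R R"
  by (simp add: bij_betw_def W_image_R inj_on_def W_inj)

lemma W_eqI:
  assumes "u \<in> W" "w \<in> W" "\<And>\<alpha>. \<alpha> \<in> R \<Longrightarrow> u \<alpha> = w \<alpha>"
  shows "u = w"
proof
  fix x
  have "x \<in> span R" by (simp add: span_R)
  then show "u x = w x"
    using linear_eq_on_span[OF W_linear[OF assms(1)] W_linear[OF assms(2)] assms(3)] by blast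
qed

lemma finite_W [simp]: "finite W"
proof -
  have "inj_on (\<lambda>w. restrict w R) W"
  proof (rule inj_onI)
    fix u w assume uw: "u \<in> W" "w \<in> W" and eq: "restrict u R = restrict w R"
    have "u \<alpha> = w \<alpha>" if "\<alpha> \<in> R" for \<alpha>
      using fun_cong[OF eq, of \<alpha>] that by simp
    then show "u = w" by (rule W_eqI[OF uw])
  qed
  moreover have "(\<lambda>w. restrict w R) ` W \<subseteq> R \<rightarrow>\<^sub>E R"
    using W_R by auto
  ultimately show ?thesis
    by (meson finite_PiE finite_R finite_imageD finite_subset)
qed

lemma coroot_W: "w \<in> W \<Longrightarrow> w (coroot \<alpha>) = coroot (w \<alpha>)"
  by (simp add: coroot_orthogonal W_orthogonal)

lemma W_reflection: "w \<in> W \<Longrightarrow> w \<circ> reflection \<alpha> = reflection (w \<alpha>) \<circ> w"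
  by (simp add: orthogonal_comp_reflection W_orthogonal)

lemma bij_betw_W_comp: "u \<in> W \<Longrightarrow> bij_betw (\<lambda>w. u \<circ> w) W W"
  by (rule bij_betw_byWitness[of _ "\<lambda>w. inv u \<circ> w"]) (auto simp: W_comp W_inv fun_eq_iff)

section \<open>Simple roots\<close>

text \<open>The product of the two Cartan integers is four times the squared cosine of the angle. It
  is below 4 by Cauchy-Schwarz, strictly because reducedness excludes parallel roots, and two
  positive integers with product at most 3 include a 1.\<close>

lemma cartan_integer_one:
  assumes "\<alpha> \<in> R" "\<beta> \<in> R" "\<alpha> \<bullet> \<beta> > 0" "\<alpha> \<noteq> \<beta>"
  shows "\<alpha> \<bullet> coroot \<beta> = 1 \<or> \<beta> \<bullet> coroot \<alpha> = 1"
proof -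
  have nz: "\<alpha> \<bullet> \<alpha> > 0" "\<beta> \<bullet> \<beta> > 0"
    using assms nonzero_R by auto
  obtain m where m: "\<alpha> \<bullet> coroot \<beta> = of_int m"
    using integral_R[OF assms(2,1)] by (auto elim: Ints_cases)
  obtain n where n: "\<beta> \<bullet> coroot \<alpha> = of_int n"
    using integral_R[OF assms(1,2)] by (auto elim: Ints_cases)
  have pos: "m > 0" "n > 0"
    using assms(3) nz m n inner_coroot_sign(2)[of \<beta> \<alpha>] inner_coroot_sign(2)[of \<alpha> \<beta>]
    by (auto simp: inner_commute)
  have eq: "real_of_int (m * n) * ((\<alpha> \<bullet> \<alpha>) * (\<beta> \<bullet> \<beta>)) = 4 * (\<alpha> \<bullet> \<beta>)\<^sup>2"
    using nz unfolding of_int_mult m[symmetric] n[symmetric]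
    by (simp add: coroot_def inner_commute power2_eq_square field_simps)
  have "(\<alpha> \<bullet> \<beta>)\<^sup>2 \<noteq> (\<alpha> \<bullet> \<alpha>) * (\<beta> \<bullet> \<beta>)"
  proof
    assume "(\<alpha> \<bullet> \<beta>)\<^sup>2 = (\<alpha> \<bullet> \<alpha>) * (\<beta> \<bullet> \<beta>)"
    then have "(\<alpha> \<bullet> \<beta>)\<^sup>2 = (norm \<alpha> * norm \<beta>)\<^sup>2"
      by (simp add: power_mult_distrib power2_norm_eq_inner)
    then have "\<alpha> \<bullet> \<beta> = norm \<alpha> * norm \<beta>"
      using assms(3) by (simp add: power2_eq_iff_nonneg)
    then have "norm \<alpha> *\<^sub>R \<beta> = norm \<beta> *\<^sub>R \<alpha>"
      using assms(3) norm_cauchy_schwarz_eq[of \<alpha> \<beta>] by auto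
    then have "(1 / norm \<alpha>) *\<^sub>R (norm \<alpha> *\<^sub>R \<beta>) = (1 / norm \<alpha>) *\<^sub>R (norm \<beta> *\<^sub>R \<alpha>)" by simp
    then have "\<beta> = (norm \<beta> / norm \<alpha>) *\<^sub>R \<alpha>"
      using nz by simp
    moreover have "norm \<beta> / norm \<alpha> > 0" using nz by auto
    moreover have "norm \<beta> / norm \<alpha> = 1 \<or> norm \<beta> / norm \<alpha> = - 1"
      using reduced_R[OF assms(1), of "norm \<beta> / norm \<alpha>"] assms(2) calculation(1) by simp
    ultimately have "norm \<beta> / norm \<alpha> = 1" by linarith
    with \<open>\<beta> = (norm \<beta> / norm \<alpha>) *\<^sub>R \<alpha>\<close> have "\<beta> = 1 *\<^sub>R \<alpha>" by metis
    then show False using assms(4) by simp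
  qed
  moreover have "(\<alpha> \<bullet> \<beta>)\<^sup>2 \<le> (\<alpha> \<bullet> \<alpha>) * (\<beta> \<bullet> \<beta>)"
    by (rule Cauchy_Schwarz_ineq)
  ultimately have "real_of_int (m * n) * ((\<alpha> \<bullet> \<alpha>) * (\<beta> \<bullet> \<beta>)) < 4 * ((\<alpha> \<bullet> \<alpha>) * (\<beta> \<bullet> \<beta>))"
    unfolding eq by simp
  then have "real_of_int (m * n) < 4"
    using nz by (simp add: mult_less_cancel_right)
  then have lt: "m * n < 4" by linarith
  have "m = 1 \<or> n = 1"
  proof (rule ccontr)
    assume "\<not> ?thesis"
    then have "m \<ge> 2" "n \<ge> 2" using pos by auto
    then have "m * n \<ge> 2 * 2" by (intro mult_mono) auto
    then show False using lt by simp
  qed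
  then show ?thesis using m n by auto
qed

lemma root_diff:
  assumes "\<alpha> \<in> R" "\<beta> \<in> R" "\<alpha> \<bullet> \<beta> > 0" "\<alpha> \<noteq> \<beta>"
  shows "\<alpha> - \<beta> \<in> R"
  using cartan_integer_one[OF assms]
proof
  assume "\<alpha> \<bullet> coroot \<beta> = 1"
  then show ?thesis
    using reflection_R[OF assms(2,1)] by (simp add: reflection_def)
next
  assume "\<beta> \<bullet> coroot \<alpha> = 1"
  then show ?thesis
    using reflection_R[OF assms(1,2)] uminus_R by (fastforce simp: reflection_def)
qed

text \<open>Taking the indecomposable positive roots requires no choice. That they form a basis is
  derived later, from their obtuse angles and from \<open>simple_decomposition\<close>.\<close>

definition simple_roots :: "(real ^ 'n) set" where
  "simple_roots = {\<alpha>\<in>P. \<forall>\<beta>\<in>P. \<forall>\<gamma>\<in>P. \<alpha> \<noteq> \<beta> + \<gamma>}"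

abbreviation "\<Delta> \<equiv> simple_roots"

lemma simple_P: "\<alpha> \<in> \<Delta> \<Longrightarrow> \<alpha> \<in> P" and finite_\<Delta> [simp]: "finite \<Delta>"
  by (auto simp: simple_roots_def)

lemma simple_R: "\<alpha> \<in> \<Delta> \<Longrightarrow> \<alpha> \<in> R"
  using simple_P P_R by auto

text \<open>The height is the value on the regular vector \<open>v\<close> that defines the positive
  system; on the finite set of roots it can decrease only finitely often.\<close>

lemma height_induct [consumes 1, case_names less]:
  assumes "\<alpha> \<in> R"
    and "\<And>\<alpha>. \<alpha> \<in> R \<Longrightarrow> (\<And>\<beta>. \<beta> \<in> R \<Longrightarrow> \<beta> \<bullet> v < \<alpha> \<bullet> v \<Longrightarrow> Pr \<beta>) \<Longrightarrow> Pr \<alpha>"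
  shows "Pr \<alpha>"
  using assms(1)
proof (induction "card {\<beta>\<in>R. \<beta> \<bullet> v < \<alpha> \<bullet> v}" arbitrary: \<alpha> rule: less_induct)
  case less
  show ?case
  proof (rule assms(2)[OF less.prems])
    fix \<beta> assume b: "\<beta> \<in> R" "\<beta> \<bullet> v < \<alpha> \<bullet> v"
    have "{\<gamma>\<in>R. \<gamma> \<bullet> v < \<beta> \<bullet> v} \<subset> {\<gamma>\<in>R. \<gamma> \<bullet> v < \<alpha> \<bullet> v}" using b by auto
    then show "Pr \<beta>" by (intro less.hyps b psubset_card_mono) auto
  qed
qed

lemma simple_decomposition:
  assumes "\<alpha> \<in> P"
  shows "\<exists>c :: real ^ 'n \<Rightarrow> nat. \<alpha> = (\<Sum>\<gamma>\<in>\<Delta>. of_nat (c \<gamma>) *\<^sub>R \<gamma>)"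
  using P_R[OF assms] assms
proof (induction rule: height_induct)
  case (less \<alpha>)
  show ?case
  proof (cases "\<alpha> \<in> \<Delta>")
    case True
    have "\<alpha> = (\<Sum>\<gamma>\<in>\<Delta>. of_nat (if \<gamma> = \<alpha> then 1 else 0) *\<^sub>R \<gamma>)"
      using True by (simp add: if_distrib if_distribR sum.delta cong: if_cong)
    then show ?thesis by (rule exI[of _ "\<lambda>\<gamma>. if \<gamma> = \<alpha> then 1 else 0"])
  next
    case False
    then obtain \<beta> \<gamma> where bg: "\<beta> \<in> P" "\<gamma> \<in> P" "\<alpha> = \<beta> + \<gamma>"
      using less.prems by (auto simp: simple_roots_def)
    then have "\<beta> \<bullet> v < \<alpha> \<bullet> v" "\<gamma> \<bullet> v < \<alpha> \<bullet> v"
      by (auto simp: inner_add_left pos_roots_eq)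
    then obtain c d :: "real ^ 'n \<Rightarrow> nat" where
      "\<beta> = (\<Sum>\<gamma>\<in>\<Delta>. of_nat (c \<gamma>) *\<^sub>R \<gamma>)" "\<gamma> = (\<Sum>\<gamma>\<in>\<Delta>. of_nat (d \<gamma>) *\<^sub>R \<gamma>)"
      using less.IH[of \<beta>] less.IH[of \<gamma>] bg P_R by auto
    then have "\<alpha> = (\<Sum>\<gamma>\<in>\<Delta>. of_nat (c \<gamma> + d \<gamma>) *\<^sub>R \<gamma>)"
      by (simp add: bg scaleR_add_left sum.distrib)
    then show ?thesis by (rule exI[of _ "\<lambda>\<gamma>. c \<gamma> + d \<gamma>"])
  qed
qed

lemma simple_obtuse:
  assumes "\<alpha> \<in> \<Delta>" "\<beta> \<in> \<Delta>" "\<alpha> \<noteq> \<beta>"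
  shows "\<alpha> \<bullet> \<beta> \<le> 0"
proof (rule ccontr)
  assume "\<not> ?thesis"
  then have "\<alpha> - \<beta> \<in> R" using root_diff assms simple_R by auto
  then have "\<alpha> - \<beta> \<in> P \<or> \<beta> - \<alpha> \<in> P" using P_or_uminus_P by fastforce
  moreover have "\<alpha> = \<beta> + (\<alpha> - \<beta>)" "\<beta> = \<alpha> + (\<beta> - \<alpha>)" by auto
  ultimately show False using assms unfolding simple_roots_def by blast
qed

text \<open>Separating positive and negative coefficients writes one vector x as two nonnegative
  combinations with disjoint supports. Obtuse angles give x \<bullet> x \<le> 0, and pairing x = 0
  with \<open>v\<close> kills the coefficients on both sides.\<close>

lemma simple_independent:
  assumes "(\<Sum>\<gamma>\<in>\<Delta>. c \<gamma> *\<^sub>R \<gamma>) = 0" "\<gamma> \<in> \<Delta>"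
  shows "c \<gamma> = (0::real)"
proof -
  have key: "d \<gamma> = 0"
    if d: "\<And>\<gamma>. \<gamma> \<in> \<Delta> \<Longrightarrow> d \<gamma> \<ge> 0" "(\<Sum>\<gamma>\<in>\<Delta>. d \<gamma> *\<^sub>R \<gamma>) = 0" "\<gamma> \<in> \<Delta>" for d :: "real^'n \<Rightarrow> real" and \<gamma>
  proof -
    have "(\<Sum>\<gamma>\<in>\<Delta>. d \<gamma> * (\<gamma> \<bullet> v)) = (\<Sum>\<gamma>\<in>\<Delta>. d \<gamma> *\<^sub>R \<gamma>) \<bullet> v" by (simp add: inner_sum_left)
    also have "\<dots> = 0" by (simp add: d)
    finally have "\<forall>\<gamma>\<in>\<Delta>. d \<gamma> * (\<gamma> \<bullet> v) = 0"
      using d(1) simple_P by (subst (asm) sum_nonneg_eq_0_iff) (auto simp: pos_roots_eq less_imp_le)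
    then show ?thesis using d(3) simple_P by (fastforce simp: pos_roots_eq)
  qed
  define a where "a \<gamma> = max (c \<gamma>) 0" for \<gamma>
  define b where "b \<gamma> = max (- c \<gamma>) 0" for \<gamma>
  define x where "x = (\<Sum>\<gamma>\<in>\<Delta>. a \<gamma> *\<^sub>R \<gamma>)"
  have cab: "c \<gamma> = a \<gamma> - b \<gamma>" for \<gamma> by (auto simp: a_def b_def)
  have "(\<Sum>\<gamma>\<in>\<Delta>. c \<gamma> *\<^sub>R \<gamma>) = x - (\<Sum>\<gamma>\<in>\<Delta>. b \<gamma> *\<^sub>R \<gamma>)"
    by (simp add: cab x_def scaleR_diff_left sum_subtractf)
  then have x: "x = (\<Sum>\<gamma>\<in>\<Delta>. b \<gamma> *\<^sub>R \<gamma>)" using assms(1) by simp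
  have "x \<bullet> x = (\<Sum>\<gamma>\<in>\<Delta>. a \<gamma> *\<^sub>R \<gamma>) \<bullet> (\<Sum>\<gamma>\<in>\<Delta>. b \<gamma> *\<^sub>R \<gamma>)"
    using x x_def by simp
  also have "\<dots> = (\<Sum>\<gamma>\<in>\<Delta>. \<Sum>\<delta>\<in>\<Delta>. a \<gamma> * b \<delta> * (\<gamma> \<bullet> \<delta>))"
    by (simp only: inner_sum_left, simp add: inner_sum_right sum_distrib_left mult_ac)
  also have "\<dots> \<le> 0"
  proof (intro sum_nonpos)
    fix \<gamma> \<delta> assume "\<gamma> \<in> \<Delta>" "\<delta> \<in> \<Delta>"
    then show "a \<gamma> * b \<delta> * (\<gamma> \<bullet> \<delta>) \<le> 0"
      using simple_obtuse[of \<gamma> \<delta>]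
      by (cases "\<gamma> = \<delta>") (auto simp: a_def b_def mult_nonneg_nonpos max_def)
  qed
  finally have "x = 0" using inner_gt_zero_iff[of x] by linarith
  then have "a \<gamma> = 0" "b \<gamma> = 0"
    using key[of a] key[of b] assms(2) x x_def by (auto simp: a_def b_def)
  then show ?thesis by (simp add: cab)
qed

lemma independent_\<Delta>: "independent \<Delta>"
proof
  assume "dependent \<Delta>"
  then obtain u where "(\<exists>x\<in>\<Delta>. u x \<noteq> 0)" "(\<Sum>v\<in>\<Delta>. u v *\<^sub>R v) = 0"
    by (auto simp: dependent_finite)
  then show False using simple_independent by auto
qed

lemma P_in_span_\<Delta>: "\<alpha> \<in> P \<Longrightarrow> \<alpha> \<in> span \<Delta>"
proof -
  assume "\<alpha> \<in> P"
  then obtain c :: "real ^ 'n \<Rightarrow> nat" where c: "\<alpha> = (\<Sum>\<gamma>\<in>\<Delta>. of_nat (c \<gamma>) *\<^sub>R \<gamma>)"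
    using simple_decomposition[of \<alpha>] by blast
  show ?thesis unfolding c by (intro span_sum span_scale span_base)
qed

lemma span_\<Delta>: "span \<Delta> = UNIV"
proof -
  have "R \<subseteq> span \<Delta>"
  proof
    fix \<alpha> assume "\<alpha> \<in> R"
    then consider "\<alpha> \<in> P" | "- \<alpha> \<in> P" using P_or_uminus_P by auto
    then show "\<alpha> \<in> span \<Delta>"
      by cases (use P_in_span_\<Delta> span_neg[of "- \<alpha>" \<Delta>] in auto)
  qed
  then show ?thesis using span_R span_minimal[of R "span \<Delta>"] by auto
qed

lemma card_\<Delta>: "card \<Delta> = CARD('n)"
  using dim_eq_card_independent[OF independent_\<Delta>] span_\<Delta>
  by (metis dim_UNIV dim_span DIM_cart DIM_real mult_1_right)

text \<open>If the reflected root were negative, \<beta> and the negative of its image would both be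
  nonnegative combinations of simple roots, with sum a multiple of \<gamma>. Independence makes
  \<beta> itself a multiple of \<gamma>, and reducedness makes it \<gamma>.\<close>

lemma reflection_simple_P:
  assumes "\<gamma> \<in> \<Delta>" "\<beta> \<in> P" "\<beta> \<noteq> \<gamma>"
  shows "reflection \<gamma> \<beta> \<in> P"
proof (rule ccontr)
  assume n: "reflection \<gamma> \<beta> \<notin> P"
  have "reflection \<gamma> \<beta> \<in> R" using assms simple_R P_R reflection_R by auto
  then have m: "- reflection \<gamma> \<beta> \<in> P" using n P_or_uminus_P by auto
  obtain c :: "real ^ 'n \<Rightarrow> nat" where c: "\<beta> = (\<Sum>\<gamma>\<in>\<Delta>. of_nat (c \<gamma>) *\<^sub>R \<gamma>)"
    using simple_decomposition[OF assms(2)] by blast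
  obtain d :: "real ^ 'n \<Rightarrow> nat" where d: "- reflection \<gamma> \<beta> = (\<Sum>\<gamma>\<in>\<Delta>. of_nat (d \<gamma>) *\<^sub>R \<gamma>)"
    using simple_decomposition[OF m] by blast
  define k where "k = \<beta> \<bullet> coroot \<gamma>"
  have "(\<Sum>\<delta>\<in>\<Delta>. (if \<delta> = \<gamma> then k else 0) *\<^sub>R \<delta>) = k *\<^sub>R \<gamma>"
    using assms(1) by (simp add: if_distrib if_distribR sum.delta cong: if_cong)
  moreover have "0 = \<beta> + (- reflection \<gamma> \<beta>) - k *\<^sub>R \<gamma>" by (simp add: reflection_def k_def)
  ultimately have "0 = (\<Sum>\<gamma>\<in>\<Delta>. of_nat (c \<gamma>) *\<^sub>R \<gamma>) + (\<Sum>\<gamma>\<in>\<Delta>. of_nat (d \<gamma>) *\<^sub>R \<gamma>)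
      - (\<Sum>\<delta>\<in>\<Delta>. (if \<delta> = \<gamma> then k else 0) *\<^sub>R \<delta>)"
    unfolding c[symmetric] d[symmetric] by simp
  also have "\<dots> = (\<Sum>\<delta>\<in>\<Delta>. (real (c \<delta>) + real (d \<delta>) - (if \<delta> = \<gamma> then k else 0)) *\<^sub>R \<delta>)"
    by (simp only: scaleR_diff_left scaleR_add_left sum.distrib sum_subtractf)
  finally have z: "real (c \<delta>) + real (d \<delta>) - (if \<delta> = \<gamma> then k else 0) = 0" if "\<delta> \<in> \<Delta>" for \<delta>
    using simple_independent[OF _ that, of "\<lambda>\<delta>. real (c \<delta>) + real (d \<delta>) - (if \<delta> = \<gamma> then k else 0)"] by simp
  then have "c \<delta> = 0" if "\<delta> \<in> \<Delta>" "\<delta> \<noteq> \<gamma>" for \<delta> using z[OF that(1)] that(2) by simp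
  then have "\<beta> = (\<Sum>\<delta>\<in>{\<gamma>}. of_nat (c \<delta>) *\<^sub>R \<delta>)"
    by (subst c, intro sum.mono_neutral_right) (use assms in auto)
  then have "\<beta> = real (c \<gamma>) *\<^sub>R \<gamma>" by simp
  then have "real (c \<gamma>) = 1"
    using reduced_R[OF simple_R[OF assms(1)], of "real (c \<gamma>)"] P_R[OF assms(2)] by auto
  then show False using \<open>\<beta> = real (c \<gamma>) *\<^sub>R \<gamma>\<close> assms(3) by simp
qed

lemma simple_inner_pos_exists:
  assumes "\<alpha> \<in> P" shows "\<exists>\<gamma>\<in>\<Delta>. \<alpha> \<bullet> \<gamma> > 0"
proof (rule ccontr)
  assume "\<not> ?thesis"
  moreover obtain c :: "real ^ 'n \<Rightarrow> nat" where c: "\<alpha> = (\<Sum>\<gamma>\<in>\<Delta>. of_nat (c \<gamma>) *\<^sub>R \<gamma>)"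
    using simple_decomposition[OF assms] by blast
  have "\<alpha> \<bullet> \<alpha> = (\<Sum>\<gamma>\<in>\<Delta>. real (c \<gamma>) * (\<alpha> \<bullet> \<gamma>))"
    by (subst (2) c) (simp add: inner_sum_right)
  ultimately have "\<alpha> \<bullet> \<alpha> \<le> 0"
    by (auto intro!: sum_nonpos simp: mult_nonneg_nonpos not_less)
  then show False using nonzero_P[OF assms] inner_gt_zero_iff[of \<alpha>] by linarith
qed

text \<open>A suitable simple reflection lowers the height and changes the coroot by a positive
  integer multiple of a simple coroot. The induction runs over the original roots, so the dual root
  system never has to be built.\<close>

lemma coroot_decomposition:
  assumes "\<alpha> \<in> P"
  shows "\<exists>c :: real ^ 'n \<Rightarrow> nat. coroot \<alpha> = (\<Sum>\<gamma>\<in>\<Delta>. of_nat (c \<gamma>) *\<^sub>R coroot \<gamma>)"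
  using P_R[OF assms] assms
proof (induction rule: height_induct)
  case (less \<alpha>)
  obtain \<gamma> where g: "\<gamma> \<in> \<Delta>" "\<alpha> \<bullet> \<gamma> > 0"
    using simple_inner_pos_exists less.prems by blast
  show ?case
  proof (cases "\<alpha> = \<gamma>")
    case True
    have "coroot \<alpha> = (\<Sum>\<gamma>\<in>\<Delta>. of_nat (if \<gamma> = \<alpha> then 1 else 0) *\<^sub>R coroot \<gamma>)"
      using True g by (simp add: if_distrib if_distribR sum.delta cong: if_cong)
    then show ?thesis by (rule exI[of _ "\<lambda>\<gamma>. if \<gamma> = \<alpha> then 1 else 0"])
  next
    case False
    define \<beta> where "\<beta> = reflection \<gamma> \<alpha>"
    have bP: "\<beta> \<in> P" unfolding \<beta>_def using reflection_simple_P g False less.prems by auto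
    have "\<beta> \<bullet> v < \<alpha> \<bullet> v"
      using g simple_P[OF g(1)] nonzero_P[of \<gamma>]
      by (auto simp: \<beta>_def reflection_def inner_diff_left pos_roots_eq inner_coroot_sign)
    then obtain c :: "real ^ 'n \<Rightarrow> nat" where c: "coroot \<beta> = (\<Sum>\<gamma>\<in>\<Delta>. of_nat (c \<gamma>) *\<^sub>R coroot \<gamma>)"
      using less.IH[of \<beta>] bP P_R by auto
    obtain m where m: "\<gamma> \<bullet> coroot \<alpha> = of_int m"
      using integral_R[OF P_R[OF less.prems] simple_R[OF g(1)]] by (auto elim: Ints_cases)
    have "\<gamma> \<bullet> coroot \<alpha> > 0"
      using g nonzero_P[OF less.prems] inner_coroot_sign(2)[of \<alpha> \<gamma>] by (simp add: inner_commute)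
    then have "m > 0" using m by simp
    then have mm: "real_of_int m = real (nat m)" by simp
    have "coroot \<beta> = reflection \<gamma> (coroot \<alpha>)"
      by (simp add: \<beta>_def coroot_orthogonal orthogonal_reflection)
    then have "coroot \<alpha> = coroot \<beta> + real (nat m) *\<^sub>R coroot \<gamma>"
      by (simp add: reflection_coroot inner_commute m mm[symmetric])
    also have "\<dots> = (\<Sum>\<delta>\<in>\<Delta>. of_nat (c \<delta> + (if \<delta> = \<gamma> then nat m else 0)) *\<^sub>R coroot \<delta>)"
    proof -
      have "(\<Sum>\<delta>\<in>\<Delta>. (if \<delta> = \<gamma> then real (nat m) else 0) *\<^sub>R coroot \<delta>) = real (nat m) *\<^sub>R coroot \<gamma>"
        using g(1) by (simp add: if_distrib if_distribR sum.delta cong: if_cong)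
      then show ?thesis
        by (simp add: c scaleR_add_left sum.distrib if_distrib[of of_nat] cong: if_cong)
    qed
    finally show ?thesis by (rule exI[of _ "\<lambda>\<delta>. c \<delta> + (if \<delta> = \<gamma> then nat m else 0)"])
  qed
qed

end

section \<open>The Weyl group\<close>

lemma finite_arg_max:
  fixes f :: "'a \<Rightarrow> real"
  assumes "finite A" "A \<noteq> {}"
  shows "\<exists>a\<in>A. \<forall>b\<in>A. f b \<le> f a"
proof -
  have "Max (f ` A) \<in> f ` A" using assms by (intro Max_in) auto
  then obtain a where "a \<in> A" "f a = Max (f ` A)" by auto
  then show ?thesis using assms(1) by (intro bexI[of _ a]) auto
qed

lemma finite_arg_min:
  fixes f :: "'a \<Rightarrow> real"
  assumes "finite A" "A \<noteq> {}"
  shows "\<exists>a\<in>A. \<forall>b\<in>A. f a \<le> f b"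
  using finite_arg_max[OF assms, of "\<lambda>a. - f a"] by simp

primrec reflection_word :: "(real ^ 'n) list \<Rightarrow> real ^ 'n \<Rightarrow> real ^ 'n" where
  "reflection_word [] = id"
| "reflection_word (\<gamma> # \<gamma>s) = reflection \<gamma> \<circ> reflection_word \<gamma>s"

lemma reflection_word_append:
  "reflection_word (xs @ ys) = reflection_word xs \<circ> reflection_word ys"
  by (induction xs) (simp_all only: append.simps reflection_word.simps comp_assoc id_comp)

lemma reflection_conj:
  fixes w :: "real ^ 'n \<Rightarrow> real ^ 'n"
  assumes "orthogonal_transformation w"
  shows "reflection (w \<alpha>) = w \<circ> reflection \<alpha> \<circ> inv w"
proof -
  have "surj w" using assms by (simp add: orthogonal_transformation_surj)
  then show ?thesis
    by (simp only: orthogonal_comp_reflection[OF assms] comp_assoc surj_iff[symmetric]) (simp add: surj_iff)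
qed

context based_root_datum
begin

lemma reflection_word_W: "set \<gamma>s \<subseteq> R \<Longrightarrow> reflection_word \<gamma>s \<in> W"
  by (induction \<gamma>s) (simp_all only: reflection_word.simps weyl_group.id weyl_group.refl set_simps insert_subset)

text \<open>Conjugation with a simple reflection that lowers the root reduces the claim to a root of
  smaller height.\<close>

lemma reflection_simple_word:
  assumes "\<alpha> \<in> P" shows "\<exists>\<gamma>s. set \<gamma>s \<subseteq> \<Delta> \<and> reflection \<alpha> = reflection_word \<gamma>s"
  using P_R[OF assms] assms
proof (induction rule: height_induct)
  case (less \<alpha>)
  obtain \<gamma> where g: "\<gamma> \<in> \<Delta>" "\<alpha> \<bullet> \<gamma> > 0"
    using simple_inner_pos_exists less.prems by blast
  show ?case
  proof (cases "\<alpha> = \<gamma>")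
    case True
    have "reflection \<alpha> = reflection_word [\<gamma>]" using True by (simp only: reflection_word.simps comp_id)
    then show ?thesis using g by (intro exI[of _ "[\<gamma>]"]) simp
  next
    case False
    define \<beta> where "\<beta> = reflection \<gamma> \<alpha>"
    have bP: "\<beta> \<in> P" unfolding \<beta>_def using reflection_simple_P g False less.prems by auto
    have "\<beta> \<bullet> v < \<alpha> \<bullet> v"
      using g simple_P[OF g(1)] nonzero_P[of \<gamma>]
      by (auto simp: \<beta>_def reflection_def inner_diff_left pos_roots_eq inner_coroot_sign)
    then obtain \<gamma>s where gs: "set \<gamma>s \<subseteq> \<Delta>" "reflection \<beta> = reflection_word \<gamma>s"
      using less.IH[of \<beta>] bP P_R by auto
    have "\<alpha> = reflection \<gamma> \<beta>" by (simp add: \<beta>_def)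
    then have "reflection \<alpha> = reflection \<gamma> \<circ> reflection \<beta> \<circ> reflection \<gamma>"
      using reflection_conj[OF orthogonal_reflection, of \<gamma> \<beta>] by (simp only: inv_reflection)
    also have "\<dots> = reflection_word (\<gamma> # \<gamma>s @ [\<gamma>])"
      by (simp only: gs reflection_word.simps reflection_word_append comp_id comp_assoc)
    finally show ?thesis using gs g by (intro exI[of _ "\<gamma> # \<gamma>s @ [\<gamma>]"]) simp
  qed
qed

lemma W_simple_word: "w \<in> W \<Longrightarrow> \<exists>\<gamma>s. set \<gamma>s \<subseteq> \<Delta> \<and> w = reflection_word \<gamma>s"
proof (induction rule: weyl_group.induct)
  case id
  then show ?case by (intro exI[of _ "[]"]) simp
next
  case (refl \<alpha> w)
  then obtain \<gamma>s where g: "set \<gamma>s \<subseteq> \<Delta>" "w = reflection_word \<gamma>s" by auto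
  obtain \<delta>s where d: "set \<delta>s \<subseteq> \<Delta>" "reflection \<alpha> = reflection_word \<delta>s"
    using P_or_uminus_P[OF refl(1)] reflection_simple_word[of \<alpha>] reflection_simple_word[of "- \<alpha>"]
    by (metis reflection_minus)
  have "reflection \<alpha> \<circ> w = reflection_word (\<delta>s @ \<gamma>s)"
    by (simp only: reflection_word_append g d)
  then show ?case using g d by (intro exI[of _ "\<delta>s @ \<gamma>s"]) simp
qed

lemma inv_reflection_comp: "\<alpha> \<in> R \<Longrightarrow> w \<in> W \<Longrightarrow> inv (reflection \<alpha> \<circ> w) x = inv w (reflection \<alpha> x)"
  using W_inv_comp[OF reflection_W[of \<alpha>], of w] by (metis comp_apply inv_reflection)

text \<open>The exchange condition in terms of lengths. The root is carried along the word until it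
  equals the current letter; there the two reflections cancel and a letter is lost.\<close>

lemma exchange:
  assumes "set us \<subseteq> \<Delta>" "\<alpha> \<in> P" "inv (reflection_word us) \<alpha> \<notin> P"
  shows "\<exists>us'. set us' \<subseteq> \<Delta> \<and> length us = Suc (length us') \<and>
           reflection \<alpha> \<circ> reflection_word us = reflection_word us'"
  using assms
proof (induction us arbitrary: \<alpha>)
  case Nil
  have "inv id \<alpha> = \<alpha>" by (simp only: inv_id id_apply)
  then show ?case using Nil.prems by (metis reflection_word.simps(1))
next
  case (Cons \<beta> us)
  have b: "\<beta> \<in> \<Delta>" "\<beta> \<in> R" and us: "set us \<subseteq> \<Delta>" using Cons.prems simple_R by auto
  have uW: "reflection_word us \<in> W"
    using us simple_R by (intro reflection_word_W) auto
  show ?case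
  proof (cases "\<alpha> = \<beta>")
    case True
    have "reflection \<alpha> \<circ> reflection_word (\<beta> # us) = reflection_word us"
      using True by (simp only: reflection_word.simps comp_assoc[symmetric] reflection_comp_reflection id_comp)
    then show ?thesis using us by (intro exI[of _ us] conjI) (assumption, simp, assumption)
  next
    case False
    have aP: "reflection \<beta> \<alpha> \<in> P" using reflection_simple_P b Cons.prems False by auto
    have "inv (reflection_word us) (reflection \<beta> \<alpha>) \<notin> P"
      using Cons.prems(3) unfolding reflection_word.simps inv_reflection_comp[OF b(2) uW] .
    then obtain us' where us': "set us' \<subseteq> \<Delta>" "length us = Suc (length us')"
      "reflection (reflection \<beta> \<alpha>) \<circ> reflection_word us = reflection_word us'"
      using Cons.IH[OF us aP] by blast
    have "reflection \<alpha> \<circ> reflection \<beta> = reflection \<beta> \<circ> reflection (reflection \<beta> \<alpha>)"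
      using orthogonal_comp_reflection[OF orthogonal_reflection, of \<beta> "reflection \<beta> \<alpha>"]
      by (simp only: reflection_reflection)
    then have "reflection \<alpha> \<circ> reflection_word (\<beta> # us) = reflection_word (\<beta> # us')"
      by (simp only: reflection_word.simps us'(3)[symmetric] comp_assoc[symmetric])
    then show ?thesis using us' b by (intro exI[of _ "\<beta> # us'"] conjI) (simp only: list.set insert_subset, simp, assumption)
  qed
qed

text \<open>In a nonempty word for w the first letter \<gamma> satisfies
  \<open>inv w \<gamma> \<in> P\<close>, so the inverse of the remaining word sends \<gamma> to a
  negative root. Then \<open>exchange\<close> yields a word for w that is shorter by two
  letters.\<close>

lemma W_fixing_P:
  assumes "w \<in> W" "\<And>\<alpha>. \<alpha> \<in> P \<Longrightarrow> w \<alpha> \<in> P"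
  shows "w = id"
proof -
  obtain \<gamma>s where g: "set \<gamma>s \<subseteq> \<Delta>" "w = reflection_word \<gamma>s" using W_simple_word assms(1) by blast
  then show ?thesis using assms
  proof (induction "length \<gamma>s" arbitrary: \<gamma>s rule: less_induct)
    case less
    show ?case
    proof (cases \<gamma>s)
      case Nil
      then show ?thesis using less.prems by (simp only: reflection_word.simps)
    next
      case (Cons \<gamma> us)
      have g: "\<gamma> \<in> \<Delta>" "\<gamma> \<in> R" and us: "set us \<subseteq> \<Delta>" using less.prems Cons simple_R by auto
      have uW: "reflection_word us \<in> W"
        using us simple_R by (intro reflection_word_W) auto
      have "w ` P = P"
        by (rule card_subset_eq) (use less.prems W_inj in \<open>auto simp: card_image inj_on_def\<close>)
      then have "inv w \<gamma> \<in> P"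
        using simple_P[OF g(1)] W_inv_left[OF less.prems(3)] by (metis (no_types, lifting) imageE)
      moreover have "inv w \<gamma> = - inv (reflection_word us) \<gamma>"
        using inv_reflection_comp[OF g(2) uW, of \<gamma>] W_minus[OF W_inv[OF uW], of \<gamma>]
          reflection_self[OF nonzero_R[OF g(2)]] less.prems(2) Cons
        by (simp only: reflection_word.simps)
      ultimately have "inv (reflection_word us) \<gamma> \<notin> P" using uminus_P by auto
      from exchange[OF us simple_P[OF g(1)] this] obtain us' where
        us': "set us' \<subseteq> \<Delta>" "length us = Suc (length us')"
          "reflection \<gamma> \<circ> reflection_word us = reflection_word us'" by blast
      have "w = reflection_word us'" using less.prems(2) Cons us' by (simp only: reflection_word.simps)
      then show ?thesis
        using less.hyps[of us'] us' Cons less.prems by simp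
    qed
  qed
qed

text \<open>Induction on a word for w: a further simple reflection either subtracts a nonnegative
  multiple of \<gamma>, which cannot raise the product with the dominant y, or the word is not
  reduced and \<open>exchange\<close> shortens it.\<close>

lemma dominant_inner_le:
  assumes "w \<in> W" "\<And>\<alpha>. \<alpha> \<in> P \<Longrightarrow> x \<bullet> \<alpha> \<ge> 0" "\<And>\<alpha>. \<alpha> \<in> P \<Longrightarrow> y \<bullet> \<alpha> \<ge> 0"
  shows "w x \<bullet> y \<le> x \<bullet> y"
proof -
  have "reflection_word \<gamma>s x \<bullet> y \<le> x \<bullet> y" if "set \<gamma>s \<subseteq> \<Delta>" for \<gamma>s
    using that
  proof (induction "length \<gamma>s" arbitrary: \<gamma>s rule: less_induct)
    case less
    show ?case
    proof (cases \<gamma>s)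
      case Nil
      then show ?thesis by simp
    next
      case (Cons \<gamma> us)
      have g: "\<gamma> \<in> \<Delta>" "\<gamma> \<in> R" "\<gamma> \<noteq> 0" and us: "set us \<subseteq> \<Delta>"
        using less.prems Cons simple_R nonzero_R by auto
      have uW: "reflection_word us \<in> W"
        using us simple_R by (intro reflection_word_W) auto
      show ?thesis
      proof (cases "inv (reflection_word us) \<gamma> \<in> P")
        case True
        have "reflection_word us x \<bullet> \<gamma> \<ge> 0"
          using assms(2)[OF True] W_inner_inv[OF uW] by simp
        then have "(reflection_word us x \<bullet> coroot \<gamma>) * (\<gamma> \<bullet> y) \<ge> 0"
          using assms(3)[OF simple_P[OF g(1)]] inner_coroot_sign(1)[OF g(3)]
          by (simp add: inner_commute[of \<gamma> y])
        then have "reflection_word \<gamma>s x \<bullet> y \<le> reflection_word us x \<bullet> y"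
          by (simp add: Cons reflection_def[of \<gamma>] inner_diff_left)
        also have "\<dots> \<le> x \<bullet> y" using less.hyps[of us] us Cons by simp
        finally show ?thesis .
      next
        case False
        from exchange[OF us simple_P[OF g(1)] this] obtain us' where
          us': "set us' \<subseteq> \<Delta>" "length us = Suc (length us')"
            "reflection \<gamma> \<circ> reflection_word us = reflection_word us'" by blast
        have "reflection_word \<gamma>s = reflection_word us'"
          using Cons us' by (simp only: reflection_word.simps)
        then show ?thesis using less.hyps[of us'] us' Cons by simp
      qed
    qed
  qed
  then show ?thesis using W_simple_word[OF assms(1)] by blast
qed

text \<open>A maximizer of \<open>w (- v) \<bullet> v\<close> moves - v into the chamber of v: if
  the image were negative on a positive root, reflecting in that root would increase the
  value.\<close>

lemma longest_element_exists: "\<exists>w\<in>W. w ` P = uminus ` P"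
proof -
  define f where "f w = w (- v) \<bullet> v" for w :: "real ^ 'n \<Rightarrow> real ^ 'n"
  obtain w where w: "w \<in> W" "\<And>u. u \<in> W \<Longrightarrow> f u \<le> f w"
    using finite_arg_max[OF finite_W, of f] id_W by blast
  have "- inv w \<alpha> \<in> P" if a: "\<alpha> \<in> P" for \<alpha>
  proof (rule ccontr)
    assume n: "- inv w \<alpha> \<notin> P"
    have iR: "inv w \<alpha> \<in> R" using W_R[OF W_inv[OF w(1)]] a P_R by auto
    then have "inv w \<alpha> \<in> P" using n P_or_uminus_P by auto
    then have "- v \<bullet> inv w \<alpha> < 0" by (simp add: pos_roots_eq inner_commute)
    then have "w (- v) \<bullet> \<alpha> < 0" using W_inner_inv[OF w(1)] by simp
    then have "(w (- v) \<bullet> coroot \<alpha>) * (\<alpha> \<bullet> v) < 0"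
      using a nonzero_P[OF a] inner_coroot_sign(3)[of \<alpha>] by (simp add: pos_roots_eq mult_neg_pos)
    then have "f w < f (reflection \<alpha> \<circ> w)"
      by (simp add: f_def reflection_def[of \<alpha>] inner_diff_left)
    moreover have "reflection \<alpha> \<circ> w \<in> W" using w(1) a P_R by (intro weyl_group.refl) auto
    ultimately show False using w(2) by force
  qed
  then have "(\<lambda>\<alpha>. - inv w \<alpha>) ` P \<subseteq> P" by auto
  moreover have "card ((\<lambda>\<alpha>. - inv w \<alpha>) ` P) = card P"
    using W_inj[OF W_inv[OF w(1)]] by (intro card_image) (simp add: inj_on_def)
  ultimately have eq: "(\<lambda>\<alpha>. - inv w \<alpha>) ` P = P"
    by (simp add: card_subset_eq)
  have "w ` P = w ` (\<lambda>\<alpha>. - inv w \<alpha>) ` P" by (simp only: eq)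
  also have "\<dots> = uminus ` P"
    using w(1) by (auto simp: image_image W_minus)
  finally show ?thesis using w(1) by blast
qed

lemma W_eq_if_image_P_eq:
  assumes "u \<in> W" "w \<in> W" "u ` P = w ` P" shows "u = w"
proof -
  have "inv u \<circ> w = id"
  proof (rule W_fixing_P)
    show "inv u \<circ> w \<in> W" using assms W_comp W_inv by auto
    fix \<alpha> assume "\<alpha> \<in> P"
    then have "w \<alpha> \<in> u ` P" using assms(3) by auto
    then show "(inv u \<circ> w) \<alpha> \<in> P" using assms(1) by auto
  qed
  then have "u ((inv u \<circ> w) x) = u x" for x by simp
  then show ?thesis using assms(1) by (simp add: fun_eq_iff)
qed

lemma longest_element: "longest_element G \<in> W" "longest_element G ` P = uminus ` P"
proof -
  have "\<exists>!w. w \<in> W \<and> w ` P = uminus ` P"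
    using longest_element_exists W_eq_if_image_P_eq by metis
  then have "longest_element G \<in> W \<and> longest_element G ` P = uminus ` P"
    unfolding longest_element_def by (rule theI')
  then show "longest_element G \<in> W" "longest_element G ` P = uminus ` P" by auto
qed

section \<open>The half sum of the positive roots\<close>

definition rho :: "real ^ 'n" where
  "rho = (1 / 2) *\<^sub>R (\<Sum>\<alpha>\<in>P. \<alpha>)"

lemma reflection_simple_rho: "\<gamma> \<in> \<Delta> \<Longrightarrow> reflection \<gamma> rho = rho - \<gamma>"
proof -
  assume g: "\<gamma> \<in> \<Delta>"
  have lin: "linear (reflection \<gamma>)" by (rule linear_reflection)
  have inj: "inj_on (reflection \<gamma>) (P - {\<gamma>})" by (metis inj_onI reflection_reflection)
  have "reflection \<gamma> ` (P - {\<gamma>}) = P - {\<gamma>}"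
  proof (rule card_subset_eq)
    show "reflection \<gamma> ` (P - {\<gamma>}) \<subseteq> P - {\<gamma>}"
    proof (rule image_subsetI)
      fix \<beta> assume b: "\<beta> \<in> P - {\<gamma>}"
      then have "reflection \<gamma> \<beta> \<in> P" using reflection_simple_P g by auto
      moreover have "reflection \<gamma> \<beta> \<noteq> \<gamma>"
      proof
        assume "reflection \<gamma> \<beta> = \<gamma>"
        then have "reflection \<gamma> \<gamma> = \<beta>" by (metis reflection_reflection)
        then have "- \<gamma> \<in> P" using b reflection_self nonzero_P simple_P[OF g] by (metis DiffD1)
        then show False using uminus_P simple_P[OF g] by blast
      qed
      ultimately show "reflection \<gamma> \<beta> \<in> P - {\<gamma>}" by auto
    qed
    show "card (reflection \<gamma> ` (P - {\<gamma>})) = card (P - {\<gamma>})"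
      by (rule card_image[OF inj])
  qed simp
  then have "(\<Sum>\<alpha>\<in>P - {\<gamma>}. \<alpha>) = (\<Sum>\<alpha>\<in>reflection \<gamma> ` (P - {\<gamma>}). \<alpha>)" by simp
  also have "\<dots> = (\<Sum>\<alpha>\<in>P - {\<gamma>}. reflection \<gamma> \<alpha>)"
    using sum.reindex[OF inj, of "\<lambda>\<alpha>. \<alpha>"] by (simp only: comp_def)
  finally have eq: "(\<Sum>\<alpha>\<in>P - {\<gamma>}. reflection \<gamma> \<alpha>) = (\<Sum>\<alpha>\<in>P - {\<gamma>}. \<alpha>)" by simp
  have "reflection \<gamma> (\<Sum>\<alpha>\<in>P. \<alpha>) = (\<Sum>\<alpha>\<in>P. reflection \<gamma> \<alpha>)"
    using linear_sum[OF lin] by simp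
  also have "\<dots> = reflection \<gamma> \<gamma> + (\<Sum>\<alpha>\<in>P - {\<gamma>}. reflection \<gamma> \<alpha>)"
    using simple_P[OF g] by (simp add: sum.remove)
  also have "\<dots> = - \<gamma> + (\<Sum>\<alpha>\<in>P - {\<gamma>}. \<alpha>)"
    using eq reflection_self[OF nonzero_P[OF simple_P[OF g]]] by simp
  also have "\<dots> = (\<Sum>\<alpha>\<in>P. \<alpha>) - 2 *\<^sub>R \<gamma>"
    using simple_P[OF g] by (simp add: sum.remove[of P \<gamma>] scaleR_2)
  finally show ?thesis
    by (simp add: rho_def linear_scale[OF lin] scaleR_diff_right)
qed

lemma rho_simple_coroot: "\<gamma> \<in> \<Delta> \<Longrightarrow> rho \<bullet> coroot \<gamma> = 1"
proof -
  assume g: "\<gamma> \<in> \<Delta>"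
  have "(rho \<bullet> coroot \<gamma> - 1) *\<^sub>R \<gamma> = 0"
    using reflection_simple_rho[OF g] by (simp add: reflection_def scaleR_diff_left)
  moreover have "\<gamma> \<noteq> 0" by (rule nonzero_R[OF simple_R[OF g]])
  ultimately show ?thesis by simp
qed

lemma simple_coroot_induct:
  assumes "\<alpha> \<in> P" "\<And>\<gamma>. \<gamma> \<in> \<Delta> \<Longrightarrow> x \<bullet> coroot \<gamma> \<ge> 0" 
  shows "x \<bullet> coroot \<alpha> \<ge> 0"
proof -
  obtain c :: "real ^ 'n \<Rightarrow> nat" where c: "coroot \<alpha> = (\<Sum>\<gamma>\<in>\<Delta>. of_nat (c \<gamma>) *\<^sub>R coroot \<gamma>)"
    using coroot_decomposition[OF assms(1)] by blast
  show ?thesis unfolding c inner_sum_right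
    by (intro sum_nonneg) (simp add: assms)
qed

lemma rho_coroot: "\<alpha> \<in> P \<Longrightarrow> \<exists>m::nat. m \<ge> 1 \<and> rho \<bullet> coroot \<alpha> = of_nat m"
proof -
  assume a: "\<alpha> \<in> P"
  obtain c :: "real ^ 'n \<Rightarrow> nat" where c: "coroot \<alpha> = (\<Sum>\<gamma>\<in>\<Delta>. of_nat (c \<gamma>) *\<^sub>R coroot \<gamma>)"
    using coroot_decomposition[OF a] by blast
  have "rho \<bullet> coroot \<alpha> = of_nat (\<Sum>\<gamma>\<in>\<Delta>. c \<gamma>)"
    unfolding c inner_sum_right by (simp add: rho_simple_coroot)
  moreover have "(\<Sum>\<gamma>\<in>\<Delta>. c \<gamma>) \<noteq> 0"
  proof
    assume "(\<Sum>\<gamma>\<in>\<Delta>. c \<gamma>) = 0"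
    then have "coroot \<alpha> = 0" unfolding c by simp
    then show False using coroot_inner_self[OF nonzero_P[OF a]] by simp
  qed
  ultimately show ?thesis by (intro exI[of _ "\<Sum>\<gamma>\<in>\<Delta>. c \<gamma>"]) linarith
qed

lemma rho_pos: "\<alpha> \<in> P \<Longrightarrow> rho \<bullet> \<alpha> > 0"
  using rho_coroot[of \<alpha>] inner_coroot_sign(2)[OF nonzero_P, of \<alpha> rho] by auto

section \<open>The coroot lattice\<close>

lemma zero_Q [simp]: "0 \<in> Q"
  unfolding coroot_lattice_def by (auto intro!: exI[of _ "\<lambda>_. 0"])

lemma Q_add: assumes "x \<in> Q" "y \<in> Q" shows "x + y \<in> Q"
proof -
  obtain c d :: "real ^ 'n \<Rightarrow> int" where "x = (\<Sum>\<alpha>\<in>R. of_int (c \<alpha>) *\<^sub>R coroot \<alpha>)"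
    "y = (\<Sum>\<alpha>\<in>R. of_int (d \<alpha>) *\<^sub>R coroot \<alpha>)"
    using assms unfolding coroot_lattice_def by blast
  then have "x + y = (\<Sum>\<alpha>\<in>R. of_int (c \<alpha> + d \<alpha>) *\<^sub>R coroot \<alpha>)"
    by (simp add: scaleR_add_left sum.distrib)
  then show ?thesis unfolding coroot_lattice_def
    by (intro CollectI exI[of _ "\<lambda>\<alpha>. c \<alpha> + d \<alpha>"]) simp
qed

lemma Q_minus: assumes "x \<in> Q" shows "- x \<in> Q"
proof -
  obtain c :: "real ^ 'n \<Rightarrow> int" where "x = (\<Sum>\<alpha>\<in>R. of_int (c \<alpha>) *\<^sub>R coroot \<alpha>)"
    using assms unfolding coroot_lattice_def by blast
  then have "- x = (\<Sum>\<alpha>\<in>R. of_int (- c \<alpha>) *\<^sub>R coroot \<alpha>)"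
    by (simp add: sum_negf)
  then show ?thesis unfolding coroot_lattice_def
    by (intro CollectI exI[of _ "\<lambda>\<alpha>. - c \<alpha>"]) simp
qed

lemma Q_diff: "x \<in> Q \<Longrightarrow> y \<in> Q \<Longrightarrow> x - y \<in> Q"
  using Q_add[of x "- y"] Q_minus[of y] by simp

lemma coroot_Q: "\<alpha> \<in> R \<Longrightarrow> coroot \<alpha> \<in> Q"
  unfolding coroot_lattice_def
  by (intro CollectI exI[of _ "\<lambda>\<beta>. if \<beta> = \<alpha> then 1 else 0"])
     (simp add: if_distrib if_distribR sum.delta cong: if_cong)

lemma Q_sum: "(\<And>i. i \<in> I \<Longrightarrow> f i \<in> Q) \<Longrightarrow> sum f I \<in> Q"
  by (induction I rule: infinite_finite_induct) (auto intro: Q_add)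

lemma Q_scale_nat: "x \<in> Q \<Longrightarrow> of_nat m *\<^sub>R x \<in> Q"
  by (induction m) (auto intro: Q_add simp: scaleR_add_left)

lemma Q_scale_int: "x \<in> Q \<Longrightarrow> of_int m *\<^sub>R x \<in> Q"
  using Q_scale_nat[of x "nat m"] Q_minus[OF Q_scale_nat[of x "nat (- m)"]]
  by (cases "m \<ge> 0") auto

lemma Q_W: assumes "w \<in> W" "x \<in> Q" shows "w x \<in> Q"
proof -
  obtain c :: "real ^ 'n \<Rightarrow> int" where x: "x = (\<Sum>\<alpha>\<in>R. of_int (c \<alpha>) *\<^sub>R coroot \<alpha>)"
    using assms unfolding coroot_lattice_def by blast
  show ?thesis unfolding x W_sum[OF assms(1)] W_scale[OF assms(1)] coroot_W[OF assms(1)]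
    using W_R[OF assms(1)] by (intro Q_sum Q_scale_int coroot_Q) blast
qed

lemma root_Q_int: assumes "\<alpha> \<in> R" "y \<in> Q" shows "\<alpha> \<bullet> y \<in> \<int>"
proof -
  obtain c :: "real ^ 'n \<Rightarrow> int" where y: "y = (\<Sum>\<alpha>\<in>R. of_int (c \<alpha>) *\<^sub>R coroot \<alpha>)"
    using assms unfolding coroot_lattice_def by blast
  show ?thesis unfolding y inner_sum_right inner_scaleR_right
    by (intro Ints_sum Ints_mult integral_R assms) auto
qed

text \<open>Lists with repetition, in place of integer coefficients, make the number of summands
  available as the quantity that is minimized in \<open>minuscule_Q_eq_zero\<close>.\<close>

lemma Q_coroot_list:
  assumes "y \<in> Q" shows "\<exists>xs. set xs \<subseteq> coroot ` R \<and> y = sum_list xs"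
proof -
  define S where "S = {sum_list xs | xs. set xs \<subseteq> coroot ` R}"
  have zero: "0 \<in> S" unfolding S_def by (auto intro!: exI[of _ "[]"])
  have add: "x + y \<in> S" if xy: "x \<in> S" "y \<in> S" for x y
  proof -
    obtain xs ys where "set xs \<subseteq> coroot ` R" "set ys \<subseteq> coroot ` R" "x = sum_list xs" "y = sum_list ys"
      using xy unfolding S_def by blast
    then show ?thesis unfolding S_def by (intro CollectI exI[of _ "xs @ ys"]) simp
  qed
  have gen: "coroot \<alpha> \<in> S" if "\<alpha> \<in> R" for \<alpha>
    using that unfolding S_def by (intro CollectI exI[of _ "[coroot \<alpha>]"]) auto
  have nat: "of_nat m *\<^sub>R x \<in> S" if "x \<in> S" for m x
    using that by (induction m) (auto intro: add zero simp: scaleR_add_left)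
  have int: "of_int m *\<^sub>R coroot \<alpha> \<in> S" if a: "\<alpha> \<in> R" for m \<alpha>
    using nat[OF gen[OF a], of "nat m"] nat[OF gen[of "- \<alpha>"], of "nat (- m)"] a
    by (cases "m \<ge> 0") (auto simp: coroot_minus)
  have sum: "sum f I \<in> S" if "\<And>i. i \<in> I \<Longrightarrow> f i \<in> S" for f :: "real ^ 'n \<Rightarrow> _" and I
    using that by (induction I rule: infinite_finite_induct) (auto intro: add zero)
  obtain c :: "real ^ 'n \<Rightarrow> int" where y: "y = (\<Sum>\<alpha>\<in>R. of_int (c \<alpha>) *\<^sub>R coroot \<alpha>)"
    using assms unfolding coroot_lattice_def by blast
  have "y \<in> S" unfolding y by (intro sum int)
  then show ?thesis unfolding S_def by blast
qed

section \<open>Bases of the coroot lattice\<close>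

text \<open>The simple roots can be indexed by the coordinate type because their number is the rank;
  square matrices can then be formed from the simple coroots.\<close>

definition sroot :: "'n \<Rightarrow> real ^ 'n" where
  "sroot = (SOME e. bij_betw e UNIV \<Delta>)"

lemma bij_sroot: "bij_betw sroot UNIV \<Delta>"
proof -
  have "\<exists>e. bij_betw e (UNIV :: 'n set) \<Delta>"
    by (rule finite_same_card_bij) (auto simp: card_\<Delta>)
  then show ?thesis unfolding sroot_def by (rule someI_ex)
qed

lemma sroot_simple: "sroot i \<in> \<Delta>"
  using bij_sroot by (auto simp: bij_betw_def)

abbreviation "scoroot i \<equiv> coroot (sroot i)"

lemma scoroot_Q: "scoroot i \<in> Q"
  by (intro coroot_Q simple_R sroot_simple)

lemma eq_zero_if_scoroot:
  assumes "\<And>i. scoroot i \<bullet> x = 0" shows "x = 0"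
proof -
  have "\<gamma> \<bullet> x = 0" if g: "\<gamma> \<in> \<Delta>" for \<gamma>
  proof -
    obtain i where "\<gamma> = sroot i" using bij_sroot g by (auto simp: bij_betw_def)
    then show ?thesis using assms[of i] nonzero_R[OF simple_R[OF g]] by (simp add: coroot_def)
  qed
  then have "orthogonal x \<gamma>" if "\<gamma> \<in> \<Delta>" for \<gamma>
    using that by (simp add: orthogonal_def inner_commute)
  moreover have "x \<in> span \<Delta>" unfolding span_\<Delta> by (rule UNIV_I)
  ultimately have "orthogonal x x" by (metis orthogonal_to_span)
  then show ?thesis by (simp add: orthogonal_def)
qed

lemma dual_basis_exists: "\<exists>f. \<forall>i j. scoroot i \<bullet> f j = (if i = j then 1 else 0)"
proof -
  define B :: "real ^ 'n ^ 'n" where "B = (\<chi> i. scoroot i)"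
  have Bi: "(B *v x) $ i = scoroot i \<bullet> x" for x i
    by (simp add: B_def matrix_vector_mult_def inner_vec_def)
  have "\<forall>x. B *v x = 0 \<longrightarrow> x = 0"
  proof (intro allI impI)
    fix x assume "B *v x = 0"
    then have "scoroot i \<bullet> x = 0" for i using Bi[of x i] by simp
    then show "x = 0" by (rule eq_zero_if_scoroot)
  qed
  then obtain B' where "B' ** B = mat 1" using matrix_left_invertible_ker by blast
  then have "B ** B' = mat 1" by (rule matrix_left_right_inverse[THEN iffD1])
  moreover have "(B ** B') $ i $ j = scoroot i \<bullet> column j B'" for i j
    by (simp add: B_def matrix_matrix_mult_def column_def inner_vec_def)
  ultimately have "scoroot i \<bullet> column j B' = (if i = j then 1 else 0)" for i j
    by (simp add: mat_def)
  then show ?thesis by (intro exI[of _ "\<lambda>j. column j B'"]) blast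
qed

text \<open>The fundamental weights. Being dual to the simple coroots, they read off coordinates in
  that basis, and integrality of these coordinates characterizes the coroot lattice.\<close>

definition fweight :: "'n \<Rightarrow> real ^ 'n" where
  "fweight = (SOME f. \<forall>i j. scoroot i \<bullet> f j = (if i = j then 1 else 0))"

lemma scoroot_fweight: "scoroot i \<bullet> fweight j = (if i = j then 1 else 0)"
  using someI_ex[OF dual_basis_exists] unfolding fweight_def by blast

lemma fweight_expansion: "x = (\<Sum>i\<in>UNIV. (scoroot i \<bullet> x) *\<^sub>R fweight i)"
proof -
  have "scoroot j \<bullet> (x - (\<Sum>i\<in>UNIV. (scoroot i \<bullet> x) *\<^sub>R fweight i)) = 0" for j
    by (simp add: inner_diff_right inner_sum_right scoroot_fweight if_distrib sum.delta' cong: if_cong)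
  from eq_zero_if_scoroot[OF this] show ?thesis by (simp only: right_minus_eq)
qed

lemma scoroot_expansion: "x = (\<Sum>i\<in>UNIV. (fweight i \<bullet> x) *\<^sub>R scoroot i)"
proof -
  have "z \<bullet> (\<Sum>i\<in>UNIV. (fweight i \<bullet> x) *\<^sub>R scoroot i) = z \<bullet> x" for z
  proof -
    have "z \<bullet> (\<Sum>i\<in>UNIV. (fweight i \<bullet> x) *\<^sub>R scoroot i)
        = (\<Sum>i\<in>UNIV. (scoroot i \<bullet> z) *\<^sub>R fweight i) \<bullet> x"
      by (simp add: inner_sum_left inner_sum_right inner_commute mult.commute)
    then show ?thesis using fweight_expansion[of z] by simp
  qed
  then show ?thesis by (metis vector_eq_ldot)
qed

lemma fweight_Q_int: assumes "y \<in> Q" shows "fweight i \<bullet> y \<in> \<int>"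
proof -
  have P: "fweight i \<bullet> coroot \<alpha> \<in> \<int>" if a: "\<alpha> \<in> P" for \<alpha>
  proof -
    obtain c :: "real ^ 'n \<Rightarrow> nat" where c: "coroot \<alpha> = (\<Sum>\<gamma>\<in>\<Delta>. of_nat (c \<gamma>) *\<^sub>R coroot \<gamma>)"
      using coroot_decomposition[OF a] by blast
    have "fweight i \<bullet> coroot \<gamma> \<in> \<int>" if g: "\<gamma> \<in> \<Delta>" for \<gamma>
    proof -
      obtain j where "\<gamma> = sroot j" using bij_sroot g by (auto simp: bij_betw_def)
      then show ?thesis using scoroot_fweight[of j i] by (simp add: inner_commute)
    qed
    then show ?thesis unfolding c inner_sum_right inner_scaleR_right
      by (intro Ints_sum Ints_mult) auto
  qed
  have R: "fweight i \<bullet> coroot \<alpha> \<in> \<int>" if a: "\<alpha> \<in> R" for \<alpha>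
    using P_or_uminus_P[OF a] P[of \<alpha>] P[of "- \<alpha>"] by (auto simp: coroot_minus)
  obtain c :: "real ^ 'n \<Rightarrow> int" where y: "y = (\<Sum>\<alpha>\<in>R. of_int (c \<alpha>) *\<^sub>R coroot \<alpha>)"
    using assms unfolding coroot_lattice_def by blast
  show ?thesis unfolding y inner_sum_right inner_scaleR_right
    by (intro Ints_sum Ints_mult R) auto
qed

lemma Q_iff: "y \<in> Q \<longleftrightarrow> (\<forall>i. fweight i \<bullet> y \<in> \<int>)"
proof
  assume a: "\<forall>i. fweight i \<bullet> y \<in> \<int>"
  have "(fweight i \<bullet> y) *\<^sub>R scoroot i \<in> Q" for i
  proof -
    obtain m where "fweight i \<bullet> y = of_int m" using a by (auto elim: Ints_cases)
    then show ?thesis using Q_scale_int[OF scoroot_Q] by simp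
  qed
  then have "(\<Sum>i\<in>UNIV. (fweight i \<bullet> y) *\<^sub>R scoroot i) \<in> Q" by (intro Q_sum)
  then show "y \<in> Q" using scoroot_expansion[of y] by simp
qed (simp add: fweight_Q_int)

lemma Q_int_iff: "(\<forall>y\<in>Q. \<mu> \<bullet> y \<in> \<int>) \<longleftrightarrow> (\<forall>i. \<mu> \<bullet> scoroot i \<in> \<int>)"
proof
  assume a: "\<forall>i. \<mu> \<bullet> scoroot i \<in> \<int>"
  show "\<forall>y\<in>Q. \<mu> \<bullet> y \<in> \<int>"
  proof
    fix y assume y: "y \<in> Q"
    have "\<mu> \<bullet> y = (\<Sum>i\<in>UNIV. (fweight i \<bullet> y) * (\<mu> \<bullet> scoroot i))"
      by (subst scoroot_expansion[of y]) (simp add: inner_sum_right)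
    also have "\<dots> \<in> \<int>" using a fweight_Q_int[OF y] by (intro Ints_sum Ints_mult) auto
    finally show "\<mu> \<bullet> y \<in> \<int>" .
  qed
qed (use scoroot_Q in auto)

lemma finite_Q_bounded: "finite {q\<in>Q. norm q \<le> C}"
proof -
  define N where "N = \<lceil>C * (\<Sum>i\<in>UNIV. norm (fweight i))\<rceil>"
  define F where "F = (\<lambda>c. (\<Sum>i\<in>UNIV. of_int (c i) *\<^sub>R scoroot i)) ` (UNIV \<rightarrow>\<^sub>E {-N..N} :: ('n \<Rightarrow> int) set)"
  have "{q\<in>Q. norm q \<le> C} \<subseteq> F"
  proof
    fix q assume q: "q \<in> {q\<in>Q. norm q \<le> C}"
    have int: "of_int \<lfloor>fweight i \<bullet> q\<rfloor> = fweight i \<bullet> q" for i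
      using fweight_Q_int[of q i] q by auto
    have b: "\<bar>fweight i \<bullet> q\<bar> \<le> of_int N" for i
    proof -
      have "\<bar>fweight i \<bullet> q\<bar> \<le> norm (fweight i) * norm q" by (rule Cauchy_Schwarz_ineq2)
      also have "\<dots> \<le> (\<Sum>i\<in>UNIV. norm (fweight i)) * C"
        using q by (intro mult_mono member_le_sum) (auto simp: sum_nonneg)
      also have "\<dots> \<le> of_int N" by (simp add: N_def mult.commute)
      finally show ?thesis .
    qed
    have "\<lfloor>fweight i \<bullet> q\<rfloor> \<in> {-N..N}" for i
      using b[of i] by (auto simp: abs_le_iff le_floor_iff floor_le_iff)
    moreover have "q = (\<Sum>i\<in>UNIV. of_int \<lfloor>fweight i \<bullet> q\<rfloor> *\<^sub>R scoroot i)"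
      unfolding int by (rule scoroot_expansion)
    ultimately show "q \<in> F" unfolding F_def by (intro image_eqI[of _ _ "\<lambda>i. \<lfloor>fweight i \<bullet> q\<rfloor>"]) auto
  qed
  moreover have "finite F" unfolding F_def by (intro finite_imageI finite_PiE) auto
  ultimately show ?thesis by (rule finite_subset)
qed

section \<open>The alcove\<close>

text \<open>For roots at an obtuse angle one Cartan integer of - \<alpha> and \<beta> is 1, so one
  of the two reflections adds the coroots.\<close>

lemma coroot_sum_cases:
  assumes "\<alpha> \<in> R" "\<beta> \<in> R" "coroot \<alpha> \<bullet> coroot \<beta> < 0"
  shows "coroot \<alpha> + coroot \<beta> = 0 \<or> coroot \<alpha> + coroot \<beta> \<in> coroot ` R"
proof (cases "- \<alpha> = \<beta>")
  case True
  then show ?thesis by (auto simp: coroot_minus)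
next
  case False
  have "\<alpha> \<bullet> \<beta> < 0"
    using assms nonzero_R[of \<alpha>] inner_coroot_sign(3)[OF nonzero_R[OF assms(2)], of "coroot \<alpha>"]
      inner_coroot_sign(3)[OF nonzero_R[OF assms(1)], of \<beta>] by (simp add: inner_commute)
  then have "- \<alpha> \<bullet> coroot \<beta> = 1 \<or> \<beta> \<bullet> coroot (- \<alpha>) = 1"
    using assms False by (intro cartan_integer_one) auto
  then show ?thesis
  proof
    assume a: "- \<alpha> \<bullet> coroot \<beta> = 1"
    have "coroot (reflection \<alpha> \<beta>) = coroot \<beta> - (coroot \<beta> \<bullet> \<alpha>) *\<^sub>R coroot \<alpha>"
      unfolding coroot_orthogonal[OF orthogonal_reflection, symmetric] by (rule reflection_coroot)
    also have "\<dots> = coroot \<alpha> + coroot \<beta>" using a by (simp add: inner_commute)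
    finally show ?thesis using reflection_R[OF assms(1,2)] by (metis imageI)
  next
    assume a: "\<beta> \<bullet> coroot (- \<alpha>) = 1"
    have "coroot (reflection \<beta> \<alpha>) = coroot \<alpha> - (coroot \<alpha> \<bullet> \<beta>) *\<^sub>R coroot \<beta>"
      unfolding coroot_orthogonal[OF orthogonal_reflection, symmetric] by (rule reflection_coroot)
    also have "\<dots> = coroot \<alpha> + coroot \<beta>" using a by (simp add: inner_commute coroot_minus)
    finally show ?thesis using reflection_R[OF assms(2,1)] by (metis imageI)
  qed
qed

lemma sum_list_norm_ge:
  fixes xs :: "(real ^ 'n) list"
  assumes "sorted_wrt (\<lambda>a b. a \<bullet> b \<ge> 0) xs"
  shows "(\<Sum>x\<leftarrow>xs. x \<bullet> x) \<le> sum_list xs \<bullet> sum_list xs"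
  using assms
proof (induction xs)
  case (Cons x xs)
  have "0 \<le> (\<Sum>y\<leftarrow>xs. x \<bullet> y)" using Cons.prems by (intro sum_list_nonneg) auto
  also have "(\<Sum>y\<leftarrow>xs. x \<bullet> y) = x \<bullet> sum_list xs"
    by (induction xs) (auto simp: inner_add_right)
  finally show ?case using Cons by (simp add: inner_add_left inner_add_right inner_commute)
qed simp

text \<open>A coroot lattice vector written with as few coroots as possible has summands with pairwise
  nonnegative inner products, so its squared norm is at least the sum of theirs.\<close>
lemma minuscule_Q_eq_zero:
  assumes "y \<in> Q" "\<And>\<alpha>. \<alpha> \<in> R \<Longrightarrow> \<bar>\<alpha> \<bullet> y\<bar> \<le> 1"
  shows "y = 0"
proof -
  define good where "good xs \<longleftrightarrow> set xs \<subseteq> coroot ` R \<and> y = sum_list xs" for xs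
  obtain xs where xs: "good xs" "\<And>ys. good ys \<Longrightarrow> length xs \<le> length ys"
    using Q_coroot_list[OF assms(1)] ex_has_least_nat[of good _ length] unfolding good_def by metis
  have "sorted_wrt (\<lambda>a b. a \<bullet> b \<ge> 0) xs"
  proof (rule ccontr)
    assume "\<not> ?thesis"
    then obtain i j where ij: "i < j" "j < length xs" "xs ! i \<bullet> xs ! j < 0"
      unfolding sorted_wrt_iff_nth_less by auto
    define as where "as = take i xs"
    define bs where "bs = take (j - Suc i) (drop (Suc i) xs)"
    define cs where "cs = drop (Suc j) xs"
    have split: "xs = as @ xs ! i # bs @ xs ! j # cs"
      unfolding as_def bs_def cs_def using ij
      by (metis (no_types, lifting) Suc_leI append_take_drop_id drop_drop id_take_nth_drop le_add_diff_inverse2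
          length_drop less_diff_conv nth_drop order.strict_trans Cons_nth_drop_Suc)
    obtain \<alpha> \<beta> where ab: "\<alpha> \<in> R" "\<beta> \<in> R" "xs ! i = coroot \<alpha>" "xs ! j = coroot \<beta>"
    proof -
      have "xs ! i \<in> coroot ` R" "xs ! j \<in> coroot ` R"
        using xs(1) ij unfolding good_def by (auto intro!: subsetD[OF _ nth_mem])
      then show ?thesis using that by blast
    qed
    have "coroot \<alpha> + coroot \<beta> = 0 \<or> coroot \<alpha> + coroot \<beta> \<in> coroot ` R"
      using coroot_sum_cases ab ij(3) by auto
    then show False
    proof
      assume z: "coroot \<alpha> + coroot \<beta> = 0"
      have "sum_list xs = sum_list (as @ bs @ cs) + (coroot \<alpha> + coroot \<beta>)"
        by (subst split) (simp add: ab)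
      then have "good (as @ bs @ cs)"
      proof -
        have "set (as @ bs @ cs) \<subseteq> set xs" using arg_cong[OF split, of set] by auto
        then show ?thesis using xs(1) z \<open>sum_list xs = _\<close> unfolding good_def by auto
      qed
      from xs(2)[OF this] show False using arg_cong[OF split, of length] by simp
    next
      assume z: "coroot \<alpha> + coroot \<beta> \<in> coroot ` R"
      have "sum_list xs = sum_list ((coroot \<alpha> + coroot \<beta>) # as @ bs @ cs)"
        by (subst split) (simp add: ab)
      moreover have "set (as @ bs @ cs) \<subseteq> set xs" using arg_cong[OF split, of set] by auto
      ultimately have "good ((coroot \<alpha> + coroot \<beta>) # as @ bs @ cs)"
        using xs(1) z unfolding good_def by auto
      from xs(2)[OF this] show False using arg_cong[OF split, of length] by simp
    qed
  qed
  then have ge: "(\<Sum>x\<leftarrow>xs. x \<bullet> x) \<le> y \<bullet> y"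
    using sum_list_norm_ge xs(1) unfolding good_def by auto
  have "y \<bullet> y = (\<Sum>x\<leftarrow>xs. y \<bullet> x)"
  proof -
    have "y \<bullet> sum_list xs = (\<Sum>x\<leftarrow>xs. y \<bullet> x)"
      by (induction xs) (auto simp: inner_add_right)
    then show ?thesis using xs(1) unfolding good_def by simp
  qed
  \<comment> \<open>The factor 1/2 closes the argument: \<alpha> \<bullet> y \<le> 1 bounds y
    \<bullet> x by 2 / (\<alpha> \<bullet> \<alpha>), half of the squared norm 4 / (\<alpha>
    \<bullet> \<alpha>) of the coroot x, so y \<bullet> y is at most half of itself.\<close>
  also have "\<dots> \<le> (\<Sum>x\<leftarrow>xs. (1/2) * (x \<bullet> x))"
  proof (rule sum_list_mono)
    fix x assume "x \<in> set xs"
    then obtain \<alpha> where a: "\<alpha> \<in> R" "x = coroot \<alpha>" using xs(1) unfolding good_def by auto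
    have pos: "\<alpha> \<bullet> \<alpha> > 0" using nonzero_R[OF a(1)] by simp
    have "y \<bullet> x = 2 / (\<alpha> \<bullet> \<alpha>) * (\<alpha> \<bullet> y)" by (simp add: a coroot_def inner_commute)
    also have "\<dots> \<le> 2 / (\<alpha> \<bullet> \<alpha>) * 1"
      using assms(2)[OF a(1)] pos by (intro mult_left_mono) auto
    also have "\<dots> = (1/2) * (x \<bullet> x)" using pos by (simp add: a coroot_def field_simps)
    finally show "y \<bullet> x \<le> (1/2) * (x \<bullet> x)" .
  qed
  also have "\<dots> = (1/2) * (\<Sum>x\<leftarrow>xs. x \<bullet> x)" by (rule sum_list_const_mult)
  also have "\<dots> \<le> (1/2) * (y \<bullet> y)" using ge by simp
  finally have "y \<bullet> y \<le> 0" by simp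
  then show ?thesis using inner_gt_zero_iff[of y] by linarith
qed

text \<open>Bounding all positive roots by 1 avoids a highest root, which is constructed only later
  and for irreducible systems.\<close>

definition alcove :: "(real ^ 'n) set" where
  "alcove = {x. \<forall>\<alpha>\<in>P. 0 < \<alpha> \<bullet> x \<and> \<alpha> \<bullet> x < 1}"

definition closed_alcove :: "(real ^ 'n) set" where
  "closed_alcove = {x. \<forall>\<alpha>\<in>P. 0 \<le> \<alpha> \<bullet> x \<and> \<alpha> \<bullet> x \<le> 1}"

lemma alcove_closed: "x \<in> alcove \<Longrightarrow> x \<in> closed_alcove"
  by (force simp: alcove_def closed_alcove_def)

text \<open>By the position of \<open>inv w \<alpha>\<close>, every positive root takes the value 0
  or 1 on y, so \<open>minuscule_Q_eq_zero\<close> applies. With y = 0 the same case distinction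
  shows that \<open>inv w\<close> preserves the positive roots.\<close>

lemma affine_fixes_alcove:
  assumes "w \<in> W" "y \<in> Q" "u \<in> alcove" "w u + y \<in> alcove"
  shows "w = id" "y = 0"
proof -
  have key: "(inv w \<alpha> \<in> P \<longrightarrow> \<alpha> \<bullet> y = 0) \<and> (inv w \<alpha> \<notin> P \<longrightarrow> \<alpha> \<bullet> y = 1)" if a: "\<alpha> \<in> P" for \<alpha>
  proof -
    obtain m where m: "\<alpha> \<bullet> y = of_int m" using root_Q_int[OF P_R[OF a] assms(2)] by (auto elim: Ints_cases)
    have "\<alpha> \<bullet> (w u + y) = inv w \<alpha> \<bullet> u + of_int m"
      using W_inner_inv[OF assms(1), of u \<alpha>] by (simp add: inner_add_right m inner_commute)
    then have b: "0 < inv w \<alpha> \<bullet> u + of_int m" "inv w \<alpha> \<bullet> u + of_int m < 1"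
      using assms(4) a by (auto simp: alcove_def)
    show ?thesis
    proof (cases "inv w \<alpha> \<in> P")
      case True
      then have "0 < inv w \<alpha> \<bullet> u" "inv w \<alpha> \<bullet> u < 1" using assms(3) by (auto simp: alcove_def)
      then have "m = 0" using b by linarith
      then show ?thesis using True m by simp
    next
      case False
      then have "- inv w \<alpha> \<in> P"
        using P_or_uminus_P[OF W_R[OF W_inv[OF assms(1)] P_R[OF a]]] by auto
      then have "0 < - inv w \<alpha> \<bullet> u" "- inv w \<alpha> \<bullet> u < 1" using assms(3) unfolding alcove_def by blast+
      then have "m = 1" using b by simp
      then show ?thesis using False m by simp
    qed
  qed
  show y: "y = 0"
  proof (rule minuscule_Q_eq_zero[OF assms(2)])
    fix \<alpha> assume "\<alpha> \<in> R"
    then consider "\<alpha> \<in> P" | "- \<alpha> \<in> P" using P_or_uminus_P by auto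
    then show "\<bar>\<alpha> \<bullet> y\<bar> \<le> 1" using key[of \<alpha>] key[of "- \<alpha>"] by cases auto
  qed
  have "inv w = id"
    by (rule W_fixing_P[OF W_inv[OF assms(1)]]) (use key y in force)
  then have "inv (inv w) = id" by (simp only: inv_id)
  then show "w = id" using W_inv_inv[OF assms(1)] by simp
qed

text \<open>The correction is a positive multiple of the product of the signed positions of z and u
  relative to the hyperplane where \<alpha> takes the value c: reflecting brings z closer to u
  exactly when the hyperplane separates them strictly. Both distance arguments for the alcove rest
  on this sign.\<close>

lemma reflection_dist:
  fixes \<alpha> z u :: "real ^ 'n"
  assumes "\<alpha> \<noteq> 0"
  shows "(norm (reflection \<alpha> z + c *\<^sub>R coroot \<alpha> - u))\<^sup>2 = (norm (z - u))\<^sup>2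
      + 4 / (\<alpha> \<bullet> \<alpha>) * ((\<alpha> \<bullet> z - c) * (\<alpha> \<bullet> u - c))"
proof -
  define a where "a = (\<alpha> \<bullet> z - c)"
  have gen: "(norm (d - a *\<^sub>R e))\<^sup>2 = (norm d)\<^sup>2 - 2 * a * (d \<bullet> e) + a\<^sup>2 * (e \<bullet> e)" for d e :: "real ^ 'n"
    unfolding power2_norm_eq_inner
    by (simp add: inner_diff_left inner_diff_right inner_commute power2_eq_square)
  have eq: "reflection \<alpha> z + c *\<^sub>R coroot \<alpha> - u = (z - u) - a *\<^sub>R coroot \<alpha>"
    by (simp add: reflection_coroot a_def scaleR_diff_left inner_commute)
  have "(norm (reflection \<alpha> z + c *\<^sub>R coroot \<alpha> - u))\<^sup>2
      = (norm (z - u))\<^sup>2 - 2 * a * ((z - u) \<bullet> coroot \<alpha>) + a\<^sup>2 * (coroot \<alpha> \<bullet> coroot \<alpha>)"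
    by (simp only: eq gen)
  also have "(z - u) \<bullet> coroot \<alpha> = 2 * (\<alpha> \<bullet> z - \<alpha> \<bullet> u) / (\<alpha> \<bullet> \<alpha>)"
    by (simp add: coroot_def inner_diff_right inner_commute)
  also have "coroot \<alpha> \<bullet> coroot \<alpha> = 4 / (\<alpha> \<bullet> \<alpha>)"
    using assms by (simp add: coroot_def)
  also have "(norm (z - u))\<^sup>2 - 2 * a * (2 * (\<alpha> \<bullet> z - \<alpha> \<bullet> u) / (\<alpha> \<bullet> \<alpha>)) + a\<^sup>2 * (4 / (\<alpha> \<bullet> \<alpha>))
      = (norm (z - u))\<^sup>2 + 4 / (\<alpha> \<bullet> \<alpha>) * (a * (a - (\<alpha> \<bullet> z - \<alpha> \<bullet> u)))"
    by (simp add: power2_eq_square diff_divide_distrib algebra_simps)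
  finally show ?thesis by (simp add: a_def)
qed

lemma reflection_affine:
  assumes "\<alpha> \<in> R" "w \<in> W" "y \<in> Q"
  shows "reflection \<alpha> \<circ> w \<in> W" "reflection \<alpha> y + of_int m *\<^sub>R coroot \<alpha> \<in> Q"
    "(reflection \<alpha> \<circ> w) x + (reflection \<alpha> y + of_int m *\<^sub>R coroot \<alpha>) = reflection \<alpha> (w x + y) + of_int m *\<^sub>R coroot \<alpha>"
  using assms linear_add[OF linear_reflection, of \<alpha>]
  by (auto intro!: weyl_group.refl Q_add Q_scale_int coroot_Q Q_W[OF reflection_W] simp: add.assoc)

lemma alcove_nonempty: "\<exists>u. u \<in> alcove"
proof -
  define M where "M = 1 + (\<Sum>\<alpha>\<in>P. \<alpha> \<bullet> v)"
  have nn: "0 \<le> (\<Sum>\<alpha>\<in>P. \<alpha> \<bullet> v)" by (intro sum_nonneg) (auto simp: pos_roots_eq)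
  have "\<alpha> \<bullet> v < M" if "\<alpha> \<in> P" for \<alpha>
    using member_le_sum[of \<alpha> P "\<lambda>\<alpha>. \<alpha> \<bullet> v"] that by (fastforce simp: M_def pos_roots_eq)
  then have "(1 / M) *\<^sub>R v \<in> alcove"
    using nn unfolding alcove_def M_def by (auto simp: pos_roots_eq divide_simps)
  then show ?thesis by blast
qed

text \<open>In a counterexample moving a base point of the alcove as little as possible, reflecting in a
  hyperplane that separates the base point from its image gives a smaller counterexample.\<close>
lemma alcove_closest:
  assumes "x \<in> closed_alcove" "u \<in> closed_alcove" "w \<in> W" "y \<in> Q"
  shows "norm (x - u) \<le> norm (w x + y - u)"
proof (rule ccontr)
  assume neg: "\<not> ?thesis"
  obtain u0 where u0: "u0 \<in> alcove" using alcove_nonempty by blast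
  define C where "C = {(w, y). w \<in> W \<and> y \<in> Q \<and> norm (w x + y - u) < norm (x - u)}"
  have "C \<subseteq> W \<times> {q\<in>Q. norm q \<le> norm (x - u) + norm x + norm u}"
  proof
    fix p assume "p \<in> C"
    then obtain w y where p: "p = (w, y)" "w \<in> W" "y \<in> Q" "norm (w x + y - u) < norm (x - u)"
      by (auto simp: C_def)
    have "y = (w x + y - u) - w x + u" by simp
    then have "norm y \<le> norm (w x + y - u) + norm (w x) + norm u"
      by (metis norm_triangle_le norm_triangle_ineq4 add_mono order_refl)
    moreover have "norm (w x) = norm x" using W_orthogonal[OF p(2)] orthogonal_transformation_norm by blast
    ultimately show "p \<in> W \<times> {q\<in>Q. norm q \<le> norm (x - u) + norm x + norm u}" using p by simp
  qed
  then have "finite C"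
    by (rule finite_subset) (intro finite_cartesian_product finite_W finite_Q_bounded)
  moreover have "(w, y) \<in> C" using neg assms by (simp add: C_def)
  ultimately obtain p where p: "p \<in> C" and "\<forall>p'\<in>C. norm (fst p u0 + snd p - u0) \<le> norm (fst p' u0 + snd p' - u0)"
    using finite_arg_min[of C "\<lambda>p. norm (fst p u0 + snd p - u0)"] by blast
  then obtain w y where wy: "w \<in> W" "y \<in> Q" "norm (w x + y - u) < norm (x - u)"
    and min: "\<And>w' y'. (w', y') \<in> C \<Longrightarrow> norm (w u0 + y - u0) \<le> norm (w' u0 + y' - u0)"
    by (cases p) (auto simp: C_def)
  have step: False if a: "\<alpha> \<in> P" and s: "(\<alpha> \<bullet> (w u0 + y) - of_int m) * (\<alpha> \<bullet> u0 - of_int m) < 0"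
    "(\<alpha> \<bullet> (w x + y) - of_int m) * (\<alpha> \<bullet> u - of_int m) \<le> 0" for \<alpha> m
  proof -
    define w' where "w' = reflection \<alpha> \<circ> w"
    define y' where "y' = reflection \<alpha> y + of_int m *\<^sub>R coroot \<alpha>"
    note r1 = reflection_affine(1)[OF P_R[OF a] wy(1,2), folded w'_def]
    note r2 = reflection_affine(2)[OF P_R[OF a] wy(1,2), of m, folded y'_def]
    note r3 = reflection_affine(3)[OF P_R[OF a] wy(1,2), of _ m, folded w'_def y'_def]
    have pos: "\<alpha> \<bullet> \<alpha> > 0" using nonzero_P[OF a] by simp
    have "(norm (w' x + y' - u))\<^sup>2 \<le> (norm (w x + y - u))\<^sup>2"
      unfolding r3 reflection_dist[OF nonzero_P[OF a]]
      using mult_nonneg_nonpos[OF less_imp_le s(2), of "4 / (\<alpha> \<bullet> \<alpha>)"] pos by simp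
    then have "norm (w' x + y' - u) \<le> norm (w x + y - u)" by (simp add: power2_le_iff_abs_le)
    then have "(w', y') \<in> C" using r1 r2 wy(3) by (auto simp: C_def)
    moreover have "(norm (w' u0 + y' - u0))\<^sup>2 < (norm (w u0 + y - u0))\<^sup>2"
      unfolding r3 reflection_dist[OF nonzero_P[OF a]]
      using mult_pos_neg[OF _ s(1), of "4 / (\<alpha> \<bullet> \<alpha>)"] pos by simp
    then have "norm (w' u0 + y' - u0) < norm (w u0 + y - u0)" by (rule power_less_imp_less_base) simp
    ultimately show False using min by force
  qed
  have "w u0 + y \<in> alcove"
  proof (rule ccontr)
    assume "w u0 + y \<notin> alcove"
    then obtain \<alpha> where a: "\<alpha> \<in> P" and na: "\<not> (0 < \<alpha> \<bullet> (w u0 + y) \<and> \<alpha> \<bullet> (w u0 + y) < 1)"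
      by (auto simp: alcove_def)
    obtain n where n: "\<alpha> \<bullet> y = of_int n" using root_Q_int[OF P_R[OF a] wy(2)] by (auto elim: Ints_cases)
    define \<beta> where "\<beta> = inv w \<alpha>"
    have iw: "\<alpha> \<bullet> (w z + y) = \<beta> \<bullet> z + of_int n" for z
      using W_inner_inv[OF wy(1), of z \<alpha>] by (simp add: inner_add_right n inner_commute \<beta>_def)
    have au: "0 < \<alpha> \<bullet> u0" "\<alpha> \<bullet> u0 < 1" "0 \<le> \<alpha> \<bullet> u" "\<alpha> \<bullet> u \<le> 1"
      using u0 assms(2) a by (auto simp: alcove_def closed_alcove_def)
    have "\<beta> \<in> R" using W_R[OF W_inv[OF wy(1)] P_R[OF a]] by (simp add: \<beta>_def)
    then consider "\<beta> \<in> P" | "- \<beta> \<in> P" using P_or_uminus_P by auto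
    \<comment> \<open>On the alcove \<beta> stays between the consecutive integers l and l + 1, with
      l = 0 or l = -1. So \<alpha> lies between l + n and l + n + 1 on the image, and unless l + n =
      0 the wall where \<alpha> is 0 or 1 separates the image from the base points.\<close>
    then obtain l :: int where l: "of_int l < \<beta> \<bullet> u0" "\<beta> \<bullet> u0 < of_int l + 1" "of_int l \<le> \<beta> \<bullet> x" "\<beta> \<bullet> x \<le> of_int l + 1"
    proof cases
      case 1
      then show ?thesis using that[of 0] u0 assms(1) by (auto simp: alcove_def closed_alcove_def)
    next
      case 2
      then have "0 < - \<beta> \<bullet> u0 \<and> - \<beta> \<bullet> u0 < 1" "0 \<le> - \<beta> \<bullet> x \<and> - \<beta> \<bullet> x \<le> 1"
        using u0 assms(1) unfolding alcove_def closed_alcove_def by blast+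
      then show ?thesis using that[of "-1"] by simp
    qed
    have "l + n \<noteq> 0"
    proof
      assume "l + n = 0"
      then have "real_of_int l + real_of_int n = 0" by (metis of_int_add of_int_0)
      then show False using na l iw[of u0] by auto
    qed
    then consider "l + n \<ge> 1" | "l + n \<le> -1" by linarith
    then show False
    proof cases
      case 1
      then have "real_of_int l + real_of_int n \<ge> 1" by (metis of_int_1_le_iff of_int_add)
      then have "\<alpha> \<bullet> (w u0 + y) > 1" "\<alpha> \<bullet> (w x + y) \<ge> 1" using l iw by auto
      then show False using step[OF a, of 1] au by (auto simp: mult_pos_neg mult_nonneg_nonpos)
    next
      case 2
      then have "real_of_int l + real_of_int n \<le> -1" by (metis of_int_le_iff of_int_add of_int_1 of_int_minus)
      then have "\<alpha> \<bullet> (w u0 + y) < 0" "\<alpha> \<bullet> (w x + y) \<le> 0" using l iw by auto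
      then show False using step[OF a, of 0] au by (auto simp: mult_neg_pos mult_nonpos_nonneg)
    qed
  qed
  then have "w = id" "y = 0" using affine_fixes_alcove[OF wy(1,2) u0] by auto
  then show False using wy(3) by simp
qed

text \<open>The image itself serves as the base point in \<open>alcove_closest\<close>, which makes
  the right-hand side zero.\<close>

lemma closed_alcove_unique:
  assumes "x \<in> closed_alcove" "w x + y \<in> closed_alcove" "w \<in> W" "y \<in> Q"
  shows "w x + y = x"
  using alcove_closest[OF assms(1,2,3,4)] by simp

text \<open>Only finitely many affine transformations leave the image of x at most as far from an
  alcove point as x itself. A nearest image lies in the closed alcove, since otherwise a reflection
  in a separating wall would bring it nearer.\<close>

lemma alcove_exists:
  "\<exists>w\<in>W. \<exists>y\<in>Q. w x + y \<in> closed_alcove"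
proof -
  obtain u0 where u0: "u0 \<in> alcove" using alcove_nonempty by blast
  define C where "C = {(w, y). w \<in> W \<and> y \<in> Q \<and> norm (w x + y - u0) \<le> norm (x - u0)}"
  have "C \<subseteq> W \<times> {q\<in>Q. norm q \<le> norm (x - u0) + norm x + norm u0}"
  proof
    fix p assume "p \<in> C"
    then obtain w y where p: "p = (w, y)" "w \<in> W" "y \<in> Q" "norm (w x + y - u0) \<le> norm (x - u0)"
      by (auto simp: C_def)
    have "y = (w x + y - u0) - w x + u0" by simp
    then have "norm y \<le> norm (w x + y - u0) + norm (w x) + norm u0"
      by (metis norm_triangle_le norm_triangle_ineq4 add_mono order_refl)
    moreover have "norm (w x) = norm x" using W_orthogonal[OF p(2)] orthogonal_transformation_norm by blast
    ultimately show "p \<in> W \<times> {q\<in>Q. norm q \<le> norm (x - u0) + norm x + norm u0}" using p by simp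
  qed
  then have "finite C"
    by (rule finite_subset) (intro finite_cartesian_product finite_W finite_Q_bounded)
  moreover have "(id, 0) \<in> C" by (auto simp: C_def)
  ultimately obtain p where p: "p \<in> C" and "\<forall>p'\<in>C. norm (fst p x + snd p - u0) \<le> norm (fst p' x + snd p' - u0)"
    using finite_arg_min[of C "\<lambda>p. norm (fst p x + snd p - u0)"] by blast
  then obtain w y where wy: "w \<in> W" "y \<in> Q" "norm (w x + y - u0) \<le> norm (x - u0)"
    and min: "\<And>w' y'. (w', y') \<in> C \<Longrightarrow> norm (w x + y - u0) \<le> norm (w' x + y' - u0)"
    by (cases p) (auto simp: C_def)
  have step: "(\<alpha> \<bullet> (w x + y) - of_int m) * (\<alpha> \<bullet> u0 - of_int m) \<ge> 0" if a: "\<alpha> \<in> P" for \<alpha> m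
  proof (rule ccontr)
    assume "\<not> ?thesis"
    then have s': "(\<alpha> \<bullet> (w x + y) - of_int m) * (\<alpha> \<bullet> u0 - of_int m) < 0" by (rule not_le_imp_less)
    define w' where "w' = reflection \<alpha> \<circ> w"
    define y' where "y' = reflection \<alpha> y + of_int m *\<^sub>R coroot \<alpha>"
    note r1 = reflection_affine(1)[OF P_R[OF a] wy(1,2), folded w'_def]
    note r2 = reflection_affine(2)[OF P_R[OF a] wy(1,2), of m, folded y'_def]
    note r3 = reflection_affine(3)[OF P_R[OF a] wy(1,2), of _ m, folded w'_def y'_def]
    have pos: "\<alpha> \<bullet> \<alpha> > 0" using nonzero_P[OF a] by simp
    have "(norm (w' x + y' - u0))\<^sup>2 < (norm (w x + y - u0))\<^sup>2"
      unfolding r3 reflection_dist[OF nonzero_P[OF a]]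
      using mult_pos_neg[OF _ s', of "4 / (\<alpha> \<bullet> \<alpha>)"] pos by simp
    then have "norm (w' x + y' - u0) < norm (w x + y - u0)" by (rule power_less_imp_less_base) simp
    moreover then have "(w', y') \<in> C" using r1 r2 wy(3) by (auto simp: C_def)
    ultimately show False using min by force
  qed
  have "0 \<le> \<alpha> \<bullet> (w x + y) \<and> \<alpha> \<bullet> (w x + y) \<le> 1" if a: "\<alpha> \<in> P" for \<alpha>
    using step[OF a, of 0] step[OF a, of 1] u0 a
    by (auto simp: alcove_def zero_le_mult_iff)
  then have "w x + y \<in> closed_alcove" by (auto simp: closed_alcove_def)
  then show ?thesis using wy by blast
qed

section \<open>The highest root\<close>

text \<open>\<open>inv w\<close> permutes the pairs of opposite roots; choosing the positive member
  of each pair gives a permutation of the positive roots. Sums and products over the roots w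
  \<alpha> thereby become sums and products over \<open>P\<close> with a sign at the
  inversions.\<close>

lemma bij_betw_pos_fold:
  assumes "w \<in> W"
  shows "bij_betw (\<lambda>\<alpha>. if inv w \<alpha> \<in> P then inv w \<alpha> else - inv w \<alpha>) P P"
proof -
  let ?b = "\<lambda>\<alpha>. if inv w \<alpha> \<in> P then inv w \<alpha> else - inv w \<alpha>"
  have sub: "?b ` P \<subseteq> P"
    using P_or_uminus_P W_R[OF W_inv[OF assms]] P_R by auto
  have "inj_on ?b P"
  proof (rule inj_onI)
    fix \<alpha> \<beta> assume ab: "\<alpha> \<in> P" "\<beta> \<in> P" "?b \<alpha> = ?b \<beta>"
    then have "inv w \<alpha> = inv w \<beta> \<or> inv w \<alpha> = inv w (- \<beta>)"
      by (auto simp: W_minus[OF W_inv[OF assms]] split: if_splits) (metis minus_minus)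
    then have "\<alpha> = \<beta> \<or> \<alpha> = - \<beta>" using W_inj[OF W_inv[OF assms]] by blast
    then show "\<alpha> = \<beta>" using ab uminus_P by auto
  qed
  then show ?thesis
    unfolding bij_betw_def using card_subset_eq[OF finite_P sub card_image] by blast
qed

lemma sum_W_pos:
  assumes "w \<in> W"
  shows "(\<Sum>\<alpha>\<in>P. f (w \<alpha>)) = (\<Sum>\<alpha>\<in>P. f (if inv w \<alpha> \<in> P then \<alpha> else - \<alpha>))"
proof -
  have "(\<Sum>\<alpha>\<in>P. f (w \<alpha>)) = (\<Sum>\<alpha>\<in>P. f (w (if inv w \<alpha> \<in> P then inv w \<alpha> else - inv w \<alpha>)))"
    using sum.reindex_bij_betw[OF bij_betw_pos_fold[OF assms], of "\<lambda>\<alpha>. f (w \<alpha>)"] by simp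
  also have "\<dots> = (\<Sum>\<alpha>\<in>P. f (if inv w \<alpha> \<in> P then \<alpha> else - \<alpha>))"
    using assms by (intro sum.cong) (auto simp: W_minus)
  finally show ?thesis .
qed

lemma prod_W_pos:
  assumes "w \<in> W"
  shows "(\<Prod>\<alpha>\<in>P. f (w \<alpha>)) = (\<Prod>\<alpha>\<in>P. f (if inv w \<alpha> \<in> P then \<alpha> else - \<alpha>))"
proof -
  have "(\<Prod>\<alpha>\<in>P. f (w \<alpha>)) = (\<Prod>\<alpha>\<in>P. f (w (if inv w \<alpha> \<in> P then inv w \<alpha> else - inv w \<alpha>)))"
    using prod.reindex_bij_betw[OF bij_betw_pos_fold[OF assms], of "\<lambda>\<alpha>. f (w \<alpha>)"] by simp
  also have "\<dots> = (\<Prod>\<alpha>\<in>P. f (if inv w \<alpha> \<in> P then \<alpha> else - \<alpha>))"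
    using assms by (intro prod.cong) (auto simp: W_minus)
  finally show ?thesis .
qed

lemma sum_R: "(\<Sum>\<alpha>\<in>R. f \<alpha>) = (\<Sum>\<alpha>\<in>P. f \<alpha> + f (- \<alpha>))" for f :: "real ^ 'n \<Rightarrow> 'b::comm_monoid_add"
  unfolding R_eq using disjoint_P
  by (subst sum.union_disjoint) (auto simp: sum.reindex sum.distrib)

lemma prod_R: "(\<Prod>\<alpha>\<in>R. f \<alpha>) = (\<Prod>\<alpha>\<in>P. f \<alpha> * f (- \<alpha>))" for f :: "real ^ 'n \<Rightarrow> 'b::comm_monoid_mult"
  unfolding R_eq using disjoint_P
  by (subst prod.union_disjoint) (auto simp: prod.reindex prod.distrib)

lemma rho_minus_W_rho:
  assumes "w \<in> W"
  shows "rho - w rho = (\<Sum>\<alpha>\<in>P. if inv w \<alpha> \<in> P then 0 else \<alpha>)"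
proof -
  have "w rho = (1/2) *\<^sub>R (\<Sum>\<alpha>\<in>P. w \<alpha>)"
    by (simp add: rho_def W_scale[OF assms] W_sum[OF assms])
  also have "(\<Sum>\<alpha>\<in>P. w \<alpha>) = (\<Sum>\<alpha>\<in>P. if inv w \<alpha> \<in> P then \<alpha> else - \<alpha>)"
    by (rule sum_W_pos[OF assms])
  also have "\<dots> = (\<Sum>\<alpha>\<in>P. \<alpha> - 2 *\<^sub>R (if inv w \<alpha> \<in> P then 0 else \<alpha>))"
    by (intro sum.cong) (auto simp: scaleR_2)
  also have "\<dots> = 2 *\<^sub>R rho - 2 *\<^sub>R (\<Sum>\<alpha>\<in>P. if inv w \<alpha> \<in> P then 0 else \<alpha>)"
    by (simp only: sum_subtractf scaleR_sum_right[symmetric]) (simp add: rho_def)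
  finally show ?thesis by (simp add: scaleR_diff_right)
qed

text \<open>The order in the definition of \<open>highest_root\<close> is the one given by
  differences in this cone.\<close>

definition pos_cone :: "(real ^ 'n) set" where
  "pos_cone = {\<Sum>\<alpha>\<in>P. of_nat (c \<alpha>) *\<^sub>R \<alpha> | c :: real ^ 'n \<Rightarrow> nat. True}"

lemma pos_cone_add: assumes "x \<in> pos_cone" "y \<in> pos_cone" shows "x + y \<in> pos_cone"
proof -
  obtain c d :: "real ^ 'n \<Rightarrow> nat" where "x = (\<Sum>\<alpha>\<in>P. of_nat (c \<alpha>) *\<^sub>R \<alpha>)" "y = (\<Sum>\<alpha>\<in>P. of_nat (d \<alpha>) *\<^sub>R \<alpha>)"
    using assms unfolding pos_cone_def by blast
  then have "x + y = (\<Sum>\<alpha>\<in>P. of_nat (c \<alpha> + d \<alpha>) *\<^sub>R \<alpha>)"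
    by (simp add: scaleR_add_left sum.distrib)
  then show ?thesis unfolding pos_cone_def by (intro CollectI exI[of _ "\<lambda>\<alpha>. c \<alpha> + d \<alpha>"]) simp
qed

lemma pos_cone_zero: "0 \<in> pos_cone"
  unfolding pos_cone_def by (intro CollectI exI[of _ "\<lambda>_. 0"]) simp

lemma pos_cone_root: "\<alpha> \<in> P \<Longrightarrow> \<alpha> \<in> pos_cone"
  unfolding pos_cone_def
  by (intro CollectI exI[of _ "\<lambda>\<beta>. if \<beta> = \<alpha> then 1 else 0"])
     (simp add: if_distrib if_distribR sum.delta cong: if_cong)

lemma pos_cone_scale: "x \<in> pos_cone \<Longrightarrow> of_nat m *\<^sub>R x \<in> pos_cone"
  by (induction m) (auto simp: pos_cone_zero pos_cone_add scaleR_add_left)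

lemma pos_cone_inner_nonneg:
  assumes "x \<in> pos_cone" "\<And>\<alpha>. \<alpha> \<in> P \<Longrightarrow> \<alpha> \<bullet> z \<ge> 0"
  shows "x \<bullet> z \<ge> 0"
  using assms unfolding pos_cone_def by (auto simp: inner_sum_left intro!: sum_nonneg)

lemma pos_cone_antisym:
  assumes "x \<in> pos_cone" "- x \<in> pos_cone"
  shows "x = 0"
proof -
  obtain c :: "real ^ 'n \<Rightarrow> nat" where c: "x = (\<Sum>\<alpha>\<in>P. of_nat (c \<alpha>) *\<^sub>R \<alpha>)"
    using assms unfolding pos_cone_def by blast
  have pv: "0 < \<alpha> \<bullet> v" if "\<alpha> \<in> P" for \<alpha> using that by (simp add: pos_roots_eq)
  have "x \<bullet> v \<ge> 0" "(- x) \<bullet> v \<ge> 0"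
    using assms pos_cone_inner_nonneg[OF _ less_imp_le[OF pv]] by blast+
  then have "x \<bullet> v = 0" by simp
  then have "(\<Sum>\<alpha>\<in>P. real (c \<alpha>) * (\<alpha> \<bullet> v)) = 0" unfolding c by (simp add: inner_sum_left)
  then have "\<forall>\<alpha>\<in>P. real (c \<alpha>) * (\<alpha> \<bullet> v) = 0"
    by (subst (asm) sum_nonneg_eq_0_iff) (auto simp: pv less_imp_le)
  then have "\<forall>\<alpha>\<in>P. c \<alpha> = 0" using pv by fastforce
  then show ?thesis unfolding c by simp
qed

end

locale simple_datum = based_root_datum G v for G :: "('n::finite) root_datum" and v :: "real ^ 'n" +
  assumes irreducible: "irreducible_roots (roots G)"
    and simply_connected: "simply_connected_group G"
    and normalized: "normalized_form G"
begin

lemma weights_iff: "\<mu> \<in> weights G \<longleftrightarrow> (\<forall>y\<in>Q. \<mu> \<bullet> y \<in> \<int>)"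
  using simply_connected by (simp add: weights_def simply_connected_group_def)

lemma root_norm_le: "\<alpha> \<in> R \<Longrightarrow> \<alpha> \<bullet> \<alpha> \<le> 2"
  using normalized by (auto simp: normalized_form_def)

text \<open>The roots orthogonal to the whole orbit of \<beta> are orthogonal to all remaining
  roots, so irreducibility leaves none. The sign is corrected by a reflection in \<gamma>.\<close>

lemma W_orbit_inner_pos:
  assumes "\<beta> \<in> R" "\<gamma> \<in> R"
  shows "\<exists>w\<in>W. w \<beta> \<bullet> \<gamma> > 0"
proof -
  define A where "A = {\<delta>\<in>R. \<exists>w\<in>W. w \<beta> \<bullet> \<delta> \<noteq> 0}"
  define B where "B = {\<delta>\<in>R. \<forall>w\<in>W. w \<beta> \<bullet> \<delta> = 0}"
  have "R = A \<union> B" by (auto simp: A_def B_def)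
  moreover have "A \<noteq> {}"
    using assms(1) nonzero_R[OF assms(1)] by (auto simp: A_def intro!: exI[of _ \<beta>] bexI[of _ id])
  moreover have "\<delta> \<bullet> \<epsilon> = 0" if de: "\<delta> \<in> A" "\<epsilon> \<in> B" for \<delta> \<epsilon>
  proof -
    obtain w where w: "w \<in> W" "w \<beta> \<bullet> \<delta> \<noteq> 0" "\<delta> \<in> R" using de by (auto simp: A_def)
    have "reflection \<delta> \<circ> w \<in> W" using w by (intro weyl_group.refl)
    then have "(reflection \<delta> \<circ> w) \<beta> \<bullet> \<epsilon> = 0" "w \<beta> \<bullet> \<epsilon> = 0" using de w(1) unfolding B_def by blast+
    then have "(w \<beta> \<bullet> coroot \<delta>) * (\<delta> \<bullet> \<epsilon>) = 0"
      by (simp add: reflection_def inner_diff_left)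
    then show ?thesis using w nonzero_R[OF w(3)] by (auto simp: coroot_def)
  qed
  ultimately have "B = {}" using irreducible unfolding irreducible_roots_def by blast
  then obtain w where w: "w \<in> W" "w \<beta> \<bullet> \<gamma> \<noteq> 0" using assms(2) by (auto simp: B_def)
  show ?thesis
  proof (cases "w \<beta> \<bullet> \<gamma> > 0")
    case True
    then show ?thesis using w by blast
  next
    case False
    have "(reflection \<gamma> \<circ> w) \<beta> \<bullet> \<gamma> = - (w \<beta> \<bullet> \<gamma>)"
      by (simp add: reflection_adjoint reflection_self nonzero_R[OF assms(2)])
    moreover have "reflection \<gamma> \<circ> w \<in> W" using w assms by (intro weyl_group.refl)
    ultimately show ?thesis using False w(2) by (intro bexI[of _ "reflection \<gamma> \<circ> w"]) auto
  qed
qed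

text \<open>No root is longer than \<theta>, and \<beta> differs from \<theta>, so the positive
  squared length of \<beta> - \<theta> keeps the integer \<beta> \<bullet> \<theta> strictly below
  2.\<close>

lemma long_root_inner:
  assumes "\<theta> \<in> R" "\<theta> \<bullet> \<theta> = 2" "\<beta> \<in> R" "\<beta> \<noteq> \<theta>" "\<beta> \<bullet> \<theta> > 0"
  shows "\<beta> \<bullet> \<theta> = 1"
proof -
  have c: "coroot \<theta> = \<theta>" using assms by (simp add: coroot_def)
  obtain m where m: "\<beta> \<bullet> \<theta> = of_int m"
    using integral_R[OF assms(1,3)] c by (auto elim: Ints_cases)
  have "(\<beta> - \<theta>) \<bullet> (\<beta> - \<theta>) > 0" using assms(4) by simp
  then have "2 * (\<beta> \<bullet> \<theta>) < 4"
    using root_norm_le[OF assms(3)] assms(2) by (simp add: inner_diff_left inner_diff_right inner_commute)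
  then show ?thesis using assms(5) m by auto
qed

text \<open>The candidate is a long root of greatest height. A root \<beta> of greatest height among
  those violating the claim is dominant, because raising it by a reflection adds only a multiple of
  a positive root. Then \<beta> \<bullet> \<theta> = 1 and \<theta> - \<beta> is a root. It is not
  positive, but its negative has product 1 - 2 with \<theta>, against dominance.\<close>

lemma highest_root_exists:
  "\<exists>\<theta>\<in>R. \<theta> \<bullet> \<theta> = 2 \<and> (\<forall>\<alpha>\<in>P. \<theta> \<bullet> \<alpha> \<ge> 0) \<and> (\<forall>\<beta>\<in>R. \<theta> - \<beta> \<in> pos_cone)"
proof -
  have "finite {\<theta>\<in>R. \<theta> \<bullet> \<theta> = 2}" "{\<theta>\<in>R. \<theta> \<bullet> \<theta> = 2} \<noteq> {}"
    using normalized by (auto simp: normalized_form_def)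
  then obtain \<theta> where th: "\<theta> \<in> R" "\<theta> \<bullet> \<theta> = 2"
    and max: "\<And>\<beta>. \<beta> \<in> R \<Longrightarrow> \<beta> \<bullet> \<beta> = 2 \<Longrightarrow> \<beta> \<bullet> v \<le> \<theta> \<bullet> v"
    using finite_arg_max[of "{\<theta>\<in>R. \<theta> \<bullet> \<theta> = 2}" "\<lambda>\<theta>. \<theta> \<bullet> v"] by auto
  have cth: "coroot \<theta> = \<theta>" using th by (simp add: coroot_def)
  have dom: "\<theta> \<bullet> \<alpha> \<ge> 0" if a: "\<alpha> \<in> P" for \<alpha>
  proof (rule ccontr)
    assume "\<not> ?thesis"
    then have "\<theta> \<bullet> coroot \<alpha> < 0" using inner_coroot_sign(3)[OF nonzero_P[OF a], of \<theta>] by simp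
    then have "\<theta> \<bullet> v < reflection \<alpha> \<theta> \<bullet> v"
      using a by (simp add: reflection_def inner_diff_left pos_roots_eq mult_neg_pos)
    then show False
      using max[of "reflection \<alpha> \<theta>"] reflection_R[OF P_R[OF a] th(1)] th(2)
      by (simp add: inner_reflection_both)
  qed
  have thP: "\<theta> \<in> P"
    using P_or_uminus_P[OF th(1)] dom[of "- \<theta>"] th by auto
  have main: "\<theta> - \<beta> \<in> pos_cone" if b: "\<beta> \<in> R" for \<beta>
  proof (rule ccontr)
    assume n: "\<theta> - \<beta> \<notin> pos_cone"
    define C where "C = {\<beta>\<in>R. \<theta> - \<beta> \<notin> pos_cone}"
    have "finite C" "C \<noteq> {}" using n b by (auto simp: C_def)
    then obtain \<beta> where b: "\<beta> \<in> R" "\<theta> - \<beta> \<notin> pos_cone"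
      and mx: "\<And>\<gamma>. \<gamma> \<in> R \<Longrightarrow> \<theta> - \<gamma> \<notin> pos_cone \<Longrightarrow> \<gamma> \<bullet> v \<le> \<beta> \<bullet> v"
      using finite_arg_max[of C "\<lambda>\<theta>. \<theta> \<bullet> v"] by (auto simp: C_def)
    have bdom: "\<beta> \<bullet> \<alpha> \<ge> 0" if a: "\<alpha> \<in> P" for \<alpha>
    proof (rule ccontr)
      assume "\<not> ?thesis"
      then have neg: "\<beta> \<bullet> coroot \<alpha> < 0" using inner_coroot_sign(3)[OF nonzero_P[OF a], of \<beta>] by simp
      then have "\<beta> \<bullet> v < reflection \<alpha> \<beta> \<bullet> v"
        using a by (simp add: reflection_def inner_diff_left pos_roots_eq mult_neg_pos)
      then have c: "\<theta> - reflection \<alpha> \<beta> \<in> pos_cone"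
        using mx[OF reflection_R[OF P_R[OF a] b(1)]] by (meson not_le)
      obtain m where m: "\<beta> \<bullet> coroot \<alpha> = of_int m"
        using integral_R[OF P_R[OF a] b(1)] by (auto elim: Ints_cases)
      then have mm: "\<beta> \<bullet> coroot \<alpha> = - real (nat (- m))" using neg by simp
      have "(\<theta> - reflection \<alpha> \<beta>) + of_nat (nat (- m)) *\<^sub>R \<alpha> \<in> pos_cone"
        by (intro pos_cone_add c pos_cone_scale pos_cone_root a)
      then show False using b(2) by (simp add: reflection_def mm)
    qed
    obtain w where w: "w \<in> W" "w \<beta> \<bullet> \<theta> > 0" using W_orbit_inner_pos[OF b(1) th(1)] by blast
    have "w \<beta> \<bullet> \<theta> \<le> \<beta> \<bullet> \<theta>" by (rule dominant_inner_le[OF w(1) bdom dom])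
    then have pos: "\<beta> \<bullet> \<theta> > 0" using w by simp
    have ne: "\<beta> \<noteq> \<theta>" using b(2) pos_cone_zero by auto
    have one: "\<beta> \<bullet> \<theta> = 1" by (rule long_root_inner[OF th b(1) ne pos])
    have "\<theta> - \<beta> \<in> R" using root_diff[OF th(1) b(1)] pos ne by (simp add: inner_commute)
    moreover have "\<theta> - \<beta> \<notin> P" using pos_cone_root b(2) by blast
    ultimately have "- (\<theta> - \<beta>) \<in> P" using P_or_uminus_P by blast
    then have "\<theta> \<bullet> (\<beta> - \<theta>) \<ge> 0" using dom by simp
    then show False using one th by (simp add: inner_diff_right inner_commute)
  qed
  show ?thesis using th dom main by blast
qed

abbreviation "\<theta> \<equiv> highest_root G"

lemma highest_root: "\<theta> \<in> R" "\<theta> \<bullet> \<theta> = 2" "\<And>\<alpha>. \<alpha> \<in> P \<Longrightarrow> \<theta> \<bullet> \<alpha> \<ge> 0"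
  "\<And>\<beta>. \<beta> \<in> R \<Longrightarrow> \<theta> - \<beta> \<in> pos_cone"
proof -
  obtain t where t: "t \<in> R" "t \<bullet> t = 2" "\<And>\<alpha>. \<alpha> \<in> P \<Longrightarrow> t \<bullet> \<alpha> \<ge> 0" "\<And>\<beta>. \<beta> \<in> R \<Longrightarrow> t - \<beta> \<in> pos_cone"
    using highest_root_exists by blast
  have "\<theta> = t"
    unfolding highest_root_def
  proof (rule the_equality)
    show "t \<in> R \<and> (\<forall>\<beta>\<in>R. \<exists>c::real ^ 'n \<Rightarrow> nat. t - \<beta> = (\<Sum>\<alpha>\<in>P. real (c \<alpha>) *\<^sub>R \<alpha>))"
      using t unfolding pos_cone_def by blast
    fix s assume s: "s \<in> R \<and> (\<forall>\<beta>\<in>R. \<exists>c::real ^ 'n \<Rightarrow> nat. s - \<beta> = (\<Sum>\<alpha>\<in>P. real (c \<alpha>) *\<^sub>R \<alpha>))"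
    then have "s - t \<in> pos_cone" using t(1) unfolding pos_cone_def by blast
    moreover have "- (s - t) \<in> pos_cone" using t(4) s by simp
    ultimately show "s = t" using pos_cone_antisym by fastforce
  qed
  then show "\<theta> \<in> R" "\<theta> \<bullet> \<theta> = 2" "\<And>\<alpha>. \<alpha> \<in> P \<Longrightarrow> \<theta> \<bullet> \<alpha> \<ge> 0" "\<And>\<beta>. \<beta> \<in> R \<Longrightarrow> \<theta> - \<beta> \<in> pos_cone"
    using t by auto
qed

lemma coroot_highest: "coroot \<theta> = \<theta>"
  using highest_root(2) by (simp add: coroot_def)

lemma highest_Q: "\<theta> \<in> Q"
  using coroot_Q[OF highest_root(1)] by (simp add: coroot_highest)

lemma highest_P: "\<theta> \<in> P"
proof (rule ccontr)
  assume "\<theta> \<notin> P"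
  then have "- \<theta> \<in> P" using P_or_uminus_P[OF highest_root(1)] by blast
  from highest_root(3)[OF this] show False by (simp add: highest_root(2))
qed

lemma root_le_highest:
  assumes "\<beta> \<in> R" "\<And>\<alpha>. \<alpha> \<in> P \<Longrightarrow> \<alpha> \<bullet> x \<ge> 0"
  shows "\<beta> \<bullet> x \<le> \<theta> \<bullet> x"
  using pos_cone_inner_nonneg[OF highest_root(4)[OF assms(1)] assms(2)] by (simp add: inner_diff_left)

section \<open>The dual Coxeter number\<close>

abbreviation "h \<equiv> dual_coxeter G"

lemma dual_coxeter_eq: "h = 1 + rho \<bullet> \<theta>"
  unfolding dual_coxeter_def rho_def coroot_highest by simp

lemma dual_coxeter_nat: "\<exists>m::nat. m \<ge> 2 \<and> h = of_nat m"
proof -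
  obtain m :: nat where "m \<ge> 1" "rho \<bullet> \<theta> = of_nat m"
    using rho_coroot[OF highest_P] by (auto simp: coroot_highest)
  then show ?thesis by (intro exI[of _ "Suc m"]) (simp add: dual_coxeter_eq)
qed

lemma dual_coxeter_pos: "h > 0"
  using dual_coxeter_nat by auto

text \<open>A positive root other than \<theta> has product 0 or 1 with the long root \<theta>, so
  squaring matters only at \<theta> itself, where it replaces 2 by 4.\<close>

lemma sum_pos_roots_square: "(\<Sum>\<alpha>\<in>P. (\<alpha> \<bullet> \<theta>)\<^sup>2) = 2 * h"
proof -
  have "(\<alpha> \<bullet> \<theta>)\<^sup>2 = \<alpha> \<bullet> \<theta>" if a: "\<alpha> \<in> P - {\<theta>}" for \<alpha>
  proof -
    have "\<alpha> \<bullet> \<theta> \<ge> 0" using highest_root(3)[of \<alpha>] a by (simp add: inner_commute)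
    then consider "\<alpha> \<bullet> \<theta> = 0" | "\<alpha> \<bullet> \<theta> > 0" by linarith
    then show ?thesis
    proof cases
      case 2
      then have "\<alpha> \<bullet> \<theta> = 1"
        using a P_R by (intro long_root_inner[OF highest_root(1,2)]) auto
      then show ?thesis by simp
    qed simp
  qed
  then have "(\<Sum>\<alpha>\<in>P - {\<theta>}. (\<alpha> \<bullet> \<theta>)\<^sup>2) = (\<Sum>\<alpha>\<in>P - {\<theta>}. \<alpha> \<bullet> \<theta>)" by simp
  moreover have "(\<Sum>\<alpha>\<in>P. (\<alpha> \<bullet> \<theta>)\<^sup>2) = 4 + (\<Sum>\<alpha>\<in>P - {\<theta>}. (\<alpha> \<bullet> \<theta>)\<^sup>2)"
    using highest_P highest_root(2) by (simp add: sum.remove[of P \<theta>])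
  moreover have "(\<Sum>\<alpha>\<in>P. \<alpha> \<bullet> \<theta>) = 2 + (\<Sum>\<alpha>\<in>P - {\<theta>}. \<alpha> \<bullet> \<theta>)"
    using highest_P highest_root(2) by (simp add: sum.remove[of P \<theta>])
  moreover have "(\<Sum>\<alpha>\<in>P. \<alpha> \<bullet> \<theta>) = 2 * (rho \<bullet> \<theta>)"
    by (simp add: rho_def inner_sum_left)
  ultimately show ?thesis by (simp add: dual_coxeter_eq)
qed

text \<open>The operator commutes with the Weyl group, so each root is an eigenvector; symmetry
  gives nonorthogonal roots equal eigenvalues, irreducibility leaves a single one, and \<theta>
  identifies it as h. This identity accounts for the shift of the level by h.\<close>

lemma sum_pos_roots: "(\<Sum>\<alpha>\<in>P. (\<alpha> \<bullet> x) *\<^sub>R \<alpha>) = h *\<^sub>R x"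
proof -
  define T where "T x = (\<Sum>\<alpha>\<in>P. (\<alpha> \<bullet> x) *\<^sub>R \<alpha>)" for x
  have T2: "2 *\<^sub>R T x = (\<Sum>\<alpha>\<in>R. (\<alpha> \<bullet> x) *\<^sub>R \<alpha>)" for x
    by (simp only: T_def sum_R scaleR_sum_right scaleR_2 inner_minus_left scaleR_minus_left
        scaleR_minus_right minus_minus)
  have lin: "linear T"
    by (rule linearI) (simp_all add: T_def inner_add_right scaleR_add_left sum.distrib scaleR_sum_right)
  have sym: "T x \<bullet> y = x \<bullet> T y" for x y
    by (simp add: T_def inner_sum_left inner_sum_right inner_commute mult.commute)
  have TW: "T (w x) = w (T x)" if w: "w \<in> W" for w x
  proof -
    have "2 *\<^sub>R T (w x) = (\<Sum>\<alpha>\<in>R. (w \<alpha> \<bullet> w x) *\<^sub>R w \<alpha>)"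
      unfolding T2 by (rule sum.reindex_bij_betw[OF bij_betw_W_R[OF w], symmetric])
    also have "\<dots> = w (2 *\<^sub>R T x)"
      unfolding T2 by (simp add: W_sum[OF w] W_scale[OF w] W_inner[OF w])
    finally show ?thesis by (simp add: W_scale[OF w])
  qed
  define c where "c \<alpha> = (T \<alpha> \<bullet> coroot \<alpha>) / 2" for \<alpha>
  have eig: "T \<alpha> = c \<alpha> *\<^sub>R \<alpha>" if a: "\<alpha> \<in> R" for \<alpha>
  proof -
    have "reflection \<alpha> (T \<alpha>) = T (- \<alpha>)"
      using TW[OF reflection_W[OF a], of \<alpha>] reflection_self[OF nonzero_R[OF a]] by simp
    also have "\<dots> = - T \<alpha>" using lin by (simp add: linear_neg)
    finally have "T \<alpha> - (T \<alpha> \<bullet> coroot \<alpha>) *\<^sub>R \<alpha> = - T \<alpha>" by (simp only: reflection_def)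
    then have "T \<alpha> - (T \<alpha> - (T \<alpha> \<bullet> coroot \<alpha>) *\<^sub>R \<alpha>) = T \<alpha> + T \<alpha>" by simp
    then have "2 *\<^sub>R T \<alpha> = (T \<alpha> \<bullet> coroot \<alpha>) *\<^sub>R \<alpha>" by (simp add: scaleR_2)
    then have "(1/2) *\<^sub>R (2 *\<^sub>R T \<alpha>) = (1/2) *\<^sub>R ((T \<alpha> \<bullet> coroot \<alpha>) *\<^sub>R \<alpha>)" by simp
    then show ?thesis by (simp add: c_def)
  qed
  have ceq: "c \<alpha> = c \<beta>" if ab: "\<alpha> \<in> R" "\<beta> \<in> R" "\<alpha> \<bullet> \<beta> \<noteq> 0" for \<alpha> \<beta>
    using sym[of \<alpha> \<beta>] eig ab by simp
  define A where "A = {\<alpha>\<in>R. c \<alpha> = c \<theta>}"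
  define B where "B = {\<alpha>\<in>R. c \<alpha> \<noteq> c \<theta>}"
  have "R = A \<union> B" "A \<noteq> {}" using highest_root(1) by (auto simp: A_def B_def)
  moreover have "\<alpha> \<bullet> \<beta> = 0" if "\<alpha> \<in> A" "\<beta> \<in> B" for \<alpha> \<beta>
    using that ceq[of \<alpha> \<beta>] by (auto simp: A_def B_def)
  ultimately have "B = {}" using irreducible unfolding irreducible_roots_def by blast
  then have "T \<alpha> = c \<theta> *\<^sub>R \<alpha>" if "\<alpha> \<in> R" for \<alpha> using eig[OF that] that by (auto simp: B_def)
  then have all: "T x = c \<theta> *\<^sub>R x" for x
    using linear_eq_on_span[OF lin, of "\<lambda>x. c \<theta> *\<^sub>R x" R x] span_R by (auto simp: linear_iff scaleR_add_right)
  have "T \<theta> \<bullet> \<theta> = 2 * h"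
    using sum_pos_roots_square by (simp add: T_def inner_sum_left power2_eq_square)
  then have "c \<theta> = h" using all[of \<theta>] highest_root(2) by simp
  then show ?thesis using all[of x] by (simp add: T_def)
qed

text \<open>Up to the factor h, the displacement of this point under x -> w x + y is the vector on
  the right of \<open>sum_affine_heights\<close>.\<close>

definition rho_point :: "real ^ 'n" where "rho_point = (1 / h) *\<^sub>R rho"

lemma rho_point_alcove: "rho_point \<in> alcove"
proof -
  have "0 < \<alpha> \<bullet> rho_point \<and> \<alpha> \<bullet> rho_point < 1" if a: "\<alpha> \<in> P" for \<alpha>
  proof -
    have "0 \<le> \<beta> \<bullet> rho" if "\<beta> \<in> P" for \<beta>
      using rho_pos[OF that] by (simp add: inner_commute)
    then have "\<alpha> \<bullet> rho \<le> \<theta> \<bullet> rho"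
      by (rule root_le_highest[OF P_R[OF a]])
    then show ?thesis using rho_pos[OF a] dual_coxeter_eq dual_coxeter_pos
      by (simp add: rho_point_def inner_commute)
  qed
  then show ?thesis by (auto simp: alcove_def)
qed

text \<open>The coefficient of \<alpha> is the integer part of \<alpha> on the image of the open
  alcove under x -> w x + y.\<close>

lemma sum_affine_heights:
  assumes "w \<in> W" "y \<in> Q"
  shows "(\<Sum>\<alpha>\<in>P. (\<alpha> \<bullet> y - (if inv w \<alpha> \<in> P then 0 else 1)) *\<^sub>R \<alpha>) = w rho + h *\<^sub>R y - rho"
proof -
  have "(\<Sum>\<alpha>\<in>P. (\<alpha> \<bullet> y - (if inv w \<alpha> \<in> P then 0 else 1)) *\<^sub>R \<alpha>)
      = (\<Sum>\<alpha>\<in>P. (\<alpha> \<bullet> y) *\<^sub>R \<alpha>) - (\<Sum>\<alpha>\<in>P. if inv w \<alpha> \<in> P then 0 else \<alpha>)"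
    unfolding sum_subtractf[symmetric] by (intro sum.cong) (auto simp: scaleR_diff_left)
  then show ?thesis unfolding sum_pos_roots rho_minus_W_rho[OF assms(1), symmetric] by simp
qed

section \<open>Weights\<close>

text \<open>Some conjugate of \<theta> has positive product with \<alpha>. Unless it is \<alpha>
  itself the product is 1, and then 2 / (\<alpha> \<bullet> \<alpha>) is a Cartan integer. So
  coroots are integral multiples of roots.\<close>

lemma two_div_root_norm: assumes "\<alpha> \<in> R" shows "2 / (\<alpha> \<bullet> \<alpha>) \<in> \<int>"
proof -
  obtain w where w: "w \<in> W" "w \<theta> \<bullet> \<alpha> > 0" using W_orbit_inner_pos[OF highest_root(1) assms] by blast
  have t: "w \<theta> \<in> R" "w \<theta> \<bullet> w \<theta> = 2"
    using W_R[OF w(1) highest_root(1)] highest_root(2) W_inner[OF w(1)] by auto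
  show ?thesis
  proof (cases "\<alpha> = w \<theta>")
    case True
    then show ?thesis using t by simp
  next
    case False
    have "\<alpha> \<bullet> w \<theta> = 1" using long_root_inner[OF t assms False] w(2) by (simp add: inner_commute)
    then have "w \<theta> \<bullet> coroot \<alpha> = 2 / (\<alpha> \<bullet> \<alpha>)" by (simp add: coroot_def inner_commute)
    then show ?thesis using integral_R[OF assms t(1)] by simp
  qed
qed

lemma weight_add: "\<mu> \<in> weights G \<Longrightarrow> \<nu> \<in> weights G \<Longrightarrow> \<mu> + \<nu> \<in> weights G"
  and weight_diff: "\<mu> \<in> weights G \<Longrightarrow> \<nu> \<in> weights G \<Longrightarrow> \<mu> - \<nu> \<in> weights G"
  and weight_minus: "\<mu> \<in> weights G \<Longrightarrow> - \<mu> \<in> weights G"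
  and weight_zero: "0 \<in> weights G"
  and weight_root: "\<alpha> \<in> R \<Longrightarrow> \<alpha> \<in> weights G"
  by (auto simp: weights_iff inner_add_left inner_diff_left root_Q_int)

lemma weight_scale_int: "\<mu> \<in> weights G \<Longrightarrow> of_int m *\<^sub>R \<mu> \<in> weights G"
  by (auto simp: weights_iff)

lemma weight_scale_nat: "\<mu> \<in> weights G \<Longrightarrow> of_nat m *\<^sub>R \<mu> \<in> weights G"
  by (auto simp: weights_iff)

lemma weight_W: assumes "w \<in> W" "\<mu> \<in> weights G" shows "w \<mu> \<in> weights G"
  using assms(2) Q_W[OF W_inv[OF assms(1)]] W_inner_inv[OF assms(1)] by (auto simp: weights_iff)

lemma weight_rho: "rho \<in> weights G"
proof -
  have "rho \<bullet> scoroot i \<in> \<int>" for i using rho_simple_coroot[OF sroot_simple] by simp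
  then show ?thesis using Q_int_iff weights_iff by blast
qed

text \<open>Equivalently, the normalized form is integral on the coroot lattice. This makes (k + h)
  y a weight for every coroot lattice vector y.\<close>

lemma Q_weight: assumes "y \<in> Q" shows "y \<in> weights G"
proof -
  have "y \<bullet> coroot \<beta> \<in> \<int>" if b: "\<beta> \<in> R" for \<beta>
  proof -
    have "\<beta> \<bullet> y \<in> \<int>" by (rule root_Q_int[OF b assms])
    then have "(2 / (\<beta> \<bullet> \<beta>)) * (\<beta> \<bullet> y) \<in> \<int>" using two_div_root_norm[OF b] by (rule Ints_mult[rotated])
    then show ?thesis by (simp add: coroot_def inner_commute)
  qed
  then show ?thesis using Q_int_iff weights_iff simple_R[OF sroot_simple] by blast
qed

abbreviation "\<Lambda> k \<equiv> level_weights G k"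

lemma level_weightsD:
  assumes "\<mu> \<in> \<Lambda> k"
  shows "\<mu> \<in> weights G" "\<And>\<alpha>. \<alpha> \<in> P \<Longrightarrow> \<alpha> \<bullet> \<mu> \<ge> 0" "\<And>\<alpha>. \<alpha> \<in> R \<Longrightarrow> \<alpha> \<bullet> \<mu> \<le> k"
proof -
  show dom: "\<alpha> \<bullet> \<mu> \<ge> 0" if "\<alpha> \<in> P" for \<alpha>
    using assms that inner_coroot_sign(1)[OF nonzero_P[OF that], of \<mu>]
    by (auto simp: level_weights_def dominant_weights_def inner_commute)
  show "\<mu> \<in> weights G" using assms by (auto simp: level_weights_def dominant_weights_def)
  fix \<alpha> assume "\<alpha> \<in> R"
  have "\<alpha> \<bullet> \<mu> \<le> \<theta> \<bullet> \<mu>" by (rule root_le_highest[OF \<open>\<alpha> \<in> R\<close> dom])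
  also have "\<dots> \<le> k" using assms by (simp add: level_weights_def inner_commute)
  finally show "\<alpha> \<bullet> \<mu> \<le> k" .
qed

lemma level_weightsI:
  assumes "\<mu> \<in> weights G" "\<And>\<alpha>. \<alpha> \<in> P \<Longrightarrow> \<alpha> \<bullet> \<mu> \<ge> 0" "\<theta> \<bullet> \<mu> \<le> k"
  shows "\<mu> \<in> \<Lambda> k"
  using assms inner_coroot_sign(1)[OF nonzero_P]
  by (auto simp: level_weights_def dominant_weights_def inner_commute)

text \<open>Level 0 is settled apart, since the alcove arguments rescale weights by 1 / k.\<close>

lemma level_weights_zero: assumes "\<mu> \<in> \<Lambda> 0" shows "\<mu> = 0"
proof -
  have "\<alpha> \<bullet> \<mu> = 0" if "\<alpha> \<in> P" for \<alpha>
    using level_weightsD(2)[OF assms that] level_weightsD(3)[OF assms P_R[OF that]] by simp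
  then have "scoroot i \<bullet> \<mu> = 0" for i using simple_P[OF sroot_simple, of i] by (simp add: coroot_def)
  then show ?thesis by (rule eq_zero_if_scoroot)
qed

lemma level_weight_closed_alcove:
  assumes "\<mu> \<in> \<Lambda> k" "k > 0" shows "(1 / k) *\<^sub>R \<mu> \<in> closed_alcove"
  using level_weightsD[OF assms(1)] assms(2) P_R by (auto simp: closed_alcove_def)

text \<open>With x = \<nu> / k, x' = \<mu> / k and u = \<open>rho_point\<close> in the closed
  alcove, polarization expresses twice the product of w x' + y - x and w u + y - u through four
  squared distances. By \<open>alcove_closest\<close>, transforming only one point of the pair x', u
  or of the pair u, x does not decrease its distance.\<close>

lemma level_weight_inner_nonneg:
  assumes "\<nu> \<in> \<Lambda> k" "\<mu> \<in> \<Lambda> k" "w \<in> W" "y \<in> Q"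
  shows "(w \<mu> + real k *\<^sub>R y - \<nu>) \<bullet> (w rho_point + y - rho_point) \<ge> 0"
proof (cases "k = 0")
  case True
  then have "\<mu> = 0" "\<nu> = 0" using assms level_weights_zero by auto
  then show ?thesis using True W_zero[OF assms(3)] by simp
next
  case False
  define x where "x = (1 / k) *\<^sub>R \<nu>"
  define x' where "x' = (1 / k) *\<^sub>R \<mu>"
  define u where "u = rho_point"
  have xs: "x \<in> closed_alcove" "x' \<in> closed_alcove" "u \<in> closed_alcove"
    using assms False level_weight_closed_alcove rho_point_alcove alcove_closed by (auto simp: x_def x'_def u_def)
  have polar: "2 * ((a - b) \<bullet> (c - d)) = (norm (a - d))\<^sup>2 + (norm (c - b))\<^sup>2 - (norm (a - c))\<^sup>2 - (norm (b - d))\<^sup>2"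
    for a b c d :: "real ^ 'n"
    unfolding power2_norm_eq_inner by (simp add: inner_diff_left inner_diff_right inner_commute)
  have "(w x' + y) - (w u + y) = w (x' - u)" by (simp add: W_diff[OF assms(3)])
  then have iso: "norm ((w x' + y) - (w u + y)) = norm (x' - u)"
    using orthogonal_transformation_norm[OF W_orthogonal[OF assms(3)]] by metis
  have "(norm (x' - u))\<^sup>2 \<le> (norm (w x' + y - u))\<^sup>2"
    by (intro power_mono alcove_closest[OF xs(2,3) assms(3,4)]) simp
  moreover have "(norm (u - x))\<^sup>2 \<le> (norm (w u + y - x))\<^sup>2"
    by (intro power_mono alcove_closest[OF xs(3,1) assms(3,4)]) simp
  ultimately have "0 \<le> 2 * ((w x' + y - x) \<bullet> (w u + y - u))"
    unfolding polar iso norm_minus_commute[of x u] by linarith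
  then have "0 \<le> real k * ((w x' + y - x) \<bullet> (w u + y - u))" by (simp add: zero_le_mult_iff)
  also have "\<dots> = (real k *\<^sub>R (w x' + y - x)) \<bullet> (w u + y - u)" by simp
  also have "real k *\<^sub>R (w x' + y - x) = w \<mu> + real k *\<^sub>R y - \<nu>"
    using False by (simp add: x_def x'_def W_scale[OF assms(3)] scaleR_diff_right scaleR_add_right)
  finally show ?thesis by (simp add: u_def)
qed

lemma level_weight_unique:
  assumes "\<nu> \<in> \<Lambda> k" "\<mu> \<in> \<Lambda> k" "w \<in> W" "y \<in> Q" "w \<mu> + real k *\<^sub>R y = \<nu>"
  shows "\<nu> = \<mu>"
proof (cases "k = 0")
  case True
  then show ?thesis using assms level_weights_zero by auto
next
  case False
  have "(1 / k) *\<^sub>R \<nu> = w ((1 / k) *\<^sub>R \<mu>) + y"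
    using False unfolding assms(5)[symmetric] W_scale[OF assms(3)] by (simp add: scaleR_add_right)
  then have "w ((1 / k) *\<^sub>R \<mu>) + y \<in> closed_alcove"
    using level_weight_closed_alcove[OF assms(1)] False by simp
  then have "w ((1 / k) *\<^sub>R \<mu>) + y = (1 / k) *\<^sub>R \<mu>"
    using closed_alcove_unique level_weight_closed_alcove[OF assms(2)] False assms by simp
  then have "(1 / k) *\<^sub>R \<nu> = (1 / k) *\<^sub>R \<mu>" using \<open>(1 / k) *\<^sub>R \<nu> = _\<close> by simp
  then show ?thesis using False by simp
qed

lemma finite_level_weights: "finite (\<Lambda> k)"
proof -
  define N where "N = \<lceil>(\<Sum>i\<in>(UNIV::'n set). 2 / (sroot i \<bullet> sroot i)) * k\<rceil>"
  define F where "F = (\<lambda>c. (\<Sum>i\<in>UNIV. of_int (c i) *\<^sub>R fweight i)) ` (UNIV \<rightarrow>\<^sub>E {0..N} :: ('n \<Rightarrow> int) set)"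
  have "\<Lambda> k \<subseteq> F"
  proof
    fix \<mu> assume m: "\<mu> \<in> \<Lambda> k"
    have int: "of_int \<lfloor>scoroot i \<bullet> \<mu>\<rfloor> = scoroot i \<bullet> \<mu>" for i
    proof -
      have "\<mu> \<bullet> scoroot i \<in> \<int>" using level_weightsD(1)[OF m] scoroot_Q[of i] unfolding weights_iff by blast
      then show ?thesis by (simp add: inner_commute)
    qed
    have b: "0 \<le> scoroot i \<bullet> \<mu>" "scoroot i \<bullet> \<mu> \<le> of_int N" for i
    proof -
      have eq: "scoroot i \<bullet> \<mu> = 2 / (sroot i \<bullet> sroot i) * (sroot i \<bullet> \<mu>)" by (simp add: coroot_def)
      have nn: "0 \<le> sroot i \<bullet> \<mu>" "sroot i \<bullet> \<mu> \<le> k"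
        using level_weightsD[OF m] simple_P[OF sroot_simple] simple_R[OF sroot_simple] by auto
      then show "0 \<le> scoroot i \<bullet> \<mu>" unfolding eq by (simp add: zero_le_mult_iff)
      have "scoroot i \<bullet> \<mu> \<le> (\<Sum>i\<in>UNIV. 2 / (sroot i \<bullet> sroot i)) * k"
        unfolding eq using nn by (intro mult_mono member_le_sum) (auto simp: sum_nonneg)
      then show "scoroot i \<bullet> \<mu> \<le> of_int N" unfolding N_def by linarith
    qed
    have "\<lfloor>scoroot i \<bullet> \<mu>\<rfloor> \<in> {0..N}" for i
      using b[of i] by (auto simp: le_floor_iff floor_le_iff)
    moreover have "\<mu> = (\<Sum>i\<in>UNIV. of_int \<lfloor>scoroot i \<bullet> \<mu>\<rfloor> *\<^sub>R fweight i)"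
      unfolding int by (rule fweight_expansion)
    ultimately show "\<mu> \<in> F" unfolding F_def by (intro image_eqI[of _ _ "\<lambda>i. \<lfloor>scoroot i \<bullet> \<mu>\<rfloor>"]) auto
  qed
  moreover have "finite F" unfolding F_def by (intro finite_imageI finite_PiE) auto
  ultimately show ?thesis by (rule finite_subset)
qed

section \<open>The longest element and dual weights\<close>

abbreviation "w\<^sub>0 \<equiv> longest_element G"

lemma longest_neg: "\<alpha> \<in> P \<Longrightarrow> - w\<^sub>0 \<alpha> \<in> P"
proof -
  assume "\<alpha> \<in> P"
  then have "w\<^sub>0 \<alpha> \<in> uminus ` P" using longest_element(2) by blast
  then show ?thesis by auto
qed

lemma longest_involution: "w\<^sub>0 (w\<^sub>0 x) = x"
proof -
  have "w\<^sub>0 \<circ> w\<^sub>0 = id"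
  proof (rule W_fixing_P[OF W_comp[OF longest_element(1) longest_element(1)]])
    fix \<alpha> assume "\<alpha> \<in> P"
    then have "- w\<^sub>0 (- w\<^sub>0 \<alpha>) \<in> P" by (intro longest_neg)
    then show "(w\<^sub>0 \<circ> w\<^sub>0) \<alpha> \<in> P" by (simp add: W_minus[OF longest_element(1)])
  qed
  then show ?thesis by (metis comp_apply id_apply)
qed

lemma longest_adjoint: "w\<^sub>0 x \<bullet> y = x \<bullet> w\<^sub>0 y"
  by (metis longest_involution W_inner longest_element(1))

lemma dual_weight_involution [simp]: "dual_weight G (dual_weight G \<mu>) = \<mu>"
  by (simp add: dual_weight_def W_minus[OF longest_element(1)] longest_involution)

lemma dual_weight_level: assumes "\<mu> \<in> \<Lambda> k" shows "dual_weight G \<mu> \<in> \<Lambda> k"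
proof (rule level_weightsI)
  show "dual_weight G \<mu> \<in> weights G"
    unfolding dual_weight_def
    by (rule weight_minus[OF weight_W[OF longest_element(1) level_weightsD(1)[OF assms]]])
  have eq: "\<alpha> \<bullet> dual_weight G \<mu> = (- w\<^sub>0 \<alpha>) \<bullet> \<mu>" for \<alpha>
    by (simp add: dual_weight_def longest_adjoint)
  show "\<alpha> \<bullet> dual_weight G \<mu> \<ge> 0" if "\<alpha> \<in> P" for \<alpha>
    unfolding eq by (rule level_weightsD(2)[OF assms longest_neg[OF that]])
  show "\<theta> \<bullet> dual_weight G \<mu> \<le> k"
    unfolding eq by (rule level_weightsD(3)[OF assms P_R[OF longest_neg[OF highest_P]]])
qed

end

section \<open>Integrals of periodic functions\<close>

definition int_vecs :: "(real ^ 'm) set" where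
  "int_vecs = {z. \<forall>i. z $ i \<in> \<int>}"

definition cube :: "(real ^ 'm) set" where
  "cube = {x. \<forall>i. 0 \<le> x $ i \<and> x $ i < 1}"

text \<open>Fundamental domains other than boxes occur because the change of variables replaces the
  cube by its image under \<Phi>.\<close>

definition fundamental :: "(real ^ 'm::finite) set \<Rightarrow> bool" where
  "fundamental S \<longleftrightarrow> S \<in> lmeasurable \<and> bounded S \<and> (\<forall>x. \<exists>!z. z \<in> int_vecs \<and> x - z \<in> S)"

lemma int_vecs_add: "x \<in> int_vecs \<Longrightarrow> y \<in> int_vecs \<Longrightarrow> x + y \<in> int_vecs"
  and int_vecs_diff: "x \<in> int_vecs \<Longrightarrow> y \<in> int_vecs \<Longrightarrow> x - y \<in> int_vecs"
  and int_vecs_minus: "x \<in> int_vecs \<Longrightarrow> - x \<in> int_vecs"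
  and int_vecs_zero: "0 \<in> int_vecs"
  by (auto simp: int_vecs_def)

lemma finite_int_vecs_bounded: "finite {z \<in> int_vecs. norm (z :: real ^ 'm::finite) \<le> C}"
proof -
  define F where "F = (\<lambda>c. \<chi> i. real_of_int (c i)) ` (UNIV \<rightarrow>\<^sub>E {-\<lceil>C\<rceil>..\<lceil>C\<rceil>} :: ('m \<Rightarrow> int) set)"
  have "{z \<in> int_vecs. norm z \<le> C} \<subseteq> F"
  proof
    fix z :: "real ^ 'm" assume z: "z \<in> {z \<in> int_vecs. norm z \<le> C}"
    have int: "of_int \<lfloor>z $ i\<rfloor> = z $ i" for i
      using z by (auto simp: int_vecs_def)
    have "\<bar>z $ i\<bar> \<le> C" for i using component_le_norm_cart[of z i] z by auto
    then have "\<bar>z $ i\<bar> \<le> of_int \<lceil>C\<rceil>" for i by (meson le_of_int_ceiling order_trans)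
    then have "real_of_int (- \<lceil>C\<rceil>) \<le> of_int \<lfloor>z $ i\<rfloor> \<and> real_of_int \<lfloor>z $ i\<rfloor> \<le> of_int \<lceil>C\<rceil>" for i
      unfolding int abs_le_iff of_int_minus by (metis minus_le_iff)
    then have "\<lfloor>z $ i\<rfloor> \<in> {-\<lceil>C\<rceil>..\<lceil>C\<rceil>}" for i
      unfolding of_int_le_iff by simp
    moreover have "z = (\<chi> i. of_int \<lfloor>z $ i\<rfloor>)" by (simp add: int vec_eq_iff)
    ultimately show "z \<in> F" unfolding F_def by (intro image_eqI[of _ _ "\<lambda>i. \<lfloor>z $ i\<rfloor>"]) auto
  qed
  moreover have "finite F" unfolding F_def by (intro finite_imageI finite_PiE) auto
  ultimately show ?thesis by (rule finite_subset)
qed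

lemma bounded_imp_subset_cball:
  fixes S :: "'a::real_normed_vector set"
  shows "bounded S \<Longrightarrow> \<exists>r. S \<subseteq> cball 0 r"
  by (auto simp: bounded_iff subset_iff)

lemma continuous_abs_int:
  fixes f :: "real ^ 'm::finite \<Rightarrow> 'b::euclidean_space"
  assumes "S \<in> lmeasurable" "bounded S" "continuous_on UNIV f"
  shows "f absolutely_integrable_on S"
proof -
  obtain r where r: "S \<subseteq> cball 0 r" using bounded_imp_subset_cball[OF assms(2)] by blast
  have "compact (f ` cball 0 r)"
    by (intro compact_continuous_image compact_cball continuous_on_subset[OF assms(3)]) simp
  then have "bounded (f ` cball 0 r)" by (rule compact_imp_bounded)
  then obtain B where "\<forall>y\<in>f ` cball 0 r. norm y \<le> B" unfolding bounded_iff by blast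
  then have B: "\<And>x. x \<in> cball 0 r \<Longrightarrow> norm (f x) \<le> B" by blast
  show ?thesis
  proof (rule measurable_bounded_by_integrable_imp_absolutely_integrable)
    show "S \<in> sets lebesgue" using assms(1) by (rule fmeasurableD)
    then show "f \<in> borel_measurable (lebesgue_on S)"
      using continuous_on_subset[OF assms(3)] by (intro continuous_imp_measurable_on_sets_lebesgue) blast
    show "(\<lambda>_. B) integrable_on S" using assms(1) by (rule integrable_on_const)
    fix x assume "x \<in> S"
    then show "norm (f x) \<le> B" using r by (intro B) blast
  qed
qed

lemma continuous_integrable:
  fixes f :: "real ^ 'm::finite \<Rightarrow> 'b::euclidean_space"
  assumes "S \<in> lmeasurable" "bounded S" "continuous_on UNIV f"
  shows "f integrable_on S"
  using continuous_abs_int[OF assms] by (rule set_lebesgue_integral_eq_integral(1))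

text \<open>The function is viewed as a vector of length one, the shape in which the change of
  variables for absolutely integrable functions applies.\<close>

lemma change_of_variables_real_valued:
  fixes f :: "real ^ 'm::{finite,wellorder} \<Rightarrow> real" and g :: "real ^ 'm::_ \<Rightarrow> real ^ 'm::_"
  assumes "S \<in> sets lebesgue"
    and "\<And>x. x \<in> S \<Longrightarrow> (g has_derivative g' x) (at x within S)"
    and "inj_on g S" "f absolutely_integrable_on (g ` S)"
  shows "integral S (\<lambda>x. \<bar>det (matrix (g' x))\<bar> * f (g x)) = integral (g ` S) f"
    "(\<lambda>x. \<bar>det (matrix (g' x))\<bar> * f (g x)) absolutely_integrable_on S"
proof -
  define F :: "real ^ 'm::_ \<Rightarrow> real ^ 1" where "F x = vec (f x)" for x
  have bl: "bounded_linear (\<lambda>x::real ^ 1. x $ 1)" by (rule bounded_linear_vec_nth)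
  have bv: "bounded_linear (vec :: real \<Rightarrow> real ^ 1)"
    by (rule linear_conv_bounded_linear[THEN iffD1]) (auto simp: linear_iff vec_eq_iff)
  have "F absolutely_integrable_on (g ` S)"
    unfolding F_def using absolutely_integrable_linear[OF assms(4) bv] by (simp add: o_def)
  then have *: "(\<lambda>x. \<bar>det (matrix (g' x))\<bar> *\<^sub>R F (g x)) absolutely_integrable_on S \<and>
      integral S (\<lambda>x. \<bar>det (matrix (g' x))\<bar> *\<^sub>R F (g x)) = integral (g ` S) F"
    by (intro has_absolute_integral_change_of_variables[OF assms(1-3), THEN iffD2] conjI) auto
  then have "(\<lambda>x. (\<bar>det (matrix (g' x))\<bar> *\<^sub>R F (g x)) $ 1) absolutely_integrable_on S"
    using absolutely_integrable_linear[OF _ bl] by (fastforce simp: o_def)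
  then show "(\<lambda>x. \<bar>det (matrix (g' x))\<bar> * f (g x)) absolutely_integrable_on S"
    by (simp add: F_def)
  have "integral S (\<lambda>x. (\<bar>det (matrix (g' x))\<bar> *\<^sub>R F (g x)) $ 1)
      = integral S (\<lambda>x. \<bar>det (matrix (g' x))\<bar> *\<^sub>R F (g x)) $ 1"
    using integral_linear[OF set_lebesgue_integral_eq_integral(1)[OF conjunct1[OF *]] bl] by (simp add: o_def)
  moreover have "integral (g ` S) (\<lambda>x. F x $ 1) = integral (g ` S) F $ 1"
    using integral_linear[OF set_lebesgue_integral_eq_integral(1)[OF \<open>F absolutely_integrable_on (g ` S)\<close>] bl]
    by (simp add: o_def)
  ultimately show "integral S (\<lambda>x. \<bar>det (matrix (g' x))\<bar> * f (g x)) = integral (g ` S) f"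
    using * by (simp add: F_def)
qed

lemma change_of_variables_complex:
  fixes f :: "real ^ 'm::{finite,wellorder} \<Rightarrow> complex" and g :: "real ^ 'm::_ \<Rightarrow> real ^ 'm::_"
  assumes "S \<in> sets lebesgue"
    and "\<And>x. x \<in> S \<Longrightarrow> (g has_derivative g' x) (at x within S)"
    and "inj_on g S" "f absolutely_integrable_on (g ` S)"
  shows "integral S (\<lambda>x. of_real \<bar>det (matrix (g' x))\<bar> * f (g x)) = integral (g ` S) f"
proof -
  have re: "(\<lambda>x. Re (f x)) absolutely_integrable_on (g ` S)"
    using absolutely_integrable_linear[OF assms(4) bounded_linear_Re] by (simp add: o_def)
  have im: "(\<lambda>x. Im (f x)) absolutely_integrable_on (g ` S)"
    using absolutely_integrable_linear[OF assms(4) bounded_linear_Im] by (simp add: o_def)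
  note cr = change_of_variables_real_valued[OF assms(1-3) re] change_of_variables_real_valued[OF assms(1-3) im]
  note hr = set_lebesgue_integral_eq_integral(1)[OF cr(2), THEN integrable_integral]
  note hi = set_lebesgue_integral_eq_integral(1)[OF cr(4), THEN integrable_integral]
  have "((\<lambda>x. of_real \<bar>det (matrix (g' x))\<bar> * f (g x)) has_integral
      Complex (integral (g ` S) (\<lambda>x. Re (f x))) (integral (g ` S) (\<lambda>x. Im (f x)))) S"
    using hr hi by (subst has_integral_componentwise_iff) (simp add: Basis_complex_def cr(1) cr(3))
  moreover have "(f has_integral Complex (integral (g ` S) (\<lambda>x. Re (f x))) (integral (g ` S) (\<lambda>x. Im (f x)))) (g ` S)"
    using re[THEN set_lebesgue_integral_eq_integral(1), THEN integrable_integral]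
      im[THEN set_lebesgue_integral_eq_integral(1), THEN integrable_integral]
    by (subst has_integral_componentwise_iff) (simp add: Basis_complex_def)
  ultimately show ?thesis by (simp add: integral_unique)
qed

lemma integral_translate:
  fixes f :: "real ^ 'm::{finite,wellorder} \<Rightarrow> complex"
  assumes "S \<in> lmeasurable" "bounded S" "continuous_on UNIV f"
  shows "integral ((+) a ` S) f = integral S (\<lambda>x. f (a + x))"
proof -
  have "f absolutely_integrable_on ((+) a ` S)"
    using assms by (intro continuous_abs_int measurable_translation bounded_translation)
  moreover have "((\<lambda>x. a + x) has_derivative (\<lambda>x. x)) (at x within S)" for x
    by (intro derivative_eq_intros) auto
  ultimately have "integral S (\<lambda>x. of_real \<bar>det (matrix (\<lambda>x :: real ^ 'm::_. x))\<bar> * f (a + x)) = integral ((+) a ` S) f"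
    by (intro change_of_variables_complex) (simp_all add: fmeasurableD assms)
  then show ?thesis by (simp add: matrix_id_mat_1[unfolded id_def])
qed

text \<open>The integer translates of T cut S into pieces, and translating each piece back gives a
  partition of T. Boundedness leaves finitely many pieces.\<close>

lemma fundamental_integral_eq:
  fixes h :: "real ^ 'm::{finite,wellorder} \<Rightarrow> complex"
  assumes S: "fundamental S" and T: "fundamental T" and h: "continuous_on UNIV h"
    and per: "\<And>x z. z \<in> int_vecs \<Longrightarrow> h (z + x) = h x"
  shows "integral S h = integral T h"
proof -
  have Sm: "S \<in> lmeasurable" and Tm: "T \<in> lmeasurable" and Sb: "bounded S" and Tb: "bounded T"
    using S T unfolding fundamental_def by simp_all
  obtain r where r: "S \<subseteq> cball 0 r" using bounded_imp_subset_cball[OF Sb] by blast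
  obtain s where s: "T \<subseteq> cball 0 s" using bounded_imp_subset_cball[OF Tb] by blast
  define Z :: "(real ^ 'm::_) set" where "Z = {z \<in> int_vecs. norm z \<le> r + s}"
  have finZ: "finite Z" unfolding Z_def by (rule finite_int_vecs_bounded)
  define A where "A z = S \<inter> (+) z ` T" for z
  define B where "B z = (+) (- z) ` S \<inter> T" for z
  have Am: "A z \<in> lmeasurable" and Ab: "bounded (A z)" for z
    unfolding A_def by (intro fmeasurable.Int measurable_translation Sm Tm, rule bounded_subset[OF Sb], blast)
  have Bm: "B z \<in> lmeasurable" and Bb: "bounded (B z)" for z
    unfolding B_def by (intro fmeasurable.Int measurable_translation Sm Tm, rule bounded_subset[OF Tb], blast)
  have AB: "A z = (+) z ` B z" for z
    unfolding A_def B_def by (auto simp: image_Int inj_on_def image_image)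
  have uS: "z = z'" if "z \<in> int_vecs" "z' \<in> int_vecs" "x - z \<in> S" "x - z' \<in> S" for x z z'
    using S that unfolding fundamental_def by blast
  have uT: "z = z'" if "z \<in> int_vecs" "z' \<in> int_vecs" "x - z \<in> T" "x - z' \<in> T" for x z z'
    using T that unfolding fundamental_def by blast
  have SU: "S = (\<Union>z\<in>Z. A z)"
  proof
    show "S \<subseteq> (\<Union>z\<in>Z. A z)"
    proof
      fix x assume x: "x \<in> S"
      obtain z where z: "z \<in> int_vecs" "x - z \<in> T" using T unfolding fundamental_def by blast
      have "norm x \<le> r" "norm (x - z) \<le> s" using x z r s by (auto simp: subset_iff)
      then have "norm z \<le> r + s" using norm_triangle_ineq4[of x "x - z"] by simp
      then have "z \<in> Z" using z by (simp add: Z_def)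
      moreover have "x \<in> A z" using x z unfolding A_def by (auto intro!: image_eqI[of _ _ "x - z"])
      ultimately show "x \<in> (\<Union>z\<in>Z. A z)" by blast
    qed
  qed (auto simp: A_def)
  have TU: "T = (\<Union>z\<in>Z. B z)"
  proof
    show "T \<subseteq> (\<Union>z\<in>Z. B z)"
    proof
      fix x assume x: "x \<in> T"
      obtain z where z: "z \<in> int_vecs" "x - z \<in> S" using S unfolding fundamental_def by blast
      have "norm x \<le> s" "norm (x - z) \<le> r" using x z r s by (auto simp: subset_iff)
      then have "norm z \<le> r + s" using norm_triangle_ineq4[of x "x - z"] by simp
      then have "- z \<in> Z" using z by (simp add: Z_def int_vecs_minus)
      moreover have "x \<in> B (- z)" using x z unfolding B_def by (auto intro!: image_eqI[of _ _ "x - z"])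
      ultimately show "x \<in> (\<Union>z\<in>Z. B z)" by blast
    qed
  qed (auto simp: B_def)
  have disjA: "A z \<inter> A z' = {}" if "z \<in> Z" "z' \<in> Z" "z \<noteq> z'" for z z'
    using that uT unfolding A_def Z_def by (auto; metis add_diff_cancel_left')
  have disjB: "B z \<inter> B z' = {}" if "z \<in> Z" "z' \<in> Z" "z \<noteq> z'" for z z'
  proof (rule ccontr)
    assume "\<not> ?thesis"
    then obtain x y y' where x: "x = - z + y" "x = - z' + y'" and y: "y \<in> S" "y' \<in> S" unfolding B_def by blast
    have "x - (- z) = y" "x - (- z') = y'" by (simp add: x(1), simp add: x(2))
    then have "x - (- z) \<in> S" "x - (- z') \<in> S" using y by simp_all
    then have "- z = - z'" using that uS[of "- z" "- z'" x] by (auto simp: Z_def int_vecs_minus)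
    then show False using that by simp
  qed
  have intA: "integral (A z) h = integral (B z) h" if "z \<in> Z" for z
  proof -
    have "integral (A z) h = integral (B z) (\<lambda>x. h (z + x))"
      unfolding AB by (rule integral_translate[OF Bm Bb h])
    then show ?thesis using per that by (simp add: Z_def)
  qed
  have "(h has_integral (\<Sum>z\<in>Z. integral (A z) h)) (\<Union>z\<in>Z. A z)"
    by (intro has_integral_UN finZ integrable_integral continuous_integrable Am Ab h)
       (auto simp: pairwise_def disjA)
  then have "integral S h = (\<Sum>z\<in>Z. integral (A z) h)"
    unfolding SU[symmetric] by (rule integral_unique)
  also have "\<dots> = (\<Sum>z\<in>Z. integral (B z) h)" by (rule sum.cong[OF HOL.refl intA])
  also have "(h has_integral (\<Sum>z\<in>Z. integral (B z) h)) (\<Union>z\<in>Z. B z)"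
    by (intro has_integral_UN finZ integrable_integral continuous_integrable Bm Bb h)
       (auto simp: pairwise_def disjB)
  then have "(\<Sum>z\<in>Z. integral (B z) h) = integral T h"
    unfolding TU[symmetric] by (rule integral_unique[symmetric])
  finally show ?thesis .
qed

lemma cube_closure: "cube \<subseteq> cbox 0 (1 :: real ^ 'm::finite)"
  by (auto simp: cube_def mem_box_cart less_imp_le)

lemma fundamental_cube: "fundamental (cube :: (real ^ 'm::finite) set)"
proof -
  have b: "bounded (cube :: (real ^ 'm) set)"
    using bounded_subset[OF bounded_cbox cube_closure] .
  have "cube = (\<Inter>i. {x :: real ^ 'm. 0 \<le> x $ i} \<inter> {x. x $ i < 1})"
    by (auto simp: cube_def)
  also have "\<dots> \<in> sets borel"
    by (intro sets.countable_INT'' sets.Int borel_closed borel_open closed_Collect_le open_Collect_less continuous_intros) auto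
  finally have "cube \<in> sets (borel :: (real ^ 'm) measure)" .
  then have "cube \<in> sets (lebesgue :: (real ^ 'm) measure)" by simp
  then have m: "(cube :: (real ^ 'm) set) \<in> lmeasurable"
    using b by (intro bounded_set_imp_lmeasurable)
  have "\<exists>!z. z \<in> int_vecs \<and> x - z \<in> cube" for x :: "real ^ 'm"
  proof (rule ex1I)
    let ?z = "(\<chi> i. of_int \<lfloor>x $ i\<rfloor>) :: real ^ 'm"
    show "?z \<in> int_vecs \<and> x - ?z \<in> cube"
      by (auto simp: int_vecs_def cube_def) linarith
    fix z assume z: "z \<in> int_vecs \<and> x - z \<in> cube"
    have "z $ i = of_int \<lfloor>x $ i\<rfloor>" for i
    proof -
      obtain n where n: "z $ i = of_int n" using z by (auto simp: int_vecs_def elim: Ints_cases)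
      have "0 \<le> x $ i - z $ i" "x $ i - z $ i < 1" using z by (auto simp: cube_def)
      then have "\<lfloor>x $ i\<rfloor> = n" using n by (intro floor_unique) auto
      then show ?thesis using n by simp
    qed
    then show "z = ?z" by (simp add: vec_eq_iff)
  qed
  then show ?thesis using m b unfolding fundamental_def by blast
qed

lemma fundamental_translate:
  assumes "fundamental S" shows "fundamental ((+) a ` S)"
proof -
  have "\<exists>!z. z \<in> int_vecs \<and> x - z \<in> (+) a ` S" for x
  proof -
    have "x - z \<in> (+) a ` S \<longleftrightarrow> (x - a) - z \<in> S" for z
      by (auto simp: image_iff algebra_simps intro: bexI[of _ "x - a - z"])
    then show ?thesis using assms unfolding fundamental_def by presburger
  qed
  then show ?thesis using assms unfolding fundamental_def
    by (auto intro: measurable_translation bounded_translation)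
qed

lemma cube_lmeasurable: "(cube :: (real ^ 'm::finite) set) \<in> lmeasurable" "bounded (cube :: (real ^ 'm::finite) set)"
  using fundamental_cube[where 'm = 'm] unfolding fundamental_def by auto

text \<open>Translating the cube by half a period along a coordinate where m is nonzero negates the
  character and preserves the integral.\<close>

lemma integral_cube_character:
  fixes m :: "real ^ 'm::{finite,wellorder}"
  assumes "m \<in> int_vecs" "m \<noteq> 0"
  shows "integral cube (\<lambda>x. cis (2 * pi * (m \<bullet> x))) = 0"
proof -
  let ?h = "\<lambda>x. cis (2 * pi * (m \<bullet> x))"
  obtain i where i: "m $ i \<noteq> 0" using assms(2) by (auto simp: vec_eq_iff)
  define a :: "real ^ 'm::_" where "a = axis i (1 / (2 * m $ i))"
  have cont: "continuous_on UNIV ?h" by (intro continuous_intros)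
  have "?h (z + x) = ?h x" if z: "z \<in> int_vecs" for z x
  proof -
    have "m \<bullet> z \<in> \<int>" using assms(1) z unfolding inner_vec_def int_vecs_def by (auto intro!: Ints_sum Ints_mult)
    then obtain n where "m \<bullet> z = of_int n" by (auto elim: Ints_cases)
    then have "?h (z + x) = cis (2 * pi * of_int n) * ?h x"
      unfolding inner_add_right distrib_left cis_mult by simp
    then show ?thesis by (simp add: cis_multiple_2pi)
  qed
  then have "integral cube ?h = integral ((+) a ` cube) ?h"
    by (intro fundamental_integral_eq fundamental_cube fundamental_translate cont)
  also have "\<dots> = integral cube (\<lambda>x. ?h (a + x))"
    by (rule integral_translate[OF cube_lmeasurable cont])
  also have "\<dots> = integral cube (\<lambda>x. - ?h x)"
  proof (rule integral_cong)
    fix x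
    have "m \<bullet> a = 1 / 2" using i by (simp add: a_def inner_axis)
    then have "2 * pi * (m \<bullet> (a + x)) = pi + 2 * pi * (m \<bullet> x)"
      by (simp add: inner_add_right distrib_left)
    then have "?h (a + x) = cis pi * ?h x" by (simp only: cis_mult)
    then show "?h (a + x) = - ?h x" by simp
  qed
  also have "\<dots> = - integral cube ?h" by simp
  finally show ?thesis by simp
qed

section \<open>Summation over the preimage of a lattice\<close>

inductive trig_poly :: "('m::finite \<Rightarrow> real ^ 'm) \<Rightarrow> (real ^ 'm \<Rightarrow> complex) \<Rightarrow> bool" for b where
  mono: "trig_poly b (\<lambda>z. a * cis (2 * pi * ((\<Sum>i\<in>UNIV. of_int (c i) *\<^sub>R b i) \<bullet> z)))"
| add: "trig_poly b f \<Longrightarrow> trig_poly b g \<Longrightarrow> trig_poly b (\<lambda>z. f z + g z)"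

lemma trig_poly_const: "trig_poly b (\<lambda>z. a)"
  using trig_poly.mono[of b a "\<lambda>_. 0"] by simp

lemma trig_poly_sum: "(\<And>i. i \<in> I \<Longrightarrow> trig_poly b (f i)) \<Longrightarrow> trig_poly b (\<lambda>z. \<Sum>i\<in>I. f i z)"
  by (induction I rule: infinite_finite_induct) (auto intro: trig_poly_const trig_poly.add)

lemma trig_poly_mono_mult:
  assumes "trig_poly b g"
  shows "trig_poly b (\<lambda>z. (a * cis (2 * pi * ((\<Sum>i\<in>UNIV. of_int (c i) *\<^sub>R b i) \<bullet> z))) * g z)"
  using assms
proof (induction rule: trig_poly.induct)
  case (mono a' c')
  have "(\<lambda>z. (a * cis (2 * pi * ((\<Sum>i\<in>UNIV. of_int (c i) *\<^sub>R b i) \<bullet> z))) * (a' * cis (2 * pi * ((\<Sum>i\<in>UNIV. of_int (c' i) *\<^sub>R b i) \<bullet> z))))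
     = (\<lambda>z. (a * a') * cis (2 * pi * ((\<Sum>i\<in>UNIV. of_int (c i + c' i) *\<^sub>R b i) \<bullet> z)))"
    by (rule ext) (simp add: scaleR_add_left sum.distrib inner_add_left distrib_left cis_mult[symmetric])
  then show ?case by (metis trig_poly.mono)
next
  case (add f g)
  then show ?case by (simp add: distrib_left trig_poly.add)
qed

lemma trig_poly_mult:
  assumes "trig_poly b f" "trig_poly b g" shows "trig_poly b (\<lambda>z. f z * g z)"
  using assms(1)
  by (induction rule: trig_poly.induct)
     (simp_all only: trig_poly_mono_mult[OF assms(2)] distrib_right trig_poly.add)

text \<open>These coordinates take values in a bounded set and turn real polynomials into
  trigonometric polynomials with frequencies in the lattice of \<open>b\<close>, so that the
  Stone-Weierstrass theorem applies to functions of them.\<close>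

definition torus_coords :: "('m::finite \<Rightarrow> real ^ 'm) \<Rightarrow> real ^ 'm \<Rightarrow> complex ^ 'm" where
  "torus_coords b z = (\<chi> i. cis (2 * pi * (b i \<bullet> z)))"

lemma trig_poly_cis: "trig_poly b (\<lambda>z. a * cis (2 * pi * (b i \<bullet> z)))"
  "trig_poly b (\<lambda>z. a * cis (- (2 * pi * (b i \<bullet> z))))"
proof -
  have "(\<Sum>j\<in>UNIV. of_int (if j = i then m else 0) *\<^sub>R b j) = of_int m *\<^sub>R b i" for m :: int
    by (simp add: if_distrib if_distribR sum.delta cong: if_cong)
  then show "trig_poly b (\<lambda>z. a * cis (2 * pi * (b i \<bullet> z)))" "trig_poly b (\<lambda>z. a * cis (- (2 * pi * (b i \<bullet> z))))"
    using trig_poly.mono[of b a "\<lambda>j. if j = i then 1 else 0"] trig_poly.mono[of b a "\<lambda>j. if j = i then -1 else 0"]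
    by simp_all
qed

text \<open>Real and imaginary parts of the coordinates are combinations of a character and its
  inverse.\<close>

lemma trig_poly_linear:
  fixes f :: "complex ^ 'm::finite \<Rightarrow> real"
  assumes "bounded_linear f"
  shows "trig_poly b (\<lambda>z. of_real (f (torus_coords b z)))"
proof -
  interpret bounded_linear f by (rule assms)
  define r where "r i = f (axis i 1)" for i
  define s where "s i = f (axis i \<i>)" for i
  have ax: "axis i z = Re z *\<^sub>R axis i 1 + Im z *\<^sub>R axis i \<i>" for i :: 'm and z :: complex
    by (simp add: vec_eq_iff axis_def complex_eq_iff)
  have "f \<zeta> = (\<Sum>i\<in>UNIV. Re (\<zeta> $ i) * r i + Im (\<zeta> $ i) * s i)" for \<zeta>
  proof -
    have "\<zeta> = (\<Sum>i\<in>UNIV. axis i (\<zeta> $ i))"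
      by (simp add: vec_eq_iff axis_def sum.delta cong: if_cong)
    then have "f \<zeta> = (\<Sum>i\<in>UNIV. f (axis i (\<zeta> $ i)))" by (metis sum)
    also have "\<dots> = (\<Sum>i\<in>UNIV. Re (\<zeta> $ i) * r i + Im (\<zeta> $ i) * s i)"
      by (subst ax) (simp add: add scale r_def s_def)
    finally show ?thesis .
  qed
  then have eq: "complex_of_real (f (torus_coords b z)) = (\<Sum>i\<in>UNIV.
      ((of_real (r i) / 2 + of_real (s i) / (2 * \<i>)) * cis (2 * pi * (b i \<bullet> z)))
      + ((of_real (r i) / 2 - of_real (s i) / (2 * \<i>)) * cis (- (2 * pi * (b i \<bullet> z)))))" for z
    by (auto simp: torus_coords_def complex_eq_iff intro!: sum.cong)
  show ?thesis unfolding eq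
    by (intro trig_poly_sum trig_poly.add trig_poly_cis)
qed

lemma trig_poly_polynomial:
  assumes "real_polynomial_function p"
  shows "trig_poly b (\<lambda>z. of_real (p (torus_coords b z)))"
  using assms
proof (induction rule: real_polynomial_function.induct)
  case (linear f)
  then show ?case by (rule trig_poly_linear)
next
  case (const c)
  then show ?case by (rule trig_poly_const)
next
  case (add f g)
  then show ?case by (simp only: of_real_add trig_poly.add)
next
  case (mult f g)
  then show ?case by (simp only: of_real_mult trig_poly_mult)
qed

lemma torus_coords_continuous: "continuous_on UNIV (torus_coords b)"
  unfolding torus_coords_def by (intro continuous_intros)

lemma trig_poly_continuous: "trig_poly b f \<Longrightarrow> continuous_on UNIV f"
  by (induction rule: trig_poly.induct) (intro continuous_intros; assumption?)+

lemma int_vecs_inner: "x \<in> int_vecs \<Longrightarrow> y \<in> int_vecs \<Longrightarrow> x \<bullet> y \<in> \<int>"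
  unfolding inner_vec_def int_vecs_def by (auto intro!: Ints_sum Ints_mult)

lemma cis_int_shift: "t \<in> \<int> \<Longrightarrow> cis (2 * pi * (t + s)) = cis (2 * pi * s)"
  by (auto elim!: Ints_cases simp: distrib_left cis_mult[symmetric] cis_multiple_2pi)

lemma trig_poly_periodic:
  assumes "\<And>i. b i \<in> int_vecs" "z \<in> int_vecs" "trig_poly b f"
  shows "f (z + x) = f x"
  using assms(3)
proof (induction rule: trig_poly.induct)
  case (mono a c)
  have "(\<Sum>i\<in>UNIV. of_int (c i) *\<^sub>R b i) \<bullet> z \<in> \<int>"
    unfolding inner_sum_left inner_scaleR_left
    by (intro Ints_sum Ints_mult int_vecs_inner assms) auto
  then show ?case by (simp add: inner_add_right cis_int_shift)
qed simp

text \<open>The vectors \<open>b\<close> generate the frequencies, so the sum runs over the points on which all of them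
  are integral; \<open>vanish\<close> says that the Fourier coefficients of the periodized pullback vanish.\<close>
locale periodic_diffeo =
  fixes \<Phi> \<Psi> :: "real ^ 'm::{finite,wellorder} \<Rightarrow> real ^ 'm::_" and D :: "real ^ 'm::_ \<Rightarrow> real ^ 'm::_ \<Rightarrow> real ^ 'm::_"
    and b :: "'m \<Rightarrow> real ^ 'm::_" and \<phi> :: "real ^ 'm::_ \<Rightarrow> complex"
  assumes period: "\<And>x z. z \<in> int_vecs \<Longrightarrow> \<Phi> (z + x) = z + \<Phi> x"
    and der: "\<And>x. (\<Phi> has_derivative D x) (at x)"
    and inverse: "\<And>x. \<Psi> (\<Phi> x) = x" "\<And>x. \<Phi> (\<Psi> x) = x"
    and cont_inv: "continuous_on UNIV \<Psi>"
    and cont_det: "continuous_on UNIV (\<lambda>x. det (matrix (D x)))"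
    and det_nonzero: "\<And>x. det (matrix (D x)) \<noteq> 0"
    and b_int: "\<And>i. b i \<in> int_vecs"
    and b_indep: "\<And>x. (\<And>i. b i \<bullet> x = 0) \<Longrightarrow> x = 0"
    and cont_phi: "continuous_on UNIV \<phi>"
    and phi_period: "\<And>x z. z \<in> int_vecs \<Longrightarrow> \<phi> (z + x) = \<phi> x"
    and vanish: "\<And>c. integral cube (\<lambda>x. \<phi> x * cis (2 * pi * ((\<Sum>i\<in>UNIV. of_int (c i) *\<^sub>R b i) \<bullet> \<Phi> x))) = 0"
begin

definition "dual_points = {p. \<forall>i. b i \<bullet> p \<in> \<int>}"

text \<open>The density transported along \<Phi>: integrating it against f amounts to integrating
  \<phi> against f composed with \<Phi>. The absolute value comes from the change of
  variables.\<close>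

definition "pullback z = \<phi> (\<Psi> z) / of_real \<bar>det (matrix (D (\<Psi> z)))\<bar>"

lemma cont_Phi: "continuous_on UNIV \<Phi>"
  using der has_derivative_continuous_on[of UNIV \<Phi> D] by simp

lemma Psi_period: "z \<in> int_vecs \<Longrightarrow> \<Psi> (z + x) = z + \<Psi> x"
  by (metis inverse period)

lemma D_period: assumes "z \<in> int_vecs" shows "D (z + x) = D x"
proof -
  have "((\<lambda>y. \<Phi> (z + y)) has_derivative (\<lambda>h. D (z + x) h)) (at x)"
    by (rule has_derivative_compose[of "\<lambda>y. z + y" "\<lambda>h. h" x UNIV \<Phi> "D (z + x)"])
       (auto intro!: derivative_eq_intros der)
  moreover have "((\<lambda>y. \<Phi> (z + y)) has_derivative (\<lambda>h. D x h)) (at x)"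
    unfolding period[OF assms] using der by (auto intro!: derivative_eq_intros)
  ultimately show ?thesis using has_derivative_unique by blast
qed

lemma pullback_cont: "continuous_on UNIV pullback"
  unfolding pullback_def using det_nonzero
  by (intro continuous_intros continuous_on_compose2[OF cont_phi cont_inv] continuous_on_compose2[OF cont_det cont_inv]) auto

lemma pullback_period: "z \<in> int_vecs \<Longrightarrow> pullback (z + x) = pullback x"
  by (simp add: pullback_def Psi_period phi_period D_period)

text \<open>Since \<Psi> commutes with integer translations, reducing \<Psi> x into the cube reduces
  x into the image of the cube.\<close>

lemma fundamental_image: "fundamental (\<Phi> ` cube)"
proof -
  have eq: "\<Phi> ` cube = \<Psi> -` cube" 
  proof (intro equalityI subsetI)
    fix x assume "x \<in> \<Psi> -` cube"
    then show "x \<in> \<Phi> ` cube" by (intro image_eqI[of _ _ "\<Psi> x"]) (simp_all add: inverse)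
  qed (auto simp: inverse)
  have "\<Phi> ` cube \<subseteq> \<Phi> ` cbox 0 1" using cube_closure by blast
  moreover have "bounded (\<Phi> ` cbox 0 1)"
    by (intro compact_imp_bounded compact_continuous_image continuous_on_subset[OF cont_Phi] compact_cbox) simp
  ultimately have b: "bounded (\<Phi> ` cube)" using bounded_subset by blast
  have "(cube :: (real ^ 'm::_) set) = (\<Inter>i. {x. 0 \<le> x $ i} \<inter> {x. x $ i < 1})"
    by (auto simp: cube_def)
  also have "\<dots> \<in> sets borel"
    by (intro sets.countable_INT'' sets.Int borel_closed borel_open closed_Collect_le open_Collect_less continuous_intros) auto
  finally have "cube \<in> sets (borel :: (real ^ 'm::_) measure)" .
  then have "\<Psi> -` cube \<in> sets borel"
    using borel_measurable_continuous_onI[OF cont_inv] by (metis measurable_sets_borel)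
  then have m: "\<Phi> ` cube \<in> lmeasurable" using b unfolding eq
    by (intro bounded_set_imp_lmeasurable) auto
  have "\<exists>!z. z \<in> int_vecs \<and> x - z \<in> \<Phi> ` cube" for x
  proof -
    have "z \<in> int_vecs \<and> x - z \<in> \<Phi> ` cube \<longleftrightarrow> z \<in> int_vecs \<and> \<Psi> x - z \<in> cube" for z
    proof -
      have "\<Psi> (x - z) = \<Psi> x - z" if "z \<in> int_vecs"
        using Psi_period[OF int_vecs_minus[OF that], of x] by simp
      then show ?thesis unfolding eq by auto
    qed
    then show ?thesis using fundamental_cube[where 'm = 'm] unfolding fundamental_def by simp
  qed
  then show ?thesis using m b unfolding fundamental_def by blast
qed

lemma integral_pullback:
  assumes "continuous_on UNIV f" "\<And>x z. z \<in> int_vecs \<Longrightarrow> f (z + x) = f x"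
  shows "integral cube (\<lambda>x. \<phi> x * f (\<Phi> x)) = integral cube (\<lambda>z. pullback z * f z)"
proof -
  have cont: "continuous_on UNIV (\<lambda>z. pullback z * f z)" by (intro continuous_intros pullback_cont assms(1))
  have m: "\<Phi> ` cube \<in> lmeasurable" "bounded (\<Phi> ` cube)" using fundamental_image unfolding fundamental_def by auto
  have "integral cube (\<lambda>x. of_real \<bar>det (matrix (D x))\<bar> * (pullback (\<Phi> x) * f (\<Phi> x))) = integral (\<Phi> ` cube) (\<lambda>z. pullback z * f z)"
  proof (rule change_of_variables_complex)
    show "cube \<in> sets lebesgue" by (rule fmeasurableD[OF cube_lmeasurable(1)])
    show "(\<Phi> has_derivative D x) (at x within cube)" for x by (rule has_derivative_at_withinI[OF der])
    show "inj_on \<Phi> cube" by (metis inj_onI inverse(1))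
    show "(\<lambda>z. pullback z * f z) absolutely_integrable_on \<Phi> ` cube" by (rule continuous_abs_int[OF m cont])
  qed
  also have "\<dots> = integral cube (\<lambda>z. pullback z * f z)"
    by (rule fundamental_integral_eq[OF fundamental_image fundamental_cube cont]) (simp add: pullback_period assms)
  finally show ?thesis using det_nonzero by (simp add: pullback_def inverse)
qed

lemma integral_GG_trig_poly:
  assumes "trig_poly b f" shows "integral cube (\<lambda>z. pullback z * f z) = 0"
  using assms
proof (induction rule: trig_poly.induct)
  case (mono a c)
  let ?e = "\<lambda>z. cis (2 * pi * ((\<Sum>i\<in>UNIV. of_int (c i) *\<^sub>R b i) \<bullet> z))"
  have t: "trig_poly b ?e" using trig_poly.mono[of b 1 c] by simp
  have "integral cube (\<lambda>z. pullback z * ?e z) = 0"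
    using integral_pullback[OF trig_poly_continuous[OF t] trig_poly_periodic[OF b_int _ t]] vanish[of c] by simp
  then have "integral cube (\<lambda>z. a * (pullback z * ?e z)) = 0" by simp
  then show ?case by (simp add: mult_ac)
next
  case (add f g)
  have "(\<lambda>z. pullback z * f z) integrable_on cube" "(\<lambda>z. pullback z * g z) integrable_on cube"
    by (intro continuous_integrable cube_lmeasurable continuous_intros pullback_cont trig_poly_continuous[OF add.hyps(1)]
        trig_poly_continuous[OF add.hyps(2)])+
  then show ?case using add.IH by (simp add: distrib_left integral_add)
qed

lemma pullback_bounded: "\<exists>B\<ge>0. \<forall>z\<in>cube. norm (pullback z) \<le> B"
proof -
  have "bounded (pullback ` cbox 0 1)"
    by (intro compact_imp_bounded compact_continuous_image continuous_on_subset[OF pullback_cont] compact_cbox) simp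
  then obtain B where B: "\<forall>y\<in>pullback ` cbox 0 1. norm y \<le> B" unfolding bounded_iff by blast
  then have "\<forall>z\<in>cube. norm (pullback z) \<le> max B 0" using cube_closure by fastforce
  then show ?thesis by (intro exI[of _ "max B 0"]) simp
qed

text \<open>Polynomials approximate \<eta> uniformly on a ball that contains all values of
  \<open>torus_coords\<close>, so the vanishing for trigonometric polynomials passes to every
  continuous function of these coordinates.\<close>

lemma integral_GG_torus:
  fixes \<eta> :: "complex ^ 'm::_ \<Rightarrow> real"
  assumes "continuous_on UNIV \<eta>"
  shows "integral cube (\<lambda>z. pullback z * of_real (\<eta> (torus_coords b z))) = 0" (is "?I = 0")
proof (rule ccontr)
  assume nz: "?I \<noteq> 0"
  obtain B where B: "B \<ge> 0" "\<And>z. z \<in> cube \<Longrightarrow> norm (pullback z) \<le> B" using pullback_bounded by blast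
  define M where "M = integral cube (\<lambda>_::real ^ 'm::_. 1::real)"
  have M: "M \<ge> 0" unfolding M_def by (rule integral_nonneg[OF integrable_on_const[OF cube_lmeasurable(1)]]) simp
  \<comment> \<open>The 1 keeps the denominator positive when B or M is 0; the error B e M is then
    smaller than the norm of the integral, a contradiction.\<close>
  define e where "e = norm ?I / (2 * (B * M + 1))"
  have e: "e > 0" using nz B(1) M by (simp add: e_def add_nonneg_pos)
  \<comment> \<open>A vector of \<open>CARD('m)\<close> entries of modulus 1 has norm at most
    \<open>CARD('m)\<close>.\<close>
  define C where "C = cball (0 :: complex ^ 'm::_) (CARD('m))"
  have inC: "torus_coords b z \<in> C" for z
  proof -
    have "norm (torus_coords b z) \<le> (\<Sum>i\<in>UNIV. norm (torus_coords b z $ i))" 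
      unfolding norm_vec_def by (rule L2_set_le_sum) simp
    then show ?thesis by (simp add: C_def torus_coords_def)
  qed
  obtain p where p: "real_polynomial_function p" "\<And>x. x \<in> C \<Longrightarrow> \<bar>\<eta> x - p x\<bar> < e"
    using Stone_Weierstrass_real_polynomial_function[of C \<eta> e] e continuous_on_subset[OF assms]
    unfolding C_def by (metis compact_cball subset_UNIV)
  let ?p = "\<lambda>z. complex_of_real (p (torus_coords b z))" and ?h = "\<lambda>z. complex_of_real (\<eta> (torus_coords b z))"
  have tp: "trig_poly b ?p" by (rule trig_poly_polynomial[OF p(1)])
  have ch: "continuous_on UNIV ?h"
    by (intro continuous_intros continuous_on_compose2[OF assms torus_coords_continuous]) auto
  have int: "(\<lambda>z. pullback z * ?h z) integrable_on cube" "(\<lambda>z. pullback z * ?p z) integrable_on cube"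
    by (intro continuous_integrable cube_lmeasurable continuous_intros pullback_cont ch trig_poly_continuous[OF tp])+
  have "?I = integral cube (\<lambda>z. pullback z * ?h z - pullback z * ?p z)"
    using integral_diff[OF int] integral_GG_trig_poly[OF tp] by simp
  also have "norm \<dots> \<le> integral cube (\<lambda>_::real ^ 'm::_. B * e)"
  proof (rule integral_norm_bound_integral[OF integrable_diff[OF int] integrable_on_const[OF cube_lmeasurable(1)]])
    fix z :: "real ^ 'm::_" assume z: "z \<in> cube"
    have "norm (pullback z * ?h z - pullback z * ?p z) = norm (pullback z) * \<bar>\<eta> (torus_coords b z) - p (torus_coords b z)\<bar>"
      by (metis norm_mult norm_of_real of_real_diff right_diff_distrib)
    also have "\<dots> \<le> B * e" using B z p(2)[OF inC, of z] by (intro mult_mono) auto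
    finally show "norm (pullback z * ?h z - pullback z * ?p z) \<le> B * e" .
  qed
  also have "\<dots> = (B * e) * M" unfolding M_def
    using integral_mult_right[of cube "B * e" "\<lambda>_::real ^ 'm::_. 1::real"] by simp
  finally have "norm ?I \<le> e * (B * M)" by (simp add: mult_ac)
  also have "\<dots> < e * (2 * (B * M + 1))" using e B(1) M by (intro mult_strict_left_mono) (auto simp: add_nonneg_pos)
  also have "\<dots> = norm ?I" using B(1) M by (simp add: e_def add_nonneg_pos less_imp_neq[symmetric])
  finally show False by simp
qed

lemma int_vecs_PP: "z \<in> int_vecs \<Longrightarrow> z \<in> dual_points"
  by (simp add: dual_points_def int_vecs_inner b_int)

lemma dual_points_add: "p \<in> dual_points \<Longrightarrow> q \<in> dual_points \<Longrightarrow> p + q \<in> dual_points" and dual_points_diff: "p \<in> dual_points \<Longrightarrow> q \<in> dual_points \<Longrightarrow> p - q \<in> dual_points"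
  by (auto simp: dual_points_def inner_add_right inner_diff_right)

lemma finite_PP_cube: "finite (dual_points \<inter> cube)"
proof -
  define g where "g p = (\<chi> i. b i \<bullet> p)" for p
  obtain B where B: "\<And>i p. p \<in> cube \<Longrightarrow> \<bar>b i \<bullet> p\<bar> \<le> B"
  proof -
    obtain r where r: "cube \<subseteq> cball (0 :: real ^ 'm::_) r" using bounded_imp_subset_cball[OF cube_lmeasurable(2)] by blast
    have "\<bar>b i \<bullet> p\<bar> \<le> (\<Sum>i\<in>UNIV. norm (b i)) * r" if p: "p \<in> cube" for i p
    proof -
      have "\<bar>b i \<bullet> p\<bar> \<le> norm (b i) * norm p" by (rule Cauchy_Schwarz_ineq2)
      also have "\<dots> \<le> (\<Sum>i\<in>UNIV. norm (b i)) * r"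
        using p r by (intro mult_mono member_le_sum) (auto simp: sum_nonneg)
      finally show ?thesis .
    qed
    then show ?thesis using that by blast
  qed
  have "g ` (dual_points \<inter> cube) \<subseteq> {z \<in> int_vecs. norm z \<le> CARD('m) * B}"
  proof
    fix y assume "y \<in> g ` (dual_points \<inter> cube)"
    then obtain p where p: "p \<in> dual_points" "p \<in> cube" "y = g p" by blast
    have "norm y \<le> (\<Sum>i\<in>UNIV. \<bar>y $ i\<bar>)" by (rule norm_le_l1_cart)
    also have "\<dots> \<le> (\<Sum>i\<in>(UNIV::'m set). B)" using B p by (intro sum_mono) (simp add: g_def)
    finally show "y \<in> {z \<in> int_vecs. norm z \<le> CARD('m) * B}" using p by (simp add: g_def int_vecs_def dual_points_def)
  qed
  then have "finite (g ` (dual_points \<inter> cube))" using finite_int_vecs_bounded finite_subset by blast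
  moreover have "inj g"
  proof (rule injI)
    fix x y assume "g x = g y"
    then have "b i \<bullet> (x - y) = 0" for i by (simp add: g_def vec_eq_iff inner_diff_right)
    then have "x - y = 0" by (rule b_indep)
    then show "x = y" by simp
  qed
  ultimately show ?thesis using finite_imageD inj_on_subset by blast
qed

text \<open>The intersection with the cube represents \<open>dual_points\<close> modulo the integer
  vectors, so this is a sum over a finite group of translations.\<close>

definition "periodization z = (\<Sum>p\<in>dual_points \<inter> cube. pullback (p + z))"

lemma periodization_cont: "continuous_on UNIV periodization"
  unfolding periodization_def by (intro continuous_intros continuous_on_compose2[OF pullback_cont]) auto

text \<open>Adding q and reducing back into the cube permutes the finitely many
  representatives.\<close>

lemma periodization_period: assumes q: "q \<in> dual_points" shows "periodization q = periodization 0"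
proof -
  have "\<exists>z. z \<in> int_vecs \<and> x - z \<in> cube" for x :: "real ^ 'm::_"
    using fundamental_cube[where 'm = 'm] unfolding fundamental_def by blast
  then obtain n where n: "\<And>x::real ^ 'm::_. n x \<in> int_vecs \<and> x - n x \<in> cube" by metis
  have uniq: "z = z'" if "z \<in> int_vecs" "z' \<in> int_vecs" "x - z \<in> cube" "x - z' \<in> cube" for x z z' :: "real ^ 'm::_"
    using fundamental_cube[where 'm = 'm] that unfolding fundamental_def by blast
  define \<sigma> where "\<sigma> p = (p + q) - n (p + q)" for p
  have inj: "inj_on \<sigma> (dual_points \<inter> cube)"
  proof (rule inj_onI)
    fix x y assume xy: "x \<in> dual_points \<inter> cube" "y \<in> dual_points \<inter> cube" "\<sigma> x = \<sigma> y"
    then have e: "x - (n (x + q) - n (y + q)) = y" by (simp add: \<sigma>_def algebra_simps)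
    have "n (x + q) - n (y + q) = 0"
      using xy e n by (intro uniq[of _ _ x]) (auto intro: int_vecs_diff int_vecs_zero)
    then show "x = y" using e by simp
  qed
  have sub: "\<sigma> ` (dual_points \<inter> cube) \<subseteq> dual_points \<inter> cube"
  proof (rule image_subsetI)
    fix x assume "x \<in> dual_points \<inter> cube"
    then have "x + q - n (x + q) \<in> dual_points" using n q by (intro dual_points_diff dual_points_add) (auto intro: int_vecs_PP)
    then show "\<sigma> x \<in> dual_points \<inter> cube" using n by (simp add: \<sigma>_def)
  qed
  have bij: "bij_betw \<sigma> (dual_points \<inter> cube) (dual_points \<inter> cube)"
    unfolding bij_betw_def using inj endo_inj_surj[OF finite_PP_cube sub inj] by blast
  have "periodization q = (\<Sum>p\<in>dual_points \<inter> cube. pullback (\<sigma> p))"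
  proof (unfold periodization_def, rule sum.cong[OF HOL.refl])
    fix p
    have "p + q = n (p + q) + \<sigma> p" by (simp add: \<sigma>_def)
    then show "pullback (p + q) = pullback (\<sigma> p)" using pullback_period n by metis
  qed
  also have "\<dots> = periodization 0" unfolding periodization_def using sum.reindex_bij_betw[OF bij, of pullback] by simp
  finally show ?thesis .
qed

text \<open>A shift by a dual point changes neither the test function nor the integral over a
  fundamental domain, so every summand of the periodization inherits the vanishing.\<close>

lemma integral_AA_torus:
  fixes \<eta> :: "complex ^ 'm::_ \<Rightarrow> real"
  assumes "continuous_on UNIV \<eta>"
  shows "integral cube (\<lambda>z. periodization z * of_real (\<eta> (torus_coords b z))) = 0"
proof -
  let ?h = "\<lambda>z. complex_of_real (\<eta> (torus_coords b z))"
  let ?f = "\<lambda>z. pullback z * ?h z"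
  have ch: "continuous_on UNIV ?h"
    by (intro continuous_intros continuous_on_compose2[OF assms torus_coords_continuous]) auto
  have cont: "continuous_on UNIV ?f" by (intro continuous_intros pullback_cont ch)
  have hp: "?h (p + z) = ?h z" if "p \<in> dual_points" for p z
    using that by (simp add: torus_coords_def dual_points_def inner_add_right cis_int_shift)
  have zero: "integral cube (\<lambda>z. ?f (p + z)) = 0" if "p \<in> dual_points" for p
  proof -
    have "integral cube (\<lambda>z. ?f (p + z)) = integral ((+) p ` cube) ?f"
      by (rule integral_translate[OF cube_lmeasurable cont, symmetric])
    also have "\<dots> = integral cube ?f"
      by (rule fundamental_integral_eq[OF fundamental_translate[OF fundamental_cube] fundamental_cube cont])
         (simp add: pullback_period hp int_vecs_PP)
    finally show ?thesis using integral_GG_torus[OF assms] by simp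
  qed
  have "integral cube (\<lambda>z. periodization z * ?h z) = integral cube (\<lambda>z. \<Sum>p\<in>dual_points \<inter> cube. ?f (p + z))"
    by (intro integral_cong) (simp add: periodization_def sum_distrib_right hp)
  also have "\<dots> = (\<Sum>p\<in>dual_points \<inter> cube. integral cube (\<lambda>z. ?f (p + z)))"
    by (intro integral_sum finite_PP_cube continuous_integrable cube_lmeasurable
        continuous_on_compose2[OF cont] continuous_intros) auto
  also have "\<dots> = 0" using zero by simp
  finally show ?thesis .
qed

text \<open>Testing against bump functions of \<open>torus_coords b z\<close> supported near \<open>1\<close>, that is, near the
  lattice \<open>dual_points\<close>, on which \<open>periodization\<close> is constant.\<close>
theorem periodization_zero: "(\<Sum>p\<in>dual_points \<inter> cube. pullback p) = 0"
proof -
  have "periodization 0 = 0"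
  proof (rule ccontr)
    assume nz: "periodization 0 \<noteq> 0"
    define \<epsilon> where "\<epsilon> = norm (periodization 0) / 2"
    have eps: "\<epsilon> > 0" using nz by (simp add: \<epsilon>_def)
    define N where "N z = norm (torus_coords b z - 1)" for z
    have Ncont: "continuous_on UNIV N" unfolding N_def by (intro continuous_intros torus_coords_continuous)
    have N0: "z \<in> dual_points" if "N z = 0" for z
    proof -
      have "cis (2 * pi * (b i \<bullet> z)) = 1" for i
        using that by (simp add: N_def torus_coords_def vec_eq_iff)
      then have "cos (2 * pi * (b i \<bullet> z)) = 1" for i by (metis cis.sel(1) one_complex.sel(1))
      then have "\<exists>n::int. b i \<bullet> z = of_int n" for i by (auto simp: cos_one_2pi_int)
      then have "b i \<bullet> z \<in> \<int>" for i by (metis Ints_of_int)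
      then show ?thesis by (simp add: dual_points_def)
    qed
    \<comment> \<open>K is where the periodization is not within \<epsilon> of its value at 0. It is
      compact and avoids the zeros of N, so N has a positive lower bound \<delta> on it, and a bump
      supported where N < \<delta> sees only values close to the one at 0.\<close>
    define K where "K = {z \<in> cbox 0 1. norm (periodization z - periodization 0) \<ge> \<epsilon>}"
    have "compact K"
    proof -
      have "closed {z. norm (periodization z - periodization 0) \<ge> \<epsilon>}"
        by (intro closed_Collect_le continuous_intros periodization_cont)
      moreover have "K = cbox 0 1 \<inter> {z. norm (periodization z - periodization 0) \<ge> \<epsilon>}" by (auto simp: K_def)
      ultimately show ?thesis using compact_Int_closed compact_cbox by metis
    qed
    have "\<exists>\<delta>>0. \<forall>z\<in>K. \<delta> \<le> N z"
    proof (cases "K = {}")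
      case False
      then obtain z0 where z0: "z0 \<in> K" "\<And>z. z \<in> K \<Longrightarrow> N z0 \<le> N z"
        using continuous_attains_inf[OF \<open>compact K\<close> False continuous_on_subset[OF Ncont]] by blast
      have "N z0 \<noteq> 0"
      proof
        assume "N z0 = 0"
        then have "periodization z0 = periodization 0" by (intro periodization_period N0)
        then show False using z0(1) eps by (simp add: K_def)
      qed
      then have "N z0 > 0" by (simp add: N_def)
      then show ?thesis using z0 by blast
    qed (auto intro: exI[of _ 1])
    then obtain \<delta> where d: "\<delta> > 0" "\<And>z. z \<in> K \<Longrightarrow> \<delta> \<le> N z" by blast
    define \<eta> where "\<eta> \<zeta> = max 0 (\<delta> - norm (\<zeta> - 1))" for \<zeta> :: "complex ^ 'm::_"
    have ec: "continuous_on UNIV \<eta>" unfolding \<eta>_def by (intro continuous_intros)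
    let ?\<psi> = "\<lambda>z. \<eta> (torus_coords b z)"
    have pc: "continuous_on UNIV ?\<psi>" by (intro continuous_on_compose2[OF ec torus_coords_continuous]) auto
    have pi: "?\<psi> integrable_on cube" by (rule continuous_integrable[OF cube_lmeasurable pc])
    have pnn: "?\<psi> z \<ge> 0" for z by (simp add: \<eta>_def)
    have cl: "norm ((periodization 0 - periodization z) * of_real (?\<psi> z)) \<le> \<epsilon> * ?\<psi> z" if "z \<in> cube" for z
    proof (cases "N z < \<delta>")
      case True
      then have "z \<notin> K" using d(2) by force
      then have "norm (periodization z - periodization 0) \<le> \<epsilon>" using that cube_closure by (force simp: K_def)
      then show ?thesis using pnn[of z] by (simp add: norm_mult norm_minus_commute mult_right_mono)
    next
      case False
      then show ?thesis by (simp add: \<eta>_def N_def)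
    qed
    define I where "I = integral cube ?\<psi>"
    have i1: "(\<lambda>z. periodization 0 * complex_of_real (?\<psi> z)) integrable_on cube"
      and i2: "(\<lambda>z. periodization z * complex_of_real (?\<psi> z)) integrable_on cube"
      and i3: "(\<lambda>z. complex_of_real (?\<psi> z)) integrable_on cube"
      by (intro continuous_integrable cube_lmeasurable continuous_intros pc periodization_cont)+
    have "integral cube (\<lambda>z. complex_of_real (?\<psi> z)) = of_real I"
      unfolding I_def by (rule integral_unique[OF has_integral_of_real[OF integrable_integral[OF pi]]])
    then have "periodization 0 * of_real I = integral cube (\<lambda>z. periodization 0 * complex_of_real (?\<psi> z))" by simp
    also have "\<dots> = integral cube (\<lambda>z. (periodization 0 - periodization z) * complex_of_real (?\<psi> z))"
      using integral_diff[OF i1 i2] integral_AA_torus[OF ec] by (simp add: left_diff_distrib)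
    finally have "norm (periodization 0 * of_real I) \<le> integral cube (\<lambda>z. \<epsilon> * ?\<psi> z)"
      using integral_norm_bound_integral[of "\<lambda>z. (periodization 0 - periodization z) * complex_of_real (?\<psi> z)" cube "\<lambda>z. \<epsilon> * ?\<psi> z"]
        integrable_diff[OF i1 i2] integrable_on_mult_right[OF pi, of \<epsilon>] cl by (simp add: left_diff_distrib)
    also have "\<dots> = \<epsilon> * I" by (simp add: I_def)
    finally have le: "norm (periodization 0) * \<bar>I\<bar> \<le> \<epsilon> * I" by (simp add: norm_mult)
    have "I > 0"
    proof -
      have "isCont N 0" using Ncont by (simp add: continuous_on_eq_continuous_at)
      then have "\<exists>r>0. \<forall>z. norm (z - 0) < r \<longrightarrow> norm (N z - N 0) < \<delta> / 2"
        using half_gt_zero[OF d(1)] unfolding continuous_at_eps_delta dist_norm real_norm_def by blast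
      moreover have "N 0 = 0" by (simp add: N_def torus_coords_def vec_eq_iff)
      moreover have "\<bar>N z\<bar> = N z" for z by (simp add: N_def)
      ultimately have "\<exists>r>0. \<forall>z. norm z < r \<longrightarrow> N z < \<delta> / 2" by simp
      then obtain r where r: "r > 0" "\<And>z. norm z < r \<Longrightarrow> N z < \<delta> / 2" by blast
      \<comment> \<open>All points of the box of side s have norm at most
        \<open>CARD('m) * s\<close>, which is at most r / 2, so the bump is at least \<delta> / 2
        there and its integral is positive. The bound 1/2 keeps the box inside the cube.\<close>
      define s where "s = min (1/2) (r / (2 * CARD('m)))"
      have s: "s > 0" "s < 1" using r(1) by (auto simp: s_def)
      define Bx where "Bx = (cbox 0 (s *\<^sub>R 1) :: (real ^ 'm::_) set)"
      have Bsub: "Bx \<subseteq> cube" 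
      proof
        fix x assume "x \<in> Bx"
        then have xi: "0 \<le> x $ i \<and> x $ i \<le> s" for i by (simp add: Bx_def mem_box_cart)
        have "0 \<le> x $ i \<and> x $ i < 1" for i using xi[of i] s(2) by linarith
        then show "x \<in> cube" unfolding cube_def by blast
      qed
      have big: "?\<psi> z \<ge> \<delta> / 2" if z: "z \<in> Bx" for z
      proof -
        have "norm z \<le> (\<Sum>i\<in>UNIV. \<bar>z $ i\<bar>)" by (rule norm_le_l1_cart)
        also have "\<dots> \<le> (\<Sum>i\<in>(UNIV::'m set). s)" using z by (intro sum_mono) (auto simp: Bx_def mem_box_cart)
        also have "\<dots> = CARD('m) * s" by simp
        also have "\<dots> \<le> CARD('m) * (r / (2 * CARD('m)))" by (intro mult_left_mono) (simp_all add: s_def)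
        also have "\<dots> < r" using r(1) by simp
        finally have "N z < \<delta> / 2" by (rule r(2))
        then show ?thesis unfolding \<eta>_def N_def by (simp add: max_def)
      qed
      have "(0 :: real ^ 'm::_) \<in> Bx" using s(1) unfolding Bx_def by (simp add: mem_box_cart)
      then have ne: "cbox 0 (s *\<^sub>R 1) \<noteq> ({} :: (real ^ 'm::_) set)" unfolding Bx_def by blast
      have "Sigma_Algebra.measure lborel Bx = (\<Prod>i\<in>(UNIV::'m set). s)"
        unfolding Bx_def content_cbox_cart[OF ne] by simp
      also have "\<dots> > 0" using s(1) by (intro prod_pos) simp
      finally have "0 < Sigma_Algebra.measure lborel Bx * (\<delta> / 2)" using d(1) by simp
      also have "\<dots> = integral Bx (\<lambda>_. \<delta> / 2)" unfolding Bx_def by simp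
      also have "\<dots> \<le> integral Bx ?\<psi>"
        using big unfolding Bx_def
        by (intro integral_le integrable_const integrable_continuous continuous_on_subset[OF pc]) simp_all
      also have "\<dots> \<le> I"
        unfolding I_def using pnn Bsub
        by (intro integral_subset_le pi)
           (simp_all add: Bx_def integrable_continuous continuous_on_subset[OF pc])
      finally show ?thesis .
    qed
    then have "norm (periodization 0) \<le> \<epsilon>" using le by simp
    then show False using nz by (simp add: \<epsilon>_def)
  qed
  then show ?thesis by (simp add: periodization_def)
qed

end

text \<open>The change of variables formula of the library needs a well-ordered index type.\<close>
typedef (overloaded) ('n::finite) idx = "{..<CARD('n)}"
  by (rule exI[of _ 0]) simp

instantiation idx :: (finite) linorder
begin
definition less_eq_idx :: "'a idx \<Rightarrow> 'a idx \<Rightarrow> bool" where "less_eq_idx i j \<longleftrightarrow> Rep_idx i \<le> Rep_idx j"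
definition less_idx :: "'a idx \<Rightarrow> 'a idx \<Rightarrow> bool" where "less_idx i j \<longleftrightarrow> Rep_idx i < Rep_idx j"
instance
  by standard (auto simp: less_eq_idx_def less_idx_def Rep_idx_inject)
end

instance idx :: (finite) wellorder
proof
  fix Pr :: "'a idx \<Rightarrow> bool" and i
  assume step: "\<And>i. (\<And>j. j < i \<Longrightarrow> Pr j) \<Longrightarrow> Pr i"
  show "Pr i"
  proof (induction "Rep_idx i" arbitrary: i rule: less_induct)
    case less
    show ?case
    proof (rule step)
      fix j assume "j < i"
      then show "Pr j" by (intro less.hyps) (simp only: less_idx_def)
    qed
  qed
qed

lemma range_Rep_idx: "range (Rep_idx :: 'a::finite idx \<Rightarrow> nat) = {..<CARD('a)}"
  using type_definition.Rep_range[OF type_definition_idx] .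

instance idx :: (finite) finite
proof
  have "inj (Rep_idx :: 'a idx \<Rightarrow> nat)" by (auto simp: inj_def Rep_idx_inject)
  moreover have "finite (range (Rep_idx :: 'a idx \<Rightarrow> nat))" by (simp add: range_Rep_idx)
  ultimately show "finite (UNIV :: 'a idx set)" by (rule finite_imageD[rotated])
qed

lemma card_idx: "CARD('a::finite idx) = CARD('a)"
proof -
  have "card (range (Rep_idx :: 'a idx \<Rightarrow> nat)) = CARD('a idx)"
    by (rule card_image) (auto simp: inj_def Rep_idx_inject)
  then show ?thesis by (simp add: range_Rep_idx)
qed

definition idx_enum :: "'n::finite idx \<Rightarrow> 'n" where
  "idx_enum = (SOME e. bij e)"

lemma bij_idx_enum: "bij (idx_enum :: 'n::finite idx \<Rightarrow> 'n)"
proof -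
  have "\<exists>e :: 'n idx \<Rightarrow> 'n. bij_betw e UNIV UNIV"
    by (rule finite_same_card_bij) (simp_all add: card_idx)
  then show ?thesis unfolding idx_enum_def by (rule someI_ex)
qed

lemma swapidseq_conj:
  assumes "bij e" "swapidseq n p" shows "swapidseq n (e \<circ> p \<circ> inv e)"
  using assms(2)
proof (induction rule: swapidseq.induct)
  case id
  have "e \<circ> id \<circ> inv e = id" using assms(1) by (simp add: fun_eq_iff bij_is_surj surj_f_inv_f)
  then show ?case by (simp only: swapidseq.id)
next
  case (comp_Suc n p a b)
  have "e \<circ> (Transposition.transpose a b \<circ> p) \<circ> inv e = Transposition.transpose (e a) (e b) \<circ> (e \<circ> p \<circ> inv e)"
    using assms(1) by (auto simp: fun_eq_iff Transposition.transpose_def dest: bij_is_inj inj_eq[THEN iffD1, rotated])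
  moreover have "e a \<noteq> e b" using comp_Suc.hyps assms(1) by (metis bij_is_inj injD)
  ultimately show ?case using swapidseq.comp_Suc[OF comp_Suc.IH] by (simp only:)
qed

lemma sign_conj:
  fixes e :: "'a::finite \<Rightarrow> 'b::finite"
  assumes "bij e" "p permutes UNIV" shows "sign (e \<circ> p \<circ> inv e) = sign p"
proof -
  have "permutation p" using assms(2) by (simp add: permutation_permutes) blast
  then obtain n where n: "swapidseq n p" unfolding permutation_def by blast
  show ?thesis
    unfolding sign_def using evenperm_unique[OF n HOL.refl] evenperm_unique[OF swapidseq_conj[OF assms(1) n] HOL.refl]
    by (simp only:)
qed

lemma permutes_UNIV_iff_bij: "p permutes UNIV \<longleftrightarrow> bij p"
  by (simp add: permutes_def bij_iff)

text \<open>Conjugation with the bijection matches the permutations of the two index types and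
  preserves their signs.\<close>

lemma det_reindex:
  fixes M :: "real ^ 'b::finite ^ 'b" and e :: "'a::finite \<Rightarrow> 'b"
  assumes e: "bij e"
  shows "det (\<chi> i j. M $ e i $ e j) = det M"
proof -
  have ei: "inv e (e i) = i" "e (inv e j) = j" for i j
    using e by (simp_all add: bij_is_inj bij_is_surj surj_f_inv_f)
  have bij: "bij_betw (\<lambda>p. e \<circ> p \<circ> inv e) {p. p permutes (UNIV :: 'a set)} {p. p permutes (UNIV :: 'b set)}"
  proof (rule bij_betw_byWitness[of _ "\<lambda>p. inv e \<circ> p \<circ> e"])
    show "\<forall>p\<in>{p. p permutes UNIV}. inv e \<circ> (e \<circ> p \<circ> inv e) \<circ> e = p" by (auto simp: fun_eq_iff ei)
    show "\<forall>p\<in>{p. p permutes UNIV}. e \<circ> (inv e \<circ> p \<circ> e) \<circ> inv e = p" by (auto simp: fun_eq_iff ei)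
    have ib: "bij (inv e)" using e by (rule bij_imp_bij_inv)
    show "(\<lambda>p. e \<circ> p \<circ> inv e) ` {p. p permutes UNIV} \<subseteq> {p. p permutes UNIV}"
      using e ib by (auto simp: permutes_UNIV_iff_bij intro!: bij_comp)
    show "(\<lambda>p. inv e \<circ> p \<circ> e) ` {p. p permutes UNIV} \<subseteq> {p. p permutes UNIV}"
      using e ib by (auto simp: permutes_UNIV_iff_bij intro!: bij_comp)
  qed
  have "det M = (\<Sum>p\<in>{p. p permutes (UNIV :: 'a set)}. of_int (sign (e \<circ> p \<circ> inv e)) * (\<Prod>i\<in>UNIV. M $ i $ (e \<circ> p \<circ> inv e) i))"
    unfolding det_def by (rule sum.reindex_bij_betw[OF bij, symmetric])
  also have "\<dots> = (\<Sum>p\<in>{p. p permutes (UNIV :: 'a set)}. of_int (sign p) * (\<Prod>i\<in>UNIV. M $ e i $ e (p i)))"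
  proof (rule sum.cong[OF HOL.refl])
    fix p :: "'a \<Rightarrow> 'a" assume "p \<in> {p. p permutes UNIV}"
    then have "sign (e \<circ> p \<circ> inv e) = sign p" by (intro sign_conj e) simp
    moreover have "(\<Prod>i\<in>UNIV. M $ i $ (e \<circ> p \<circ> inv e) i) = (\<Prod>i\<in>UNIV. M $ e i $ e (p i))"
      using prod.reindex_bij_betw[OF e, of "\<lambda>i. M $ i $ (e \<circ> p \<circ> inv e) i"] by (simp add: ei)
    ultimately show "of_int (sign (e \<circ> p \<circ> inv e)) * (\<Prod>i\<in>UNIV. M $ i $ (e \<circ> p \<circ> inv e) i)
        = of_int (sign p) * (\<Prod>i\<in>UNIV. M $ e i $ e (p i))" by (simp only:)
  qed
  also have "\<dots> = det (\<chi> i j. M $ e i $ e j)" unfolding det_def by simp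
  finally show ?thesis by simp
qed

section \<open>The phase shift\<close>

text \<open>The argument of (1 - t / \<zeta>) / (1 - t \<zeta>), in units of 2 \<pi>, for \<zeta> =
  exp (2 \<pi> i s). For \<bar>t\<bar> < 1 numerator and denominator are conjugate with positive
  real part, so arctan gives a smooth branch; the quotient doubles the angle, which cancels the
  2.\<close>

definition qphase :: "real \<Rightarrow> real \<Rightarrow> real" where
  "qphase t s = arctan (t * sin (2 * pi * s) / (1 - t * cos (2 * pi * s))) / pi"

text \<open>Twice the real part of t \<zeta> / (1 - t \<zeta>). This links the derivative of
  \<open>qphase\<close> with the summands of \<open>H_dagger\<close>.\<close>

definition qslope :: "real \<Rightarrow> real \<Rightarrow> real" where
  "qslope t s = 2 * (t * cos (2 * pi * s) - t\<^sup>2) / (1 - 2 * t * cos (2 * pi * s) + t\<^sup>2)"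

lemma one_minus_t_cos_pos: "\<bar>t\<bar> < 1 \<Longrightarrow> 0 < 1 - t * cos x" for t x :: real
proof -
  assume "\<bar>t\<bar> < 1"
  have "\<bar>t * cos x\<bar> \<le> \<bar>t\<bar> * 1" unfolding abs_mult by (intro mult_left_mono) auto
  then show ?thesis using \<open>\<bar>t\<bar> < 1\<close> by linarith
qed

lemma norm_sq_pos: "\<bar>t\<bar> < 1 \<Longrightarrow> 0 < 1 - 2 * t * cos x + t\<^sup>2" for t x :: real
proof -
  assume t: "\<bar>t\<bar> < 1"
  have "(1 - t * c)\<^sup>2 + (t * d)\<^sup>2 = 1 - 2 * t * c + t\<^sup>2 * (c\<^sup>2 + d\<^sup>2)" for c d :: real
    by (simp add: power2_eq_square algebra_simps)
  from this[of "cos x" "sin x"] have "1 - 2 * t * cos x + t\<^sup>2 = (1 - t * cos x)\<^sup>2 + (t * sin x)\<^sup>2" by simp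
  moreover have "(1 - t * cos x)\<^sup>2 > 0" using one_minus_t_cos_pos[OF t, of x] by simp
  ultimately show ?thesis by (smt (verit) zero_le_power2)
qed

lemma polar_arctan:
  assumes "Re z > 0"
  shows "z = of_real (norm z) * cis (arctan (Im z / Re z))"
proof -
  have n: "norm z = Re z * sqrt (1 + (Im z / Re z)\<^sup>2)"
  proof -
    have "(norm z)\<^sup>2 = (Re z * sqrt (1 + (Im z / Re z)\<^sup>2))\<^sup>2"
      using assms by (simp add: cmod_power2 power_mult_distrib field_simps add_pos_nonneg)
    then show ?thesis using assms by (simp add: power2_eq_iff_nonneg)
  qed
  have "sqrt (1 + (Im z / Re z)\<^sup>2) > 0" by (simp add: add_pos_nonneg)
  then show ?thesis
    using assms by (simp add: complex_eq_iff n cos_arctan sin_arctan)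
qed

lemma cis_qphase:
  assumes "\<bar>t\<bar> < 1"
  shows "cis (2 * pi * qphase t s) = (1 - of_real t * cis (- (2 * pi * s))) / (1 - of_real t * cis (2 * pi * s))"
proof -
  define z where "z = 1 - of_real t * cis (- (2 * pi * s))"
  define \<phi> where "\<phi> = arctan (Im z / Re z)"
  have re: "Re z > 0" using one_minus_t_cos_pos[OF assms] by (simp add: z_def)
  then have nz: "norm z \<noteq> 0" by auto
  have z: "z = of_real (norm z) * cis \<phi>" unfolding \<phi>_def by (rule polar_arctan[OF re])
  have q: "2 * pi * qphase t s = \<phi> + \<phi>" by (simp add: qphase_def \<phi>_def z_def)
  have "1 - of_real t * cis (2 * pi * s) = cnj z" by (simp add: z_def complex_eq_iff)
  also have "\<dots> = of_real (norm z) * cis (- \<phi>)" by (subst z) (simp add: cis_cnj)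
  finally have "z / (1 - of_real t * cis (2 * pi * s)) = cis \<phi> / cis (- \<phi>)"
    using nz z by (metis (no_types, lifting) mult_divide_mult_cancel_left of_real_eq_0_iff)
  then show ?thesis unfolding z_def[symmetric] q by (simp add: cis_divide)
qed

lemma qphase_deriv:
  assumes "\<bar>t\<bar> < 1"
  shows "(qphase t has_real_derivative qslope t s) (at s)"
proof -
  have p: "1 - t * cos (2 * pi * s) > 0" by (rule one_minus_t_cos_pos[OF assms])
  have p2: "1 - 2 * t * cos (2 * pi * s) + t\<^sup>2 > 0" by (rule norm_sq_pos[OF assms])
  define c where "c = cos (2 * pi * s)"
  define d where "d = sin (2 * pi * s)"
  have cd: "d\<^sup>2 = 1 - c\<^sup>2" unfolding c_def d_def by (rule sin_squared_eq)
  define u' where "u' = (2 * pi * (t * c) * (1 - t * c) - t * d * (2 * pi * (t * d))) / (1 - t * c)\<^sup>2"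
  have u: "((\<lambda>s. t * sin (2 * pi * s) / (1 - t * cos (2 * pi * s))) has_real_derivative u') (at s)"
    using p by (auto intro!: derivative_eq_intros simp: u'_def c_def d_def power2_eq_square)
  have der: "(qphase t has_real_derivative (inverse (1 + (t * d / (1 - t * c))\<^sup>2) * u') / pi) (at s)"
    unfolding qphase_def c_def d_def by (rule DERIV_cdivide[OF DERIV_chain2[OF DERIV_arctan u]])
  have num: "u' = 2 * pi * (t * c - t\<^sup>2) / (1 - t * c)\<^sup>2"
  proof -
    have "2 * pi * (t * c) * (1 - t * c) - t * d * (2 * pi * (t * d)) = 2 * pi * (t * c - t\<^sup>2 * (c\<^sup>2 + d\<^sup>2))"
      by (simp add: power2_eq_square algebra_simps)
    then show ?thesis unfolding u'_def cd by simp
  qed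
  have den: "1 + (t * d / (1 - t * c))\<^sup>2 = (1 - 2 * t * c + t\<^sup>2) / (1 - t * c)\<^sup>2"
  proof -
    have "(1 - t * c)\<^sup>2 + t\<^sup>2 * d\<^sup>2 = 1 - 2 * t * c + t\<^sup>2"
      unfolding cd by (simp add: power2_eq_square algebra_simps)
    then show ?thesis using p by (simp add: c_def power_divide power_mult_distrib add_divide_eq_iff field_simps)
  qed
  have "inverse (1 + (t * d / (1 - t * c))\<^sup>2) * u' / pi = qslope t s"
  proof -
    have gen: "inverse (B / A) * (2 * pi * X / A) / pi = 2 * X / B" if "A > 0" "B > 0" for A B X :: real
      using that by (simp add: field_simps)
    have "(1 - t * c)\<^sup>2 > 0" "1 - 2 * t * c + t\<^sup>2 > 0" using p p2 by (simp_all add: c_def)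
    from gen[OF this] show ?thesis unfolding den num qslope_def c_def[symmetric] .
  qed
  then show ?thesis using der by simp
qed

text \<open>For \<bar>t\<bar> \<le> 1/2 the denominator is at least the square of 1 - \<bar>t\<bar>,
  hence at least 1/4, and the numerator is at most 3 \<bar>t\<bar>; this gives 12.\<close>

lemma qslope_bound: assumes "\<bar>t\<bar> \<le> 1/2" shows "\<bar>qslope t s\<bar> \<le> 12 * \<bar>t\<bar>"
proof -
  define c where "c = cos (2 * pi * s)"
  have c: "\<bar>c\<bar> \<le> 1" by (simp add: c_def)
  have tc: "\<bar>t * c\<bar> \<le> \<bar>t\<bar>" using c mult_left_le[of "\<bar>c\<bar>" "\<bar>t\<bar>"] by (simp add: abs_mult)
  have t2: "t\<^sup>2 \<le> \<bar>t\<bar> * (1/2)" using assms unfolding power2_eq_square by (metis abs_mult_self_eq abs_ge_zero mult_left_mono)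
  have den: "1 - 2 * t * c + t\<^sup>2 \<ge> 1/4"
  proof -
    have "1 - 2 * t * c + t\<^sup>2 \<ge> 1 - 2 * \<bar>t\<bar> + \<bar>t\<bar>\<^sup>2" using tc by (simp add: abs_le_iff)
    also have "1 - 2 * \<bar>t\<bar> + \<bar>t\<bar>\<^sup>2 = (1 - \<bar>t\<bar>)\<^sup>2" by (simp add: power2_eq_square algebra_simps)
    also have "(1 - \<bar>t\<bar>)\<^sup>2 \<ge> (1/2)\<^sup>2" using assms by (intro power_mono) auto
    finally show ?thesis by (simp add: power2_eq_square)
  qed
  have num: "\<bar>2 * (t * c - t\<^sup>2)\<bar> \<le> 3 * \<bar>t\<bar>" 
  proof -
    have "\<bar>2 * (a - b)\<bar> \<le> 3 * d" if "\<bar>a\<bar> \<le> d" "b \<le> d * (1/2)" "0 \<le> b" for a b d :: real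
      using that by (auto simp: abs_if split: if_splits)
    from this[OF tc t2 zero_le_power2] show ?thesis .
  qed
  have "\<bar>qslope t s\<bar> = \<bar>2 * (t * c - t\<^sup>2)\<bar> / (1 - 2 * t * c + t\<^sup>2)"
    using den by (simp add: qslope_def c_def abs_divide)
  also have "\<dots> \<le> (3 * \<bar>t\<bar>) / (1/4)" using den num by (intro frac_le) auto
  finally show ?thesis by simp
qed

lemma qslope_complex:
  assumes "\<bar>t\<bar> < 1" "\<zeta> = cis (2 * pi * s)" "\<zeta>' = cis (- (2 * pi * s))"
  shows "complex_of_real (qslope t s) = of_real t * \<zeta> / (1 - of_real t * \<zeta>) + of_real t * \<zeta>' / (1 - of_real t * \<zeta>')"
proof -
  have n1: "1 - of_real t * \<zeta> \<noteq> 0"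
    using one_minus_t_cos_pos[OF assms(1), of "2 * pi * s"] by (auto simp: assms complex_eq_iff)
  have n2: "1 - of_real t * \<zeta>' \<noteq> 0"
    using one_minus_t_cos_pos[OF assms(1), of "2 * pi * s"] by (auto simp: assms complex_eq_iff)
  have prod: "\<zeta> * \<zeta>' = 1" by (simp add: assms cis_mult)
  have sum: "\<zeta> + \<zeta>' = of_real (2 * cos (2 * pi * s))" by (simp add: assms complex_eq_iff)
  have "of_real t * \<zeta> / (1 - of_real t * \<zeta>) + of_real t * \<zeta>' / (1 - of_real t * \<zeta>')
     = (of_real t * \<zeta> * (1 - of_real t * \<zeta>') + of_real t * \<zeta>' * (1 - of_real t * \<zeta>)) / ((1 - of_real t * \<zeta>) * (1 - of_real t * \<zeta>'))"
    using n1 n2 by (rule add_frac_eq)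
  also have "of_real t * \<zeta> * (1 - of_real t * \<zeta>') + of_real t * \<zeta>' * (1 - of_real t * \<zeta>)
     = of_real t * (\<zeta> + \<zeta>') - 2 * (of_real t)\<^sup>2 * (\<zeta> * \<zeta>')" by (simp add: power2_eq_square algebra_simps)
  also have "(1 - of_real t * \<zeta>) * (1 - of_real t * \<zeta>') = 1 - of_real t * (\<zeta> + \<zeta>') + (of_real t)\<^sup>2 * (\<zeta> * \<zeta>')"
    by (simp add: power2_eq_square algebra_simps)
  also have "(of_real t * (\<zeta> + \<zeta>') - 2 * (of_real t)\<^sup>2 * (\<zeta> * \<zeta>')) / (1 - of_real t * (\<zeta> + \<zeta>') + (of_real t)\<^sup>2 * (\<zeta> * \<zeta>'))
     = complex_of_real (qslope t s)"
    unfolding prod sum qslope_def by (simp add: algebra_simps)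
  finally show ?thesis by simp
qed

lemma qphase_odd: "qphase t (- s) = - qphase t s"
  by (simp add: qphase_def arctan_minus)

lemma sin_cos_int_shift:
  assumes "n \<in> \<int>" shows "sin (2 * pi * (n + s)) = sin (2 * pi * s)" "cos (2 * pi * (n + s)) = cos (2 * pi * s)"
proof -
  have "cis (2 * pi * (n + s)) = cis (2 * pi * s)" by (rule cis_int_shift[OF assms])
  then show "sin (2 * pi * (n + s)) = sin (2 * pi * s)" "cos (2 * pi * (n + s)) = cos (2 * pi * s)"
    by (simp_all add: complex_eq_iff)
qed

lemma qphase_period: "n \<in> \<int> \<Longrightarrow> qphase t (n + s) = qphase t s"
  unfolding qphase_def by (simp only: sin_cos_int_shift)

lemma qphase_bound: assumes "\<bar>t\<bar> \<le> 1/2" shows "\<bar>qphase t s\<bar> \<le> 2 * \<bar>t\<bar>"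
proof -
  have "\<bar>t * cos (2 * pi * s)\<bar> \<le> \<bar>t\<bar> * 1" unfolding abs_mult by (intro mult_left_mono) auto
  then have p: "1 - t * cos (2 * pi * s) \<ge> 1/2" using assms by linarith
  have "\<bar>t * sin (2 * pi * s)\<bar> \<le> \<bar>t\<bar> * 1" unfolding abs_mult by (intro mult_left_mono) auto
  then have "\<bar>t * sin (2 * pi * s) / (1 - t * cos (2 * pi * s))\<bar> \<le> \<bar>t\<bar> / (1/2)"
    unfolding abs_divide using p by (intro frac_le) auto
  then have "\<bar>t * sin (2 * pi * s) / (1 - t * cos (2 * pi * s))\<bar> \<le> 2 * \<bar>t\<bar>" by simp
  then have "\<bar>arctan (t * sin (2 * pi * s) / (1 - t * cos (2 * pi * s)))\<bar> \<le> 2 * \<bar>t\<bar>"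
    by (rule order_trans[OF abs_arctan_le])
  moreover have "pi \<ge> 1" using pi_gt3 by linarith
  ultimately have "\<bar>arctan (t * sin (2 * pi * s) / (1 - t * cos (2 * pi * s)))\<bar> / pi \<le> 2 * \<bar>t\<bar> / 1"
    by (intro frac_le) auto
  then show ?thesis by (simp add: qphase_def abs_divide)
qed

lemma qphase_lipschitz:
  assumes "\<bar>t\<bar> \<le> 1/2" shows "\<bar>qphase t r - qphase t s\<bar> \<le> 12 * \<bar>t\<bar> * \<bar>r - s\<bar>"
proof -
  have "norm (qphase t r - qphase t s) \<le> 12 * \<bar>t\<bar> * norm (r - s)"
    by (rule field_differentiable_bound[of UNIV "qphase t" "qslope t"])
       (use assms qslope_bound in \<open>auto intro!: qphase_deriv\<close>)
  then show ?thesis by simp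
qed

lemma qslope_continuous: "\<bar>t\<bar> < 1 \<Longrightarrow> continuous_on UNIV (qslope t)"
  unfolding qslope_def by (intro continuous_intros ballI less_imp_neq[OF norm_sq_pos, symmetric])

lemma prod_cis: "(\<Prod>a\<in>A. cis (f a)) = cis (\<Sum>a\<in>A. f a)"
  by (induction A rule: infinite_finite_induct) (simp_all add: cis_mult)

text \<open>The bounds make the map \<open>Phi\<close> below differ from the identity by a contraction with factor
  \<open>1 / 2\<close>.\<close>
locale bethe = simple_datum G v for G :: "('n::finite) root_datum" and v :: "real ^ 'n" +
  fixes k :: nat and t :: real
  assumes t_half: "\<bar>t\<bar> \<le> 1/2" and t_small: "48 * real (card (pos_roots G)) * \<bar>t\<bar> \<le> real k + dual_coxeter G"
begin

abbreviation "kap \<equiv> real k + h"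

lemma t_less_one: "\<bar>t\<bar> < 1" using t_half by linarith

lemma kap_pos: "kap > 0" using dual_coxeter_pos by linarith

lemma kap_nat: "\<exists>m. kap = of_nat m"
proof -
  obtain m where "h = of_nat m" using dual_coxeter_nat by blast
  then show ?thesis by (intro exI[of _ "k + m"]) simp
qed

section \<open>The deformed map and its inverse\<close>

definition phase_sum :: "real ^ 'n \<Rightarrow> real ^ 'n" where
  "phase_sum x = (\<Sum>\<alpha>\<in>P. qphase t (\<alpha> \<bullet> x) *\<^sub>R \<alpha>)"

text \<open>The inner product of \<open>Phi x\<close> with \<open>y\<close> is the argument, divided by \<open>2\<pi> (k + h)\<close>, of the
  left-hand side of the equations defining \<open>F_rho\<close>.\<close>
definition Phi :: "real ^ 'n \<Rightarrow> real ^ 'n" where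
  "Phi x = x + (1 / kap) *\<^sub>R phase_sum x"

definition DPhi :: "real ^ 'n \<Rightarrow> real ^ 'n \<Rightarrow> real ^ 'n" where
  "DPhi x y = y + (1 / kap) *\<^sub>R (\<Sum>\<alpha>\<in>P. (qslope t (\<alpha> \<bullet> x) * (\<alpha> \<bullet> y)) *\<^sub>R \<alpha>)"

lemma Phi_deriv: "(Phi has_derivative DPhi x) (at x)"
proof -
  have q: "((\<lambda>x. qphase t (\<alpha> \<bullet> x)) has_derivative (\<lambda>y. qslope t (\<alpha> \<bullet> x) * (\<alpha> \<bullet> y))) (at x)" for \<alpha>
  proof -
    have "((\<lambda>x. \<alpha> \<bullet> x) has_derivative (\<lambda>y. \<alpha> \<bullet> y)) (at x)"
      by (rule bounded_linear_imp_has_derivative[OF bounded_linear_inner_right])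
    from DERIV_compose_FDERIV[OF qphase_deriv[OF t_less_one] this]
    show ?thesis by (simp only: mult.commute)
  qed
  show ?thesis
    unfolding Phi_def[abs_def] phase_sum_def DPhi_def[abs_def]
    by (rule has_derivative_add[OF has_derivative_ident has_derivative_scaleR_right[OF has_derivative_sum]])
       (rule has_derivative_scaleR_left[OF q])
qed

lemma root_norm: "\<alpha> \<in> P \<Longrightarrow> norm \<alpha> * norm \<alpha> \<le> 2"
  using root_norm_le[OF P_R] by (simp add: power2_norm_eq_inner power2_eq_square[symmetric])

lemma card_t: "24 * real (card P) * \<bar>t\<bar> \<le> kap / 2"
  using t_small by simp

text \<open>The Lipschitz constant 12 \<bar>t\<bar> and a squared root length of at most 2 give 24
  \<bar>t\<bar> per positive root; asking the total to be at most half of \<open>kap\<close> is the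
  48 in \<open>t_small\<close>.\<close>

lemma sum_roots_bound:
  assumes "\<And>\<alpha>. \<alpha> \<in> P \<Longrightarrow> \<bar>c \<alpha>\<bar> \<le> 12 * \<bar>t\<bar> * (norm \<alpha> * d)" "d \<ge> 0"
  shows "norm ((1 / kap) *\<^sub>R (\<Sum>\<alpha>\<in>P. c \<alpha> *\<^sub>R \<alpha>)) \<le> d / 2"
proof -
  have "norm (\<Sum>\<alpha>\<in>P. c \<alpha> *\<^sub>R \<alpha>) \<le> (\<Sum>\<alpha>\<in>P. 24 * \<bar>t\<bar> * d)"
  proof (rule sum_norm_le)
    fix \<alpha> assume a: "\<alpha> \<in> P"
    have "norm (c \<alpha> *\<^sub>R \<alpha>) \<le> (12 * \<bar>t\<bar> * (norm \<alpha> * d)) * norm \<alpha>"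
      unfolding norm_scaleR by (intro mult_right_mono assms a) simp
    also have "\<dots> = 12 * \<bar>t\<bar> * d * (norm \<alpha> * norm \<alpha>)" by (simp add: mult_ac)
    also have "\<dots> \<le> 12 * \<bar>t\<bar> * d * 2" using root_norm[OF a] assms(2) by (intro mult_left_mono) auto
    finally show "norm (c \<alpha> *\<^sub>R \<alpha>) \<le> 24 * \<bar>t\<bar> * d" by simp
  qed
  also have "\<dots> = (24 * real (card P) * \<bar>t\<bar>) * d" by simp
  also have "\<dots> \<le> kap / 2 * d" by (intro mult_right_mono card_t assms)
  finally have le: "norm (\<Sum>\<alpha>\<in>P. c \<alpha> *\<^sub>R \<alpha>) \<le> kap / 2 * d" .
  have gen: "(1 / K) * N \<le> d / 2" if "N \<le> K / 2 * d" "K > 0" for K N :: real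
    using that by (simp add: field_simps)
  show ?thesis using gen[OF le kap_pos] kap_pos by simp
qed

lemma phase_sum_contraction: "norm ((1 / kap) *\<^sub>R phase_sum x - (1 / kap) *\<^sub>R phase_sum y) \<le> norm (x - y) / 2"
proof -
  have "(1 / kap) *\<^sub>R phase_sum x - (1 / kap) *\<^sub>R phase_sum y = (1 / kap) *\<^sub>R (\<Sum>\<alpha>\<in>P. (qphase t (\<alpha> \<bullet> x) - qphase t (\<alpha> \<bullet> y)) *\<^sub>R \<alpha>)"
    by (simp add: phase_sum_def scaleR_diff_left sum_subtractf scaleR_diff_right)
  also have "norm \<dots> \<le> norm (x - y) / 2"
  proof (rule sum_roots_bound)
    fix \<alpha>
    have "\<bar>qphase t (\<alpha> \<bullet> x) - qphase t (\<alpha> \<bullet> y)\<bar> \<le> 12 * \<bar>t\<bar> * \<bar>\<alpha> \<bullet> x - \<alpha> \<bullet> y\<bar>"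
      by (rule qphase_lipschitz[OF t_half])
    also have "\<bar>\<alpha> \<bullet> x - \<alpha> \<bullet> y\<bar> \<le> norm \<alpha> * norm (x - y)"
      using Cauchy_Schwarz_ineq2[of \<alpha> "x - y"] by (simp add: inner_diff_right)
    finally show "\<bar>qphase t (\<alpha> \<bullet> x) - qphase t (\<alpha> \<bullet> y)\<bar> \<le> 12 * \<bar>t\<bar> * (norm \<alpha> * norm (x - y))"
      by (simp add: mult_left_mono)
  qed simp
  finally show ?thesis .
qed

lemma Phi_expanding: "norm (x - y) \<le> 2 * norm (Phi x - Phi y)"
proof -
  have "x - y = (Phi x - Phi y) - ((1 / kap) *\<^sub>R phase_sum x - (1 / kap) *\<^sub>R phase_sum y)" by (simp add: Phi_def)
  then have "norm (x - y) \<le> norm (Phi x - Phi y) + norm ((1 / kap) *\<^sub>R phase_sum x - (1 / kap) *\<^sub>R phase_sum y)"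
    by (metis norm_triangle_ineq4)
  then show ?thesis using phase_sum_contraction[of x y] by linarith
qed

lemma Phi_inj: "Phi x = Phi y \<Longrightarrow> x = y"
  using Phi_expanding[of x y] by simp

text \<open>A preimage of z is a fixed point of the contraction that subtracts the scaled phase sum
  from z.\<close>

lemma Phi_surj: "\<exists>x. Phi x = z"
proof -
  have "\<exists>!x. z - (1 / kap) *\<^sub>R phase_sum x = x"
  proof (rule banach_fix_type[of "1/2"])
    show "\<forall>x y. dist (z - (1 / kap) *\<^sub>R phase_sum x) (z - (1 / kap) *\<^sub>R phase_sum y) \<le> 1 / 2 * dist x y"
      using phase_sum_contraction by (simp add: dist_norm norm_minus_commute)
  qed auto
  then obtain x where "z - (1 / kap) *\<^sub>R phase_sum x = x" by blast
  then have "Phi x = z" unfolding Phi_def by (metis diff_add_cancel)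
  then show ?thesis by blast
qed

definition Psi :: "real ^ 'n \<Rightarrow> real ^ 'n" where "Psi z = (THE x. Phi x = z)"

lemma Phi_Psi [simp]: "Phi (Psi z) = z"
proof -
  obtain x where x: "Phi x = z" using Phi_surj by blast
  have "Psi z = x" unfolding Psi_def by (rule the_equality) (use Phi_inj x in blast)+
  then show ?thesis using x by simp
qed

lemma Psi_Phi [simp]: "Psi (Phi x) = x"
  by (rule Phi_inj) simp

lemma Psi_cont: "continuous_on UNIV Psi"
proof -
  have "2-lipschitz_on UNIV Psi"
    by (rule lipschitz_onI) (use Phi_expanding[of "Psi _" "Psi _"] in \<open>auto simp: dist_norm\<close>)
  then show ?thesis by (rule lipschitz_on_continuous_on)
qed

text \<open>The deviation is of order t, so a nonvanishing statement at t = 0 near a fixed torsion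
  point p can be carried over to the moving point \<open>Psi p\<close>.\<close>

lemma Phi_close: "norm (Phi x - x) \<le> 4 * real (card P) * \<bar>t\<bar> / kap"
proof -
  have "norm (phase_sum x) \<le> (\<Sum>\<alpha>\<in>P. 4 * \<bar>t\<bar>)"
    unfolding phase_sum_def
  proof (rule sum_norm_le)
    fix \<alpha> assume a: "\<alpha> \<in> P"
    have "norm \<alpha> \<le> 2"
    proof (rule ccontr)
      assume "\<not> ?thesis"
      then have "2 * 2 < norm \<alpha> * norm \<alpha>" by (intro mult_strict_mono) auto
      then show False using root_norm[OF a] by simp
    qed
    then have "\<bar>qphase t (\<alpha> \<bullet> x)\<bar> * norm \<alpha> \<le> (2 * \<bar>t\<bar>) * 2"
      by (intro mult_mono qphase_bound[OF t_half]) auto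
    then show "norm (qphase t (\<alpha> \<bullet> x) *\<^sub>R \<alpha>) \<le> 4 * \<bar>t\<bar>" by simp
  qed
  then have "norm (phase_sum x) / kap \<le> (4 * real (card P) * \<bar>t\<bar>) / kap"
    using kap_pos by (intro divide_right_mono) (auto simp: mult_ac)
  then show ?thesis using kap_pos by (simp add: Phi_def)
qed

text \<open>\<open>qphase\<close> is odd, so each summand depends only on a pair of opposite roots,
  and the images w \<alpha> may replace the positive roots.\<close>

lemma phase_sum_W: assumes "w \<in> W" shows "phase_sum (w x) = w (phase_sum x)"
proof -
  have "w (phase_sum x) = (\<Sum>\<alpha>\<in>P. qphase t (w \<alpha> \<bullet> w x) *\<^sub>R w \<alpha>)"
    unfolding phase_sum_def W_sum[OF assms] W_scale[OF assms] W_inner[OF assms] ..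
  also have "\<dots> = (\<Sum>\<alpha>\<in>P. qphase t ((if inv w \<alpha> \<in> P then \<alpha> else - \<alpha>) \<bullet> w x) *\<^sub>R (if inv w \<alpha> \<in> P then \<alpha> else - \<alpha>))"
    by (rule sum_W_pos[OF assms, of "\<lambda>\<alpha>. qphase t (\<alpha> \<bullet> w x) *\<^sub>R \<alpha>"])
  also have "\<dots> = phase_sum (w x)" unfolding phase_sum_def
    by (intro sum.cong HOL.refl) (simp add: qphase_odd)
  finally show ?thesis by simp
qed

lemma Phi_W: "w \<in> W \<Longrightarrow> Phi (w x) = w (Phi x)"
  by (simp add: Phi_def phase_sum_W W_add W_scale)

lemma Phi_Q: assumes "y \<in> Q" shows "Phi (y + x) = y + Phi x"
proof -
  have "qphase t (\<alpha> \<bullet> (y + x)) = qphase t (\<alpha> \<bullet> x)" if "\<alpha> \<in> P" for \<alpha>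
    unfolding inner_add_right by (rule qphase_period[OF root_Q_int[OF P_R[OF that] assms]])
  then have "phase_sum (y + x) = phase_sum x" unfolding phase_sum_def by (intro sum.cong HOL.refl) simp
  then show ?thesis by (simp add: Phi_def)
qed

lemma Phi_affine: "w \<in> W \<Longrightarrow> y \<in> Q \<Longrightarrow> Phi (w x + y) = w (Phi x) + y"
  using Phi_Q[of y "w x"] by (simp add: add.commute Phi_W)

lemma linear_DPhi: "linear (DPhi x)"
  by (rule linearI)
     (simp_all add: DPhi_def inner_add_right distrib_left scaleR_add_left sum.distrib scaleR_add_right
       scaleR_sum_right mult_ac)

lemma DPhi_near: "norm (DPhi x y - y) \<le> norm y / 2"
proof -
  have "norm ((1 / kap) *\<^sub>R (\<Sum>\<alpha>\<in>P. (qslope t (\<alpha> \<bullet> x) * (\<alpha> \<bullet> y)) *\<^sub>R \<alpha>)) \<le> norm y / 2"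
  proof (rule sum_roots_bound)
    fix \<alpha>
    show "\<bar>qslope t (\<alpha> \<bullet> x) * (\<alpha> \<bullet> y)\<bar> \<le> 12 * \<bar>t\<bar> * (norm \<alpha> * norm y)"
      unfolding abs_mult by (intro mult_mono qslope_bound[OF t_half] Cauchy_Schwarz_ineq2) auto
  qed simp
  then show ?thesis by (simp add: DPhi_def)
qed

lemma det_DPhi_nonzero: "det (matrix (DPhi x)) \<noteq> 0"
proof -
  have "y = 0" if "matrix (DPhi x) *v y = 0" for y
  proof -
    have "DPhi x y = 0" using that by (simp add: matrix_works linear_DPhi)
    then show ?thesis using DPhi_near[of x y] by simp
  qed
  then have "invertible (matrix (DPhi x))"
    using matrix_left_invertible_ker[of "matrix (DPhi x)"] by (auto simp: invertible_left_inverse)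
  then show ?thesis by (simp add: invertible_det_nz)
qed

lemma det_DPhi_cont: "continuous_on UNIV (\<lambda>x. det (matrix (DPhi x)))"
proof -
  have "continuous_on UNIV (\<lambda>x. qslope t (\<alpha> \<bullet> x))" for \<alpha>
    by (intro continuous_on_compose2[OF qslope_continuous[OF t_less_one]] continuous_intros) auto
  then have ent: "continuous_on UNIV (\<lambda>x. matrix (DPhi x) $ i $ j)" for i j
    unfolding matrix_def DPhi_def using kap_pos by (simp, intro continuous_intros) auto
  then show ?thesis unfolding det_def
    by (intro continuous_on_sum continuous_on_mult continuous_on_const continuous_on_prod ent)
qed

text \<open>The determinant is continuous and nowhere zero on a connected space. A fixed sign
  matters because \<open>theta\<close> contains the determinant itself, the change of variables its
  absolute value.\<close>

lemma det_DPhi_sign: "det (matrix (DPhi x)) * det (matrix (DPhi y)) > 0"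
proof (rule ccontr)
  let ?d = "\<lambda>x. det (matrix (DPhi x))"
  assume "\<not> ?thesis"
  then have neg: "?d x * ?d y < 0" using det_DPhi_nonzero[of x] det_DPhi_nonzero[of y] by (simp add: not_less order_less_le)
  have conn: "connected (range ?d)"
    by (rule connected_continuous_image[OF det_DPhi_cont connected_UNIV])
  have "0 \<in> range ?d"
  proof (cases "?d x < 0")
    case True
    then have "?d y > 0" using neg by (simp add: mult_less_0_iff)
    then show ?thesis using connectedD_interval[OF conn, of "?d x" "?d y" 0] True by auto
  next
    case False
    then have "?d x > 0" "?d y < 0" using neg by (auto simp: mult_less_0_iff)
    then show ?thesis using connectedD_interval[OF conn, of "?d y" "?d x" 0] by auto
  qed
  then show False using det_DPhi_nonzero by auto
qed

section \<open>Torus points\<close>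

abbreviation "te x \<equiv> torus_exp G x"

lemma te_apply: "\<mu> \<in> weights G \<Longrightarrow> te x \<mu> = cis (2 * pi * (\<mu> \<bullet> x))"
  by (simp add: torus_exp_def)

lemma te_root: "\<alpha> \<in> R \<Longrightarrow> te x \<alpha> = cis (2 * pi * (\<alpha> \<bullet> x))"
  by (rule te_apply[OF weight_root])

lemma cis_eq_imp_int: assumes "cis (2 * pi * a) = cis (2 * pi * b)" shows "a - b \<in> \<int>"
proof -
  have "cis (2 * pi * (a - b)) = cis (2 * pi * a) / cis (2 * pi * b)" by (simp add: cis_divide right_diff_distrib)
  also have "\<dots> = 1" using assms by simp
  finally have "cos (2 * pi * (a - b)) = 1" by (metis cis.sel(1) one_complex.sel(1))
  then obtain n :: int where "a - b = of_int n" by (auto simp: cos_one_2pi_int)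
  then show ?thesis by simp
qed

lemma fweight_weight: "fweight i \<in> weights G"
  unfolding weights_iff using fweight_Q_int by blast

lemma te_eq_iff: "te x = te y \<longleftrightarrow> x - y \<in> Q"
proof
  assume eq: "te x = te y"
  have "fweight i \<bullet> (x - y) \<in> \<int>" for i
  proof -
    have "cis (2 * pi * (fweight i \<bullet> x)) = cis (2 * pi * (fweight i \<bullet> y))"
      using fun_cong[OF eq, of "fweight i"] by (simp add: te_apply fweight_weight)
    from cis_eq_imp_int[OF this] show ?thesis by (simp add: inner_diff_right)
  qed
  then show "x - y \<in> Q" by (simp add: Q_iff)
next
  assume q: "x - y \<in> Q"
  have "cis (2 * pi * (\<mu> \<bullet> x)) = cis (2 * pi * (\<mu> \<bullet> y))" if "\<mu> \<in> weights G" for \<mu>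
  proof -
    have "\<mu> \<bullet> x = \<mu> \<bullet> (x - y) + \<mu> \<bullet> y" by (simp add: inner_diff_right)
    moreover have "\<mu> \<bullet> (x - y) \<in> \<int>" using that q by (simp add: weights_iff)
    ultimately show ?thesis by (simp only: cis_int_shift)
  qed
  then show "te x = te y" by (auto simp: torus_exp_def)
qed

lemma torus_act_te: assumes "w \<in> W" shows "torus_act G w (te x) = te (w x)"
proof
  fix \<mu>
  show "torus_act G w (te x) \<mu> = te (w x) \<mu>"
  proof (cases "\<mu> \<in> weights G")
    case True
    then show ?thesis
      using weight_W[OF W_inv[OF assms] True] W_inner_inv[OF assms, of x \<mu>]
      by (simp add: torus_act_def te_apply inner_commute)
  qed (simp add: torus_act_def torus_exp_def)
qed

lemma bethe_lhs:
  assumes "y \<in> Q"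
  shows "cis (2 * pi * (kap * (x \<bullet> y))) * (\<Prod>\<alpha>\<in>P.
     ((1 - of_real t * te x (- \<alpha>)) / (1 - of_real t * te x \<alpha>)) powi \<lfloor>\<alpha> \<bullet> y\<rfloor>) = cis (2 * pi * (kap * (Phi x \<bullet> y)))"
proof -
  have "(\<Prod>\<alpha>\<in>P. ((1 - of_real t * te x (- \<alpha>)) / (1 - of_real t * te x \<alpha>)) powi \<lfloor>\<alpha> \<bullet> y\<rfloor>)
     = (\<Prod>\<alpha>\<in>P. cis (2 * pi * (qphase t (\<alpha> \<bullet> x) * (\<alpha> \<bullet> y))))"
  proof (rule prod.cong[OF HOL.refl])
    fix \<alpha> assume a: "\<alpha> \<in> P"
    have int: "of_int \<lfloor>\<alpha> \<bullet> y\<rfloor> = \<alpha> \<bullet> y" using root_Q_int[OF P_R[OF a] assms] by simp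
    have "te x \<alpha> = cis (2 * pi * (\<alpha> \<bullet> x))" "te x (- \<alpha>) = cis (- (2 * pi * (\<alpha> \<bullet> x)))"
      using te_root[of \<alpha>] te_root[of "- \<alpha>"] P_R[OF a] by simp_all
    then have "(1 - of_real t * te x (- \<alpha>)) / (1 - of_real t * te x \<alpha>) = cis (2 * pi * qphase t (\<alpha> \<bullet> x))"
      by (simp only: cis_qphase[OF t_less_one])
    then show "((1 - of_real t * te x (- \<alpha>)) / (1 - of_real t * te x \<alpha>)) powi \<lfloor>\<alpha> \<bullet> y\<rfloor>
       = cis (2 * pi * (qphase t (\<alpha> \<bullet> x) * (\<alpha> \<bullet> y)))"
      by (simp only: cis_power_int int) (simp add: mult_ac)
  qed
  also have "\<dots> = cis (\<Sum>\<alpha>\<in>P. 2 * pi * (qphase t (\<alpha> \<bullet> x) * (\<alpha> \<bullet> y)))"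
    by (rule prod_cis)
  also have "(\<Sum>\<alpha>\<in>P. 2 * pi * (qphase t (\<alpha> \<bullet> x) * (\<alpha> \<bullet> y))) = 2 * pi * (phase_sum x \<bullet> y)"
    by (simp add: phase_sum_def inner_sum_left sum_distrib_left)
  finally have eq: "(\<Prod>\<alpha>\<in>P. ((1 - of_real t * te x (- \<alpha>)) / (1 - of_real t * te x \<alpha>)) powi \<lfloor>\<alpha> \<bullet> y\<rfloor>)
      = cis (2 * pi * (phase_sum x \<bullet> y))" .
  have "K * ((x + (1 / K) *\<^sub>R phase_sum x) \<bullet> y) = K * (x \<bullet> y) + phase_sum x \<bullet> y" if "K > 0" for K
    using that by (simp add: inner_add_left distrib_left)
  from this[OF kap_pos] show ?thesis unfolding eq cis_mult Phi_def by (simp only: distrib_left)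
qed

lemma cis_eq_one_iff: "cis (2 * pi * a) = 1 \<longleftrightarrow> a \<in> \<int>"
  using cis_eq_imp_int[of a 0] cis_int_shift[of a 0] by auto

lemma F_rho_eq: "F_rho G k t = te ` {x. kap *\<^sub>R Phi x \<in> weights G}"
proof -
  have "(\<forall>y\<in>Q. cis (2 * pi * (kap * (x \<bullet> y))) * (\<Prod>\<alpha>\<in>P.
     ((1 - of_real t * te x (- \<alpha>)) / (1 - of_real t * te x \<alpha>)) powi \<lfloor>\<alpha> \<bullet> y\<rfloor>) = 1)
     \<longleftrightarrow> kap *\<^sub>R Phi x \<in> weights G" for x
  proof -
    have "(\<forall>y\<in>Q. cis (2 * pi * (kap * (x \<bullet> y))) * (\<Prod>\<alpha>\<in>P.
       ((1 - of_real t * te x (- \<alpha>)) / (1 - of_real t * te x \<alpha>)) powi \<lfloor>\<alpha> \<bullet> y\<rfloor>) = 1)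
      \<longleftrightarrow> (\<forall>y\<in>Q. cis (2 * pi * (kap * (Phi x \<bullet> y))) = 1)"
      by (intro ball_cong HOL.refl) (simp only: bethe_lhs)
    then show ?thesis by (simp only: cis_eq_one_iff weights_iff inner_scaleR_left)
  qed
  then show ?thesis unfolding F_rho_def by blast
qed

text \<open>Opposite roots combine to \<open>qslope\<close>. So the endomorphism in
  \<open>theta\<close> is the derivative of \<open>Phi\<close>, and its determinant is the Jacobian
  that appears in the sum over solutions.\<close>

lemma H_dagger_te: "H_dagger G k t (te x) = DPhi x"
  unfolding H_dagger_def
proof (rule the_equality)
  have main: "(\<Sum>\<alpha>\<in>R. of_real t * te x \<alpha> / (1 - of_real t * te x \<alpha>) * of_real (\<alpha> \<bullet> y) * of_real (\<alpha> \<bullet> y'))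
     = complex_of_real (\<Sum>\<alpha>\<in>P. qslope t (\<alpha> \<bullet> x) * (\<alpha> \<bullet> y) * (\<alpha> \<bullet> y'))" for y y'
  proof -
    have "(\<Sum>\<alpha>\<in>R. of_real t * te x \<alpha> / (1 - of_real t * te x \<alpha>) * of_real (\<alpha> \<bullet> y) * of_real (\<alpha> \<bullet> y'))
      = (\<Sum>\<alpha>\<in>P. complex_of_real (qslope t (\<alpha> \<bullet> x)) * of_real (\<alpha> \<bullet> y) * of_real (\<alpha> \<bullet> y'))"
      unfolding sum_R
    proof (rule sum.cong[OF HOL.refl])
      fix \<alpha> assume a: "\<alpha> \<in> P"
      have e: "te x \<alpha> = cis (2 * pi * (\<alpha> \<bullet> x))" "te x (- \<alpha>) = cis (- (2 * pi * (\<alpha> \<bullet> x)))"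
        using te_root[of \<alpha>] te_root[of "- \<alpha>"] P_R[OF a] by simp_all
      show "of_real t * te x \<alpha> / (1 - of_real t * te x \<alpha>) * of_real (\<alpha> \<bullet> y) * of_real (\<alpha> \<bullet> y')
         + of_real t * te x (- \<alpha>) / (1 - of_real t * te x (- \<alpha>)) * of_real (- \<alpha> \<bullet> y) * of_real (- \<alpha> \<bullet> y')
         = complex_of_real (qslope t (\<alpha> \<bullet> x)) * of_real (\<alpha> \<bullet> y) * of_real (\<alpha> \<bullet> y')"
        unfolding qslope_complex[OF t_less_one e] by (simp add: distrib_right)
    qed
    then show ?thesis by simp
  qed
  have ip: "kap * (DPhi x y \<bullet> y') = kap * (y \<bullet> y') + (\<Sum>\<alpha>\<in>P. qslope t (\<alpha> \<bullet> x) * (\<alpha> \<bullet> y) * (\<alpha> \<bullet> y'))" for y y'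
  proof -
    have "kap * (DPhi x y \<bullet> y') = kap * (y \<bullet> y') + kap * (1 / kap) * ((\<Sum>\<alpha>\<in>P. (qslope t (\<alpha> \<bullet> x) * (\<alpha> \<bullet> y)) *\<^sub>R \<alpha>) \<bullet> y')"
      by (simp add: DPhi_def inner_add_left distrib_left)
    then show ?thesis using kap_pos by (simp add: inner_sum_left)
  qed
  show "linear (DPhi x) \<and> (\<forall>y y'. complex_of_real (kap * (DPhi x y \<bullet> y')) = complex_of_real (kap * (y \<bullet> y')) +
     (\<Sum>\<alpha>\<in>R. of_real t * te x \<alpha> / (1 - of_real t * te x \<alpha>) * of_real (\<alpha> \<bullet> y) * of_real (\<alpha> \<bullet> y')))"
    unfolding main ip by (simp only: linear_DPhi of_real_add simp_thms)
  fix H assume H: "linear H \<and> (\<forall>y y'. complex_of_real (kap * (H y \<bullet> y')) = complex_of_real (kap * (y \<bullet> y')) +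
     (\<Sum>\<alpha>\<in>R. of_real t * te x \<alpha> / (1 - of_real t * te x \<alpha>) * of_real (\<alpha> \<bullet> y) * of_real (\<alpha> \<bullet> y')))"
  show "H = DPhi x"
  proof
    fix y
    have "H y \<bullet> y' = DPhi x y \<bullet> y'" for y'
    proof -
      have "complex_of_real (kap * (H y \<bullet> y')) = complex_of_real (kap * (DPhi x y \<bullet> y'))"
        using H unfolding main ip by (simp only: of_real_add)
      then have "kap * (H y \<bullet> y') = kap * (DPhi x y \<bullet> y')" by (simp only: of_real_eq_iff)
      then show ?thesis using kap_pos by simp
    qed
    then show "H y = DPhi x y" by (metis vector_eq_rdot)
  qed
qed

section \<open>Lattice coordinates\<close>

text \<open>Coordinates along the simple coroots, in which the coroot lattice becomes the set of
  integer vectors.\<close>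

definition of_coords :: "real ^ 'n idx \<Rightarrow> real ^ 'n" where
  "of_coords s = (\<Sum>j\<in>UNIV. (s $ j) *\<^sub>R scoroot (idx_enum j))"

definition to_coords :: "real ^ 'n \<Rightarrow> real ^ 'n idx" where
  "to_coords x = (\<chi> j. fweight (idx_enum j) \<bullet> x)"

lemma idx_enum_eq_iff: "idx_enum i = idx_enum j \<longleftrightarrow> i = j"
  using bij_idx_enum by (metis bij_is_inj injD)

lemma linear_Lc: "linear of_coords"
  by (rule linearI) (simp_all add: of_coords_def scaleR_add_left sum.distrib scaleR_sum_right)

lemma linear_Lci: "linear to_coords"
  by (rule linearI) (simp_all add: to_coords_def vec_eq_iff inner_add_right)

lemma to_coords_Lc [simp]: "to_coords (of_coords s) = s"
proof -
  have "fweight (idx_enum i) \<bullet> of_coords s = s $ i" for i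
    by (simp add: of_coords_def inner_sum_right inner_commute[of "fweight _"] scoroot_fweight idx_enum_eq_iff
        if_distrib sum.delta cong: if_cong)
  then show ?thesis by (simp add: to_coords_def vec_eq_iff)
qed

lemma of_coords_Lci [simp]: "of_coords (to_coords x) = x"
proof -
  have "of_coords (to_coords x) = (\<Sum>j\<in>UNIV. (fweight (idx_enum j) \<bullet> x) *\<^sub>R scoroot (idx_enum j))"
    by (simp add: of_coords_def to_coords_def)
  also have "\<dots> = (\<Sum>i\<in>UNIV. (fweight i \<bullet> x) *\<^sub>R scoroot i)"
    by (rule sum.reindex_bij_betw[OF bij_idx_enum])
  finally show ?thesis using scoroot_expansion by simp
qed

lemma of_coords_Q_iff: "of_coords s \<in> Q \<longleftrightarrow> s \<in> int_vecs"
proof -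
  have "of_coords s \<in> Q \<longleftrightarrow> (\<forall>j. fweight (idx_enum j) \<bullet> of_coords s \<in> \<int>)"
    unfolding Q_iff using bij_idx_enum by (metis bij_pointE)
  also have "\<dots> \<longleftrightarrow> (\<forall>j. to_coords (of_coords s) $ j \<in> \<int>)" unfolding to_coords_def by simp
  finally show ?thesis by (simp add: int_vecs_def)
qed

text \<open>The coordinate maps change the index type, so the determinants are compared in two
  stages: conjugation by maps within one type, then renumbering of the indices.\<close>

lemma det_coords:
  assumes "linear A"
  shows "det (matrix (to_coords \<circ> A \<circ> of_coords)) = det (matrix A)"
proof -
  define L0 :: "real ^ 'n \<Rightarrow> real ^ 'n" where "L0 x = (\<Sum>i\<in>UNIV. (x $ i) *\<^sub>R scoroot i)" for x
  define L1 :: "real ^ 'n \<Rightarrow> real ^ 'n" where "L1 x = (\<chi> i. fweight i \<bullet> x)" for x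
  have lin: "linear L0" "linear L1"
    by (auto intro!: linearI simp: L0_def L1_def scaleR_add_left sum.distrib scaleR_sum_right vec_eq_iff inner_add_right)
  have L10: "L1 (L0 x) = x" for x
    by (simp add: L1_def L0_def vec_eq_iff inner_sum_right inner_commute[of "fweight _"] scoroot_fweight
        if_distrib sum.delta cong: if_cong)
  have L0a: "L0 (axis j 1) = scoroot j" for j
    by (simp add: L0_def axis_def if_distrib if_distribR sum.delta cong: if_cong)
  have Lca: "of_coords (axis j 1) = scoroot (idx_enum j)" for j
    by (simp add: of_coords_def axis_def if_distrib if_distribR sum.delta cong: if_cong)
  have "matrix (to_coords \<circ> A \<circ> of_coords) = (\<chi> i j. matrix (L1 \<circ> A \<circ> L0) $ idx_enum i $ idx_enum j)"
    by (simp add: matrix_def vec_eq_iff L0a Lca to_coords_def L1_def)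
  then have "det (matrix (to_coords \<circ> A \<circ> of_coords)) = det (matrix (L1 \<circ> A \<circ> L0))"
    by (simp only: det_reindex[OF bij_idx_enum])
  also have "matrix (L1 \<circ> A \<circ> L0) = matrix L1 ** matrix A ** matrix L0"
    using lin assms by (simp add: matrix_compose linear_compose)
  also have "det \<dots> = det (matrix L1 ** matrix L0) * det (matrix A)" by (simp add: det_mul)
  also have "matrix L1 ** matrix L0 = mat 1"
  proof -
    have "matrix L1 ** matrix L0 = matrix (L1 \<circ> L0)" using lin by (simp add: matrix_compose)
    also have "L1 \<circ> L0 = id" using L10 by (simp add: fun_eq_iff)
    finally show ?thesis by (simp only: matrix_id_mat_1)
  qed
  finally show ?thesis by (simp only: det_I mult_1)
qed

text \<open>One representative modulo the coroot lattice of each z with (k + h) z a weight; the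
  solutions themselves are the points \<open>Psi z\<close>.\<close>

definition bethe_cell :: "(real ^ 'n) set" where
  "bethe_cell = {z. kap *\<^sub>R z \<in> weights G \<and> (\<forall>i. 0 \<le> fweight i \<bullet> z \<and> fweight i \<bullet> z < 1)}"

theorem bethe_sum_zero:
  fixes \<phi> :: "real ^ 'n \<Rightarrow> complex"
  assumes cont: "continuous_on UNIV \<phi>"
    and per: "\<And>x y. y \<in> Q \<Longrightarrow> \<phi> (y + x) = \<phi> x"
    and van: "\<And>y. y \<in> Q \<Longrightarrow> integral cube (\<lambda>s. \<phi> (of_coords s) * cis (2 * pi * (kap * (y \<bullet> Phi (of_coords s))))) = 0"
  shows "(\<Sum>z\<in>bethe_cell. \<phi> (Psi z) / of_real \<bar>det (matrix (DPhi (Psi z)))\<bar>) = 0" and "finite bethe_cell"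
proof -
  \<comment> \<open>\<open>b j\<close> is the linear form \<open>kap\<close> times the product with
    the j-th simple coroot, in coroot coordinates. It is integral because the form is integral on
    \<open>Q\<close> and \<open>kap\<close> is a natural number, and all \<open>b j\<close> are
    integral at a point exactly when \<open>kap\<close> times the point is a weight.\<close>
  define b :: "'n idx \<Rightarrow> real ^ 'n idx" where "b j = (\<chi> i. kap * (scoroot (idx_enum j) \<bullet> scoroot (idx_enum i)))" for j
  have bs: "b j \<bullet> s = kap * (scoroot (idx_enum j) \<bullet> of_coords s)" for j s
  proof -
    have "b j \<bullet> s = (\<Sum>i\<in>UNIV. b j $ i * s $ i)" unfolding inner_vec_def by simp
    then show ?thesis by (simp add: b_def of_coords_def inner_sum_right sum_distrib_left mult_ac)
  qed
  have csum: "(\<Sum>j\<in>UNIV. of_int (c j) *\<^sub>R b j) \<bullet> s = kap * ((\<Sum>j\<in>UNIV. of_int (c j) *\<^sub>R scoroot (idx_enum j)) \<bullet> of_coords s)" for c s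
    by (simp add: inner_sum_left bs sum_distrib_left mult_ac)
  have contL: "continuous_on S of_coords" "continuous_on T to_coords" for S T
    using linear_Lc linear_Lci by (auto intro: linear_continuous_on simp: linear_conv_bounded_linear)
  interpret deform_product: periodic_diffeo "to_coords \<circ> Phi \<circ> of_coords" "to_coords \<circ> Psi \<circ> of_coords" "\<lambda>s. to_coords \<circ> DPhi (of_coords s) \<circ> of_coords" b "\<phi> \<circ> of_coords"
  proof
    fix x z :: "real ^ 'n idx" assume z: "z \<in> int_vecs"
    then have q: "of_coords z \<in> Q" by (simp add: of_coords_Q_iff)
    show "(to_coords \<circ> Phi \<circ> of_coords) (z + x) = z + (to_coords \<circ> Phi \<circ> of_coords) x"
      by (simp add: linear_add[OF linear_Lc] Phi_Q[OF q] linear_add[OF linear_Lci])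
    show "(\<phi> \<circ> of_coords) (z + x) = (\<phi> \<circ> of_coords) x"
      by (simp add: linear_add[OF linear_Lc] per[OF q])
  next
    fix x :: "real ^ 'n idx"
    have l: "(of_coords has_derivative of_coords) (at x)"
      using linear_Lc by (intro bounded_linear_imp_has_derivative) (simp add: linear_conv_bounded_linear)
    have li: "(to_coords has_derivative to_coords) (at y)" for y
      using linear_Lci by (intro bounded_linear_imp_has_derivative) (simp add: linear_conv_bounded_linear)
    show "((to_coords \<circ> Phi \<circ> of_coords) has_derivative (to_coords \<circ> DPhi (of_coords x) \<circ> of_coords)) (at x)"
      using diff_chain_at[OF l diff_chain_at[OF Phi_deriv li]] by (simp only: comp_assoc)
    show "(to_coords \<circ> Psi \<circ> of_coords) ((to_coords \<circ> Phi \<circ> of_coords) x) = x" "(to_coords \<circ> Phi \<circ> of_coords) ((to_coords \<circ> Psi \<circ> of_coords) x) = x" by simp_all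
    show "det (matrix (to_coords \<circ> DPhi (of_coords x) \<circ> of_coords)) \<noteq> 0" by (simp only: det_coords[OF linear_DPhi] det_DPhi_nonzero simp_thms)
  next
    show "continuous_on UNIV (to_coords \<circ> Psi \<circ> of_coords)"
      by (intro continuous_on_compose contL continuous_on_subset[OF Psi_cont]) auto
    show "continuous_on UNIV (\<lambda>x. det (matrix (to_coords \<circ> DPhi (of_coords x) \<circ> of_coords)))"
      unfolding det_coords[OF linear_DPhi] by (intro continuous_on_compose2[OF det_DPhi_cont contL(1)]) auto
    show "continuous_on UNIV (\<phi> \<circ> of_coords)"
      by (intro continuous_on_compose contL continuous_on_subset[OF cont]) auto
  next
    fix i
    obtain m where m: "kap = of_nat m" using kap_nat by blast
    show "b i \<in> int_vecs"
      unfolding int_vecs_def b_def using Q_weight[OF scoroot_Q] scoroot_Q by (auto simp: weights_iff m simp del: of_nat_add)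
  next
    fix x assume z: "\<And>i. b i \<bullet> x = 0"
    have "scoroot i \<bullet> of_coords x = 0" for i
    proof -
      have "idx_enum (inv idx_enum i) = i" by (rule surj_f_inv_f[OF bij_is_surj[OF bij_idx_enum]])
      then show ?thesis using z[of "inv idx_enum i"] kap_pos by (simp add: bs)
    qed
    then have "of_coords x = 0" by (rule eq_zero_if_scoroot)
    then show "x = 0" using to_coords_Lc[of x] linear_0[OF linear_Lci] by simp
  next
    fix c :: "'n idx \<Rightarrow> int"
    have "(\<Sum>j\<in>UNIV. of_int (c j) *\<^sub>R scoroot (idx_enum j)) \<in> Q" by (intro Q_sum Q_scale_int scoroot_Q)
    from van[OF this] show "integral cube (\<lambda>x. (\<phi> \<circ> of_coords) x * cis (2 * pi * ((\<Sum>i\<in>UNIV. of_int (c i) *\<^sub>R b i) \<bullet> (to_coords \<circ> Phi \<circ> of_coords) x))) = 0"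
      unfolding csum by simp
  qed
  have cell: "bethe_cell = of_coords ` (deform_product.dual_points \<inter> cube)"
  proof -
    have dual_points: "s \<in> deform_product.dual_points \<longleftrightarrow> kap *\<^sub>R of_coords s \<in> weights G" for s
    proof -
      have "kap *\<^sub>R of_coords s \<in> weights G \<longleftrightarrow> (\<forall>i. kap * (scoroot i \<bullet> of_coords s) \<in> \<int>)"
        unfolding weights_iff Q_int_iff by (simp add: inner_commute)
      also have "\<dots> \<longleftrightarrow> (\<forall>j. kap * (scoroot (idx_enum j) \<bullet> of_coords s) \<in> \<int>)"
        using bij_idx_enum by (metis bij_pointE)
      finally show ?thesis unfolding deform_product.dual_points_def bs by simp
    qed
    have cube: "s \<in> cube \<longleftrightarrow> (\<forall>i. 0 \<le> fweight i \<bullet> of_coords s \<and> fweight i \<bullet> of_coords s < 1)" for s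
    proof -
      have "s \<in> cube \<longleftrightarrow> (\<forall>j. 0 \<le> to_coords (of_coords s) $ j \<and> to_coords (of_coords s) $ j < 1)" by (simp add: cube_def)
      also have "\<dots> \<longleftrightarrow> (\<forall>i. 0 \<le> fweight i \<bullet> of_coords s \<and> fweight i \<bullet> of_coords s < 1)"
        unfolding to_coords_def vec_lambda_beta using bij_idx_enum by (metis bij_pointE)
      finally show ?thesis .
    qed
    show ?thesis
    proof (intro equalityI subsetI)
      fix z assume "z \<in> bethe_cell"
      then show "z \<in> of_coords ` (deform_product.dual_points \<inter> cube)"
        by (intro image_eqI[of _ _ "to_coords z"]) (auto simp: dual_points cube bethe_cell_def)
    qed (auto simp: dual_points cube bethe_cell_def)
  qed
  have inj: "inj_on of_coords (deform_product.dual_points \<inter> cube)" by (metis inj_onI to_coords_Lc)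
  show "finite bethe_cell" unfolding cell using deform_product.finite_PP_cube by simp
  have pullback: "deform_product.pullback s = \<phi> (Psi (of_coords s)) / of_real \<bar>det (matrix (DPhi (Psi (of_coords s))))\<bar>" for s
    unfolding deform_product.pullback_def det_coords[OF linear_DPhi] by simp
  have "(\<Sum>z\<in>bethe_cell. \<phi> (Psi z) / of_real \<bar>det (matrix (DPhi (Psi z)))\<bar>)
      = (\<Sum>s\<in>deform_product.dual_points \<inter> cube. \<phi> (Psi (of_coords s)) / of_real \<bar>det (matrix (DPhi (Psi (of_coords s))))\<bar>)"
    by (rule sum.reindex_cong[OF inj cell HOL.refl])
  also have "\<dots> = (\<Sum>s\<in>deform_product.dual_points \<inter> cube. deform_product.pullback s)"
    by (rule sum.cong[OF HOL.refl pullback[symmetric]])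
  also have "\<dots> = 0" by (rule deform_product.periodization_zero)
  finally show "(\<Sum>z\<in>bethe_cell. \<phi> (Psi z) / of_real \<bar>det (matrix (DPhi (Psi z)))\<bar>) = 0" .
qed

end

section \<open>Characters and Fourier spectra\<close>

definition ch :: "real ^ 'n \<Rightarrow> real ^ 'n \<Rightarrow> complex" where
  "ch \<mu> x = cis (2 * pi * (\<mu> \<bullet> x))"

lemma ch_add: "ch (\<mu> + \<nu>) x = ch \<mu> x * ch \<nu> x"
  by (simp add: ch_def inner_add_left distrib_left cis_mult)

lemma ch_minus: "ch (- \<mu>) x = cnj (ch \<mu> x)"
  by (simp add: ch_def cis_cnj)

lemma ch_zero [simp]: "ch 0 x = 1"
  by (simp add: ch_def)

lemma norm_ch [simp]: "norm (ch \<mu> x) = 1"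
  by (simp add: ch_def)

lemma ch_minus_mult: "ch (- \<mu>) x * ch \<mu> x = 1"
  using ch_add[of "- \<mu>" \<mu> x] by simp

lemma ch_power: "ch \<mu> x ^ n = ch (of_nat n *\<^sub>R \<mu>) x"
  by (induction n) (simp_all add: ch_add scaleR_add_left)

lemma ch_continuous: "continuous_on S (ch \<mu>)"
  unfolding ch_def[abs_def] by (intro continuous_intros)

inductive spec_poly :: "(real ^ 'n::finite) set \<Rightarrow> (real ^ 'n \<Rightarrow> complex) \<Rightarrow> bool" for A where
  zero: "spec_poly A (\<lambda>x. 0)"
| mono: "\<mu> \<in> A \<Longrightarrow> spec_poly A (\<lambda>x. a * ch \<mu> x)"
| add: "spec_poly A f \<Longrightarrow> spec_poly A g \<Longrightarrow> spec_poly A (\<lambda>x. f x + g x)"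

text \<open>Uniform limits take the place of Fourier series: only the set of possible frequencies is
  recorded, and under products these sets add.\<close>

definition spec_closure :: "(real ^ 'n::finite) set \<Rightarrow> (real ^ 'n \<Rightarrow> complex) \<Rightarrow> bool" where
  "spec_closure A f \<longleftrightarrow> (\<forall>e>0. \<exists>g. spec_poly A g \<and> (\<forall>x. norm (f x - g x) < e))"

lemma spec_poly_closure: "spec_poly A f \<Longrightarrow> spec_closure A f"
  unfolding spec_closure_def by (intro allI impI exI[of _ f]) simp

lemma spec_poly_bounded: "spec_poly A f \<Longrightarrow> \<exists>B. \<forall>x. norm (f x) \<le> B"
proof (induction rule: spec_poly.induct)
  case (mono \<mu> a)
  then show ?case by (intro exI[of _ "norm a"]) (simp add: norm_mult)
next
  case (add f g)
  then obtain B C where "\<forall>x. norm (f x) \<le> B" "\<forall>x. norm (g x) \<le> C" by blast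
  then show ?case by (intro exI[of _ "B + C"]) (meson add_mono norm_triangle_le)
qed (auto intro: exI[of _ 0])

lemma spec_closure_bounded: assumes "spec_closure A f" shows "\<exists>B>0. \<forall>x. norm (f x) \<le> B"
proof -
  obtain g where g: "spec_poly A g" "\<And>x. norm (f x - g x) < 1"
    using assms unfolding spec_closure_def by (metis zero_less_one)
  obtain B where B: "\<And>x. norm (g x) \<le> B" using spec_poly_bounded[OF g(1)] by blast
  have "norm (f x) \<le> \<bar>B\<bar> + 1" for x
    using norm_triangle_ineq[of "f x - g x" "g x"] g(2)[of x] B[of x] by simp
  then show ?thesis by (intro exI[of _ "\<bar>B\<bar> + 1"]) auto
qed

lemma spec_poly_mult:
  assumes "spec_poly A f" "spec_poly B g" "\<And>\<mu> \<nu>. \<mu> \<in> A \<Longrightarrow> \<nu> \<in> B \<Longrightarrow> \<mu> + \<nu> \<in> C"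
  shows "spec_poly C (\<lambda>x. f x * g x)"
  using assms(1)
proof (induction rule: spec_poly.induct)
  case zero
  then show ?case using spec_poly.zero by simp
next
  case (mono \<mu> a)
  from assms(2) show ?case
  proof (induction rule: spec_poly.induct)
    case zero
    then show ?case using spec_poly.zero by simp
  next
    case (mono \<nu> b)
    have "(\<lambda>x. a * ch \<mu> x * (b * ch \<nu> x)) = (\<lambda>x. (a * b) * ch (\<mu> + \<nu>) x)"
      by (simp add: fun_eq_iff ch_add)
    then show ?case using spec_poly.mono[OF assms(3)[OF \<open>\<mu> \<in> A\<close> mono], of "a * b"] by (simp only:)
  next
    case (add f g)
    then show ?case by (simp only: distrib_left spec_poly.add)
  qed
next
  case (add f g)
  then show ?case by (simp only: distrib_right spec_poly.add)
qed

lemma spec_closure_mult: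
  assumes "spec_closure A f" "spec_closure B g" "\<And>\<mu> \<nu>. \<mu> \<in> A \<Longrightarrow> \<nu> \<in> B \<Longrightarrow> \<mu> + \<nu> \<in> C"
  shows "spec_closure C (\<lambda>x. f x * g x)"
  unfolding spec_closure_def
proof (intro allI impI)
  fix e :: real assume e: "e > 0"
  obtain M where M: "M > 0" "\<And>x. norm (g x) \<le> M" using spec_closure_bounded[OF assms(2)] by blast
  have "e / (2 * M) > 0" using e M by simp
  then obtain f' where f': "spec_poly A f'" "\<And>x. norm (f x - f' x) < e / (2 * M)"
    using assms(1) unfolding spec_closure_def by blast
  obtain N where N: "N > 0" "\<And>x. norm (f' x) \<le> N" using spec_closure_bounded[OF spec_poly_closure[OF f'(1)]] by blast
  have "e / (2 * N) > 0" using e N by simp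
  then obtain g' where g': "spec_poly B g'" "\<And>x. norm (g x - g' x) < e / (2 * N)"
    using assms(2) unfolding spec_closure_def by blast
  have "norm (f x * g x - f' x * g' x) < e" for x
  proof -
    have "f x * g x - f' x * g' x = (f x - f' x) * g x + f' x * (g x - g' x)" by (simp add: algebra_simps)
    then have "norm (f x * g x - f' x * g' x) \<le> norm (f x - f' x) * norm (g x) + norm (f' x) * norm (g x - g' x)"
      by (metis norm_mult norm_triangle_ineq)
    also have "norm (f x - f' x) * norm (g x) \<le> norm (f x - f' x) * M" by (intro mult_left_mono M) simp
    also have "\<dots> < e / (2 * M) * M" by (intro mult_strict_right_mono f' M)
    also have "norm (f' x) * norm (g x - g' x) \<le> N * norm (g x - g' x)" by (intro mult_right_mono N) simp
    also have "\<dots> < N * (e / (2 * N))" by (intro mult_strict_left_mono g' N)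
    finally show ?thesis using M N by simp
  qed
  then show "\<exists>h. spec_poly C h \<and> (\<forall>x. norm (f x * g x - h x) < e)"
    using spec_poly_mult[OF f'(1) g'(1) assms(3)] by blast
qed

lemma spec_poly_comp:
  assumes "spec_poly A f" "\<And>\<mu> x. \<mu> \<in> A \<Longrightarrow> ch \<mu> (u x) = ch (w \<mu>) x"
  shows "spec_poly (w ` A) (\<lambda>x. f (u x))"
  using assms(1)
proof (induction rule: spec_poly.induct)
  case (mono \<mu> a)
  then show ?case using spec_poly.mono[of "w \<mu>" "w ` A" a] assms(2) by simp
qed (auto intro: spec_poly.zero spec_poly.add)

lemma spec_closure_comp:
  assumes "spec_closure A f" "\<And>\<mu> x. \<mu> \<in> A \<Longrightarrow> ch \<mu> (u x) = ch (w \<mu>) x"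
  shows "spec_closure (w ` A) (\<lambda>x. f (u x))"
  unfolding spec_closure_def
proof (intro allI impI)
  fix e :: real assume "e > 0"
  then obtain g where g: "spec_poly A g" "\<And>x. norm (f x - g x) < e"
    using assms(1) unfolding spec_closure_def by blast
  show "\<exists>h. spec_poly (w ` A) h \<and> (\<forall>x. norm (f (u x) - h x) < e)"
    using spec_poly_comp[OF g(1) assms(2)] g(2) by (intro exI[of _ "\<lambda>x. g (u x)"]) blast
qed

lemma spec_poly_continuous: "spec_poly A f \<Longrightarrow> continuous_on UNIV f"
  by (induction rule: spec_poly.induct) (auto intro!: continuous_on_add continuous_on_mult_left continuous_on_const ch_continuous)

lemma one_minus_t_ch_nonzero: "\<bar>t\<bar> < 1 \<Longrightarrow> 1 - complex_of_real t * ch \<mu> x \<noteq> 0"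
proof
  assume t: "\<bar>t\<bar> < 1" and "1 - complex_of_real t * ch \<mu> x = 0"
  then have "norm (complex_of_real t * ch \<mu> x) = 1" by (metis eq_iff_diff_eq_0 norm_one)
  then show False using t by (simp add: norm_mult)
qed

text \<open>The partial sums of the geometric series converge uniformly in x because \<bar>t\<bar> <
  1 and characters have modulus 1.\<close>

lemma spec_closure_geometric:
  assumes t: "\<bar>t\<bar> < 1"
  shows "spec_closure {of_int n *\<^sub>R \<beta> | n. n \<ge> 0} (\<lambda>x. 1 / (1 - of_real t * ch \<beta> x))"
  unfolding spec_closure_def
proof (intro allI impI)
  fix e :: real assume e: "e > 0"
  let ?A = "{of_int n *\<^sub>R \<beta> | n. n \<ge> 0}"
  have "(\<lambda>J. \<bar>t\<bar> ^ J) \<longlonglongrightarrow> 0" using t by (intro LIMSEQ_realpow_zero) auto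
  moreover have "e * (1 - \<bar>t\<bar>) > 0" using e t by simp
  ultimately obtain J where J: "\<bar>t\<bar> ^ J < e * (1 - \<bar>t\<bar>)"
    by (metis (no_types, lifting) LIMSEQ_D abs_ge_zero diff_zero order_refl power_abs real_norm_def abs_of_nonneg zero_le_power)
  define g where "g x = (\<Sum>j<J. (of_real t * ch \<beta> x) ^ j)" for x
  have "spec_poly ?A (\<lambda>x. \<Sum>j\<in>S. (of_real t * ch \<beta> x) ^ j)" if "finite S" for S
    using that
  proof (induction S)
    case empty
    then show ?case using spec_poly.zero by simp
  next
    case (insert j S)
    have "(of_real t * ch \<beta> x) ^ j = of_real t ^ j * ch (of_int (int j) *\<^sub>R \<beta>) x" for x
      by (simp add: power_mult_distrib ch_power)
    moreover have "spec_poly ?A (\<lambda>x. of_real t ^ j * ch (of_int (int j) *\<^sub>R \<beta>) x)"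
      by (rule spec_poly.mono, rule CollectI, rule exI[of _ "int j"]) simp
    ultimately have "spec_poly ?A (\<lambda>x. (of_real t * ch \<beta> x) ^ j)" by (simp only:)
    then show ?case using insert by (simp add: spec_poly.add)
  qed
  then have "spec_poly ?A g" unfolding g_def by blast
  moreover have "norm (1 / (1 - of_real t * ch \<beta> x) - g x) < e" for x
  proof -
    define z where "z = of_real t * ch \<beta> x"
    have nz: "1 - z \<noteq> 0" unfolding z_def by (rule one_minus_t_ch_nonzero[OF t])
    have z: "norm z = \<bar>t\<bar>" by (simp add: z_def norm_mult)
    have "(1 - z) * g x = 1 - z ^ J"
      unfolding g_def z_def[symmetric] using one_diff_power_eq[of z J] by simp
    then have "1 / (1 - z) - g x = z ^ J / (1 - z)" using nz by (simp add: field_simps)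
    then have "norm (1 / (1 - z) - g x) = \<bar>t\<bar> ^ J / norm (1 - z)" by (simp add: norm_divide norm_power z)
    also have "\<dots> \<le> \<bar>t\<bar> ^ J / (1 - \<bar>t\<bar>)"
    proof (rule divide_left_mono)
      show "1 - \<bar>t\<bar> \<le> norm (1 - z)" using norm_triangle_ineq2[of 1 z] z by simp
      then show "0 < norm (1 - z) * (1 - \<bar>t\<bar>)" using t by (intro mult_pos_pos) linarith+
    qed simp
    also have "\<dots> < e" using J t by (simp add: divide_less_eq)
    finally show ?thesis by (simp add: z_def)
  qed
  ultimately show "\<exists>g. spec_poly ?A g \<and> (\<forall>x. norm (1 / (1 - of_real t * ch \<beta> x) - g x) < e)" by blast
qed

text \<open>The numerator lowers the frequency by at most one multiple of \<beta>, and the geometric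
  series only raises it; hence the bound - 1.\<close>

lemma spec_closure_ratio:
  assumes t: "\<bar>t\<bar> < 1"
  shows "spec_closure {of_int n *\<^sub>R \<beta> | n. n \<ge> - 1} (\<lambda>x. (1 - of_real t * ch (- \<beta>) x) / (1 - of_real t * ch \<beta> x))"
proof -
  let ?B = "{of_int n *\<^sub>R \<beta> | n. n = 0 \<or> n = (- 1 :: int)}"
  have "spec_poly ?B (\<lambda>x. 1 * ch (of_int 0 *\<^sub>R \<beta>) x + (- of_real t) * ch (of_int (- 1) *\<^sub>R \<beta>) x)"
    by (intro spec_poly.add spec_poly.mono) blast+
  then have B: "spec_closure ?B (\<lambda>x. 1 - of_real t * ch (- \<beta>) x)" by (intro spec_poly_closure) simp
  have "spec_closure {of_int n *\<^sub>R \<beta> | n. n \<ge> - 1} (\<lambda>x. (1 - of_real t * ch (- \<beta>) x) * (1 / (1 - of_real t * ch \<beta> x)))"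
  proof (rule spec_closure_mult[OF B spec_closure_geometric[OF t]])
    fix \<mu> \<nu> assume "\<mu> \<in> ?B" "\<nu> \<in> {of_int n *\<^sub>R \<beta> | n. n \<ge> 0}"
    then obtain m n :: int where "\<mu> = of_int m *\<^sub>R \<beta>" "m = 0 \<or> m = -1" "\<nu> = of_int n *\<^sub>R \<beta>" "n \<ge> 0" by blast
    then show "\<mu> + \<nu> \<in> {of_int n *\<^sub>R \<beta> | n. n \<ge> - 1}"
      by (intro CollectI exI[of _ "m + n"]) (auto simp: scaleR_add_left)
  qed
  then show ?thesis by simp
qed

lemma spec_closure_one: "0 \<in> A \<Longrightarrow> spec_closure A (\<lambda>x. 1)"
  using spec_poly_closure[OF spec_poly.mono[of 0 A 1]] by simp

lemma spec_closure_ratio_power: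
  assumes t: "\<bar>t\<bar> < 1"
  shows "spec_closure {of_int n *\<^sub>R \<beta> | n. n \<ge> - int j}
    (\<lambda>x. ((1 - of_real t * ch (- \<beta>) x) / (1 - of_real t * ch \<beta> x)) ^ j)"
proof (induction j)
  case 0
  have "spec_closure {of_int n *\<^sub>R \<beta> | n. n \<ge> - int 0} (\<lambda>x. 1)"
    by (rule spec_closure_one, rule CollectI, rule exI[of _ 0]) simp
  then show ?case by simp
next
  case (Suc j)
  have "spec_closure {of_int n *\<^sub>R \<beta> | n. n \<ge> - int (Suc j)} (\<lambda>x. (1 - of_real t * ch (- \<beta>) x) / (1 - of_real t * ch \<beta> x) *
      ((1 - of_real t * ch (- \<beta>) x) / (1 - of_real t * ch \<beta> x)) ^ j)"
  proof (rule spec_closure_mult[OF spec_closure_ratio[OF t] Suc])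
    fix \<mu> \<nu> assume "\<mu> \<in> {of_int n *\<^sub>R \<beta> | n. n \<ge> - 1}" "\<nu> \<in> {of_int n *\<^sub>R \<beta> | n. n \<ge> - int j}"
    then obtain m n :: int where "\<mu> = of_int m *\<^sub>R \<beta>" "m \<ge> -1" "\<nu> = of_int n *\<^sub>R \<beta>" "n \<ge> - int j" by blast
    then show "\<mu> + \<nu> \<in> {of_int n *\<^sub>R \<beta> | n. n \<ge> - int (Suc j)}"
      by (intro CollectI exI[of _ "m + n"]) (auto simp: scaleR_add_left)
  qed
  then show ?case by (simp only: power_Suc)
qed

text \<open>The multiples \<open>n \<beta>\<close> that can occur in the Fourier expansion of the \<open>e\<close>-th power of
  \<open>(1 - t exp (- \<beta>)) / (1 - t exp \<beta>)\<close>.\<close>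
definition exponents_ok :: "int \<Rightarrow> int \<Rightarrow> bool" where
  "exponents_ok e n \<longleftrightarrow> (e > 0 \<longrightarrow> n \<ge> - e) \<and> (e < 0 \<longrightarrow> n \<le> - e) \<and> (e = 0 \<longrightarrow> n = 0)"

lemma spec_closure_mono:
  assumes "spec_closure A f" "A \<subseteq> B" shows "spec_closure B f"
proof -
  have "spec_poly B g" if "spec_poly A g" for g
    using that assms(2) by (induction rule: spec_poly.induct) (auto intro: spec_poly.intros)
  then show ?thesis using assms(1) unfolding spec_closure_def by meson
qed

lemma spec_closure_ratio_powi:
  assumes t: "\<bar>t\<bar> < 1"
  shows "spec_closure {of_int n *\<^sub>R \<beta> | n. exponents_ok e n}
    (\<lambda>x. ((1 - of_real t * ch (- \<beta>) x) / (1 - of_real t * ch \<beta> x)) powi e)"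
proof -
  consider "e = 0" | "e > 0" | "e < 0" by linarith
  then show ?thesis
  proof cases
    case 1
    have "spec_closure {of_int n *\<^sub>R \<beta> | n. exponents_ok e n} (\<lambda>x. 1)"
      by (rule spec_closure_one, rule CollectI, rule exI[of _ 0]) (simp add: 1 exponents_ok_def)
    then show ?thesis using 1 by simp
  next
    case 2
    then have e: "e = int (nat e)" by simp
    have "spec_closure {of_int n *\<^sub>R \<beta> | n. exponents_ok e n} (\<lambda>x. ((1 - of_real t * ch (- \<beta>) x) / (1 - of_real t * ch \<beta> x)) ^ nat e)"
      by (rule spec_closure_mono[OF spec_closure_ratio_power[OF t]]) (use 2 in \<open>auto simp: exponents_ok_def\<close>)
    then show ?thesis by (subst e) (simp only: power_int_of_nat)
  next
    case 3
    \<comment> \<open>A negative exponent inverts the ratio, which exchanges \<beta> and - \<beta>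
      and turns the lower bound into an upper one.\<close>
    then have e: "e = - int (nat (- e))" by simp
    have "{of_int n *\<^sub>R (- \<beta>) | n. n \<ge> - int (nat (- e))} \<subseteq> {of_int n *\<^sub>R \<beta> | n. exponents_ok e n}"
    proof
      fix \<mu> assume "\<mu> \<in> {of_int n *\<^sub>R (- \<beta>) | n. n \<ge> - int (nat (- e))}"
      then obtain n :: int where "\<mu> = of_int n *\<^sub>R (- \<beta>)" "n \<ge> - int (nat (- e))" by blast
      then show "\<mu> \<in> {of_int n *\<^sub>R \<beta> | n. exponents_ok e n}"
        using 3 by (intro CollectI exI[of _ "- n"]) (auto simp: exponents_ok_def)
    qed
    from spec_closure_mono[OF spec_closure_ratio_power[OF t] this]
    have s: "spec_closure {of_int n *\<^sub>R \<beta> | n. exponents_ok e n}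
       (\<lambda>x. ((1 - of_real t * ch \<beta> x) / (1 - of_real t * ch (- \<beta>) x)) ^ nat (- e))" by simp
    have "((1 - of_real t * ch (- \<beta>) x) / (1 - of_real t * ch \<beta> x)) powi e
      = ((1 - of_real t * ch \<beta> x) / (1 - of_real t * ch (- \<beta>) x)) ^ nat (- e)" for x
      by (subst e) (simp only: power_int_minus power_int_of_nat power_inverse[symmetric] inverse_divide)
    then show ?thesis using s by (simp only:)
  qed
qed

lemma spec_closure_prod:
  assumes t: "\<bar>t\<bar> < 1" and "finite S"
  shows "spec_closure {\<Sum>\<beta>\<in>S. of_int (n \<beta>) *\<^sub>R \<beta> | n. \<forall>\<beta>\<in>S. exponents_ok (e \<beta>) (n \<beta>)}
    (\<lambda>x. \<Prod>\<beta>\<in>S. ((1 - of_real t * ch (- \<beta>) x) / (1 - of_real t * ch \<beta> x)) powi (e \<beta>))"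
  using assms(2)
proof (induction S)
  case empty
  have "spec_closure {\<Sum>\<beta>\<in>{}. of_int (n \<beta>) *\<^sub>R \<beta> | n. \<forall>\<beta>\<in>{}. exponents_ok (e \<beta>) (n \<beta>)} (\<lambda>x. 1)"
    by (rule spec_closure_one) simp
  then show ?case by simp
next
  case (insert \<gamma> S)
  let ?C = "{\<Sum>\<beta>\<in>insert \<gamma> S. of_int (n \<beta>) *\<^sub>R \<beta> | n. \<forall>\<beta>\<in>insert \<gamma> S. exponents_ok (e \<beta>) (n \<beta>)}"
  have "spec_closure ?C (\<lambda>x. ((1 - of_real t * ch (- \<gamma>) x) / (1 - of_real t * ch \<gamma> x)) powi (e \<gamma>) *
     (\<Prod>\<beta>\<in>S. ((1 - of_real t * ch (- \<beta>) x) / (1 - of_real t * ch \<beta> x)) powi (e \<beta>)))"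
  proof (rule spec_closure_mult[OF spec_closure_ratio_powi[OF t] insert.IH])
    fix \<mu> \<nu> assume "\<mu> \<in> {of_int n *\<^sub>R \<gamma> | n. exponents_ok (e \<gamma>) n}"
      "\<nu> \<in> {\<Sum>\<beta>\<in>S. of_int (n \<beta>) *\<^sub>R \<beta> | n. \<forall>\<beta>\<in>S. exponents_ok (e \<beta>) (n \<beta>)}"
    then obtain m n where mn: "\<mu> = of_int m *\<^sub>R \<gamma>" "exponents_ok (e \<gamma>) m"
      "\<nu> = (\<Sum>\<beta>\<in>S. of_int (n \<beta>) *\<^sub>R \<beta>)" "\<forall>\<beta>\<in>S. exponents_ok (e \<beta>) (n \<beta>)" by blast
    have "(\<Sum>\<beta>\<in>S. of_int ((n(\<gamma> := m)) \<beta>) *\<^sub>R \<beta>) = \<nu>"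
      unfolding mn(3) using insert.hyps by (intro sum.cong HOL.refl) auto
    then have "\<mu> + \<nu> = (\<Sum>\<beta>\<in>insert \<gamma> S. of_int ((n(\<gamma> := m)) \<beta>) *\<^sub>R \<beta>)"
      using insert.hyps mn(1) by simp
    moreover have "\<forall>\<beta>\<in>insert \<gamma> S. exponents_ok (e \<beta>) ((n(\<gamma> := m)) \<beta>)"
      using mn insert.hyps by auto
    ultimately show "\<mu> + \<nu> \<in> ?C" by blast
  qed
  then show ?case using insert.hyps by simp
qed

section \<open>Frequencies of the terms of the integrand\<close>

context bethe
begin

text \<open>A nonzero weight is a nonzero integer vector in coroot coordinates, so its character
  integrates to zero over the cube; uniform limits inherit this.\<close>

lemma integral_spec_zero:
  assumes "spec_closure A f" "A \<subseteq> weights G" "0 \<notin> A" "continuous_on UNIV f"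
  shows "integral cube (\<lambda>s. f (of_coords s)) = 0"
proof (rule ccontr)
  assume nz: "integral cube (\<lambda>s. f (of_coords s)) \<noteq> 0"
  have of_coords: "continuous_on UNIV of_coords"
    using linear_Lc by (auto intro: linear_continuous_on simp: linear_conv_bounded_linear)
  have poly: "integral cube (\<lambda>s. g (of_coords s)) = 0" if "spec_poly A g" for g
    using that
  proof (induction rule: spec_poly.induct)
    case (mono \<mu> a)
    define m :: "real ^ 'n idx" where "m = (\<chi> j. \<mu> \<bullet> scoroot (idx_enum j))"
    have ms: "m \<bullet> s = \<mu> \<bullet> of_coords s" for s
    proof -
      have "m \<bullet> s = (\<Sum>i\<in>UNIV. m $ i * s $ i)" unfolding inner_vec_def by simp
      then show ?thesis by (simp add: m_def of_coords_def inner_sum_right mult_ac)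
    qed
    have w: "\<mu> \<in> weights G" "\<mu> \<noteq> 0" using mono assms by auto
    then have "m \<in> int_vecs" unfolding int_vecs_def m_def using scoroot_Q by (auto simp: weights_iff)
    moreover have "m \<noteq> 0"
    proof
      assume "m = 0"
      then have "\<mu> \<bullet> of_coords (to_coords \<mu>) = 0" using ms[of "to_coords \<mu>"] by simp
      then show False using w by simp
    qed
    ultimately have "integral cube (\<lambda>s. ch \<mu> (of_coords s)) = 0"
      using integral_cube_character[of m] by (simp add: ch_def ms)
    then show ?case by simp
  next
    case (add f g)
    have "(\<lambda>s. f (of_coords s)) integrable_on cube" "(\<lambda>s. g (of_coords s)) integrable_on cube"
      by (intro continuous_integrable cube_lmeasurable continuous_on_compose2[OF spec_poly_continuous[OF add.hyps(1)] of_coords]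
          continuous_on_compose2[OF spec_poly_continuous[OF add.hyps(2)] of_coords]; simp)+
    then show ?case using add.IH by (simp add: integral_add)
  qed simp
  define M where "M = integral cube (\<lambda>_::real ^ 'n idx. 1::real)"
  have M: "M \<ge> 0" unfolding M_def by (rule integral_nonneg[OF integrable_on_const[OF cube_lmeasurable(1)]]) simp
  define e where "e = norm (integral cube (\<lambda>s. f (of_coords s))) / (2 * (M + 1))"
  have e: "e > 0" using nz M by (simp add: e_def)
  obtain g where g: "spec_poly A g" "\<And>x. norm (f x - g x) < e" using assms(1) e unfolding spec_closure_def by blast
  have i1: "(\<lambda>s. f (of_coords s)) integrable_on cube"
    by (intro continuous_integrable cube_lmeasurable continuous_on_compose2[OF assms(4) of_coords]) simp
  have i2: "(\<lambda>s. g (of_coords s)) integrable_on cube"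
    by (intro continuous_integrable cube_lmeasurable continuous_on_compose2[OF spec_poly_continuous[OF g(1)] of_coords]) simp
  have "norm (integral cube (\<lambda>s. f (of_coords s) - g (of_coords s))) \<le> integral cube (\<lambda>_::real ^ 'n idx. e)"
    by (rule integral_norm_bound_integral[OF integrable_diff[OF i1 i2] integrable_on_const[OF cube_lmeasurable(1)]])
       (use g(2) less_imp_le in blast)
  also have "\<dots> = e * M" unfolding M_def using integral_mult_right[of cube e "\<lambda>_::real ^ 'n idx. 1::real"] by simp
  finally have "norm (integral cube (\<lambda>s. f (of_coords s))) \<le> e * M"
    using integral_diff[OF i1 i2] poly[OF g(1)] by simp
  also have "\<dots> < e * (2 * (M + 1))" using e M by (intro mult_strict_left_mono) auto
  also have "\<dots> = norm (integral cube (\<lambda>s. f (of_coords s)))" using M by (simp add: e_def)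
  finally show False by simp
qed

definition deform_factor :: "real ^ 'n \<Rightarrow> real ^ 'n \<Rightarrow> complex" where
  "deform_factor \<beta> x = 1 - of_real t * ch \<beta> x"

lemma deform_factor_nonzero: "deform_factor \<beta> x \<noteq> 0"
  unfolding deform_factor_def by (rule one_minus_t_ch_nonzero[OF t_less_one])

lemma deform_factor_continuous: "continuous_on S (deform_factor \<beta>)"
  unfolding deform_factor_def[abs_def] by (intro continuous_intros ch_continuous)

lemma deform_factor_minus: "deform_factor (- \<beta>) x = cnj (deform_factor \<beta> x)"
  by (simp add: deform_factor_def ch_minus)

lemma ch_W: "w \<in> W \<Longrightarrow> ch (w \<mu>) (w x) = ch \<mu> x" and ch_W_inv: "w \<in> W \<Longrightarrow> ch \<mu> (inv w x) = ch (w \<mu>) x"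
  using W_inner_inv[of w \<mu> x] by (simp_all add: ch_def W_inner)

lemma bethe_phase:
  assumes "y \<in> Q"
  shows "cis (2 * pi * (kap * (y \<bullet> Phi x))) = ch (kap *\<^sub>R y) x * (\<Prod>\<alpha>\<in>P. (deform_factor (- \<alpha>) x / deform_factor \<alpha> x) powi \<lfloor>\<alpha> \<bullet> y\<rfloor>)"
proof -
  have "te x \<alpha> = ch \<alpha> x" "te x (- \<alpha>) = ch (- \<alpha>) x" if "\<alpha> \<in> P" for \<alpha>
    using te_root[of \<alpha> x] te_root[of "- \<alpha>" x] P_R[OF that] by (simp_all add: ch_def)
  then have "(\<Prod>\<alpha>\<in>P. ((1 - of_real t * te x (- \<alpha>)) / (1 - of_real t * te x \<alpha>)) powi \<lfloor>\<alpha> \<bullet> y\<rfloor>)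
      = (\<Prod>\<alpha>\<in>P. (deform_factor (- \<alpha>) x / deform_factor \<alpha> x) powi \<lfloor>\<alpha> \<bullet> y\<rfloor>)"
    by (intro prod.cong HOL.refl) (simp add: deform_factor_def)
  moreover have "cis (2 * pi * (kap * (x \<bullet> y))) = ch (kap *\<^sub>R y) x" by (simp add: ch_def inner_commute)
  ultimately show ?thesis using bethe_lhs[OF assms, of x] by (simp add: inner_commute)
qed

text \<open>Up to the action of \<open>w\<close>, the term of the expanded integrand that belongs to a pair \<open>(w, w')\<close>
  of Weyl group elements is \<open>orbit_term\<close> for \<open>u\<close> the quotient of \<open>w'\<close> by \<open>w\<close>.\<close>
definition orbit_term :: "real ^ 'n \<Rightarrow> real ^ 'n \<Rightarrow> (real ^ 'n \<Rightarrow> real ^ 'n) \<Rightarrow> real ^ 'n \<Rightarrow> real ^ 'n \<Rightarrow> complex" where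
  "orbit_term \<mu> \<nu> u y x = ch (\<mu> + rho - u (\<nu> + rho)) x * (\<Prod>\<alpha>\<in>P. deform_factor (- \<alpha>) x) / (\<Prod>\<alpha>\<in>P. deform_factor (- u \<alpha>) x)
     * cis (2 * pi * (kap * (y \<bullet> Phi x)))"

text \<open>In the quotient of the two products of \<open>deform_factor\<close> the factors at
  noninversions cancel, and each inversion leaves one ratio, which adds 1 to the exponent that comes
  from the phase.\<close>

lemma orbit_term_product:
  assumes "u \<in> W" "y \<in> Q"
  shows "orbit_term \<mu> \<nu> u y x = ch (\<mu> + rho - u (\<nu> + rho) + kap *\<^sub>R y) x *
    (\<Prod>\<alpha>\<in>P. (deform_factor (- \<alpha>) x / deform_factor \<alpha> x) powi (\<lfloor>\<alpha> \<bullet> y\<rfloor> + (if inv u \<alpha> \<in> P then 0 else 1)))"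
proof -
  have "(\<Prod>\<alpha>\<in>P. deform_factor (- u \<alpha>) x) = (\<Prod>\<alpha>\<in>P. if inv u \<alpha> \<in> P then deform_factor (- \<alpha>) x else deform_factor \<alpha> x)"
    by (subst prod_W_pos[OF assms(1), of "\<lambda>\<alpha>. deform_factor (- \<alpha>) x"]) (intro prod.cong HOL.refl, simp)
  then have "(\<Prod>\<alpha>\<in>P. deform_factor (- \<alpha>) x) / (\<Prod>\<alpha>\<in>P. deform_factor (- u \<alpha>) x)
      = (\<Prod>\<alpha>\<in>P. (deform_factor (- \<alpha>) x / deform_factor \<alpha> x) powi (if inv u \<alpha> \<in> P then 0 else 1))"
    by (simp only: prod_dividef[symmetric]) (intro prod.cong HOL.refl, simp add: deform_factor_nonzero)
  then show ?thesis
    unfolding orbit_term_def bethe_phase[OF assms(2)] times_divide_eq_right[symmetric]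
    by (simp add: ch_add power_int_add deform_factor_nonzero prod.distrib mult_ac)
qed

lemma orbit_term_continuous: "continuous_on UNIV (orbit_term \<mu> \<nu> u y)"
  unfolding orbit_term_def[abs_def]
  by (intro continuous_intros ch_continuous deform_factor_continuous continuous_on_compose2[OF ch_continuous] has_derivative_continuous_on[OF Phi_deriv[THEN has_derivative_at_withinI]])
     (simp add: deform_factor_nonzero)

text \<open>A frequency 0 would have to attain the bounds on all multiples of roots at once, and
  this would identify \<mu> and \<nu> modulo the affine Weyl group at level k.\<close>

lemma orbit_term_spectrum:
  assumes "\<mu> \<in> \<Lambda> k" "\<nu> \<in> \<Lambda> k" "\<mu> \<noteq> \<nu>" "u \<in> W" "y \<in> Q"
  shows "\<exists>A. spec_closure A (orbit_term \<mu> \<nu> u y) \<and> A \<subseteq> weights G \<and> 0 \<notin> A"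
proof -
  define e where "e \<alpha> = \<lfloor>\<alpha> \<bullet> y\<rfloor> + (if inv u \<alpha> \<in> P then 0 else 1)" for \<alpha>
  define \<nu>0 where "\<nu>0 = \<mu> + rho - u (\<nu> + rho) + kap *\<^sub>R y"
  define B where "B = {\<Sum>\<beta>\<in>P. of_int (n \<beta>) *\<^sub>R \<beta> | n. \<forall>\<beta>\<in>P. exponents_ok (e \<beta>) (n \<beta>)}"
  define A where "A = {\<nu>0 + \<beta> | \<beta>. \<beta> \<in> B}"
  have "spec_closure {\<nu>0} (\<lambda>x. 1 * ch \<nu>0 x)" by (intro spec_poly_closure spec_poly.mono) simp
  moreover have "spec_closure B (\<lambda>x. \<Prod>\<alpha>\<in>P. (deform_factor (- \<alpha>) x / deform_factor \<alpha> x) powi e \<alpha>)"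
    unfolding B_def deform_factor_def by (rule spec_closure_prod[OF t_less_one finite_P])
  ultimately have "spec_closure A (\<lambda>x. 1 * ch \<nu>0 x * (\<Prod>\<alpha>\<in>P. (deform_factor (- \<alpha>) x / deform_factor \<alpha> x) powi e \<alpha>))"
    by (rule spec_closure_mult) (auto simp: A_def)
  then have s: "spec_closure A (orbit_term \<mu> \<nu> u y)"
    unfolding orbit_term_product[OF assms(4,5), abs_def] e_def \<nu>0_def by simp
  obtain K where K: "kap = of_nat K" using kap_nat by blast
  have "\<nu>0 \<in> weights G"
    unfolding \<nu>0_def K using level_weightsD(1)[OF assms(1)] level_weightsD(1)[OF assms(2)] weight_rho Q_weight[OF assms(5)]
    by (intro weight_add weight_diff weight_scale_nat weight_W[OF assms(4)]) auto
  moreover have "\<beta> \<in> weights G" if "\<beta> \<in> B" for \<beta>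
  proof -
    have "(\<Sum>\<beta>\<in>S. of_int (n \<beta>) *\<^sub>R \<beta>) \<in> weights G" if "finite S" "S \<subseteq> P" for S n
      using that by (induction S) (auto intro: weight_zero weight_add weight_scale_int weight_root P_R)
    then show ?thesis using that finite_P unfolding B_def by blast
  qed
  ultimately have w: "A \<subseteq> weights G" unfolding A_def using weight_add by blast
  have "0 \<notin> A"
  proof
    assume "0 \<in> A"
    then obtain n where n: "0 = \<nu>0 + (\<Sum>\<beta>\<in>P. of_int (n \<beta>) *\<^sub>R \<beta>)" "\<forall>\<beta>\<in>P. exponents_ok (e \<beta>) (n \<beta>)"
      unfolding A_def B_def by blast
    \<comment> \<open>With this sign, \<alpha> lies between \<open>- e \<alpha>\<close> and
      \<open>- e \<alpha> + 1\<close> on the image of the open alcove under x -> u x + z, for every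
      positive root \<alpha>.\<close>
    define z where "z = - y"
    have z: "z \<in> Q" unfolding z_def by (rule Q_minus[OF assms(5)])
    define \<xi> where "\<xi> = u rho_point + z - rho_point"
    have e_eq: "- real_of_int (e \<alpha>) = \<alpha> \<bullet> z - (if inv u \<alpha> \<in> P then 0 else 1)" if "\<alpha> \<in> P" for \<alpha>
    proof -
      have "of_int \<lfloor>\<alpha> \<bullet> y\<rfloor> = \<alpha> \<bullet> y" using root_Q_int[OF P_R[OF that] assms(5)] by simp
      then show ?thesis by (simp add: e_def z_def)
    qed
    have top: "(\<Sum>\<alpha>\<in>P. (- real_of_int (e \<alpha>)) *\<^sub>R \<alpha>) = u rho + h *\<^sub>R z - rho"
      using sum_affine_heights[OF assms(4) z] e_eq by (simp cong: sum.cong)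
    have top2: "\<nu>0 + (\<Sum>\<alpha>\<in>P. (- real_of_int (e \<alpha>)) *\<^sub>R \<alpha>) = - (u \<nu> + real k *\<^sub>R z - \<mu>)"
      unfolding top \<nu>0_def z_def by (simp add: W_add[OF assms(4)] scaleR_add_left)
    \<comment> \<open>On \<open>rho_point\<close> the value of \<alpha> has integer part 0, on its
      image \<open>- e \<alpha>\<close>; if the latter is not 0 it fixes the sign of \<alpha> on the
      displacement \<xi>.\<close>
    have sgn: "(e \<alpha> < 0 \<longrightarrow> \<alpha> \<bullet> \<xi> > 0) \<and> (e \<alpha> > 0 \<longrightarrow> \<alpha> \<bullet> \<xi> < 0)" if a: "\<alpha> \<in> P" for \<alpha>
    proof -
      have r: "0 < \<alpha> \<bullet> rho_point" "\<alpha> \<bullet> rho_point < 1" using rho_point_alcove a by (auto simp: alcove_def)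
      have eq: "\<alpha> \<bullet> \<xi> = inv u \<alpha> \<bullet> rho_point + \<alpha> \<bullet> z - \<alpha> \<bullet> rho_point"
        using W_inner_inv[OF assms(4), of rho_point \<alpha>] by (simp add: \<xi>_def inner_diff_right inner_add_right inner_commute)
      show ?thesis
      proof (cases "inv u \<alpha> \<in> P")
        case True
        then have "0 < inv u \<alpha> \<bullet> rho_point" "inv u \<alpha> \<bullet> rho_point < 1" using rho_point_alcove by (auto simp: alcove_def)
        moreover have "\<alpha> \<bullet> z = - real_of_int (e \<alpha>)" using e_eq[OF a] True by simp
        moreover have "e \<alpha> < 0 \<Longrightarrow> - real_of_int (e \<alpha>) \<ge> 1" "e \<alpha> > 0 \<Longrightarrow> - real_of_int (e \<alpha>) \<le> -1" by linarith+
        ultimately show ?thesis using r eq by auto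
      next
        case False
        then have "- inv u \<alpha> \<in> P" using P_or_uminus_P[OF W_R[OF W_inv[OF assms(4)] P_R[OF a]]] by blast
        then have "0 < - inv u \<alpha> \<bullet> rho_point \<and> - inv u \<alpha> \<bullet> rho_point < 1" using rho_point_alcove unfolding alcove_def by blast
        moreover have "\<alpha> \<bullet> z = 1 - real_of_int (e \<alpha>)" using e_eq[OF a] False by simp
        moreover have "e \<alpha> < 0 \<Longrightarrow> - real_of_int (e \<alpha>) \<ge> 1" "e \<alpha> > 0 \<Longrightarrow> - real_of_int (e \<alpha>) \<le> -1" by linarith+
        ultimately show ?thesis using r eq by auto
      qed
    qed
    have le: "of_int (n \<alpha>) * (\<alpha> \<bullet> \<xi>) \<le> - real_of_int (e \<alpha>) * (\<alpha> \<bullet> \<xi>)" if a: "\<alpha> \<in> P" for \<alpha>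
    proof -
      have ok: "exponents_ok (e \<alpha>) (n \<alpha>)" using n(2) a by blast
      consider "e \<alpha> = 0" | "e \<alpha> > 0" | "e \<alpha> < 0" by linarith
      then show ?thesis
      proof cases
        case 1
        then show ?thesis using ok by (simp add: exponents_ok_def)
      next
        case 2
        then have "n \<alpha> \<ge> - e \<alpha>" using ok by (simp add: exponents_ok_def)
        then have "real_of_int (n \<alpha>) \<ge> - real_of_int (e \<alpha>)" by linarith
        then show ?thesis using sgn[OF a] 2 by (intro mult_right_mono_neg) auto
      next
        case 3
        then have "n \<alpha> \<le> - e \<alpha>" using ok by (simp add: exponents_ok_def)
        then have "real_of_int (n \<alpha>) \<le> - real_of_int (e \<alpha>)" by linarith
        then show ?thesis using sgn[OF a] 3 by (intro mult_right_mono) auto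
      qed
    qed
    have "0 = \<nu>0 \<bullet> \<xi> + (\<Sum>\<alpha>\<in>P. of_int (n \<alpha>) * (\<alpha> \<bullet> \<xi>))"
      using arg_cong[OF n(1), of "\<lambda>x. x \<bullet> \<xi>"] by (simp add: inner_add_left inner_sum_left)
    moreover have "\<nu>0 \<bullet> \<xi> + (\<Sum>\<alpha>\<in>P. - real_of_int (e \<alpha>) * (\<alpha> \<bullet> \<xi>)) \<le> 0"
      using arg_cong[OF top2, of "\<lambda>x. x \<bullet> \<xi>"] level_weight_inner_nonneg[OF assms(1,2,4) z]
      by (simp only: inner_add_left inner_sum_left inner_scaleR_left inner_minus_left \<xi>_def[symmetric])
    moreover have "(\<Sum>\<alpha>\<in>P. of_int (n \<alpha>) * (\<alpha> \<bullet> \<xi>)) \<le> (\<Sum>\<alpha>\<in>P. - real_of_int (e \<alpha>) * (\<alpha> \<bullet> \<xi>))"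
      by (intro sum_mono le)
    \<comment> \<open>The total is 0, while its upper bound at the extreme multiples is at most 0.
      So equality holds in the sum, and then in every term.\<close>
    ultimately have eqs: "(\<Sum>\<alpha>\<in>P. of_int (n \<alpha>) * (\<alpha> \<bullet> \<xi>)) = (\<Sum>\<alpha>\<in>P. - real_of_int (e \<alpha>) * (\<alpha> \<bullet> \<xi>))" by linarith
    have each: "of_int (n \<alpha>) * (\<alpha> \<bullet> \<xi>) = - real_of_int (e \<alpha>) * (\<alpha> \<bullet> \<xi>)" if "\<alpha> \<in> P" for \<alpha>
      using sum_mono_inv[OF eqs le that finite_P] .
    have ne: "real_of_int (n \<alpha>) = - real_of_int (e \<alpha>)" if a: "\<alpha> \<in> P" for \<alpha>
    proof (cases "e \<alpha> = 0")
      case True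
      then show ?thesis using n(2) a by (simp add: exponents_ok_def)
    next
      case False
      then have nz: "\<alpha> \<bullet> \<xi> \<noteq> 0" using sgn[OF a] by fastforce
      show ?thesis by (rule mult_right_cancel[OF nz, THEN iffD1, OF each[OF a]])
    qed
    have "(\<Sum>\<alpha>\<in>P. of_int (n \<alpha>) *\<^sub>R \<alpha>) = (\<Sum>\<alpha>\<in>P. (- real_of_int (e \<alpha>)) *\<^sub>R \<alpha>)"
      by (intro sum.cong HOL.refl) (simp only: ne)
    then have "- (u \<nu> + real k *\<^sub>R z - \<mu>) = 0" using n(1) top2 by metis
    then have "u \<nu> + real k *\<^sub>R z = \<mu>" by simp
    then show False using level_weight_unique[OF assms(1,2,4) z] assms(3) by blast
  qed
  then show ?thesis using s w by blast
qed

end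

section \<open>Weyl numerators\<close>

text \<open>Artin's argument: subtracting a multiple of the relation from its translate by q removes
  the index j. The relation is assumed on L only, and closure of L under addition is what permits
  the translation.\<close>

lemma characters_independent:
  fixes \<psi> :: "'i \<Rightarrow> 'a::ab_group_add \<Rightarrow> complex"
  assumes "finite I" and L: "0 \<in> L" "\<And>p q. p \<in> L \<Longrightarrow> q \<in> L \<Longrightarrow> p + q \<in> L"
    and mult: "\<And>i p q. \<psi> i (p + q) = \<psi> i p * \<psi> i q" and one: "\<And>i. \<psi> i 0 = 1"
    and distinct: "\<And>i j. i \<in> I \<Longrightarrow> j \<in> I \<Longrightarrow> i \<noteq> j \<Longrightarrow> \<exists>p\<in>L. \<psi> i p \<noteq> \<psi> j p"
    and zero: "\<And>p. p \<in> L \<Longrightarrow> (\<Sum>i\<in>I. c i * \<psi> i p) = 0"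
  shows "\<forall>i\<in>I. c i = 0"
  using assms(1) distinct zero
proof (induction I arbitrary: c)
  case (insert j I)
  have "c i = 0" if i: "i \<in> I" for i
  proof -
    obtain q where q: "q \<in> L" "\<psi> i q \<noteq> \<psi> j q" using insert.prems(1)[of i j] i insert.hyps by blast
    have "(\<Sum>i\<in>I. (c i * (\<psi> i q - \<psi> j q)) * \<psi> i p) = 0" if p: "p \<in> L" for p
    proof -
      have "(\<Sum>i\<in>insert j I. c i * \<psi> i (q + p)) = 0" "(\<Sum>i\<in>insert j I. c i * \<psi> i p) = 0"
        using insert.prems(2) p q L by blast+
      then have "c j * (\<psi> j q * \<psi> j p) + (\<Sum>i\<in>I. c i * (\<psi> i q * \<psi> i p)) = 0" "c j * \<psi> j p + (\<Sum>i\<in>I. c i * \<psi> i p) = 0"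
        using insert.hyps by (simp_all add: mult)
      then have "(c j * (\<psi> j q * \<psi> j p) + (\<Sum>i\<in>I. c i * (\<psi> i q * \<psi> i p))) - \<psi> j q * (c j * \<psi> j p + (\<Sum>i\<in>I. c i * \<psi> i p)) = 0"
        by simp
      then show ?thesis
        by (simp add: algebra_simps sum_distrib_left sum_subtractf)
    qed
    then have "\<forall>i\<in>I. c i * (\<psi> i q - \<psi> j q) = 0"
      using insert.IH[of "\<lambda>i. c i * (\<psi> i q - \<psi> j q)"] insert.prems(1) by blast
    then show ?thesis using i q(2) by auto
  qed
  moreover have "c j = 0"
    using insert.prems(2)[OF L(1)] insert.hyps calculation by (simp add: one)
  ultimately show ?case by blast
qed simp

lemma ch_point_add: "ch \<mu> (x + y) = ch \<mu> x * ch \<mu> y"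
  by (simp add: ch_def inner_add_right distrib_left cis_mult)

text \<open>The half-angle form: over the positive roots the sines multiply to \<open>delta\<close>
  and the phases to the character of - \<rho>.\<close>

lemma one_minus_ch: "1 - ch (- \<beta>) x = 2 * \<i> * of_real (sin (pi * (\<beta> \<bullet> x))) * cis (- (pi * (\<beta> \<bullet> x)))"
proof -
  define a where "a = pi * (\<beta> \<bullet> x)"
  have "cis a - cis (- a) = 2 * \<i> * of_real (sin a)" by (simp add: complex_eq_iff)
  then have "(cis a - cis (- a)) * cis (- a) = 2 * \<i> * of_real (sin a) * cis (- a)" by simp
  moreover have "(cis a - cis (- a)) * cis (- a) = 1 - cis (- a + - a)" by (simp only: left_diff_distrib cis_mult) simp
  moreover have "ch (- \<beta>) x = cis (- a + - a)" by (simp add: ch_def a_def mult.assoc)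
  ultimately show ?thesis by (simp only: a_def)
qed

context simple_datum
begin

text \<open>The parity of the number of inversions, complex valued for direct use as a
  coefficient.\<close>

definition weyl_sign :: "(real ^ 'n \<Rightarrow> real ^ 'n) \<Rightarrow> complex" where
  "weyl_sign w = (\<Prod>\<alpha>\<in>P. if inv w \<alpha> \<in> P then 1 else - 1)"

text \<open>The Weyl denominator up to a constant, as a product of sines: it is real and vanishes
  exactly on the affine root hyperplanes.\<close>

definition delta :: "real ^ 'n \<Rightarrow> complex" where
  "delta x = (\<Prod>\<alpha>\<in>P. of_real (sin (pi * (\<alpha> \<bullet> x))))"

lemma delta_W_prod: "w \<in> W \<Longrightarrow> (\<Prod>\<alpha>\<in>P. complex_of_real (sin (pi * (w \<alpha> \<bullet> x)))) = weyl_sign w * delta x"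
proof -
  assume w: "w \<in> W"
  have "(\<Prod>\<alpha>\<in>P. complex_of_real (sin (pi * (w \<alpha> \<bullet> x)))) = (\<Prod>\<alpha>\<in>P. complex_of_real (sin (pi * ((if inv w \<alpha> \<in> P then \<alpha> else - \<alpha>) \<bullet> x))))"
    by (rule prod_W_pos[OF w])
  also have "\<dots> = (\<Prod>\<alpha>\<in>P. (if inv w \<alpha> \<in> P then 1 else - 1) * of_real (sin (pi * (\<alpha> \<bullet> x))))"
    by (intro prod.cong HOL.refl) simp
  finally show ?thesis by (simp add: weyl_sign_def delta_def prod.distrib)
qed

lemma delta_inv: "w \<in> W \<Longrightarrow> delta (inv w x) = weyl_sign w * delta x"
  using delta_W_prod[of w x] W_inner_inv[of w _ x] by (simp add: delta_def)

lemma delta_nonzero_iff: "delta x \<noteq> 0 \<longleftrightarrow> (\<forall>\<alpha>\<in>P. \<alpha> \<bullet> x \<notin> \<int>)"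
proof -
  have "sin (pi * s) = 0 \<longleftrightarrow> s \<in> \<int>" for s :: real
    unfolding sin_zero_iff_int2 by (auto elim!: Ints_cases)
  then show ?thesis by (simp add: delta_def)
qed

lemma delta_alcove: "x \<in> alcove \<Longrightarrow> delta x \<noteq> 0"
  unfolding delta_nonzero_iff alcove_def by (auto elim!: Ints_cases)

text \<open>\<open>delta\<close> is antisymmetric and does not vanish at \<open>rho_point\<close>,
  so evaluating it at images of this point reads off the signs.\<close>

lemma weyl_sign_mult: assumes "u \<in> W" "w \<in> W" shows "weyl_sign (u \<circ> w) = weyl_sign u * weyl_sign w"
proof -
  let ?d = "delta rho_point"
  have nz: "?d \<noteq> 0" by (rule delta_alcove[OF rho_point_alcove])
  have "weyl_sign (u \<circ> w) * ?d = delta (inv (u \<circ> w) rho_point)" by (rule delta_inv[OF W_comp[OF assms], symmetric])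
  also have "inv (u \<circ> w) rho_point = inv w (inv u rho_point)" by (simp add: W_inv_comp[OF assms])
  also have "delta \<dots> = weyl_sign w * (weyl_sign u * ?d)" by (simp only: delta_inv[OF assms(2)] delta_inv[OF assms(1)])
  finally have "weyl_sign (u \<circ> w) * ?d = (weyl_sign u * weyl_sign w) * ?d" by (simp only: mult_ac)
  then show ?thesis by (rule mult_right_cancel[OF nz, THEN iffD1])
qed

lemma weyl_sign_cnj: "cnj (weyl_sign w) = weyl_sign w"
  unfolding weyl_sign_def cnj_prod by (intro prod.cong) auto

lemma weyl_sign_square: "weyl_sign w * weyl_sign w = 1"
  unfolding weyl_sign_def prod.distrib[symmetric] by (intro prod.neutral) auto

lemma weyl_sign_id: "weyl_sign id = 1"
  unfolding weyl_sign_def inv_id by (intro prod.neutral) simp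

lemma weyl_sign_inv: assumes "w \<in> W" shows "weyl_sign (inv w) = weyl_sign w"
proof -
  have "inv w \<circ> w = id" using assms by (simp add: fun_eq_iff)
  then have "weyl_sign (inv w) * weyl_sign w = 1" using weyl_sign_mult[OF W_inv[OF assms] assms] weyl_sign_id by simp
  then have "weyl_sign (inv w) * weyl_sign w * weyl_sign w = weyl_sign w" by simp
  then show ?thesis by (simp add: mult.assoc weyl_sign_square)
qed

lemma weyl_sign_simple: assumes "\<gamma> \<in> \<Delta>" shows "weyl_sign (reflection \<gamma>) = - 1"
proof -
  have "reflection \<gamma> \<beta> \<in> P \<longleftrightarrow> \<beta> \<noteq> \<gamma>" if "\<beta> \<in> P" for \<beta>
    using reflection_simple_P[OF assms that] reflection_self[OF nonzero_P[OF simple_P[OF assms]]]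
      uminus_P[OF simple_P[OF assms]] by metis
  then have "weyl_sign (reflection \<gamma>) = (\<Prod>\<beta>\<in>P. if \<beta> = \<gamma> then - 1 else 1)"
    unfolding weyl_sign_def inv_reflection by (intro prod.cong) auto
  then show ?thesis using simple_P[OF assms] by (simp add: prod.delta)
qed

lemma root_conj_simple:
  assumes "\<alpha> \<in> P" shows "\<exists>w\<in>W. \<exists>\<gamma>\<in>\<Delta>. \<alpha> = w \<gamma>"
  using P_R[OF assms] assms
proof (induction rule: height_induct)
  case (less \<alpha>)
  obtain \<gamma> where g: "\<gamma> \<in> \<Delta>" "\<alpha> \<bullet> \<gamma> > 0" using simple_inner_pos_exists less.prems by blast
  show ?case
  proof (cases "\<alpha> = \<gamma>")
    case True
    then show ?thesis using g by (intro bexI[of _ id] bexI[of _ \<gamma>]) simp_all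
  next
    case False
    have bP: "reflection \<gamma> \<alpha> \<in> P" using reflection_simple_P g False less.prems by auto
    have "reflection \<gamma> \<alpha> \<bullet> v < \<alpha> \<bullet> v"
      using g simple_P[OF g(1)] nonzero_P[of \<gamma>]
      by (auto simp: reflection_def inner_diff_left pos_roots_eq inner_coroot_sign)
    from less.IH[OF P_R[OF bP] this bP] obtain w \<beta> where w: "w \<in> W" "\<beta> \<in> \<Delta>" "reflection \<gamma> \<alpha> = w \<beta>" by blast
    have "\<alpha> = (reflection \<gamma> \<circ> w) \<beta>" using w(3) by (metis comp_apply reflection_reflection)
    moreover have "reflection \<gamma> \<circ> w \<in> W" by (rule weyl_group.refl[OF simple_R[OF g(1)] w(1)])
    ultimately show ?thesis using w(2) by blast
  qed
qed

text \<open>Every positive root is conjugate to a simple one, whose reflection has a single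
  inversion.\<close>

lemma weyl_sign_reflection: assumes "\<alpha> \<in> P" shows "weyl_sign (reflection \<alpha>) = - 1"
proof -
  obtain w \<gamma> where w: "w \<in> W" "\<gamma> \<in> \<Delta>" "\<alpha> = w \<gamma>" using root_conj_simple[OF assms] by blast
  have g: "reflection \<gamma> \<in> W" by (rule reflection_W[OF simple_R[OF w(2)]])
  have "reflection \<alpha> \<circ> w = w \<circ> reflection \<gamma>" unfolding w(3) by (rule W_reflection[OF w(1), symmetric])
  then have "weyl_sign (reflection \<alpha>) * weyl_sign w = weyl_sign w * weyl_sign (reflection \<gamma>)"
    by (simp only: weyl_sign_mult[OF reflection_W[OF P_R[OF assms]] w(1), symmetric] weyl_sign_mult[OF w(1) g, symmetric])
  then have "weyl_sign (reflection \<alpha>) * (weyl_sign w * weyl_sign w) = (weyl_sign w * weyl_sign w) * weyl_sign (reflection \<gamma>)" by (metis mult.assoc mult.commute)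
  then show ?thesis by (simp only: weyl_sign_square weyl_sign_simple[OF w(2)] mult_1 mult_1_right)
qed

lemma ch_period: "\<mu> \<in> weights G \<Longrightarrow> y \<in> Q \<Longrightarrow> ch \<mu> (y + x) = ch \<mu> x"
  unfolding ch_def inner_add_right by (rule cis_int_shift) (simp add: weights_iff)

lemma level_rho_alcove:
  assumes "\<mu> \<in> \<Lambda> k" shows "(1 / (real k + h)) *\<^sub>R (\<mu> + rho) \<in> alcove"
proof -
  have "0 < \<alpha> \<bullet> (\<mu> + rho) \<and> \<alpha> \<bullet> (\<mu> + rho) < real k + h" if a: "\<alpha> \<in> P" for \<alpha>
  proof -
    have "0 < \<alpha> \<bullet> rho_point" "\<alpha> \<bullet> rho_point < 1" using rho_point_alcove a by (auto simp: alcove_def)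
    then have "0 < \<alpha> \<bullet> rho" "\<alpha> \<bullet> rho < h" using dual_coxeter_pos by (simp_all add: rho_point_def zero_less_mult_iff zero_less_divide_iff)
    then show ?thesis using level_weightsD(2)[OF assms a] level_weightsD(3)[OF assms P_R[OF a]] by (simp add: inner_add_right)
  qed
  then show ?thesis using dual_coxeter_pos by (simp add: alcove_def)
qed

text \<open>The numerator of \<open>Theta\<close> once the factors without t are collected into
  \<open>weyl_denom\<close>: antisymmetric, continuous across the walls for \<bar>t\<bar> < 1, and
  at t = 0 the numerator of the Weyl character formula.\<close>

definition char_numerator :: "real \<Rightarrow> real ^ 'n \<Rightarrow> real ^ 'n \<Rightarrow> complex" where
  "char_numerator t \<mu> x = (\<Sum>w\<in>W. weyl_sign w * ch (w (\<mu> + rho)) x / (\<Prod>\<alpha>\<in>P. 1 - of_real t * ch (w \<alpha>) x))"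

lemma ch_inv_point: "u \<in> W \<Longrightarrow> ch \<mu> (inv u x) = ch (u \<mu>) x"
  using W_inner_inv[of u \<mu> x] by (simp add: ch_def)

lemma char_numerator_inv: assumes "u \<in> W" shows "char_numerator t \<mu> (inv u x) = weyl_sign u * char_numerator t \<mu> x"
proof -
  define F where "F w = weyl_sign w * ch (w (\<mu> + rho)) x / (\<Prod>\<alpha>\<in>P. 1 - of_real t * ch (w \<alpha>) x)" for w
  have "char_numerator t \<mu> (inv u x) = (\<Sum>w\<in>W. weyl_sign w * ch (u (w (\<mu> + rho))) x / (\<Prod>\<alpha>\<in>P. 1 - of_real t * ch (u (w \<alpha>)) x))"
    unfolding char_numerator_def ch_inv_point[OF assms] ..
  also have "\<dots> = (\<Sum>w\<in>W. weyl_sign u * F (u \<circ> w))"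
  proof (rule sum.cong[OF HOL.refl])
    fix w assume w: "w \<in> W"
    have "weyl_sign w = weyl_sign u * weyl_sign (u \<circ> w)" unfolding weyl_sign_mult[OF assms w] mult.assoc[symmetric] weyl_sign_square by simp
    then show "weyl_sign w * ch (u (w (\<mu> + rho))) x / (\<Prod>\<alpha>\<in>P. 1 - of_real t * ch (u (w \<alpha>)) x) = weyl_sign u * F (u \<circ> w)"
      unfolding F_def comp_apply by simp
  qed
  also have "\<dots> = weyl_sign u * (\<Sum>w\<in>W. F (u \<circ> w))" by (simp only: sum_distrib_left)
  also have "(\<Sum>w\<in>W. F (u \<circ> w)) = (\<Sum>w\<in>W. F w)" by (rule sum.reindex_bij_betw[OF bij_betw_W_comp[OF assms]])
  finally show ?thesis by (simp only: char_numerator_def F_def)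
qed

lemma char_numerator_W: "u \<in> W \<Longrightarrow> char_numerator t \<mu> (u x) = weyl_sign u * char_numerator t \<mu> x"
  using char_numerator_inv[OF W_inv, of u t \<mu> x] by (simp only: W_inv_inv weyl_sign_inv)

lemma delta_W: "u \<in> W \<Longrightarrow> delta (u x) = weyl_sign u * delta x"
  using delta_inv[OF W_inv, of u x] by (simp only: W_inv_inv weyl_sign_inv)

lemma char_numerator_period: assumes "\<mu> \<in> weights G" "y \<in> Q" shows "char_numerator t \<mu> (y + x) = char_numerator t \<mu> x"
proof -
  have "ch (w (\<mu> + rho)) (y + x) = ch (w (\<mu> + rho)) x" "ch (w \<alpha>) (y + x) = ch (w \<alpha>) x" if "w \<in> W" "\<alpha> \<in> P" for w \<alpha>
    using ch_period[OF weight_W[OF that(1) weight_add[OF assms(1) weight_rho]] assms(2)]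
      ch_period[OF weight_W[OF that(1) weight_root[OF P_R[OF that(2)]]] assms(2)] by blast+
  moreover have "ch (w (\<mu> + rho)) (y + x) = ch (w (\<mu> + rho)) x" if "w \<in> W" for w
    using ch_period[OF weight_W[OF that(1) weight_add[OF assms(1) weight_rho]] assms(2)] .
  ultimately show ?thesis unfolding char_numerator_def by (intro sum.cong HOL.refl) (simp cong: prod.cong)
qed

text \<open>On a wall the reflection moves x only by a coroot lattice vector, so the numerator
  equals its own negative. Irregular solutions can therefore be included in the sums.\<close>

lemma char_numerator_wall:
  assumes "\<mu> \<in> weights G" "delta x = 0" shows "char_numerator t \<mu> x = 0"
proof -
  obtain \<alpha> where a: "\<alpha> \<in> P" "\<alpha> \<bullet> x \<in> \<int>" using assms(2) delta_nonzero_iff by blast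
  obtain m where m: "\<alpha> \<bullet> x = of_int m" using a(2) by (auto elim: Ints_cases)
  have q: "of_int (- m) *\<^sub>R coroot \<alpha> \<in> Q" by (rule Q_scale_int[OF coroot_Q[OF P_R[OF a(1)]]])
  have "reflection \<alpha> x = of_int (- m) *\<^sub>R coroot \<alpha> + x" by (simp add: reflection_coroot inner_commute[of x] m)
  then have "char_numerator t \<mu> (reflection \<alpha> x) = char_numerator t \<mu> x" using char_numerator_period[OF assms(1) q] by simp
  moreover have "char_numerator t \<mu> (reflection \<alpha> x) = - char_numerator t \<mu> x"
    using char_numerator_W[OF reflection_W[OF P_R[OF a(1)]], of t \<mu> x] weyl_sign_reflection[OF a(1)] by simp
  ultimately show ?thesis by simp
qed

text \<open>At \<open>t = 0\<close> the numerator of the Weyl character formula is a combination of characters that are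
  pairwise distinct on the \<open>(k + h)\<close>-torsion points.\<close>
lemma char_numerator_zero_nonvanishing:
  assumes "\<mu> \<in> \<Lambda> k"
  shows "\<exists>p. (real k + h) *\<^sub>R p \<in> weights G \<and> char_numerator 0 \<mu> p \<noteq> 0"
proof (rule ccontr)
  assume neg: "\<not> ?thesis"
  define K where "K = real k + h"
  have K: "K > 0" using dual_coxeter_pos by (simp add: K_def)
  define L where "L = {p. K *\<^sub>R p \<in> weights G}"
  have "\<forall>w\<in>W. weyl_sign w = 0"
  proof (rule characters_independent[of W L "\<lambda>w. ch (w (\<mu> + rho))" weyl_sign])
    show "(\<Sum>w\<in>W. weyl_sign w * ch (w (\<mu> + rho)) p) = 0" if "p \<in> L" for p
      using neg that by (auto simp: char_numerator_def L_def K_def)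
    show "0 \<in> L" "\<And>p q. p \<in> L \<Longrightarrow> q \<in> L \<Longrightarrow> p + q \<in> L"
      by (auto simp: L_def weight_zero scaleR_add_right weight_add)
    show "ch (w (\<mu> + rho)) (p + q) = ch (w (\<mu> + rho)) p * ch (w (\<mu> + rho)) q" for w p q by (rule ch_point_add)
    show "ch (w (\<mu> + rho)) 0 = 1" for w by (simp add: ch_def)
    fix w w' assume w: "w \<in> W" "w' \<in> W" "w \<noteq> w'"
    show "\<exists>p\<in>L. ch (w (\<mu> + rho)) p \<noteq> ch (w' (\<mu> + rho)) p"
    proof (rule ccontr)
      assume "\<not> ?thesis"
      then have eq: "\<And>p. p \<in> L \<Longrightarrow> ch (w (\<mu> + rho)) p = ch (w' (\<mu> + rho)) p" by blast
      define z where "z = (1 / K) *\<^sub>R (\<mu> + rho)"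
      have z: "z \<in> alcove" unfolding z_def K_def by (rule level_rho_alcove[OF assms])
      \<comment> \<open>Equality of the two characters on all torsion points puts q in the coroot
        lattice. Two Weyl images of an alcove point then agree modulo \<open>Q\<close>, which forces
        w = w'.\<close>
      define q where "q = w z - w' z"
      have "fweight i \<bullet> q \<in> \<int>" for i
      proof -
        have "fweight i \<in> weights G" unfolding weights_iff using fweight_Q_int by blast
        then have "(1 / K) *\<^sub>R fweight i \<in> L" using K by (simp add: L_def)
        from eq[OF this] have "cis (2 * pi * (w (\<mu> + rho) \<bullet> ((1 / K) *\<^sub>R fweight i))) = cis (2 * pi * (w' (\<mu> + rho) \<bullet> ((1 / K) *\<^sub>R fweight i)))"
          by (simp only: ch_def)
        then have "cos (2 * pi * (w (\<mu> + rho) \<bullet> ((1 / K) *\<^sub>R fweight i) - w' (\<mu> + rho) \<bullet> ((1 / K) *\<^sub>R fweight i))) = 1"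
          using cis_divide[of "2 * pi * (w (\<mu> + rho) \<bullet> ((1 / K) *\<^sub>R fweight i))" "2 * pi * (w' (\<mu> + rho) \<bullet> ((1 / K) *\<^sub>R fweight i))"]
          by (simp add: right_diff_distrib) (metis cis.sel(1) one_complex.sel(1))
        then have "w (\<mu> + rho) \<bullet> ((1 / K) *\<^sub>R fweight i) - w' (\<mu> + rho) \<bullet> ((1 / K) *\<^sub>R fweight i) \<in> \<int>"
          by (auto simp: cos_one_2pi_int)
        then show ?thesis
          by (simp add: q_def z_def W_scale[OF w(1)] W_scale[OF w(2)] inner_diff_right inner_commute)
      qed
      then have q: "q \<in> Q" by (simp add: Q_iff)
      have "(inv w \<circ> w') z + inv w q = z"
        by (simp add: q_def W_diff[OF W_inv[OF w(1)]] w(1))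
      then have "inv w \<circ> w' = id"
        using affine_fixes_alcove(1)[OF W_comp[OF W_inv[OF w(1)] w(2)] Q_W[OF W_inv[OF w(1)] q] z] z by simp
      then have "w ((inv w \<circ> w') x) = w x" for x by simp
      then have "w' = w" using w(1) by (simp add: fun_eq_iff)
      then show False using w(3) by simp
    qed
  qed simp
  then show False using weyl_sign_id id_W by force
qed

text \<open>Continuity is joint in t and the point because the points of evaluation move with
  t.\<close>

lemma char_numerator_continuous: "isCont (\<lambda>p. char_numerator (fst p) \<mu> (snd p)) (0, x)"
proof -
  have "isCont (\<lambda>p. cis (2 * pi * (\<beta> \<bullet> snd p))) (0 :: real, x)" for \<beta> :: "real ^ 'n"
    unfolding cis_conv_exp by (intro continuous_intros)
  then show ?thesis unfolding char_numerator_def ch_def by (intro continuous_intros) auto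
qed

definition weyl_denom :: "real ^ 'n \<Rightarrow> complex" where
  "weyl_denom x = (2 * \<i>) ^ card P * delta x"

lemma weyl_denominator:
  assumes "w \<in> W"
  shows "(\<Prod>\<alpha>\<in>P. 1 - ch (- w \<alpha>) x) = weyl_denom x * weyl_sign w * ch (- w rho) x"
proof -
  have "(\<Prod>\<alpha>\<in>P. 1 - ch (- w \<alpha>) x) = (2 * \<i>) ^ card P * (\<Prod>\<alpha>\<in>P. complex_of_real (sin (pi * (w \<alpha> \<bullet> x)))) * (\<Prod>\<alpha>\<in>P. cis (- (pi * (w \<alpha> \<bullet> x))))"
    by (simp add: one_minus_ch prod.distrib)
  also have "(\<Prod>\<alpha>\<in>P. cis (- (pi * (w \<alpha> \<bullet> x)))) = cis (\<Sum>\<alpha>\<in>P. - (pi * (w \<alpha> \<bullet> x)))" by (rule prod_cis)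
  also have "(\<Sum>\<alpha>\<in>P. - (pi * (w \<alpha> \<bullet> x))) = 2 * pi * ((- w rho) \<bullet> x)"
    by (simp add: rho_def W_scale[OF assms] W_sum[OF assms] inner_sum_left sum_negf sum_distrib_left)
  finally show ?thesis by (simp only: delta_W_prod[OF assms] weyl_denom_def ch_def mult_ac)
qed

end

section \<open>Theta functions and weights at torus points, and their orthogonality sums\<close>

context bethe
begin

lemma te_ch: "\<mu> \<in> weights G \<Longrightarrow> te x \<mu> = ch \<mu> x"
  by (simp add: te_apply ch_def)

lemma char_numerator_dn: "char_numerator t \<mu> x = (\<Sum>w\<in>W. weyl_sign w * ch (w (\<mu> + rho)) x / (\<Prod>\<alpha>\<in>P. deform_factor (w \<alpha>) x))"
  by (simp add: char_numerator_def deform_factor_def)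

lemma Theta_te:
  assumes "\<mu> \<in> weights G" shows "Theta G \<mu> t (te x) = char_numerator t \<mu> x / weyl_denom x"
proof -
  have "te x (w \<mu>) / (\<Prod>\<alpha>\<in>P. (1 - te x (- w \<alpha>)) * (1 - of_real t * te x (w \<alpha>)))
      = weyl_sign w * ch (w (\<mu> + rho)) x / (\<Prod>\<alpha>\<in>P. deform_factor (w \<alpha>) x) / weyl_denom x" if w: "w \<in> W" for w
  proof -
    have tew: "te x (w \<alpha>) = ch (w \<alpha>) x" "te x (- w \<alpha>) = ch (- w \<alpha>) x" if "\<alpha> \<in> P" for \<alpha>
      using W_R[OF w P_R[OF that]] by (simp_all add: te_ch weight_root)
    have "(\<Prod>\<alpha>\<in>P. (1 - te x (- w \<alpha>)) * (1 - of_real t * te x (w \<alpha>))) = (\<Prod>\<alpha>\<in>P. (1 - ch (- w \<alpha>) x) * deform_factor (w \<alpha>) x)"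
      by (intro prod.cong HOL.refl) (simp add: tew deform_factor_def)
    also have "\<dots> = weyl_denom x * weyl_sign w * ch (- w rho) x * (\<Prod>\<alpha>\<in>P. deform_factor (w \<alpha>) x)"
      unfolding prod.distrib weyl_denominator[OF w] ..
    finally have den: "(\<Prod>\<alpha>\<in>P. (1 - te x (- w \<alpha>)) * (1 - of_real t * te x (w \<alpha>))) = weyl_denom x * weyl_sign w * ch (- w rho) x * (\<Prod>\<alpha>\<in>P. deform_factor (w \<alpha>) x)" .
    have num: "te x (w \<mu>) = weyl_sign w * ch (w (\<mu> + rho)) x * (weyl_sign w * ch (- w rho) x)"
    proof -
      have "weyl_sign w * ch (w (\<mu> + rho)) x * (weyl_sign w * ch (- w rho) x) = (weyl_sign w * weyl_sign w) * (ch (w \<mu>) x * (ch (- w rho) x * ch (w rho) x))"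
        by (simp only: W_add[OF w] ch_add mult_ac)
      then show ?thesis by (simp only: weyl_sign_square ch_minus_mult te_ch[OF weight_W[OF w assms]] mult_1 mult_1_right)
    qed
    have nz: "weyl_sign w * ch (- w rho) x \<noteq> 0" using weyl_sign_square[of w] norm_ch[of "- w rho" x] by (metis mult_eq_0_iff norm_zero zero_neq_one)
    show ?thesis unfolding den num using nz by (simp add: mult_ac)
  qed
  then have "Theta G \<mu> t (te x) = (\<Sum>w\<in>W. weyl_sign w * ch (w (\<mu> + rho)) x / (\<Prod>\<alpha>\<in>P. deform_factor (w \<alpha>) x) / weyl_denom x)"
    unfolding Theta_def by (rule sum.cong[OF HOL.refl])
  then show ?thesis unfolding char_numerator_dn sum_divide_distrib .
qed

text \<open>Replacing w by w composed with \<open>w\<^sub>0\<close>, and using that the negative of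
  \<open>w\<^sub>0\<close> permutes the positive roots, inverts every character. On the compact
  torus this is conjugation, so the bilinear pairing becomes a Hermitian one.\<close>

lemma Theta_dual:
  assumes "\<mu> \<in> weights G" shows "Theta G (dual_weight G \<mu>) t (te x) = cnj (Theta G \<mu> t (te x))"
proof -
  define f where "f \<beta> = (1 - te x (- \<beta>)) * (1 - of_real t * te x \<beta>)" for \<beta>
  have tec: "te x (- \<mu>) = cnj (te x \<mu>)" if "\<mu> \<in> weights G" for \<mu>
    using that weight_minus[OF that] by (simp add: te_ch ch_minus)
  have bij: "bij_betw (\<lambda>w. w \<circ> w\<^sub>0) W W"
  proof (rule bij_betw_byWitness[of _ "\<lambda>w. w \<circ> w\<^sub>0"])
    show "(\<lambda>w. w \<circ> w\<^sub>0) ` W \<subseteq> W" using W_comp longest_element(1) by blast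
    then show "(\<lambda>w. w \<circ> w\<^sub>0) ` W \<subseteq> W" .
  qed (simp_all add: fun_eq_iff longest_involution)
  have "Theta G (dual_weight G \<mu>) t (te x) = (\<Sum>w\<in>W. te x (w (- w\<^sub>0 \<mu>)) / (\<Prod>\<alpha>\<in>P. f (w \<alpha>)))"
    unfolding Theta_def dual_weight_def f_def ..
  also have "\<dots> = (\<Sum>w\<in>W. te x ((w \<circ> w\<^sub>0) (- w\<^sub>0 \<mu>)) / (\<Prod>\<alpha>\<in>P. f ((w \<circ> w\<^sub>0) \<alpha>)))"
    by (rule sum.reindex_bij_betw[OF bij, symmetric])
  also have "\<dots> = (\<Sum>w\<in>W. cnj (te x (w \<mu>) / (\<Prod>\<alpha>\<in>P. f (w \<alpha>))))"
  proof (rule sum.cong[OF HOL.refl])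
    fix w assume w: "w \<in> W"
    have e: "(w \<circ> w\<^sub>0) (- w\<^sub>0 \<mu>) = - w \<mu>"
      by (simp add: W_minus[OF longest_element(1)] longest_involution W_minus[OF w])
    have "bij_betw (\<lambda>\<alpha>. - w\<^sub>0 \<alpha>) P P"
      by (rule bij_betw_byWitness[of _ "\<lambda>\<alpha>. - w\<^sub>0 \<alpha>"])
         (auto simp: W_minus[OF longest_element(1)] longest_involution longest_neg)
    then have "(\<Prod>\<alpha>\<in>P. f ((w \<circ> w\<^sub>0) \<alpha>)) = (\<Prod>\<alpha>\<in>P. f ((w \<circ> w\<^sub>0) (- w\<^sub>0 \<alpha>)))"
      by (rule prod.reindex_bij_betw[symmetric])
    also have "\<dots> = (\<Prod>\<alpha>\<in>P. f (- w \<alpha>))"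
      by (intro prod.cong HOL.refl) (simp add: W_minus[OF longest_element(1)] longest_involution W_minus[OF w])
    also have "\<dots> = (\<Prod>\<alpha>\<in>P. cnj (f (w \<alpha>)))"
    proof (intro prod.cong HOL.refl)
      fix \<alpha> assume "\<alpha> \<in> P"
      then have "w \<alpha> \<in> weights G" using W_R[OF w P_R] weight_root by blast
      then show "f (- w \<alpha>) = cnj (f (w \<alpha>))" unfolding f_def by (simp add: tec)
    qed
    finally show "te x ((w \<circ> w\<^sub>0) (- w\<^sub>0 \<mu>)) / (\<Prod>\<alpha>\<in>P. f ((w \<circ> w\<^sub>0) \<alpha>)) = cnj (te x (w \<mu>) / (\<Prod>\<alpha>\<in>P. f (w \<alpha>)))"
      unfolding e using tec[OF weight_W[OF w assms]] by (simp add: cnj_prod)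
  qed
  finally show ?thesis unfolding Theta_def f_def cnj_sum[symmetric] .
qed

abbreviation "jac_det x \<equiv> det (matrix (DPhi x))"

definition theta_factor :: complex where "theta_factor = (1 - of_real t) ^ CARD('n) * (1 / of_nat (card (F_set G k)))"

definition deform_product :: "real ^ 'n \<Rightarrow> complex" where "deform_product x = (\<Prod>\<alpha>\<in>P. deform_factor \<alpha> x * deform_factor (- \<alpha>) x)"

lemma theta_te: "theta G k t (te x) = theta_factor * (weyl_denom x * cnj (weyl_denom x) * deform_product x / of_real (jac_det x))"
proof -
  have "(\<Prod>\<alpha>\<in>R. (1 - te x \<alpha>) * (1 - of_real t * te x \<alpha>)) = (\<Prod>\<alpha>\<in>R. (1 - ch \<alpha> x) * deform_factor \<alpha> x)"
    by (intro prod.cong HOL.refl) (simp add: te_ch weight_root deform_factor_def)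
  also have "\<dots> = (\<Prod>\<alpha>\<in>P. (1 - ch (- \<alpha>) x) * cnj (1 - ch (- \<alpha>) x) * (deform_factor \<alpha> x * deform_factor (- \<alpha>) x))"
    unfolding prod_R by (intro prod.cong HOL.refl) (simp add: ch_minus mult_ac)
  also have "\<dots> = (\<Prod>\<alpha>\<in>P. 1 - ch (- \<alpha>) x) * cnj (\<Prod>\<alpha>\<in>P. 1 - ch (- \<alpha>) x) * deform_product x"
    by (simp only: prod.distrib deform_product_def cnj_prod)
  also have "(\<Prod>\<alpha>\<in>P. 1 - ch (- \<alpha>) x) = weyl_denom x * ch (- rho) x"
    using weyl_denominator[OF id_W, of x] weyl_sign_id by simp
  also have "weyl_denom x * ch (- rho) x * cnj (weyl_denom x * ch (- rho) x) * deform_product x = (ch (- rho) x * ch rho x) * (weyl_denom x * cnj (weyl_denom x) * deform_product x)"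
    by (simp add: ch_minus mult_ac)
  finally show ?thesis unfolding theta_def H_dagger_te theta_factor_def by (simp add: ch_minus_mult)
qed

lemma deform_product_pos: "\<exists>r>0. deform_product x = complex_of_real r"
proof -
  have "deform_factor \<alpha> x * deform_factor (- \<alpha>) x = complex_of_real ((norm (deform_factor \<alpha> x))\<^sup>2)" for \<alpha>
    by (simp only: deform_factor_minus complex_norm_square)
  then have "deform_product x = complex_of_real (\<Prod>\<alpha>\<in>P. (norm (deform_factor \<alpha> x))\<^sup>2)" by (simp add: deform_product_def)
  moreover have "(\<Prod>\<alpha>\<in>P. (norm (deform_factor \<alpha> x))\<^sup>2) > 0" using deform_factor_nonzero by (intro prod_pos) simp
  ultimately show ?thesis by blast
qed

text \<open>The summand of the pairing without the constant and the Jacobian. The Weyl denominators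
  have cancelled, so it is continuous on the whole space, and periodic when \<mu> and \<nu> are
  weights, as the Fourier argument requires.\<close>

definition phi :: "real ^ 'n \<Rightarrow> real ^ 'n \<Rightarrow> real ^ 'n \<Rightarrow> complex" where
  "phi \<mu> \<nu> x = deform_product x * char_numerator t \<mu> x * cnj (char_numerator t \<nu> x)"

lemma theta_Theta_te:
  assumes "\<mu> \<in> weights G" "\<nu> \<in> weights G" "delta x \<noteq> 0"
  shows "theta G k t (te x) * (Theta G \<mu> t (te x) * cnj (Theta G \<nu> t (te x))) = theta_factor * (phi \<mu> \<nu> x / of_real (jac_det x))"
proof -
  have "weyl_denom x \<noteq> 0" using assms(3) by (simp add: weyl_denom_def)
  then show ?thesis unfolding theta_te Theta_te[OF assms(1)] Theta_te[OF assms(2)] phi_def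
    by (simp add: field_simps)
qed

text \<open>The term of each pair (w, w') is pulled back by w. The invariant factor
  \<open>deform_product\<close> cancels the denominator belonging to w and leaves the product over
  negative roots in \<open>orbit_term\<close>.\<close>

lemma phi_expand:
  assumes "y \<in> Q"
  shows "phi \<mu> \<nu> x * cis (2 * pi * (kap * (y \<bullet> Phi x)))
    = (\<Sum>w\<in>W. \<Sum>w'\<in>W. weyl_sign w * weyl_sign w' * orbit_term \<mu> \<nu> (inv w \<circ> w') (inv w y) (inv w x))"
proof -
  have "phi \<mu> \<nu> x * cis (2 * pi * (kap * (y \<bullet> Phi x))) = (\<Sum>w\<in>W. \<Sum>w'\<in>W.
      deform_product x * (weyl_sign w * ch (w (\<mu> + rho)) x / (\<Prod>\<alpha>\<in>P. deform_factor (w \<alpha>) x)) * (weyl_sign w' * ch (- w' (\<nu> + rho)) x / (\<Prod>\<alpha>\<in>P. deform_factor (- w' \<alpha>) x))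
      * cis (2 * pi * (kap * (y \<bullet> Phi x))))"
    unfolding phi_def char_numerator_dn cnj_sum
    by (simp add: sum_distrib_left sum_distrib_right weyl_sign_cnj ch_minus deform_factor_minus cnj_prod) (subst sum.swap, simp add: mult_ac sum_divide_distrib)
  also have "\<dots> = (\<Sum>w\<in>W. \<Sum>w'\<in>W. weyl_sign w * weyl_sign w' * orbit_term \<mu> \<nu> (inv w \<circ> w') (inv w y) (inv w x))"
  proof (intro sum.cong HOL.refl)
    fix w w' assume w: "w \<in> W" "w' \<in> W"
    have dnw: "deform_factor \<beta> (inv w x) = deform_factor (w \<beta>) x" for \<beta> by (simp add: deform_factor_def ch_W_inv[OF w(1)])
    have "deform_product x = (\<Prod>\<alpha>\<in>R. deform_factor \<alpha> x)" unfolding deform_product_def prod_R ..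
    also have "\<dots> = (\<Prod>\<alpha>\<in>R. deform_factor (w \<alpha>) x)" by (rule prod.reindex_bij_betw[OF bij_betw_W_R[OF w(1)], symmetric])
    finally have deform_product: "deform_product x = (\<Prod>\<alpha>\<in>P. deform_factor (w \<alpha>) x) * (\<Prod>\<alpha>\<in>P. deform_factor (w (- \<alpha>)) x)" unfolding prod_R prod.distrib .
    have ww: "w ((inv w \<circ> w') z) = w' z" for z using w(1) by simp
    have e1: "ch (\<mu> + rho - (inv w \<circ> w') (\<nu> + rho)) (inv w x) = ch (w (\<mu> + rho)) x * ch (- w' (\<nu> + rho)) x"
      unfolding ch_W_inv[OF w(1)] W_diff[OF w(1)] ww by (simp only: diff_conv_add_uminus ch_add)
    have e2: "inv w y \<bullet> Phi (inv w x) = y \<bullet> Phi x"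
      unfolding Phi_W[OF W_inv[OF w(1)]] W_inner[OF W_inv[OF w(1)]] ..
    have e3: "(\<Prod>\<alpha>\<in>P. deform_factor (- (inv w \<circ> w') \<alpha>) (inv w x)) = (\<Prod>\<alpha>\<in>P. deform_factor (- w' \<alpha>) x)"
      unfolding dnw W_minus[OF w(1)] ww ..
    have nz: "(\<Prod>\<alpha>\<in>P. deform_factor (w \<alpha>) x) \<noteq> 0" using deform_factor_nonzero by simp
    show "deform_product x * (weyl_sign w * ch (w (\<mu> + rho)) x / (\<Prod>\<alpha>\<in>P. deform_factor (w \<alpha>) x)) * (weyl_sign w' * ch (- w' (\<nu> + rho)) x / (\<Prod>\<alpha>\<in>P. deform_factor (- w' \<alpha>) x))
      * cis (2 * pi * (kap * (y \<bullet> Phi x))) = weyl_sign w * weyl_sign w' * orbit_term \<mu> \<nu> (inv w \<circ> w') (inv w y) (inv w x)"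
      unfolding orbit_term_def e1 e2 e3 unfolding dnw deform_product using nz by (simp add: mult_ac)
  qed
  finally show ?thesis .
qed

lemma char_numerator_cont: "continuous_on S (char_numerator t \<mu>)"
  unfolding char_numerator_dn[abs_def] by (intro continuous_intros ch_continuous deform_factor_continuous) (simp add: deform_factor_nonzero)

lemma phi_cont: "continuous_on UNIV (phi \<mu> \<nu>)"
  unfolding phi_def[abs_def] deform_product_def by (intro continuous_intros deform_factor_continuous char_numerator_cont)

lemma phi_period: assumes "\<mu> \<in> weights G" "\<nu> \<in> weights G" "y \<in> Q" shows "phi \<mu> \<nu> (y + x) = phi \<mu> \<nu> x"
proof -
  have "deform_factor \<alpha> (y + x) = deform_factor \<alpha> x" "deform_factor (- \<alpha>) (y + x) = deform_factor (- \<alpha>) x" if "\<alpha> \<in> P" for \<alpha>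
    using ch_period[OF weight_root[OF P_R[OF that]] assms(3)] ch_period[OF weight_minus[OF weight_root[OF P_R[OF that]]] assms(3)]
    by (simp_all add: deform_factor_def)
  then have "deform_product (y + x) = deform_product x" unfolding deform_product_def by (intro prod.cong HOL.refl) simp
  then show ?thesis by (simp add: phi_def char_numerator_period assms)
qed

text \<open>By \<open>orbit_term_spectrum\<close> no term of \<open>phi_expand\<close> has frequency
  0, and undoing the pullback applies w to the frequencies, which keeps 0 out.\<close>

lemma phi_sum_zero:
  assumes "\<mu> \<in> \<Lambda> k" "\<nu> \<in> \<Lambda> k" "\<mu> \<noteq> \<nu>"
  shows "(\<Sum>z\<in>bethe_cell. phi \<mu> \<nu> (Psi z) / of_real \<bar>jac_det (Psi z)\<bar>) = 0"
proof (rule bethe_sum_zero(1)[OF phi_cont])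
  show "phi \<mu> \<nu> (y + x) = phi \<mu> \<nu> x" if "y \<in> Q" for x y
    using level_weightsD(1)[OF assms(1)] level_weightsD(1)[OF assms(2)] that by (rule phi_period)
  fix y assume y: "y \<in> Q"
  have of_coords: "continuous_on UNIV of_coords"
    using linear_Lc by (auto intro: linear_continuous_on simp: linear_conv_bounded_linear)
  define F where "F w w' x = orbit_term \<mu> \<nu> (inv w \<circ> w') (inv w y) (inv w x)" for w w' x
  have Fc: "continuous_on UNIV (F w w')" if w: "w \<in> W" for w w'
    unfolding F_def
    using linear_continuous_on[of "inv w"] W_linear[OF W_inv[OF w]] linear_conv_bounded_linear
    by (intro continuous_on_compose2[OF orbit_term_continuous]) auto
  have Fz: "integral cube (\<lambda>s. F w w' (of_coords s)) = 0" if w: "w \<in> W" "w' \<in> W" for w w'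
  proof -
    obtain A where A: "spec_closure A (orbit_term \<mu> \<nu> (inv w \<circ> w') (inv w y))" "A \<subseteq> weights G" "0 \<notin> A"
      using orbit_term_spectrum[OF assms W_comp[OF W_inv[OF w(1)] w(2)] Q_W[OF W_inv[OF w(1)] y]] by blast
    have "spec_closure (w ` A) (F w w')"
      unfolding F_def by (rule spec_closure_comp[OF A(1) ch_W_inv[OF w(1)]])
    moreover have "w ` A \<subseteq> weights G" using A(2) weight_W[OF w(1)] by blast
    moreover have "0 \<notin> w ` A" using A(3) W_inj[OF w(1), of _ 0] W_zero[OF w(1)] by (metis imageE)
    ultimately show ?thesis by (rule integral_spec_zero[OF _ _ _ Fc[OF w(1)]])
  qed
  have Fi: "(\<lambda>s. weyl_sign w * weyl_sign w' * F w w' (of_coords s)) integrable_on cube" if w: "w \<in> W" for w w'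
    by (intro continuous_integrable cube_lmeasurable continuous_intros continuous_on_compose2[OF Fc[OF w] of_coords]) simp
  have "integral cube (\<lambda>s. phi \<mu> \<nu> (of_coords s) * cis (2 * pi * (kap * (y \<bullet> Phi (of_coords s)))))
      = integral cube (\<lambda>s. \<Sum>w\<in>W. \<Sum>w'\<in>W. weyl_sign w * weyl_sign w' * F w w' (of_coords s))"
    unfolding phi_expand[OF y] F_def ..
  also have "\<dots> = (\<Sum>w\<in>W. integral cube (\<lambda>s. \<Sum>w'\<in>W. weyl_sign w * weyl_sign w' * F w w' (of_coords s)))"
    by (intro integral_sum finite_W integrable_sum Fi)
  also have "\<dots> = (\<Sum>w\<in>W. \<Sum>w'\<in>W. integral cube (\<lambda>s. weyl_sign w * weyl_sign w' * F w w' (of_coords s)))"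
    by (intro sum.cong HOL.refl integral_sum finite_W Fi)
  also have "\<dots> = 0" by (simp add: Fz)
  finally show "integral cube (\<lambda>s. phi \<mu> \<nu> (of_coords s) * cis (2 * pi * (kap * (y \<bullet> Phi (of_coords s))))) = 0" .
qed

section \<open>Regular solutions\<close>

lemma weyl_sign_nonzero: "weyl_sign w \<noteq> 0"
  using weyl_sign_square[of w] by auto

lemma delta_affine: assumes "w \<in> W" "y \<in> Q" shows "delta (w x + y) = 0 \<longleftrightarrow> delta x = 0"
proof -
  have "\<alpha> \<bullet> (w x + y) \<in> \<int> \<longleftrightarrow> \<alpha> \<bullet> w x \<in> \<int>" if "\<alpha> \<in> P" for \<alpha>
    using root_Q_int[OF P_R[OF that] assms(2)] unfolding inner_add_right by (metis Ints_add Ints_diff add_diff_cancel_right')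
  then have "delta (w x + y) = 0 \<longleftrightarrow> delta (w x) = 0" using delta_nonzero_iff by blast
  then show ?thesis by (simp add: delta_W[OF assms(1)] weyl_sign_nonzero)
qed

lemma closed_alcove_regular:
  assumes "x \<in> closed_alcove" "delta x \<noteq> 0" shows "x \<in> alcove"
proof -
  have "0 < \<alpha> \<bullet> x \<and> \<alpha> \<bullet> x < 1" if a: "\<alpha> \<in> P" for \<alpha>
  proof -
    have "\<alpha> \<bullet> x \<notin> \<int>" using assms(2) a delta_nonzero_iff by blast
    then have "\<alpha> \<bullet> x \<noteq> 0" "\<alpha> \<bullet> x \<noteq> 1" by (metis Ints_0, metis Ints_1)
    then show ?thesis using assms(1) a by (fastforce simp: closed_alcove_def)
  qed
  then show ?thesis by (simp add: alcove_def)
qed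

text \<open>\<open>Phi\<close> commutes with the affine reflection in a wall and is injective, so
  only points of the wall are mapped into it.\<close>

lemma delta_Phi: assumes "delta x \<noteq> 0" shows "delta (Phi x) \<noteq> 0"
  unfolding delta_nonzero_iff
proof (intro ballI notI)
  fix \<alpha> assume a: "\<alpha> \<in> P" and "\<alpha> \<bullet> Phi x \<in> \<int>"
  then obtain m where m: "\<alpha> \<bullet> Phi x = of_int m" by (auto elim: Ints_cases)
  have r: "reflection \<alpha> z + of_int m *\<^sub>R coroot \<alpha> = z + (of_int m - \<alpha> \<bullet> z) *\<^sub>R coroot \<alpha>" for z
    by (simp add: reflection_coroot inner_commute[of z] scaleR_diff_left)
  have "Phi (reflection \<alpha> x + of_int m *\<^sub>R coroot \<alpha>) = reflection \<alpha> (Phi x) + of_int m *\<^sub>R coroot \<alpha>"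
    by (rule Phi_affine[OF reflection_W[OF P_R[OF a]] Q_scale_int[OF coroot_Q[OF P_R[OF a]]]])
  also have "\<dots> = Phi x" unfolding r m by simp
  finally have "reflection \<alpha> x + of_int m *\<^sub>R coroot \<alpha> = x" by (rule Phi_inj)
  then have "(of_int m - \<alpha> \<bullet> x) *\<^sub>R coroot \<alpha> = 0" unfolding r by simp
  moreover have "coroot \<alpha> \<noteq> 0" using coroot_inner_self[OF nonzero_P[OF a]] by auto
  ultimately have "\<alpha> \<bullet> x = of_int m" by simp
  then show False using assms a delta_nonzero_iff by (metis Ints_of_int)
qed

text \<open>After x is moved into the open alcove, an element fixing its torus point becomes an
  affine Weyl transformation that fixes an alcove point.\<close>

lemma regular_stabilizer:
  assumes "delta x \<noteq> 0" "w \<in> W" "te (w x) = te x" shows "w = id"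
proof -
  obtain u y where u: "u \<in> W" "y \<in> Q" "u x + y \<in> closed_alcove" using alcove_exists by blast
  define z where "z = u x + y"
  have z: "z \<in> alcove" unfolding z_def using u delta_affine assms(1) by (intro closed_alcove_regular) auto
  define q where "q = w x - x"
  have q: "q \<in> Q" using assms(3) by (simp add: te_eq_iff q_def)
  \<comment> \<open>The translation part of the map x -> w x - q, which fixes x, after conjugation
    with x -> u x + y.\<close>
  define y' where "y' = y - u q - u (w (inv u y))"
  have uwu: "u \<circ> (w \<circ> inv u) \<in> W" by (rule W_comp[OF u(1) W_comp[OF assms(2) W_inv[OF u(1)]]])
  have "y' \<in> Q" unfolding y'_def by (rule Q_diff[OF Q_diff[OF u(2) Q_W[OF u(1) q]] Q_W[OF u(1) Q_W[OF assms(2) Q_W[OF W_inv[OF u(1)] u(2)]]]])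
  moreover have "(u \<circ> (w \<circ> inv u)) z + y' = z"
    unfolding z_def y'_def q_def
    by (simp add: W_add[OF W_inv[OF u(1)]] W_add[OF u(1)] W_add[OF assms(2)] W_diff[OF u(1)] u(1))
  ultimately have id: "u \<circ> (w \<circ> inv u) = id" using affine_fixes_alcove(1)[OF uwu] z by metis
  have "w a = a" for a
  proof -
    have "u (w (inv u (u a))) = u a" using fun_cong[OF id, of "u a"] by (simp only: comp_apply id_apply)
    then show ?thesis using u(1) W_inj by simp
  qed
  then show ?thesis by (simp add: fun_eq_iff)
qed

lemma regular_iff: "(\<forall>w\<in>W. torus_act G w (te x) = te x \<longrightarrow> w = id) \<longleftrightarrow> delta x \<noteq> 0"
proof
  assume tr: "\<forall>w\<in>W. torus_act G w (te x) = te x \<longrightarrow> w = id"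
  show "delta x \<noteq> 0"
  proof
    assume "delta x = 0"
    then obtain \<alpha> where a: "\<alpha> \<in> P" "\<alpha> \<bullet> x \<in> \<int>" using delta_nonzero_iff by blast
    then obtain m where m: "\<alpha> \<bullet> x = of_int m" by (auto elim: Ints_cases)
    have "reflection \<alpha> x - x = of_int (- m) *\<^sub>R coroot \<alpha>" by (simp add: reflection_coroot inner_commute[of x] m)
    then have "te (reflection \<alpha> x) = te x" using Q_scale_int[OF coroot_Q[OF P_R[OF a(1)]], of "- m"] by (simp add: te_eq_iff)
    then have "reflection \<alpha> = id" using tr reflection_W[OF P_R[OF a(1)]] by (simp add: torus_act_te)
    then have "- \<alpha> = \<alpha>" using reflection_self[OF nonzero_P[OF a(1)]] by simp
    then show False using uminus_P[OF a(1)] a(1) by metis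
  qed
qed (use regular_stabilizer torus_act_te in auto)

definition bethe_points :: "(real ^ 'n) set" where
  "bethe_points = {x. kap *\<^sub>R Phi x \<in> weights G \<and> delta x \<noteq> 0}"

lemma F_rho_reg_eq: "F_rho_reg G k t = te ` bethe_points"
  unfolding F_rho_reg_def F_rho_eq bethe_points_def using regular_iff by blast

lemma kap_Q_weight: "y \<in> Q \<Longrightarrow> kap *\<^sub>R y \<in> weights G"
  using kap_nat weight_scale_nat[OF Q_weight] by metis

lemma cell_representative: "\<exists>q\<in>Q. \<forall>i. 0 \<le> fweight i \<bullet> (q + x) \<and> fweight i \<bullet> (q + x) < 1"
proof
  define q where "q = (\<Sum>i\<in>UNIV. of_int (- \<lfloor>fweight i \<bullet> x\<rfloor>) *\<^sub>R scoroot i)"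
  show "q \<in> Q" unfolding q_def by (intro Q_sum Q_scale_int scoroot_Q)
  have "fweight i \<bullet> q = - of_int \<lfloor>fweight i \<bullet> x\<rfloor>" for i
    by (simp add: q_def inner_sum_right inner_commute[of "fweight _"] scoroot_fweight if_distrib sum.delta cong: if_cong)
  then show "\<forall>i. 0 \<le> fweight i \<bullet> (q + x) \<and> fweight i \<bullet> (q + x) < 1"
    by (simp add: inner_add_right) linarith
qed

lemma bethe_cell_representative:
  assumes "kap *\<^sub>R x \<in> weights G" shows "\<exists>q\<in>Q. q + x \<in> bethe_cell"
  using cell_representative[of x] assms kap_Q_weight weight_add unfolding bethe_cell_def by (fastforce simp: scaleR_add_right)

lemma Psi_Q: assumes "y \<in> Q" shows "Psi (y + z) = y + Psi z"
  using Phi_Q[OF assms, of "Psi z"] by (metis Phi_Psi Psi_Phi)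

text \<open>The half-open coordinates of the cell pick one point from each coset of
  \<open>Q\<close>, and \<open>Psi\<close> commutes with translations by \<open>Q\<close>.\<close>

lemma bij_betw_bethe: "bij_betw (\<lambda>z. te (Psi z)) {z\<in>bethe_cell. delta (Psi z) \<noteq> 0} (F_rho_reg G k t)"
proof (rule bij_betw_imageI)
  show "inj_on (\<lambda>z. te (Psi z)) {z\<in>bethe_cell. delta (Psi z) \<noteq> 0}"
  proof (rule inj_onI)
    fix a b assume a: "a \<in> {z\<in>bethe_cell. delta (Psi z) \<noteq> 0}" and b: "b \<in> {z\<in>bethe_cell. delta (Psi z) \<noteq> 0}"
      and eq: "te (Psi a) = te (Psi b)"
    define q where "q = Psi a - Psi b"
    have q: "q \<in> Q" using eq by (simp add: q_def te_eq_iff)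
    have "Psi a = Psi (q + b)" unfolding Psi_Q[OF q] by (simp add: q_def)
    then have ab: "a = q + b" by (metis Phi_Psi)
    have "fweight i \<bullet> q = 0" for i
    proof -
      obtain m where m: "fweight i \<bullet> q = of_int m" using fweight_Q_int[OF q] by (auto elim: Ints_cases)
      have "0 \<le> fweight i \<bullet> a" "fweight i \<bullet> a < 1" "0 \<le> fweight i \<bullet> b" "fweight i \<bullet> b < 1"
        using a b by (auto simp: bethe_cell_def)
      then have "real_of_int m < 1" "- 1 < real_of_int m" unfolding ab inner_add_right m by linarith+
      then show ?thesis unfolding m by simp
    qed
    then have "q = 0" using scoroot_expansion[of q] by simp
    then show "a = b" using ab by simp
  qed
  show "(\<lambda>z. te (Psi z)) ` {z\<in>bethe_cell. delta (Psi z) \<noteq> 0} = F_rho_reg G k t"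
  proof
    show "(\<lambda>z. te (Psi z)) ` {z\<in>bethe_cell. delta (Psi z) \<noteq> 0} \<subseteq> F_rho_reg G k t"
      unfolding F_rho_reg_eq bethe_points_def by (auto simp: bethe_cell_def)
    show "F_rho_reg G k t \<subseteq> (\<lambda>z. te (Psi z)) ` {z\<in>bethe_cell. delta (Psi z) \<noteq> 0}"
    proof
      fix f assume "f \<in> F_rho_reg G k t"
      then obtain x where x: "f = te x" "kap *\<^sub>R Phi x \<in> weights G" "delta x \<noteq> 0"
        unfolding F_rho_reg_eq bethe_points_def by blast
      obtain q where q: "q \<in> Q" "q + Phi x \<in> bethe_cell" using bethe_cell_representative[OF x(2)] by blast
      have ps: "Psi (q + Phi x) = id x + q" by (simp add: Psi_Q[OF q(1)] add.commute)
      have "delta (Psi (q + Phi x)) \<noteq> 0" unfolding ps using delta_affine[OF id_W q(1)] x(3) by blast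
      moreover have "te (Psi (q + Phi x)) = f" unfolding ps x(1) te_eq_iff using q(1) by simp
      ultimately show "f \<in> (\<lambda>z. te (Psi z)) ` {z\<in>bethe_cell. delta (Psi z) \<noteq> 0}" using q(2) by (intro image_eqI[of _ _ "q + Phi x"]) auto
    qed
  qed
qed

lemma finite_F_rho_reg: "finite (F_rho_reg G k t)"
  using bij_betw_finite[OF bij_betw_bethe] bethe_sum_zero(2)[of "\<lambda>x. 0"] by simp

text \<open>The constant divides by the cardinality of \<open>F_set\<close>, which would count as 0
  for an infinite or empty set; finiteness and nonemptiness are the content.\<close>

lemma theta_factor_nonzero: "theta_factor \<noteq> 0"
proof -
  have F: "F_set G k = te ` {x. kap *\<^sub>R x \<in> weights G}"
    unfolding F_set_def weights_iff by (auto simp: inner_commute)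
  have "F_set G k \<subseteq> te ` bethe_cell"
  proof
    fix f assume "f \<in> F_set G k"
    then obtain x where x: "f = te x" "kap *\<^sub>R x \<in> weights G" unfolding F by blast
    obtain q where q: "q \<in> Q" "q + x \<in> bethe_cell" using bethe_cell_representative[OF x(2)] by blast
    have "te (q + x) = f" unfolding x(1) te_eq_iff using q(1) by simp
    then show "f \<in> te ` bethe_cell" using q(2) by blast
  qed
  then have "finite (F_set G k)" using bethe_sum_zero(2)[of "\<lambda>x. 0"] by (auto intro: finite_subset)
  moreover have "te 0 \<in> F_set G k" unfolding F using weight_zero by auto
  ultimately have "card (F_set G k) \<noteq> 0" by auto
  moreover have "1 - complex_of_real t \<noteq> 0" using t_half by (metis abs_of_pos diff_gt_0_iff_gt eq_iff_diff_eq_0 less_irrefl of_real_eq_1_iff t_less_one zero_less_one abs_1)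
  ultimately show ?thesis by (simp add: theta_factor_def)
qed

section \<open>Sums over orbits\<close>

definition orb :: "real ^ 'n \<Rightarrow> (real ^ 'n \<Rightarrow> complex) set" where
  "orb x = (\<lambda>w. te (w x)) ` W"

definition orbits :: "(real ^ 'n \<Rightarrow> complex) set set" where
  "orbits = weyl_orbits G (F_rho_reg G k t)"

definition rep :: "(real ^ 'n \<Rightarrow> complex) set \<Rightarrow> real ^ 'n \<Rightarrow> complex" where
  "rep O' = (SOME f. f \<in> O')"

lemma torus_orbit: "(\<lambda>w. torus_act G w (te x)) ` W = orb x"
  unfolding orb_def by (intro image_cong HOL.refl torus_act_te)

lemma orbits_eq: "orbits = orb ` bethe_points"
  unfolding orbits_def weyl_orbits_def F_rho_reg_eq image_image torus_orbit ..

lemma finite_orbits: "finite orbits"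
  unfolding orbits_def weyl_orbits_def by (intro finite_imageI finite_F_rho_reg)

lemma bethe_points_W: "x \<in> bethe_points \<Longrightarrow> w \<in> W \<Longrightarrow> w x \<in> bethe_points"
  using delta_affine[of w 0 x] weight_W[of w "kap *\<^sub>R Phi x"]
  by (simp add: bethe_points_def Phi_W W_scale)

lemma orb_affine: assumes "w \<in> W" "y \<in> Q" shows "orb (w x + y) = orb x"
proof -
  have "te (u (w x + y)) = te ((u \<circ> w) x)" if "u \<in> W" for u
    using Q_W[OF that assms(2)] by (simp add: te_eq_iff W_add[OF that])
  then have "orb (w x + y) = (\<lambda>u. te ((u \<circ> w) x)) ` W" unfolding orb_def by (intro image_cong) auto
  also have "\<dots> = (\<lambda>u. te (u x)) ` (\<lambda>u. u \<circ> w) ` W" by (simp only: image_image)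
  also have "(\<lambda>u. u \<circ> w) ` W = W"
  proof
    show "(\<lambda>u. u \<circ> w) ` W \<subseteq> W" using W_comp[OF _ assms(1)] by blast
    show "W \<subseteq> (\<lambda>u. u \<circ> w) ` W"
    proof
      fix u assume u: "u \<in> W"
      have "u = (u \<circ> inv w) \<circ> w" using assms(1) by (simp add: fun_eq_iff)
      then show "u \<in> (\<lambda>u. u \<circ> w) ` W" using W_comp[OF u W_inv[OF assms(1)]] by (rule image_eqI)
    qed
  qed
  finally show ?thesis by (simp only: orb_def)
qed

lemma te_in_orb: "te x \<in> orb x"
  unfolding orb_def using id_W by (rule image_eqI[rotated]) simp

lemma orb_W: "w \<in> W \<Longrightarrow> orb (w x) = orb x"
  using orb_affine[of w 0 x] by simp

lemma rep_orb: "\<exists>w\<in>W. rep (orb x) = te (w x)"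
proof -
  have "rep (orb x) \<in> orb x" unfolding rep_def by (rule someI[of _ "te x"]) (rule te_in_orb)
  then show ?thesis by (auto simp: orb_def)
qed

lemma card_orb: assumes "x \<in> bethe_points" shows "card (orb x) = card W"
  unfolding orb_def
proof (rule card_image, rule inj_onI)
  fix u w assume u: "u \<in> W" and w: "w \<in> W" and eq: "te (u x) = te (w x)"
  have "inv w (u x) - x = inv w (u x - w x)" by (simp add: W_diff[OF W_inv[OF w]] w)
  then have "te ((inv w \<circ> u) x) = te x" using eq Q_W[OF W_inv[OF w], of "u x - w x"] by (simp add: te_eq_iff)
  then have id: "inv w \<circ> u = id"
    using assms regular_stabilizer[of x, OF _ W_comp[OF W_inv[OF w] u]] by (simp add: bethe_points_def)
  have "u a = w a" for a
  proof -
    have "w (inv w (u a)) = w a" using fun_cong[OF id, of a] by simp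
    then show ?thesis using w by simp
  qed
  then show "u = w" by (simp add: fun_eq_iff)
qed

text \<open>Regular points have trivial stabilizers, so every orbit has exactly as many elements as
  the Weyl group.\<close>

lemma orbit_sum:
  assumes inv: "\<And>x w. x \<in> bethe_points \<Longrightarrow> w \<in> W \<Longrightarrow> F (te (w x)) = (F (te x) :: complex)"
  shows "(\<Sum>f\<in>F_rho_reg G k t. F f) = of_nat (card W) * (\<Sum>O'\<in>orbits. F (rep O'))"
proof -
  let ?g = "\<lambda>f. (\<lambda>w. torus_act G w f) ` W"
  have "(\<Sum>f\<in>F_rho_reg G k t. F f) = (\<Sum>O'\<in>orbits. \<Sum>f\<in>{f\<in>F_rho_reg G k t. ?g f = O'}. F f)"
    by (rule sum.group[OF finite_F_rho_reg finite_orbits, symmetric]) (simp add: orbits_def weyl_orbits_def)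
  also have "\<dots> = (\<Sum>O'\<in>orbits. of_nat (card W) * F (rep O'))"
  proof (rule sum.cong[OF HOL.refl])
    fix O' assume "O' \<in> orbits"
    then obtain x where x: "x \<in> bethe_points" "O' = orb x" unfolding orbits_eq by blast
    obtain w where w: "w \<in> W" "rep O' = te (w x)" using rep_orb x(2) by blast
    have "{f\<in>F_rho_reg G k t. ?g f = O'} = orb x"
    proof
      show "{f\<in>F_rho_reg G k t. ?g f = O'} \<subseteq> orb x"
        unfolding F_rho_reg_eq x(2) using torus_orbit te_in_orb by fastforce
      show "orb x \<subseteq> {f\<in>F_rho_reg G k t. ?g f = O'}"
      proof
        fix f assume "f \<in> orb x"
        then obtain u where u: "u \<in> W" "f = te (u x)" unfolding orb_def by blast
        show "f \<in> {f\<in>F_rho_reg G k t. ?g f = O'}"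
          unfolding F_rho_reg_eq u(2) x(2) using torus_orbit[of "u x"] orb_W[OF u(1)] bethe_points_W[OF x(1) u(1)] by simp
      qed
    qed
    moreover have "F f = F (te x)" if "f \<in> orb x" for f using that inv[OF x(1)] by (auto simp: orb_def)
    ultimately show "(\<Sum>f\<in>{f\<in>F_rho_reg G k t. ?g f = O'}. F f) = of_nat (card W) * F (rep O')"
      using w inv[OF x(1) w(1)] card_orb[OF x(1)] by simp
  qed
  finally show ?thesis by (simp only: sum_distrib_left)
qed

text \<open>Differentiating the equivariance of \<open>Phi\<close> conjugates the derivative by w,
  whose determinant cancels.\<close>

lemma jac_det_W: assumes "w \<in> W" shows "jac_det (w x) = jac_det x"
proof -
  have bl: "(w has_derivative w) (at y)" for y
    using W_linear[OF assms] by (intro bounded_linear_imp_has_derivative) (simp add: linear_conv_bounded_linear)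
  have "((\<lambda>x. Phi (w x)) has_derivative (\<lambda>y. DPhi (w x) (w y))) (at x)"
    by (rule has_derivative_compose[OF bl Phi_deriv])
  moreover have "((\<lambda>x. w (Phi x)) has_derivative (\<lambda>y. w (DPhi x y))) (at x)"
    by (rule has_derivative_compose[OF Phi_deriv bl])
  ultimately have "(\<lambda>y. DPhi (w x) (w y)) = (\<lambda>y. w (DPhi x y))"
    unfolding Phi_W[OF assms] by (rule has_derivative_unique)
  then have "matrix (DPhi (w x)) ** matrix w = matrix w ** matrix (DPhi x)"
    using matrix_compose[OF W_linear[OF assms] linear_DPhi, of "w x"] matrix_compose[OF linear_DPhi W_linear[OF assms], of x]
    by (simp add: o_def)
  then have "jac_det (w x) * det (matrix w) = det (matrix w) * jac_det x" unfolding det_mul[symmetric] by simp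
  moreover have "det (matrix w) \<noteq> 0"
    using det_orthogonal_matrix W_orthogonal[OF assms] by (fastforce simp: orthogonal_transformation_matrix)
  ultimately show ?thesis by simp
qed

lemma Theta_W: assumes "\<mu> \<in> weights G" "w \<in> W" shows "Theta G \<mu> t (te (w x)) = Theta G \<mu> t (te x)"
  by (simp add: Theta_te[OF assms(1)] char_numerator_W[OF assms(2)] weyl_denom_def delta_W[OF assms(2)] weyl_sign_nonzero)

lemma theta_W: assumes "w \<in> W" shows "theta G k t (te (w x)) = theta G k t (te x)"
proof -
  have "deform_product (w x) = (\<Prod>\<alpha>\<in>R. deform_factor \<alpha> (w x))" unfolding deform_product_def prod_R ..
  also have "\<dots> = (\<Prod>\<alpha>\<in>R. deform_factor (w \<alpha>) (w x))" by (rule prod.reindex_bij_betw[OF bij_betw_W_R[OF assms], symmetric])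
  also have "\<dots> = (\<Prod>\<alpha>\<in>R. deform_factor \<alpha> x)" by (simp add: deform_factor_def ch_W[OF assms])
  also have "\<dots> = deform_product x" unfolding deform_product_def prod_R ..
  finally have deform_product: "deform_product (w x) = deform_product x" .
  have "weyl_denom (w x) * cnj (weyl_denom (w x)) = (weyl_sign w * weyl_sign w) * (weyl_denom x * cnj (weyl_denom x))"
    by (simp add: weyl_denom_def delta_W[OF assms] weyl_sign_cnj mult_ac)
  then show ?thesis unfolding theta_te deform_product jac_det_W[OF assms] by (simp add: weyl_sign_square)
qed

definition sgn_dtm :: real where "sgn_dtm = sgn (jac_det 0)"

lemma jac_det_abs: "jac_det x = sgn_dtm * \<bar>jac_det x\<bar>" and sgn_dtm_nonzero: "sgn_dtm \<noteq> 0"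
proof -
  have "sgn (jac_det x) = sgn (jac_det 0)"
    using det_DPhi_sign[of x 0] by (auto simp: zero_less_mult_iff)
  then show "jac_det x = sgn_dtm * \<bar>jac_det x\<bar>" unfolding sgn_dtm_def by (metis sgn_mult_abs)
  show "sgn_dtm \<noteq> 0" using det_DPhi_nonzero[of 0] by (simp add: sgn_dtm_def sgn_zero_iff)
qed

text \<open>\<open>phi\<close> vanishes on the walls, so the sum over regular solutions extends to
  the whole cell, where the vanishing theorem applies. The constant sign of the Jacobian goes into
  the prefactor.\<close>

lemma orbit_pairing:
  assumes "\<mu> \<in> weights G" "\<nu> \<in> weights G"
  shows "of_nat (card W) * (\<Sum>O'\<in>orbits. theta G k t (rep O') * (Theta G \<mu> t (rep O') * Theta G (dual_weight G \<nu>) t (rep O')))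
    = theta_factor * inverse (of_real sgn_dtm) * (\<Sum>z\<in>bethe_cell. phi \<mu> \<nu> (Psi z) / of_real \<bar>jac_det (Psi z)\<bar>)"
proof -
  define F where "F f = theta G k t f * (Theta G \<mu> t f * Theta G (dual_weight G \<nu>) t f)" for f
  have dw: "dual_weight G \<nu> \<in> weights G"
    unfolding dual_weight_def by (rule weight_minus[OF weight_W[OF longest_element(1) assms(2)]])
  have "of_nat (card W) * (\<Sum>O'\<in>orbits. F (rep O')) = (\<Sum>f\<in>F_rho_reg G k t. F f)"
    by (rule orbit_sum[symmetric]) (simp add: F_def theta_W Theta_W[OF assms(1)] Theta_W[OF dw])
  also have "\<dots> = (\<Sum>z\<in>{z\<in>bethe_cell. delta (Psi z) \<noteq> 0}. F (te (Psi z)))"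
    by (rule sum.reindex_bij_betw[OF bij_betw_bethe, symmetric])
  also have "\<dots> = (\<Sum>z\<in>{z\<in>bethe_cell. delta (Psi z) \<noteq> 0}. theta_factor * (phi \<mu> \<nu> (Psi z) / of_real (jac_det (Psi z))))"
    by (intro sum.cong HOL.refl) (simp add: F_def Theta_dual[OF assms(2)] theta_Theta_te[OF assms])
  also have "\<dots> = (\<Sum>z\<in>bethe_cell. theta_factor * (phi \<mu> \<nu> (Psi z) / of_real (jac_det (Psi z))))"
    by (intro sum.mono_neutral_left bethe_sum_zero(2)[of "\<lambda>x. 0"]) (auto simp: phi_def char_numerator_wall[OF assms(1)])
  also have "\<dots> = (\<Sum>z\<in>bethe_cell. theta_factor * inverse (of_real sgn_dtm) * (phi \<mu> \<nu> (Psi z) / of_real \<bar>jac_det (Psi z)\<bar>))"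
  proof (intro sum.cong HOL.refl)
    fix z
    have "complex_of_real (jac_det (Psi z)) = of_real sgn_dtm * of_real \<bar>jac_det (Psi z)\<bar>"
      unfolding of_real_mult[symmetric] jac_det_abs[symmetric] ..
    then show "theta_factor * (phi \<mu> \<nu> (Psi z) / of_real (jac_det (Psi z))) = theta_factor * inverse (of_real sgn_dtm) * (phi \<mu> \<nu> (Psi z) / of_real \<bar>jac_det (Psi z)\<bar>)"
      by (simp only: divide_inverse inverse_mult_distrib mult_ac)
  qed
  finally show ?thesis by (simp only: F_def sum_distrib_left)
qed

lemma card_W_nonzero: "of_nat (card W) \<noteq> (0 :: complex)"
  using id_W finite_W by (metis card_0_eq empty_iff of_nat_eq_0_iff)

lemma orbit_orthogonal:
  assumes "\<mu> \<in> \<Lambda> k" "\<nu> \<in> \<Lambda> k" "\<nu> \<noteq> dual_weight G \<mu>"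
  shows "(\<Sum>O'\<in>orbits. theta G k t (rep O') * (Theta G \<mu> t (rep O') * Theta G \<nu> t (rep O'))) = 0"
proof -
  have d: "dual_weight G \<nu> \<in> \<Lambda> k" "\<mu> \<noteq> dual_weight G \<nu>"
    using dual_weight_level[OF assms(2)] assms(3) by auto
  show ?thesis
    using orbit_pairing[OF level_weightsD(1)[OF assms(1)] level_weightsD(1)[OF d(1)]] phi_sum_zero[OF assms(1) d] card_W_nonzero by simp
qed

text \<open>For equal weights every summand over the cell is the squared modulus of the numerator
  times the positive \<open>deform_product\<close>, divided by a positive Jacobian. One point with
  nonzero numerator makes the sum positive.\<close>

lemma orbit_norm_nonzero:
  assumes "\<mu> \<in> \<Lambda> k" "kap *\<^sub>R p \<in> weights G" "char_numerator t \<mu> (Psi p) \<noteq> 0"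
  shows "(\<Sum>O'\<in>orbits. theta G k t (rep O') * (Theta G \<mu> t (rep O') * Theta G (dual_weight G \<mu>) t (rep O'))) \<noteq> 0"
proof -
  have mu: "\<mu> \<in> weights G" by (rule level_weightsD(1)[OF assms(1)])
  obtain q where q: "q \<in> Q" "q + p \<in> bethe_cell" using bethe_cell_representative[OF assms(2)] by blast
  obtain r where r: "\<And>x. r x > 0" "\<And>x. deform_product x = complex_of_real (r x)" using deform_product_pos by metis
  define s where "s z = r (Psi z) * (norm (char_numerator t \<mu> (Psi z)))\<^sup>2 / \<bar>jac_det (Psi z)\<bar>" for z
  have "phi \<mu> \<mu> (Psi z) / of_real \<bar>jac_det (Psi z)\<bar> = complex_of_real (s z)" for z
    by (simp add: phi_def r(2) s_def complex_norm_square[symmetric] mult.assoc)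
  then have sum: "(\<Sum>z\<in>bethe_cell. phi \<mu> \<mu> (Psi z) / of_real \<bar>jac_det (Psi z)\<bar>) = complex_of_real (\<Sum>z\<in>bethe_cell. s z)" by simp
  have "char_numerator t \<mu> (Psi (q + p)) \<noteq> 0" unfolding Psi_Q[OF q(1)] char_numerator_period[OF mu q(1)] by (rule assms(3))
  then have "s (q + p) > 0" using r(1) det_DPhi_nonzero by (simp add: s_def)
  then have "(\<Sum>z\<in>bethe_cell. s z) > 0"
    using q(2) bethe_sum_zero(2)[of "\<lambda>x. 0"] r(1)
    by (intro sum_pos2[of _ "q + p"]) (auto simp: s_def intro!: divide_nonneg_nonneg mult_nonneg_nonneg less_imp_le[OF r(1)])
  then have "of_nat (card W) * (\<Sum>O'\<in>orbits. theta G k t (rep O') * (Theta G \<mu> t (rep O') * Theta G (dual_weight G \<mu>) t (rep O'))) \<noteq> 0"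
    unfolding orbit_pairing[OF mu mu] sum using theta_factor_nonzero sgn_dtm_nonzero by (simp del: of_real_sum)
  then show ?thesis by simp
qed

text \<open>The solutions of the deformed equations lie in the deformed alcove exactly where the
  undeformed ones lie in the alcove, and those are indexed by the level \<open>k\<close> weights shifted by \<open>\<rho>\<close>.\<close>
lemma card_orbits: "card orbits \<le> card (\<Lambda> k)"
proof -
  have "orbits \<subseteq> (\<lambda>\<mu>. orb (Psi ((1 / kap) *\<^sub>R (\<mu> + rho)))) ` \<Lambda> k"
  proof
    fix O' assume "O' \<in> orbits"
    then obtain x where x: "O' = orb x" "kap *\<^sub>R Phi x \<in> weights G" "delta x \<noteq> 0"
      unfolding orbits_eq bethe_points_def by blast
    obtain w y where w: "w \<in> W" "y \<in> Q" "w (Phi x) + y \<in> closed_alcove" using alcove_exists by blast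
    define z where "z = w (Phi x) + y"
    have zP: "z = Phi (w x + y)" unfolding z_def by (rule Phi_affine[OF w(1,2), symmetric])
    have z: "z \<in> alcove"
      using w(3) delta_Phi[of "w x + y"] delta_affine[OF w(1,2)] x(3)
      by (intro closed_alcove_regular) (simp_all add: zP Phi_affine[OF w(1,2)])
    have zw: "kap *\<^sub>R z \<in> weights G"
      unfolding z_def scaleR_add_right W_scale[OF w(1), symmetric]
      by (rule weight_add[OF weight_W[OF w(1) x(2)] kap_Q_weight[OF w(2)]])
    define \<mu> where "\<mu> = kap *\<^sub>R z - rho"
    have mw: "\<mu> \<in> weights G" unfolding \<mu>_def by (rule weight_diff[OF zw weight_rho])
    have int: "kap *\<^sub>R z \<bullet> y' \<in> \<int>" if "y' \<in> Q" for y' using zw that unfolding weights_iff by blast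
    \<comment> \<open>The product of \<open>kap *\<^sub>R z\<close> with a simple coroot is a
      positive integer, hence at least 1, the value of \<rho> on that coroot.\<close>
    have simple: "\<mu> \<bullet> coroot \<gamma> \<ge> 0" if g: "\<gamma> \<in> \<Delta>" for \<gamma>
    proof -
      obtain m where m: "kap *\<^sub>R z \<bullet> coroot \<gamma> = of_int m" using int[OF coroot_Q[OF simple_R[OF g]]] by (auto elim: Ints_cases)
      have "0 < kap *\<^sub>R z \<bullet> \<gamma>" using z simple_P[OF g] kap_pos by (simp add: alcove_def inner_commute)
      then have "0 < kap *\<^sub>R z \<bullet> coroot \<gamma>" using inner_coroot_sign(2)[OF nonzero_P[OF simple_P[OF g]]] by blast
      then have "1 \<le> kap *\<^sub>R z \<bullet> coroot \<gamma>" unfolding m by simp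
      then show ?thesis unfolding \<mu>_def inner_diff_left rho_simple_coroot[OF g] by linarith
    qed
    have "\<mu> \<in> \<Lambda> k"
    proof (rule level_weightsI[OF mw])
      fix \<alpha> assume a: "\<alpha> \<in> P"
      then have "0 \<le> \<mu> \<bullet> coroot \<alpha>" using simple by (rule simple_coroot_induct)
      then show "0 \<le> \<alpha> \<bullet> \<mu>" using inner_coroot_sign(1)[OF nonzero_P[OF a]] by (simp add: inner_commute)
    next
      obtain m where m: "kap *\<^sub>R z \<bullet> \<theta> = of_int m" using int[OF highest_Q] by (auto elim: Ints_cases)
      obtain n where n: "kap = of_nat n" using kap_nat by blast
      have "kap * (\<theta> \<bullet> z) < kap" using z highest_P kap_pos by (simp add: alcove_def)
      then have "of_int m < kap" unfolding m[symmetric] by (simp add: inner_commute)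
      then have "m < int n" unfolding n by (metis of_int_less_iff of_int_of_nat_eq)
      \<comment> \<open>An integer below \<open>kap\<close>, which is k + h, is at most k + h - 1,
        and subtracting \<rho> \<bullet> \<theta> = h - 1 leaves exactly k.\<close>
      then have "of_int m \<le> kap - 1" unfolding n by linarith
      moreover have "\<theta> \<bullet> \<mu> = of_int m - (h - 1)"
      proof -
        have "\<theta> \<bullet> \<mu> = kap *\<^sub>R z \<bullet> \<theta> - rho \<bullet> \<theta>" unfolding \<mu>_def by (simp only: inner_diff_right inner_commute)
        then show ?thesis unfolding m using dual_coxeter_eq by linarith
      qed
      ultimately show "\<theta> \<bullet> \<mu> \<le> real k" by simp
    qed
    moreover have "(1 / kap) *\<^sub>R (\<mu> + rho) = z" using kap_pos by (simp add: \<mu>_def)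
    then have "O' = orb (Psi ((1 / kap) *\<^sub>R (\<mu> + rho)))" unfolding x(1) zP by (simp add: orb_affine[OF w(1,2)])
    ultimately show "O' \<in> (\<lambda>\<mu>. orb (Psi ((1 / kap) *\<^sub>R (\<mu> + rho)))) ` \<Lambda> k" by blast
  qed
  then show ?thesis by (rule surj_card_le[OF finite_level_weights])
qed

lemma verlinde_d_orbits:
  "verlinde_d G k 0 \<mu>s t = (\<Sum>O'\<in>orbits. theta G k t (rep O') * (\<Prod>\<mu>\<leftarrow>\<mu>s. Theta G \<mu> t (rep O')))"
  by (simp add: verlinde_d_def orbits_def rep_def Let_def)

end

section \<open>Frobenius algebras of functions on a finite set\<close>

lemma vector_space_fun_scale: "vector_space (fun_scale :: complex \<Rightarrow> ('a \<Rightarrow> complex) \<Rightarrow> 'a \<Rightarrow> complex)"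
  by unfold_locales (auto simp: fun_scale_def fun_eq_iff algebra_simps)

lemma sum_fun_apply: "(\<Sum>i\<in>I. f i) x = (\<Sum>i\<in>I. f i x)" for f :: "'i \<Rightarrow> 'a \<Rightarrow> complex"
  by (induction I rule: infinite_finite_induct) auto

text \<open>The algebraic structure separated from its origin: functions on a finite set, orthogonal
  up to the involution \<open>dual\<close> for a weighted sum, and not fewer than the points. The
  resulting algebra is that of all functions on X.\<close>

locale orthogonal_functions =
  fixes L :: "'a set" and X :: "'x set" and T :: "'a \<Rightarrow> 'x \<Rightarrow> complex" and m :: "'x \<Rightarrow> complex"
    and dual :: "'a \<Rightarrow> 'a"
  assumes finite_L: "finite L" and finite_X: "finite X" and card_le: "card X \<le> card L"
    and dual_L: "\<And>a. a \<in> L \<Longrightarrow> dual a \<in> L" and dual_dual: "\<And>a. a \<in> L \<Longrightarrow> dual (dual a) = a"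
    and orthogonal: "\<And>a b. a \<in> L \<Longrightarrow> b \<in> L \<Longrightarrow> b \<noteq> dual a \<Longrightarrow> (\<Sum>x\<in>X. m x * (T a x * T b x)) = 0"
    and norm_nonzero: "\<And>a. a \<in> L \<Longrightarrow> (\<Sum>x\<in>X. m x * (T a x * T (dual a) x)) \<noteq> 0"
begin

interpretation fs: vector_space "fun_scale :: complex \<Rightarrow> ('b \<Rightarrow> complex) \<Rightarrow> 'b \<Rightarrow> complex"
  by (rule vector_space_fun_scale)

definition N :: "'a \<Rightarrow> complex" where "N a = (\<Sum>x\<in>X. m x * (T a x * T (dual a) x))"

definition E :: "('a \<Rightarrow> complex) \<Rightarrow> 'x \<Rightarrow> complex" where "E u x = (\<Sum>a\<in>L. u a * T a x)"

lemma orthogonality: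
  assumes "a \<in> L" "b \<in> L" shows "(\<Sum>x\<in>X. m x * (T a x * T (dual b) x)) = (if a = b then N b else 0)"
proof (cases "a = b")
  case False
  then have "dual b \<noteq> dual a" using assms dual_dual by metis
  then show ?thesis using orthogonal[OF assms(1) dual_L[OF assms(2)]] False by simp
qed (simp add: N_def)

lemma coefficient:
  assumes "b \<in> L" shows "(\<Sum>x\<in>X. m x * (E u x * T (dual b) x)) = u b * N b"
proof -
  have "(\<Sum>x\<in>X. m x * (E u x * T (dual b) x)) = (\<Sum>a\<in>L. u a * (\<Sum>x\<in>X. m x * (T a x * T (dual b) x)))"
    unfolding E_def by (simp add: sum_distrib_left sum_distrib_right mult_ac) (rule sum.swap)
  also have "\<dots> = (\<Sum>a\<in>L. if a = b then u a * N b else 0)" by (intro sum.cong HOL.refl) (simp add: orthogonality assms)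
  finally show ?thesis using assms finite_L by simp
qed

text \<open>Orthogonality makes the functions independent, and their number is at least the
  dimension of the space of functions on X, so they span it.\<close>

lemma completeness: "\<exists>u. \<forall>x\<in>X. g x = E u x"
proof -
  \<comment> \<open>Values outside X are not controlled, so the functions are cut off there before
    linear algebra is applied.\<close>
  define T' where "T' a = (\<lambda>x. if x \<in> X then T a x else 0)" for a
  have inj: "inj_on T' L"
  proof (rule inj_onI)
    fix a b assume ab: "a \<in> L" "b \<in> L" "T' a = T' b"
    have "T a x = T b x" if "x \<in> X" for x using fun_cong[OF ab(3), of x] that by (simp add: T'_def)
    then have "(\<Sum>x\<in>X. m x * (T a x * T (dual b) x)) = N b" unfolding N_def by (intro sum.cong) auto
    then show "a = b" using orthogonality[OF ab(1,2)] norm_nonzero[OF ab(2)] by (auto simp: N_def split: if_splits)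
  qed
  have ind: "\<not> fs.dependent (T' ` L)"
  proof (rule fs.independent_if_scalars_zero)
    fix f y assume z: "(\<Sum>y\<in>T' ` L. fun_scale (f y) y) = 0" and y: "y \<in> T' ` L"
    obtain b where b: "b \<in> L" "y = T' b" using y by blast
    have "E (\<lambda>a. f (T' a)) x = 0" if "x \<in> X" for x
      using fun_cong[OF z, of x] that unfolding sum.reindex[OF inj] sum_fun_apply
      by (simp add: E_def T'_def fun_scale_def)
    then have "f (T' b) * N b = 0" using coefficient[OF b(1), of "\<lambda>a. f (T' a)"] by simp
    then show "f y = 0" using norm_nonzero[OF b(1)] b(2) by (simp add: N_def)
  qed (simp add: finite_L)
  have expand: "g' \<in> fs.span (basis_vec ` X)" if "\<And>x. x \<notin> X \<Longrightarrow> g' x = 0" for g'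
  proof -
    have "g' = (\<Sum>x\<in>X. fun_scale (g' x) (basis_vec x))"
      using that finite_X by (auto simp: fun_eq_iff sum_fun_apply fun_scale_def basis_vec_def if_distrib sum.delta' cong: if_cong)
    also have "\<dots> \<in> fs.span (basis_vec ` X)" by (intro fs.span_sum fs.span_scale fs.span_base) auto
    finally show ?thesis .
  qed
  have sub: "T' ` L \<subseteq> fs.span (basis_vec ` X)"
  proof
    fix y assume "y \<in> T' ` L"
    then show "y \<in> fs.span (basis_vec ` X)" by (intro expand) (auto simp: T'_def)
  qed
  have "(\<lambda>x. if x \<in> X then g x else 0) \<in> fs.span (T' ` L)"
  proof (rule ccontr)
    let ?g = "\<lambda>x. if x \<in> X then g x else 0"
    assume notin: "?g \<notin> fs.span (T' ` L)"
    then have "\<not> fs.dependent (insert ?g (T' ` L))" by (rule fs.independent_insertI[OF _ ind])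
    moreover have "insert ?g (T' ` L) \<subseteq> fs.span (basis_vec ` X)" using sub by (auto intro: expand)
    ultimately have "card (insert ?g (T' ` L)) \<le> card (basis_vec ` X :: ('x \<Rightarrow> complex) set)"
      by (metis fs.independent_span_bound finite_imageI finite_X)
    also have "\<dots> \<le> card X" by (rule card_image_le[OF finite_X])
    also have "\<dots> \<le> card (T' ` L)" using card_le card_image[OF inj] by simp
    finally have "card (insert ?g (T' ` L)) \<le> card (T' ` L)" .
    moreover have "?g \<notin> T' ` L" using notin fs.span_base by blast
    ultimately show False using finite_L by simp
  qed
  then obtain f where f: "(\<lambda>x. if x \<in> X then g x else 0) = (\<Sum>y\<in>T' ` L. fun_scale (f y) y)"
    unfolding fs.span_finite[OF finite_imageI[OF finite_L]] by blast
  have "g x = E (\<lambda>a. f (T' a)) x" if "x \<in> X" for x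
    using fun_cong[OF f, of x] that unfolding sum.reindex[OF inj] sum_fun_apply
    by (simp add: E_def T'_def fun_scale_def)
  then show ?thesis by blast
qed

text \<open>Shaped like \<open>star_basis\<close>, so that the two are identified by unfolding
  definitions.\<close>

definition product_basis :: "'a \<Rightarrow> 'a \<Rightarrow> 'a \<Rightarrow> complex" where
  "product_basis a b = (\<Sum>c\<in>L. fun_scale ((\<Sum>x\<in>X. m x * (T a x * (T b x * T (dual c) x))) * inverse (N c)) (basis_vec c))"

definition product :: "('a \<Rightarrow> complex) \<Rightarrow> ('a \<Rightarrow> complex) \<Rightarrow> 'a \<Rightarrow> complex" where
  "product u u' = (\<Sum>a\<in>L. \<Sum>b\<in>L. fun_scale (u a * u' b) (product_basis a b))"

definition bilinear_form :: "('a \<Rightarrow> complex) \<Rightarrow> ('a \<Rightarrow> complex) \<Rightarrow> complex" where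
  "bilinear_form u u' = (\<Sum>a\<in>L. \<Sum>b\<in>L. u a * u' b * (if a = dual b then N a else 0))"

lemma free_space_iff: "u \<in> free_space L \<longleftrightarrow> (\<forall>a. a \<notin> L \<longrightarrow> u a = 0)"
  using finite_L by (auto simp: free_space_def intro: finite_subset)

lemma E_add: "E (u + u') x = E u x + E u' x" and E_scale: "E (fun_scale c u) x = c * E u x"
  and E_sum: "E (\<Sum>i\<in>I. f i) x = (\<Sum>i\<in>I. E (f i) x)" for f :: "'i \<Rightarrow> 'a \<Rightarrow> complex"
proof -
  show "E (u + u') x = E u x + E u' x" by (simp add: E_def distrib_right sum.distrib)
  show "E (fun_scale c u) x = c * E u x" by (simp add: E_def fun_scale_def sum_distrib_left mult_ac)
  show "E (\<Sum>i\<in>I. f i) x = (\<Sum>i\<in>I. E (f i) x)"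
    by (simp add: E_def sum_fun_apply sum_distrib_right) (rule sum.swap)
qed

lemma E_basis: "a \<in> L \<Longrightarrow> E (basis_vec a) x = T a x"
proof -
  assume a: "a \<in> L"
  have "E (basis_vec a) x = (\<Sum>b\<in>L. if b = a then T b x else 0)"
    unfolding E_def basis_vec_def by (intro sum.cong) auto
  then show ?thesis using a finite_L by simp
qed

lemma E_inject:
  assumes "u \<in> free_space L" "u' \<in> free_space L" "\<And>x. x \<in> X \<Longrightarrow> E u x = E u' x" shows "u = u'"
proof
  fix b
  show "u b = u' b"
  proof (cases "b \<in> L")
    case True
    have "u b * N b = u' b * N b"
      unfolding coefficient[OF True, symmetric] by (intro sum.cong) (auto simp: assms(3))
    then show ?thesis using norm_nonzero[OF True] by (simp add: N_def)
  qed (use assms in \<open>simp add: free_space_iff\<close>)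
qed

text \<open>By orthogonality the structure constants are the expansion coefficients of the pointwise
  product.\<close>

lemma E_product_basis:
  assumes "a \<in> L" "b \<in> L" "x \<in> X" shows "E (product_basis a b) x = T a x * T b x"
proof -
  obtain u where u: "\<And>x. x \<in> X \<Longrightarrow> T a x * T b x = E u x"
    using completeness[of "\<lambda>x. T a x * T b x"] by blast
  have "(\<Sum>x\<in>X. m x * (T a x * (T b x * T (dual c) x))) * inverse (N c) = u c" if c: "c \<in> L" for c
  proof -
    have "(\<Sum>x\<in>X. m x * (T a x * (T b x * T (dual c) x))) = u c * N c"
      unfolding coefficient[OF c, symmetric] by (intro sum.cong HOL.refl) (simp add: u[symmetric])
    then show ?thesis using norm_nonzero[OF c] by (simp add: N_def)
  qed
  then have "E (product_basis a b) x = (\<Sum>c\<in>L. u c * T c x)"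
    unfolding product_basis_def E_sum E_scale by (intro sum.cong HOL.refl) (simp add: E_basis)
  then show ?thesis using u[OF assms(3)] by (simp add: E_def)
qed

lemma E_product: "x \<in> X \<Longrightarrow> E (product u u') x = E u x * E u' x"
proof -
  assume x: "x \<in> X"
  have "E (product u u') x = (\<Sum>a\<in>L. \<Sum>b\<in>L. (u a * T a x) * (u' b * T b x))"
    unfolding product_def E_sum E_scale by (intro sum.cong HOL.refl) (simp add: E_product_basis x mult_ac)
  then show ?thesis unfolding E_def sum_product .
qed

lemma bilinear_form_E: "bilinear_form u u' = (\<Sum>x\<in>X. m x * (E u x * E u' x))"
proof -
  have "(\<Sum>x\<in>X. m x * (E u x * E u' x)) = (\<Sum>x\<in>X. \<Sum>b\<in>L. u' b * (m x * (E u x * T b x)))"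
    unfolding E_def[of u'] by (simp add: sum_distrib_left mult_ac)
  also have "\<dots> = (\<Sum>b\<in>L. u' b * (\<Sum>x\<in>X. m x * (E u x * T b x)))"
    by (subst sum.swap) (simp add: sum_distrib_left)
  also have "\<dots> = (\<Sum>b\<in>L. u' b * (u (dual b) * N (dual b)))"
  proof (intro sum.cong HOL.refl)
    fix b assume "b \<in> L"
    then show "u' b * (\<Sum>x\<in>X. m x * (E u x * T b x)) = u' b * (u (dual b) * N (dual b))"
      using coefficient[OF dual_L, of b u] by (simp add: dual_dual)
  qed
  also have "\<dots> = (\<Sum>b\<in>L. \<Sum>a\<in>L. u a * u' b * (if a = dual b then N a else 0))"
  proof (intro sum.cong HOL.refl)
    fix b assume "b \<in> L"
    then show "u' b * (u (dual b) * N (dual b)) = (\<Sum>a\<in>L. u a * u' b * (if a = dual b then N a else 0))"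
      using dual_L finite_L by (simp add: if_distrib sum.delta mult_ac cong: if_cong)
  qed
  also have "\<dots> = bilinear_form u u'" unfolding bilinear_form_def by (rule sum.swap)
  finally show ?thesis by (rule sym)
qed

lemma bilinear_form_sym: "bilinear_form u u' = bilinear_form u' u"
  unfolding bilinear_form_E by (simp add: mult_ac)

lemma bilinear_form_nondegenerate:
  assumes "u \<in> free_space L" "\<And>u'. u' \<in> free_space L \<Longrightarrow> bilinear_form u u' = 0" shows "u = 0"
proof
  fix a
  show "u a = 0 a"
  proof (cases "a \<in> L")
    case True
    have "basis_vec (dual a) \<in> free_space L" using dual_L[OF True] by (auto simp: free_space_iff basis_vec_def)
    then have "bilinear_form u (basis_vec (dual a)) = 0" by (rule assms(2))
    then have "u a * N a = 0"
      unfolding bilinear_form_E coefficient[OF True, symmetric] by (simp add: E_basis dual_L[OF True])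
    then show ?thesis using norm_nonzero[OF True] by (simp add: N_def)
  qed (use assms(1) in \<open>simp add: free_space_iff\<close>)
qed

text \<open>\<open>E\<close> is injective on the carrier and turns the product into pointwise
  multiplication, so the algebra identities are checked on functions on X.\<close>

theorem frobenius: "frobenius_algebra fun_scale (free_space L) product bilinear_form"
proof
  show sub: "fs.subspace (free_space L)"
    unfolding fs.subspace_def by (auto simp: free_space_iff fun_scale_def)
  have bas: "basis_vec a \<in> free_space L" if "a \<in> L" for a
    using that by (auto simp: free_space_iff basis_vec_def)
  have "free_space L \<subseteq> fs.span (basis_vec ` L)"
  proof
    fix u assume u: "u \<in> free_space L"
    have "u = (\<Sum>a\<in>L. fun_scale (u a) (basis_vec a))"
      using u finite_L by (auto simp: free_space_iff fun_eq_iff sum_fun_apply fun_scale_def basis_vec_def if_distrib sum.delta' cong: if_cong)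
    also have "\<dots> \<in> fs.span (basis_vec ` L)" by (intro fs.span_sum fs.span_scale fs.span_base) auto
    finally show "u \<in> fs.span (basis_vec ` L)" .
  qed
  then show "\<exists>B. finite B \<and> free_space L = fs.span B"
    using fs.span_minimal[OF _ sub, of "basis_vec ` L"] bas finite_L by (intro exI[of _ "basis_vec ` L"]) auto
  have closed: "product u u' \<in> free_space L" for u u'
    unfolding product_def product_basis_def
    by (intro fs.subspace_sum[OF sub] fs.subspace_scale[OF sub] bas)
  then show "product u u' \<in> free_space L" for u u' .
  note add = fs.subspace_add[OF sub] and scale = fs.subspace_scale[OF sub]
  show "product (u + u') w = product u w + product u' w" for u u' w
    by (rule E_inject[OF closed add[OF closed closed]]) (simp add: E_product E_add distrib_right)
  show "product u (w + w') = product u w + product u w'" for u w w'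
    by (rule E_inject[OF closed add[OF closed closed]]) (simp add: E_product E_add distrib_left)
  show "product (fun_scale c u) w = fun_scale c (product u w)" for c u w
    by (rule E_inject[OF closed scale[OF closed]]) (simp add: E_product E_scale)
  show "product u (fun_scale c w) = fun_scale c (product u w)" for c u w
    by (rule E_inject[OF closed scale[OF closed]]) (simp add: E_product E_scale)
  show "product (product u u') w = product u (product u' w)" for u u' w
    by (rule E_inject[OF closed closed]) (simp add: E_product)
  \<comment> \<open>The unit has the constant function 1 as its image; it is set to zero outside L
    in order to lie in the carrier.\<close>
  obtain e' where e': "\<And>x. x \<in> X \<Longrightarrow> 1 = E e' x" using completeness[of "\<lambda>x. 1"] by blast
  define e where "e = (\<lambda>a. if a \<in> L then e' a else 0)"
  have e: "e \<in> free_space L" by (simp add: free_space_iff e_def)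
  have Ee: "E e x = 1" if "x \<in> X" for x unfolding e'[OF that] unfolding E_def e_def by (intro sum.cong) auto
  have "product e u = u \<and> product u e = u" if "u \<in> free_space L" for u
    by (intro conjI E_inject[OF closed that]) (simp_all add: E_product Ee)
  then show "\<exists>e\<in>free_space L. \<forall>u\<in>free_space L. product e u = u \<and> product u e = u" using e by blast
  show "bilinear_form (u + u') w = bilinear_form u w + bilinear_form u' w" for u u' w
    by (simp add: bilinear_form_E E_add algebra_simps sum.distrib)
  show "bilinear_form u (w + w') = bilinear_form u w + bilinear_form u w'" for u w w'
    by (simp add: bilinear_form_E E_add algebra_simps sum.distrib)
  show "bilinear_form (fun_scale c u) w = c * bilinear_form u w" for c u w
    by (simp add: bilinear_form_E E_scale sum_distrib_left mult_ac)
  show "bilinear_form u (fun_scale c w) = c * bilinear_form u w" for c u w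
    by (simp add: bilinear_form_E E_scale sum_distrib_left mult_ac)
  show "bilinear_form (product u u') w = bilinear_form u (product u' w)" for u u' w
    by (simp add: bilinear_form_E E_product mult_ac)
  show "u = 0" if "u \<in> free_space L" "\<And>w. w \<in> free_space L \<Longrightarrow> bilinear_form u w = 0" for u
    using that by (rule bilinear_form_nondegenerate)
  show "w = 0" if "w \<in> free_space L" "\<And>u. u \<in> free_space L \<Longrightarrow> bilinear_form u w = 0" for w
    using that(1) by (rule bilinear_form_nondegenerate) (metis bilinear_form_sym that(2))
qed

end

section \<open>The Verlinde algebra for small parameters\<close>

text \<open>The numerator will be evaluated at \<open>Psi p\<close>, which is only known to be
  within a multiple of \<bar>t\<bar> of p. The statement therefore covers all points in that range,
  whose joint distance from (0, p) is at most (1 + C) \<bar>t\<bar>.\<close>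

lemma (in simple_datum) char_numerator_nonvanishing_nearby:
  assumes "\<mu> \<in> \<Lambda> k" "C \<ge> 0"
  shows "\<exists>p. (real k + h) *\<^sub>R p \<in> weights G \<and> (\<forall>\<^sub>F t in nhds 0. \<forall>x. norm (x - p) \<le> C * \<bar>t\<bar> \<longrightarrow> char_numerator t \<mu> x \<noteq> 0)"
proof -
  obtain p where p: "(real k + h) *\<^sub>R p \<in> weights G" "char_numerator 0 \<mu> p \<noteq> 0" using char_numerator_zero_nonvanishing[OF assms(1)] by blast
  have "\<exists>\<delta>>0. \<forall>y. dist (0, p) y < \<delta> \<longrightarrow> char_numerator (fst y) \<mu> (snd y) \<noteq> 0"
    using continuous_at_avoid[OF char_numerator_continuous[of p \<mu>], of 0] p(2) by simp
  then obtain \<delta> where d: "\<delta> > 0" "\<And>t x. dist (0, p) (t, x) < \<delta> \<Longrightarrow> char_numerator t \<mu> x \<noteq> 0" by fastforce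
  have "char_numerator t \<mu> x \<noteq> 0" if t: "dist t 0 < \<delta> / (1 + C)" and x: "norm (x - p) \<le> C * \<bar>t\<bar>" for t x
  proof (rule d(2))
    have "dist (0, p) (t, x) \<le> \<bar>t\<bar> + norm (x - p)"
      using sqrt_sum_squares_le_sum[of "\<bar>t\<bar>" "norm (x - p)"] by (simp add: dist_Pair_Pair) (simp add: dist_norm norm_minus_commute)
    also have "\<dots> \<le> (1 + C) * \<bar>t\<bar>" using x by (simp add: algebra_simps)
    also have "\<dots> < \<delta>" using t assms(2) by (simp add: dist_norm field_simps)
    finally show "dist (0, p) (t, x) < \<delta>" .
  qed
  moreover have "\<delta> / (1 + C) > 0" using d(1) assms(2) by simp
  ultimately have "\<forall>\<^sub>F t in nhds 0. \<forall>x. norm (x - p) \<le> C * \<bar>t\<bar> \<longrightarrow> char_numerator t \<mu> x \<noteq> 0"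
    unfolding eventually_nhds_metric by blast
  then show ?thesis using p(1) by blast
qed

lemma (in bethe) verlinde_frobenius:
  assumes "\<And>\<mu>. \<mu> \<in> \<Lambda> k \<Longrightarrow> \<exists>p. kap *\<^sub>R p \<in> weights G \<and> char_numerator t \<mu> (Psi p) \<noteq> 0"
  shows "frobenius_algebra fun_scale (verlinde_space G k) (star G k t) (pairing G k t)"
    and "pairing G k t u u' = pairing G k t u' u"
proof -
  interpret orthogonal_functions "\<Lambda> k" orbits "\<lambda>\<mu> O'. Theta G \<mu> t (rep O')" "\<lambda>O'. theta G k t (rep O')" "dual_weight G"
  proof
    show "finite (\<Lambda> k)" by (rule finite_level_weights)
    show "finite orbits" by (rule finite_orbits)
    show "card orbits \<le> card (\<Lambda> k)" by (rule card_orbits)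
    show "dual_weight G \<mu> \<in> \<Lambda> k" if "\<mu> \<in> \<Lambda> k" for \<mu> using that by (rule dual_weight_level)
    show "dual_weight G (dual_weight G \<mu>) = \<mu>" for \<mu> by simp
    show "(\<Sum>O'\<in>orbits. theta G k t (rep O') * (Theta G \<mu> t (rep O') * Theta G \<nu> t (rep O'))) = 0"
      if "\<mu> \<in> \<Lambda> k" "\<nu> \<in> \<Lambda> k" "\<nu> \<noteq> dual_weight G \<mu>" for \<mu> \<nu> using that by (rule orbit_orthogonal)
    show "(\<Sum>O'\<in>orbits. theta G k t (rep O') * (Theta G \<mu> t (rep O') * Theta G (dual_weight G \<mu>) t (rep O'))) \<noteq> 0"
      if "\<mu> \<in> \<Lambda> k" for \<mu> using assms[OF that] orbit_norm_nonzero[OF that] by blast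
  qed
  have d: "d_weight G k \<mu> t = inverse (N \<mu>)" for \<mu>
    by (simp add: d_weight_def verlinde_d_orbits N_def)
  have sb: "star_basis G k t = product_basis"
    unfolding fun_eq_iff star_basis_def product_basis_def d verlinde_d_orbits by simp
  have st: "star G k t = product" unfolding fun_eq_iff star_def product_def by (simp add: sb)
  have pr: "pairing G k t = bilinear_form"
    unfolding fun_eq_iff pairing_def bilinear_form_def pairing_basis_def d inverse_inverse_eq by simp
  show "frobenius_algebra fun_scale (verlinde_space G k) (star G k t) (pairing G k t)"
    unfolding st pr verlinde_space_def by (rule frobenius)
  show "pairing G k t u u' = pairing G k t u' u" unfolding pr by (rule bilinear_form_sym)
qed

theorem theorem5:
  fixes G :: "('n::finite) root_datum" and k :: nat
  assumes "simple_group G" and "simply_connected_group G" and "normalized_form G"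
  shows "finite (level_weights G k) \<and>
    (\<exists>\<epsilon>>0. \<forall>t::real. \<bar>t\<bar> < \<epsilon> \<longrightarrow>
       frobenius_algebra fun_scale (verlinde_space G k) (star G k t) (pairing G k t) \<and>
       (\<forall>u\<in>verlinde_space G k. \<forall>v\<in>verlinde_space G k. pairing G k t u v = pairing G k t v u))"
proof -
  obtain v where v: "\<forall>\<alpha>\<in>roots G. \<alpha> \<bullet> v \<noteq> 0" "pos_roots G = {\<alpha>\<in>roots G. \<alpha> \<bullet> v > 0}"
    using assms(1) unfolding simple_group_def semisimple_group_def positive_system_def by blast
  interpret simple_datum G v
    using assms v by unfold_locales (auto simp: simple_group_def)
  \<comment> \<open>The constant of \<open>Phi_close\<close>.\<close>
  define C where "C = 4 * real (card P) / (real k + h)"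
  have K: "real k + h > 0" using dual_coxeter_pos by simp
  have "\<forall>\<mu>\<in>\<Lambda> k. \<exists>p. (real k + h) *\<^sub>R p \<in> weights G \<and> (\<forall>\<^sub>F t in nhds 0. \<forall>x. norm (x - p) \<le> C * \<bar>t\<bar> \<longrightarrow> char_numerator t \<mu> x \<noteq> 0)"
    using K by (intro ballI char_numerator_nonvanishing_nearby) (simp_all add: C_def)
  from bchoice[OF this] obtain p where
    p: "\<forall>\<mu>\<in>\<Lambda> k. (real k + h) *\<^sub>R p \<mu> \<in> weights G \<and> (\<forall>\<^sub>F t in nhds 0. \<forall>x. norm (x - p \<mu>) \<le> C * \<bar>t\<bar> \<longrightarrow> char_numerator t \<mu> x \<noteq> 0)" ..
  have "\<forall>\<^sub>F t in nhds 0. \<forall>\<mu>\<in>\<Lambda> k. \<forall>x. norm (x - p \<mu>) \<le> C * \<bar>t\<bar> \<longrightarrow> char_numerator t \<mu> x \<noteq> 0"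
    using p by (intro eventually_ball_finite finite_level_weights) blast
  then obtain \<epsilon> where e: "\<epsilon> > 0"
      "\<And>t \<mu> x. \<bar>t\<bar> < \<epsilon> \<Longrightarrow> \<mu> \<in> \<Lambda> k \<Longrightarrow> norm (x - p \<mu>) \<le> C * \<bar>t\<bar> \<Longrightarrow> char_numerator t \<mu> x \<noteq> 0"
    unfolding eventually_nhds_metric by (auto simp: dist_norm)
  \<comment> \<open>The three bounds provide, in turn, the nonvanishing of all numerators,
    \<open>t_half\<close> and \<open>t_small\<close>; the added 1 keeps the last denominator visibly
    positive.\<close>
  define \<delta> where "\<delta> = min \<epsilon> (min (1 / 2) ((real k + h) / (48 * (real (card P) + 1))))"
  have "\<delta> > 0" using e(1) K by (simp add: \<delta>_def)
  moreover have "frobenius_algebra fun_scale (verlinde_space G k) (star G k t) (pairing G k t) \<and>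
       (\<forall>u\<in>verlinde_space G k. \<forall>v\<in>verlinde_space G k. pairing G k t u v = pairing G k t v u)" if t: "\<bar>t\<bar> < \<delta>" for t
  proof -
    have "\<bar>t\<bar> < (real k + h) / (48 * (real (card P) + 1))" using t by (simp add: \<delta>_def)
    then have "48 * (real (card P) + 1) * \<bar>t\<bar> < real k + h" by (simp add: pos_less_divide_eq mult.commute)
    moreover have "48 * real (card P) * \<bar>t\<bar> \<le> 48 * (real (card P) + 1) * \<bar>t\<bar>" by (intro mult_right_mono) auto
    ultimately interpret bethe G v k t
      using t by unfold_locales (simp_all add: \<delta>_def)
    have "\<exists>p. (real k + h) *\<^sub>R p \<in> weights G \<and> char_numerator t \<mu> (Psi p) \<noteq> 0" if m: "\<mu> \<in> \<Lambda> k" for \<mu>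
    proof (intro exI conjI)
      show "(real k + h) *\<^sub>R p \<mu> \<in> weights G" using p m by blast
      show "char_numerator t \<mu> (Psi (p \<mu>)) \<noteq> 0"
        using t Phi_close[of "Psi (p \<mu>)"] by (intro e(2)[OF _ m]) (simp_all add: \<delta>_def C_def norm_minus_commute)
    qed
    then show ?thesis using verlinde_frobenius by blast
  qed
  ultimately show ?thesis using finite_level_weights by blast
qed

end
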